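(* Let $\Delta$ be a nonhyperelliptic lattice polygon with $g$ interior lattice points, and let $g^{(1)}$ be the number of interior lattice points of its interior polygon $\Delta^{(1)}$. Let $\mathcal{T}$ be a regular unimodular triangulation of $\Delta$. Let $b_1$ be the number of lattice points in $\partial\Delta^{(1)}$ incident to only one radial edge of $\mathcal{T}$, and let $b_2$ be the number of lattice points in $\partial\Delta^{(1)}$ incident to two or more radial edges of $\mathcal{T}$, all of whose endpoints (on $\partial\Delta$) are mutually collinear. Then \[\dim(\mathbb{M}_{\mathcal{T}})=3g-3-2g^{(1)}-2b_1-b_2.\]
   Context: All polygons are two-dimensional convex lattice polygons in $\mathbb{R}^2$. The interior polygon $\Delta^{(1)}$ is the convex hull of the lattice points in the interior of $\Delta$; $\Delta$ is nonhyperelliptic if $\dim \Delta^{(1)}=2$. The genus $g$ of $\Delta$ is its number of interior lattice points. A triangulation of $\Delta$ (with vertices at lattice points) is unimodular if all its triangles have area $1/2$. It is regular if it is induced by a height function $\omega:\Delta\cap\mathbb{Z}^2\to\mathbb{R}$, i.e. it is the projection to $\Delta$ of the lower convex hull of the lifted points $(p,\omega(p))$. Radial edge: an edge $e$ of $\mathcal{T}$ connecting an interior lattice point of $\Delta$ to a boundary lattice point of $\Delta$ such that $e\cap\Delta^{(1)}$ is a single point. Tropical curves and skeletons: a height function $\omega$ inducing $\mathcal{T}$ defines the smooth tropical plane curve $C\subset\mathbb{R}^2$ of points where $\min_{(i,j)\in\Delta\cap\mathbb{Z}^2}(\omega(i,j)+ix+jy)$ is attained at least twice; $C$ is dual to $\mathcal{T}$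 (vertices to triangles, bounded edges to interior edges of $\mathcal{T}$, rays to boundary edges). The length of a bounded edge is its lattice length (Euclidean length divided by the length of a primitive integer vector in its direction). For $g\ge 2$, the skeleton of $C$ is the metric graph obtained by removing all rays, iteratively removing 1-valent vertices with their attached edges, and then concatenating any edges joined at a 2-valent vertex, adding lengths; it is a trivalent graph of genus (first Betti number) $g$ with $3g-3$ edges. Its combinatorial type depends only on $\mathcal{T}$. $\mathbb{M}_g$ is the moduli space of metric graphs of genus $g$ (a polyhedral space of dimension $3g-3$), and $\mathbb{M}_{\mathcal{T}}\subset\mathbb{M}_g$ is the closure of the set of all metric graphs that are skeletons of smooth tropical plane curves dual to $\mathcal{T}$. Its dimension is the dimension of the cone in $\mathbb{R}^{3g-3}$ of edge-length vectors of these skeletons. *)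

theory Defs
  imports "HOL-Analysis.Analysis" "HOL-Analysis.Finite_Function_Topology"
begin

type_synonym plane = "real ^ 2"

definition lattice_points :: "plane set" where
  "lattice_points = {p. \<forall>i. p $ i \<in> \<int>}"

definition lattice_polygon :: "plane set \<Rightarrow> bool" where
  "lattice_polygon D \<longleftrightarrow>
     (\<exists>S. finite S \<and> S \<subseteq> lattice_points \<and> D = convex hull S) \<and> aff_dim D = 2"

definition interior_polygon :: "plane set \<Rightarrow> plane set" where
  "interior_polygon D = convex hull (interior D \<inter> lattice_points)"

definition nonhyperelliptic :: "plane set \<Rightarrow> bool" where
  "nonhyperelliptic D \<longleftrightarrow> aff_dim (interior_polygon D) = 2"

definition genus :: "plane set \<Rightarrow> nat" where
  "genus D = card (interior D \<inter> lattice_points)"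

text \<open>A triangulation is given by its set of (closed, two-dimensional) triangles; the
  library predicate \<^const>\<open>triangulation\<close> says that they meet face to face.\<close>

definition lattice_triangulation :: "plane set \<Rightarrow> plane set set \<Rightarrow> bool" where
  "lattice_triangulation D \<T> \<longleftrightarrow>
     triangulation \<T> \<and> \<Union>\<T> = D \<and>
     (\<forall>\<sigma>\<in>\<T>. 2 simplex \<sigma> \<and> {v. v extreme_point_of \<sigma>} \<subseteq> lattice_points)"

definition unimodular :: "plane set set \<Rightarrow> bool" where
  "unimodular \<T> \<longleftrightarrow> (\<forall>\<sigma>\<in>\<T>. measure lebesgue \<sigma> = 1 / 2)"

text \<open>A height function is a total function on the plane, of which only the values at the
  lattice points of the polygon matter. A face of the lifted polytope is lower if it is
  the set of minimizers of a linear functional \<open>(x, t) \<mapsto> u \<bullet> x + t\<close>.\<close>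

definition lifted_polytope :: "plane set \<Rightarrow> (plane \<Rightarrow> real) \<Rightarrow> (plane \<times> real) set" where
  "lifted_polytope D \<omega> = convex hull ((\<lambda>p. (p, \<omega> p)) ` (D \<inter> lattice_points))"

definition lower_face_of :: "(plane \<times> real) set \<Rightarrow> (plane \<times> real) set \<Rightarrow> bool" where
  "lower_face_of F P \<longleftrightarrow> (\<exists>u. F = {z \<in> P. \<forall>z'\<in>P. (u, 1) \<bullet> z \<le> (u, 1) \<bullet> z'})"

definition induces :: "plane set \<Rightarrow> (plane \<Rightarrow> real) \<Rightarrow> plane set set \<Rightarrow> bool" where
  "induces D \<omega> \<T> \<longleftrightarrow>
     \<T> = {fst ` F | F. lower_face_of F (lifted_polytope D \<omega>) \<and> aff_dim F = 2}"

definition regular :: "plane set \<Rightarrow> plane set set \<Rightarrow> bool" where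
  "regular D \<T> \<longleftrightarrow> (\<exists>\<omega>. induces D \<omega> \<T>)"

definition edges :: "plane set set \<Rightarrow> plane set set" where
  "edges \<T> = {e. \<exists>\<sigma>\<in>\<T>. e edge_of \<sigma>}"

definition radial_edges :: "plane set \<Rightarrow> plane set set \<Rightarrow> plane set set" where
  "radial_edges D \<T> =
     {e \<in> edges \<T>.
        (\<exists>p q. e = closed_segment p q \<and> p \<in> interior D \<inter> lattice_points \<and> q \<in> frontier D \<inter> lattice_points) \<and>
        (\<exists>x. e \<inter> interior_polygon D = {x})}"

definition radial_edges_at :: "plane set \<Rightarrow> plane set set \<Rightarrow> plane \<Rightarrow> plane set set" where
  "radial_edges_at D \<T> p = {e \<in> radial_edges D \<T>. p extreme_point_of e}"

definition radial_ends :: "plane set \<Rightarrow> plane set set \<Rightarrow> plane \<Rightarrow> plane set" where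
  "radial_ends D \<T> p =
     {q \<in> frontier D. \<exists>e \<in> radial_edges_at D \<T> p. q extreme_point_of e}"

definition b1 :: "plane set \<Rightarrow> plane set set \<Rightarrow> nat" where
  "b1 D \<T> = card {p \<in> frontier (interior_polygon D) \<inter> lattice_points. card (radial_edges_at D \<T> p) = 1}"

definition b2 :: "plane set \<Rightarrow> plane set set \<Rightarrow> nat" where
  "b2 D \<T> = card {p \<in> frontier (interior_polygon D) \<inter> lattice_points.
     card (radial_edges_at D \<T> p) \<ge> 2 \<and> collinear (radial_ends D \<T> p)}"

definition minimizers :: "plane set \<Rightarrow> (plane \<Rightarrow> real) \<Rightarrow> plane \<Rightarrow> plane set" where
  "minimizers D \<omega> x =
     {p \<in> D \<inter> lattice_points. \<forall>q \<in> D \<inter> lattice_points. \<omega> p + p \<bullet> x \<le> \<omega> q + q \<bullet> x}"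

definition tropical_curve :: "plane set \<Rightarrow> (plane \<Rightarrow> real) \<Rightarrow> plane set" where
  "tropical_curve D \<omega> = {x. card (minimizers D \<omega> x) \<ge> 2}"

text \<open>The curve is a polyhedral complex; \<open>curve_cell D \<omega> x\<close> is its smallest closed cell
  containing \<open>x\<close>. Rays are the unbounded one-dimensional cells.\<close>

definition curve_cell :: "plane set \<Rightarrow> (plane \<Rightarrow> real) \<Rightarrow> plane \<Rightarrow> plane set" where
  "curve_cell D \<omega> x = {y. minimizers D \<omega> x \<subseteq> minimizers D \<omega> y}"

definition curve_vertices :: "plane set \<Rightarrow> (plane \<Rightarrow> real) \<Rightarrow> plane set" where
  "curve_vertices D \<omega> = {x \<in> tropical_curve D \<omega>. curve_cell D \<omega> x = {x}}"

definition bounded_edges :: "plane set \<Rightarrow> (plane \<Rightarrow> real) \<Rightarrow> plane set set" where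
  "bounded_edges D \<omega> =
     {curve_cell D \<omega> x | x. x \<in> tropical_curve D \<omega> \<and>
        aff_dim (curve_cell D \<omega> x) = 1 \<and> bounded (curve_cell D \<omega> x)}"

definition primitive :: "plane \<Rightarrow> bool" where
  "primitive v \<longleftrightarrow> (\<exists>m n :: int. coprime m n \<and> v = vector [of_int m, of_int n])"

definition lattice_length :: "plane set \<Rightarrow> real" where
  "lattice_length s = (THE l. \<exists>a b v c. s = closed_segment a b \<and> a \<noteq> b \<and>
     primitive v \<and> b - a = c *\<^sub>R v \<and> l = norm (b - a) / norm v)"

text \<open>The following operations concern a graph with vertex set \<open>V\<close> and edge set \<open>E\<close>,
  where edges are sets of points and \<open>v \<in> V\<close> is an end of \<open>s \<in> E\<close> iff \<open>v \<in> s\<close>.\<close>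

definition valence :: "'a set set \<Rightarrow> 'a \<Rightarrow> nat" where
  "valence E v = card {s \<in> E. v \<in> s}"

definition prune :: "'a set \<Rightarrow> 'a set set \<Rightarrow> 'a set set" where
  "prune V E = {s \<in> E. \<forall>v\<in>V. v \<in> s \<longrightarrow> valence E v \<noteq> 1}"

definition core_edges :: "'a set \<Rightarrow> 'a set set \<Rightarrow> 'a set set" where
  "core_edges V E = (\<Inter>n. (prune V ^^ n) E)"

definition joined :: "'a set \<Rightarrow> 'a set set \<Rightarrow> ('a set \<times> 'a set) set" where
  "joined V E = {(s, t). s \<in> E \<and> t \<in> E \<and> (\<exists>v\<in>V. valence E v = 2 \<and> v \<in> s \<and> v \<in> t)}"

text \<open>An edge of the skeleton is represented by the set of bounded edges of the curve that
  are concatenated to form it.\<close>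

definition skeleton_edges :: "plane set \<Rightarrow> (plane \<Rightarrow> real) \<Rightarrow> plane set set set" where
  "skeleton_edges D \<omega> =
     (let V = curve_vertices D \<omega>; E = core_edges V (bounded_edges D \<omega>) in E // (joined V E)\<^sup>*)"

definition skeleton_length :: "plane set set \<Rightarrow> real" where
  "skeleton_length S = (\<Sum>s\<in>S. lattice_length s)"

definition dual_edge :: "plane set \<Rightarrow> (plane \<Rightarrow> real) \<Rightarrow> plane set \<Rightarrow> plane set" where
  "dual_edge D \<omega> e = {x \<in> tropical_curve D \<omega>. e \<inter> lattice_points \<subseteq> minimizers D \<omega> x}"

text \<open>To compare the skeletons of different curves dual to the same triangulation \<open>\<T>\<close>, an
  edge of the skeleton is named by the set \<open>L\<close> of edges of \<open>\<T>\<close> dual to its constituents.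
  The edge-length vector is the finitely supported function that sends \<open>L\<close> to the length of
  the skeleton edge so named, and to \<open>0\<close> if \<open>L\<close> names no skeleton edge. As the
  combinatorial type of the skeleton depends only on \<open>\<T>\<close>, all vectors for a given \<open>\<T>\<close>
  lie in a single coordinate subspace, a copy of \<open>\<real>\<^bsup>3g-3\<^esup>\<close>.\<close>

definition edge_lengths ::
  "plane set \<Rightarrow> plane set set \<Rightarrow> (plane \<Rightarrow> real) \<Rightarrow> (plane set set \<Rightarrow>\<^sub>0 real)" where
  "edge_lengths D \<T> \<omega> = Abs_poly_mapping (\<lambda>L.
     if L \<subseteq> edges \<T> \<and> dual_edge D \<omega> ` L \<in> skeleton_edges D \<omega>
     then skeleton_length (dual_edge D \<omega> ` L) else 0)"

definition moduli_cone :: "plane set \<Rightarrow> plane set set \<Rightarrow> (plane set set \<Rightarrow>\<^sub>0 real) set" where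
  "moduli_cone D \<T> = edge_lengths D \<T> ` {\<omega>. induces D \<omega> \<T>}"

text \<open>The dimension of a cone is the dimension of its linear span. Passing to the closure of
  the image of the cone in the moduli space of metric graphs does not change the dimension.\<close>

definition moduli_dim :: "plane set \<Rightarrow> plane set set \<Rightarrow> nat" where
  "moduli_dim D \<T> = dim (moduli_cone D \<T>)"

end

theory Submission
  imports Defs
begin

text \<open>The edge of the curve dual to an interior edge \<open>pq\<close> of the triangulation has a lattice length that is
  a linear function of the heights. The heights inducing the triangulation form an open set, so the
  dimension is the rank of the linear map that sends heights to skeleton lengths. The linear
  relations between the lengths of all bounded edges are the closing relations of the polygons dual to
  the stars of the interior lattice points \<open>p\<close>: two independent relations for each \<open>p\<close>, combined with a
  coefficient vector \<open>l p\<close>. A pruned edge has no interior end point and gets coefficient \<open>0\<close>. Hence such a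
  combination is a relation between skeleton lengths iff its coefficients agree on concatenated
  edges, that is, iff \<open>l p\<close> is orthogonal to \<open>a - b\<close> for each triangle \<open>pab\<close> with \<open>ab\<close> pruned. For \<open>p\<close> on the
  boundary of the interior polygon, the points \<open>a\<close>, \<open>b\<close> in question are the consecutive ends of the radial
  edges at \<open>p\<close>; for other \<open>p\<close> there are none. So the vectors \<open>l p\<close> form a space of dimension 2 if \<open>p\<close> is
  interior to the interior polygon or has a single radial edge, 1 if it has several with collinear
  ends, and 0 otherwise. As the skeleton has \<open>3 * g - 3\<close> edges, rank and nullity give the formula.\<close>

section \<open>Regular unimodular triangulations\<close>

text \<open>Planar topology is avoided: of the triangulation only two things are used, that every
  triangle is the exact set of minimizers of the heights plus a linear form, and that the triangles
  cover the hull. Crossing an edge is then a pivot of the simplex method, and the dual graph is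
  connected because pivots towards a given triangle decrease a potential. That there are no
  relations but the closing relations is not shown by constructing heights. The closing relations
  are independent, since zero coefficients spread from a boundary edge over all triangles; the
  heights whose lengths all vanish have dimension at most 3; Euler's relation then leaves no room
  for further relations. The edges that disappear are described without running the pruning: they
  are the chords of the polygon with all interior points strictly on one side. Unimodularity links
  them to the interior polygon. A corner \<open>p\<close> opposite to such an edge has lattice
  distance 1 from it, the other interior lattice points have distance at least 1, so the parallel
  through \<open>p\<close> supports the interior polygon. This is why only points on its boundary
  see such edges.\<close>

definition cr :: "plane \<Rightarrow> plane \<Rightarrow> real" where
  "cr u v = u$1 * v$2 - u$2 * v$1"

definition rot :: "plane \<Rightarrow> plane" where
  "rot v = vector [- v$2, v$1]"

lemma inner_plane: "x \<bullet> y = x$1 * y$1 + x$2 * y$2" for x y :: plane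
  by (simp add: inner_vec_def sum_2)

lemma rot_component [simp]: "rot v $ 1 = - v$2" "rot v $ 2 = v$1"
  by (simp_all add: rot_def)

lemma plane_eq_iff: "x = y \<longleftrightarrow> x$1 = y$1 \<and> x$2 = y$2" for x y :: plane
  by (simp add: vec_eq_iff forall_2)

lemma rot_inner: "rot u \<bullet> v = cr u v"
  by (simp add: inner_plane cr_def)

lemma cr_skew: "cr v u = - cr u v"
  by (simp add: cr_def)

lemma cr_self [simp]: "cr u u = 0"
  by (simp add: cr_def)

lemma cr_add: "cr (u + v) w = cr u w + cr v w" "cr w (u + v) = cr w u + cr w v"
  by (simp_all add: cr_def algebra_simps)

lemma cr_diff: "cr (u - v) w = cr u w - cr v w" "cr w (u - v) = cr w u - cr w v"
  by (simp_all add: cr_def algebra_simps)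

lemma cr_scale [simp]: "cr (c *\<^sub>R u) w = c * cr u w" "cr w (c *\<^sub>R u) = c * cr w u"
  by (simp_all add: cr_def algebra_simps)

lemma cr_minus [simp]: "cr w (- u) = - cr w u"
  by (simp add: cr_def algebra_simps)

lemma cr_zero [simp]: "cr 0 w = 0" "cr w 0 = 0"
  by (simp_all add: cr_def)

text \<open>Cramer's rule, free of division so that signs of determinants can be read off before any
  of them is known to be nonzero.\<close>

lemma cr_cramer: "cr a b *\<^sub>R w = cr w b *\<^sub>R a + cr a w *\<^sub>R b"
  by (simp add: cr_def plane_eq_iff algebra_simps)

lemma cr_rebase: "cr (q - p) (r - p) = cr (r - q) (p - q)"
  by (simp add: cr_def algebra_simps)

lemma cr_swap: "cr (p - q) (r - q) = - cr (q - p) (r - p)"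
  by (simp add: cr_def algebra_simps)

lemma cr_lattice: "u \<in> lattice_points \<Longrightarrow> v \<in> lattice_points \<Longrightarrow> cr u v \<in> \<int>"
  by (simp add: lattice_points_def cr_def)

lemma lattice_diff: "u \<in> lattice_points \<Longrightarrow> v \<in> lattice_points \<Longrightarrow> u - v \<in> lattice_points"
  by (simp add: lattice_points_def)

lemma inner_zero_zero:
  assumes "cr a b \<noteq> 0" "a \<bullet> d = 0" "b \<bullet> d = 0"
  shows "d = 0"
proof -
  have "cr a b * d$1 = (a \<bullet> d) * b$2 - (b \<bullet> d) * a$2" "cr a b * d$2 = (b \<bullet> d) * a$1 - (a \<bullet> d) * b$1"
    by (simp_all add: inner_plane cr_def algebra_simps)
  then show ?thesis using assms by (auto simp: plane_eq_iff)
qed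

text \<open>As the doubled area is 1, the barycentric coordinates of \<open>v\<close> are
  determinants of lattice vectors and hence integers; nonnegative integers with sum 1 leave only the
  corners.\<close>

lemma unimodular_triangle_lattice:
  assumes c: "cr (q - p) (r - p) = 1" and lat: "p \<in> lattice_points" "q \<in> lattice_points" "r \<in> lattice_points" "v \<in> lattice_points"
    and v: "v \<in> convex hull {p,q,r}"
  shows "v \<in> {p,q,r}"
proof -
  obtain x y z where xyz: "x \<ge> 0" "y \<ge> 0" "z \<ge> 0" "x + y + z = 1" "v = x *\<^sub>R p + y *\<^sub>R q + z *\<^sub>R r"
    using v unfolding convex_hull_3 by auto
  have x: "x = 1 - y - z" using xyz by simp
  have vp: "v - p = y *\<^sub>R (q - p) + z *\<^sub>R (r - p)"
    unfolding xyz(5) x by (simp add: scaleR_diff_left scaleR_diff_right)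
  have "y = cr (v - p) (r - p)" "z = cr (q - p) (v - p)"
    unfolding vp using c by (simp_all add: cr_add)
  moreover have "cr (v - p) (r - p) \<in> \<int>" "cr (q - p) (v - p) \<in> \<int>"
    using lat by (auto intro!: cr_lattice lattice_diff)
  ultimately obtain m n :: int where mn: "y = of_int m" "z = of_int n" by (auto elim!: Ints_cases)
  have "m \<ge> 0" "n \<ge> 0" "m + n \<le> 1" using xyz mn by (auto simp flip: of_int_add)
  then have "m = 0 \<and> n = 0 \<or> m = 1 \<and> n = 0 \<or> m = 0 \<and> n = 1" by auto
  then show ?thesis using vp mn by auto
qed

section \<open>Minimizers: the cells of the regular subdivision and their dual points\<close>

definition mins :: "plane set \<Rightarrow> (plane \<Rightarrow> real) \<Rightarrow> plane \<Rightarrow> plane set" where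
  "mins A w x = {p \<in> A. \<forall>q\<in>A. w p + p \<bullet> x \<le> w q + q \<bullet> x}"

lemma mins_sub: "mins A w x \<subseteq> A"
  by (auto simp: mins_def)

lemma mins_le: "p \<in> mins A w x \<Longrightarrow> q \<in> A \<Longrightarrow> w p + p \<bullet> x \<le> w q + q \<bullet> x"
  by (auto simp: mins_def)

lemma mins_eq: "p \<in> mins A w x \<Longrightarrow> q \<in> mins A w x \<Longrightarrow> w p + p \<bullet> x = w q + q \<bullet> x"
  by (force simp: mins_def)

lemma mins_memI: "p \<in> mins A w x \<Longrightarrow> q \<in> A \<Longrightarrow> w q + q \<bullet> x \<le> w p + p \<bullet> x \<Longrightarrow> q \<in> mins A w x"
  by (force simp: mins_def)

lemma mins_nonempty: "finite A \<Longrightarrow> A \<noteq> {} \<Longrightarrow> mins A w x \<noteq> {}"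
proof -
  assume "finite A" "A \<noteq> {}"
  then obtain p where "p \<in> A" "\<forall>q\<in>A. w p + p \<bullet> x \<le> w q + q \<bullet> x"
    using ex_min_if_finite[of "(\<lambda>p. w p + p \<bullet> x) ` A"] by (force simp: not_less)
  then show ?thesis by (auto simp: mins_def)
qed

text \<open>Over a common point of the hulls of two cells, the two supporting affine functions agree.\<close>

lemma mins_hull:
  assumes P: "finite P" "P \<subseteq> mins A w x" and al: "\<And>p. p \<in> P \<Longrightarrow> \<alpha> p > 0" "sum \<alpha> P = 1"
    and Q: "Q \<subseteq> mins A w y" and z: "(\<Sum>p\<in>P. \<alpha> p *\<^sub>R p) \<in> convex hull Q"
  shows "P \<subseteq> mins A w y"
proof -
  have "P \<noteq> {}" using al(2) by auto
  then obtain p0 where p0: "p0 \<in> P" by auto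
  have "Q \<noteq> {}" using z by auto
  then obtain q0 where q0: "q0 \<in> Q" by auto
  \<comment> \<open>\<open>c - (x - y) \<bullet> z\<close> is the difference of the affine functions
    of \<open>z\<close> that support the lifted points at \<open>x\<close> and at \<open>y\<close>.
    It is at least 0 on \<open>P\<close> and at most 0 on the hull of \<open>Q\<close>; the common
    point has positive weights on \<open>P\<close>, so it vanishes on all of
    \<open>P\<close>.\<close>
  define c where "c = w p0 + p0 \<bullet> x - (w q0 + q0 \<bullet> y)"
  have "Q \<subseteq> {z. c \<le> (x - y) \<bullet> z}"
  proof
    fix q assume q: "q \<in> Q"
    have "w p0 + p0 \<bullet> x \<le> w q + q \<bullet> x" "w q + q \<bullet> y = w q0 + q0 \<bullet> y"
      using q q0 p0 P Q mins_sub mins_le mins_eq by blast+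
    then show "q \<in> {z. c \<le> (x - y) \<bullet> z}"
      by (simp add: c_def inner_diff_left inner_diff_right inner_commute)
  qed
  then have "convex hull Q \<subseteq> {z. c \<le> (x - y) \<bullet> z}"
    using convex_halfspace_ge[of c "x - y"] by (intro hull_minimal) (auto simp: inner_commute)
  then have "c \<le> (x - y) \<bullet> (\<Sum>p\<in>P. \<alpha> p *\<^sub>R p)" using z by auto
  then have 1: "0 \<le> (\<Sum>p\<in>P. \<alpha> p * ((x - y) \<bullet> p - c))"
    using al(2) by (simp add: inner_sum_right right_diff_distrib sum_subtractf flip: sum_distrib_right)
  have 2: "(x - y) \<bullet> p - c \<le> 0" if "p \<in> P" for p
  proof -
    have "w p + p \<bullet> x = w p0 + p0 \<bullet> x" "w q0 + q0 \<bullet> y \<le> w p + p \<bullet> y"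
      using that q0 p0 P Q mins_sub mins_le mins_eq by blast+
    then show ?thesis by (simp add: c_def inner_diff_left inner_diff_right inner_commute)
  qed
  have "(\<Sum>p\<in>P. \<alpha> p * (c - (x - y) \<bullet> p)) = 0"
  proof (rule antisym)
    show "(\<Sum>p\<in>P. \<alpha> p * (c - (x - y) \<bullet> p)) \<le> 0"
      using 1 by (simp add: right_diff_distrib sum_subtractf)
    show "0 \<le> (\<Sum>p\<in>P. \<alpha> p * (c - (x - y) \<bullet> p))"
      using 2 al by (intro sum_nonneg mult_nonneg_nonneg) (auto simp: less_imp_le)
  qed
  then have 3: "\<forall>p\<in>P. \<alpha> p * (c - (x - y) \<bullet> p) = 0"
    using P(1) 2 al by (subst (asm) sum_nonneg_eq_0_iff) (auto intro!: mult_nonneg_nonneg simp: less_imp_le)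
  show ?thesis
  proof
    fix p assume p: "p \<in> P"
    then have "(x - y) \<bullet> p = c" using 3 al by force
    moreover have "w p + p \<bullet> x = w p0 + p0 \<bullet> x" using p p0 P mins_eq by blast
    ultimately have "w p + p \<bullet> y = w q0 + q0 \<bullet> y"
      by (simp add: c_def inner_diff_left inner_diff_right inner_commute)
    then show "p \<in> mins A w y" using p q0 Q P mins_sub
      by (metis in_mono mins_memI order_refl)
  qed
qed

text \<open>The ratio test of the simplex method. As \<open>x\<close> moves along \<open>u\<close>,
  the points of \<open>P\<close> stay tied, while the points \<open>q\<close> with
  \<open>u \<bullet> (q - p) < 0\<close> gain on them; the first of these to draw level joins the
  minimizers.\<close>

lemma mins_linesearch:
  assumes fin: "finite A" and P: "P \<subseteq> mins A w x" "p \<in> P" "\<And>p'. p' \<in> P \<Longrightarrow> u \<bullet> (p' - p) = 0"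
    and a: "a \<in> A" "u \<bullet> (a - p) < 0"
  obtains t q where "t \<ge> 0" "q \<in> A" "u \<bullet> (q - p) < 0" "insert q P \<subseteq> mins A w (x + t *\<^sub>R u)"
proof -
  define \<gamma> where "\<gamma> q = w q + q \<bullet> x - (w p + p \<bullet> x)" for q
  define B where "B = {q \<in> A. u \<bullet> (q - p) < 0}"
  define f where "f q = \<gamma> q / - (u \<bullet> (q - p))" for q
  have "finite B" "B \<noteq> {}" using fin a by (auto simp: B_def)
  then obtain q where q: "q \<in> B" "\<And>q'. q' \<in> B \<Longrightarrow> f q \<le> f q'"
    using arg_min_if_finite[of B f] by (metis not_less)
  have \<gamma>0: "\<gamma> q' \<ge> 0" if "q' \<in> A" for q' using that P mins_le[of p A w x q'] by (auto simp: \<gamma>_def)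
  define t where "t = f q"
  have t0: "t \<ge> 0" using q(1) \<gamma>0[of q] by (auto simp: t_def f_def B_def divide_nonneg_neg)
  have ok: "w p + p \<bullet> (x + t *\<^sub>R u) \<le> w q' + q' \<bullet> (x + t *\<^sub>R u)" if "q' \<in> A" for q'
  proof (cases "u \<bullet> (q' - p) < 0")
    case True
    then have "t \<le> f q'" using q that by (auto simp: B_def t_def)
    then have "t * - (u \<bullet> (q' - p)) \<le> \<gamma> q'" using True by (simp add: f_def field_simps)
    then show ?thesis by (simp add: \<gamma>_def algebra_simps inner_commute)
  next
    case False
    then have "0 \<le> t * (u \<bullet> (q' - p))" using t0 by simp
    then show ?thesis using \<gamma>0[OF that] by (simp add: \<gamma>_def algebra_simps inner_commute)
  qed
  have pA: "p \<in> A" using P mins_sub by blast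
  have pm: "p \<in> mins A w (x + t *\<^sub>R u)" using ok pA by (auto simp: mins_def)
  have "t * - (u \<bullet> (q - p)) = \<gamma> q" using q(1) by (simp add: t_def f_def B_def)
  then have "w q + q \<bullet> (x + t *\<^sub>R u) = w p + p \<bullet> (x + t *\<^sub>R u)"
    by (simp add: \<gamma>_def algebra_simps inner_commute)
  then have "q \<in> mins A w (x + t *\<^sub>R u)" using q(1) pm mins_memI by (auto simp: B_def)
  moreover have "p' \<in> mins A w (x + t *\<^sub>R u)" if "p' \<in> P" for p'
  proof -
    have "u \<bullet> p' = u \<bullet> p" using P(3)[OF that] by (simp add: inner_diff_right)
    moreover have "w p' + p' \<bullet> x = w p + p \<bullet> x" using that P mins_eq by blast
    ultimately have "w p' + p' \<bullet> (x + t *\<^sub>R u) = w p + p \<bullet> (x + t *\<^sub>R u)"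
      by (simp add: algebra_simps inner_commute)
    then show ?thesis using mins_memI[OF pm, of p'] that P mins_sub[of A w x] by auto
  qed
  ultimately show ?thesis using t0 q(1) by (intro that[of t q]) (auto simp: B_def)
qed

text \<open>A regular unimodular triangulation of the convex hull of \<open>A\<close>, given by the vertex sets of its
  triangles; \<open>TV_mins\<close> says that the heights \<open>w\<close> induce it.\<close>

locale regtri =
  fixes A :: "plane set" and TV :: "plane set set" and w :: "plane \<Rightarrow> real"
  assumes finA: "finite A" and latA: "A \<subseteq> lattice_points"
    and TV_tri: "X \<in> TV \<Longrightarrow> \<exists>p q r. X = {p,q,r} \<and> p \<in> A \<and> q \<in> A \<and> r \<in> A \<and> cr (q - p) (r - p) = 1"
    and TV_mins: "X \<in> TV \<Longrightarrow> \<exists>x. mins A w x = X"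
    and cover: "z \<in> convex hull A \<Longrightarrow> \<exists>X\<in>TV. z \<in> convex hull X"
    and A_ne: "A \<noteq> {}"
begin

lemma TV_sub: "X \<in> TV \<Longrightarrow> X \<subseteq> A"
  using TV_tri by blast

lemma finTV: "finite TV"
  using finA TV_sub by (metis PowI finite_Pow_iff finite_subset subsetI)

lemma TV_fin: "X \<in> TV \<Longrightarrow> finite X"
  using TV_sub finA finite_subset by blast

lemma TV_card: "X \<in> TV \<Longrightarrow> card X = 3"
  using TV_tri[of X] by (auto simp: cr_def card_insert_if) 

lemma TV_unit:
  assumes "{p,q,r} \<in> TV" shows "cr (q - p) (r - p) = 1 \<or> cr (q - p) (r - p) = -1"
proof -
  obtain a b c where abc: "{p,q,r} = {a,b,c}" "cr (b - a) (c - a) = 1"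
    using TV_tri[OF assms] by blast
  have "card {p,q,r} = 3" using TV_card assms by auto
  then have ne: "p \<noteq> q" "p \<noteq> r" "q \<noteq> r" by (auto simp: card_insert_if split: if_splits)
  have e: "cr (q - p) (r - p) = p$1*q$2 - p$2*q$1 + q$1*r$2 - q$2*r$1 + r$1*p$2 - r$2*p$1"
    for p q r :: plane by (simp add: cr_def algebra_simps)
  have "p \<in> {a,b,c}" "q \<in> {a,b,c}" "r \<in> {a,b,c}" using abc by auto
  then show ?thesis using abc(2) ne unfolding e by (auto simp: algebra_simps)
qed

text \<open>The vertex of the curve dual to the triangle; \<open>pt_unique\<close> shows that there
  is no choice.\<close>

definition pt :: "plane set \<Rightarrow> plane" where
  "pt X = (SOME x. mins A w x = X)"

lemma mins_pt: "X \<in> TV \<Longrightarrow> mins A w (pt X) = X"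
  unfolding pt_def by (rule someI_ex) (rule TV_mins)

text \<open>The centroid of the minimizers lies in some triangle. It has positive weight at every
  minimizer, so \<open>mins_hull\<close> makes all of them corners of that triangle.\<close>

lemma mins_sub_TV: "\<exists>X\<in>TV. mins A w x \<subseteq> X"
proof -
  define P where "P = mins A w x"
  have P: "finite P" "P \<noteq> {}" "P \<subseteq> A"
    using finA A_ne mins_nonempty mins_sub finite_subset unfolding P_def by metis+
  define f where "f p = 1 / real (card P)" for p :: plane
  define z where "z = (\<Sum>p\<in>P. f p *\<^sub>R p)"
  have "z \<in> convex hull P" unfolding z_def
    using P hull_subset[of P convex] by (intro convex_sum) (auto simp: f_def)
  then have "z \<in> convex hull A" using P hull_mono by blast
  then obtain X where X: "X \<in> TV" "z \<in> convex hull X" using cover by blast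
  have "P \<subseteq> mins A w (pt X)"
    using P X mins_pt[OF X(1)]
    by - (rule mins_hull[of P A w x f X], auto simp: z_def P_def f_def card_gt_0_iff)
  then show ?thesis using X mins_pt P_def by auto
qed

lemma TV_ne: "TV \<noteq> {}"
  using mins_sub_TV by blast

section \<open>Edges and the triangles on their two sides\<close>

definition Eall :: "plane set set" where
  "Eall = {{p,q} | p q. p \<noteq> q \<and> (\<exists>X\<in>TV. p \<in> X \<and> q \<in> X)}"

abbreviation edg :: "plane \<Rightarrow> plane \<Rightarrow> bool" where
  "edg p q \<equiv> {p,q} \<in> Eall"

lemma edg_iff: "edg p q \<longleftrightarrow> p \<noteq> q \<and> (\<exists>r. {p,q,r} \<in> TV)"
proof
  assume "edg p q"
  then obtain X where X: "p \<noteq> q" "X \<in> TV" "p \<in> X" "q \<in> X"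
    unfolding Eall_def by (simp add: doubleton_eq_iff) blast
  from TV_tri[OF X(2)] obtain a b c where "X = {a,b,c}" by blast
  with X have "X = {p,q,a} \<or> X = {p,q,b} \<or> X = {p,q,c}" by auto
  with X show "p \<noteq> q \<and> (\<exists>r. {p,q,r} \<in> TV)" by auto
next
  assume "p \<noteq> q \<and> (\<exists>r. {p,q,r} \<in> TV)"
  then show "edg p q" unfolding Eall_def by blast
qed

lemma edgE: assumes "edg p q" obtains r where "{p,q,r} \<in> TV" "p \<noteq> q"
  using iffD1[OF edg_iff assms] by blast

lemma edg_A: "edg p q \<Longrightarrow> p \<in> A \<and> q \<in> A"
  by (meson TV_sub edgE insert_subset)

lemma finEall: "finite Eall"
proof -
  have "Eall \<subseteq> Pow A" using edg_A unfolding Eall_def using TV_sub by blast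
  then show ?thesis using finA finite_subset by blast
qed

lemma tri_distinct: "{p,q,r} \<in> TV \<Longrightarrow> p \<noteq> q \<and> q \<noteq> r \<and> p \<noteq> r"
  using TV_card[of "{p,q,r}"] by (auto simp: card_insert_if split: if_splits)

lemma edgI: "p \<noteq> q \<Longrightarrow> X \<in> TV \<Longrightarrow> p \<in> X \<Longrightarrow> q \<in> X \<Longrightarrow> edg p q"
  unfolding Eall_def by blast

lemma tri_edg: "{p,q,r} \<in> TV \<Longrightarrow> edg p q \<and> edg q r \<and> edg p r \<and> edg q p \<and> edg r q \<and> edg r p"
  using tri_distinct[of p q r] edgI[of _ _ "{p,q,r}"] by auto

lemma tri_eqI: "p \<noteq> q \<Longrightarrow> p \<noteq> r \<Longrightarrow> q \<noteq> r \<Longrightarrow> X \<in> TV \<Longrightarrow> {p,q,r} \<subseteq> X \<Longrightarrow> X = {p,q,r}"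
  using TV_card[of X] TV_fin[of X] card_subset_eq[of X "{p,q,r}"] by auto

text \<open>An edge \<open>pc\<close> that starts inside the angle at \<open>p\<close> has a
  relatively interior point in the triangle \<open>pab\<close>, so \<open>mins_hull\<close> would
  make \<open>c\<close> one of its corners.\<close>

lemma no_overlap_pos:
  assumes X: "{p,a,b} \<in> TV" and e: "edg p c"
    and pos: "cr (a - p) (c - p) > 0" "cr (c - p) (b - p) > 0" "cr (a - p) (b - p) > 0"
  shows False
proof -
  obtain c' where c': "{p,c,c'} \<in> TV" "p \<noteq> c" using edgE[OF e] by metis
  define \<alpha> \<beta> where "\<alpha> = cr (c - p) (b - p)" and "\<beta> = cr (a - p) (c - p)"
  have "cr (a - p) (b - p) = 1" using TV_unit[OF X] pos by auto
  then have c: "c - p = \<alpha> *\<^sub>R (a - p) + \<beta> *\<^sub>R (b - p)"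
    using cr_cramer[of "a - p" "b - p" "c - p"] by (simp add: \<alpha>_def \<beta>_def)
  have ab: "\<alpha> > 0" "\<beta> > 0" using pos by (auto simp: \<alpha>_def \<beta>_def)
  \<comment> \<open>Chosen such that \<open>p + t *\<^sub>R (c - p)\<close> has the weights
    \<open>t\<close>, \<open>t * \<alpha>\<close>, \<open>t * \<beta>\<close> at \<open>p\<close>,
    \<open>a\<close>, \<open>b\<close>, with sum 1.\<close>
  define t where "t = 1 / (1 + \<alpha> + \<beta>)"
  have "t * (1 + \<alpha> + \<beta>) = 1" using ab by (simp add: t_def)
  then have t3: "t * \<alpha> + t * \<beta> + t = 1" by (simp add: distrib_left)
  have t: "0 < t" "t < 1" using ab by (simp_all add: t_def)
  define f where "f x = (if x = p then 1 - t else t)" for x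
  have u: "t = 1 - t * \<alpha> - t * \<beta>" using t3 by simp
  have "(\<Sum>x\<in>{p,c}. f x *\<^sub>R x) = p + t *\<^sub>R (c - p)"
    using c'(2) by (simp add: f_def scaleR_diff_left scaleR_diff_right)
  moreover have "p + t *\<^sub>R (c - p) = (1 - t * \<alpha> - t * \<beta>) *\<^sub>R p + (t * \<alpha>) *\<^sub>R a + (t * \<beta>) *\<^sub>R b"
    by (simp only: c) (simp add: scaleR_diff_left scaleR_diff_right scaleR_add_right)
  ultimately have s: "(\<Sum>x\<in>{p,c}. f x *\<^sub>R x) = t *\<^sub>R p + (t * \<alpha>) *\<^sub>R a + (t * \<beta>) *\<^sub>R b"
    using u by metis
  have "t *\<^sub>R p + (t * \<alpha>) *\<^sub>R a + (t * \<beta>) *\<^sub>R b \<in> convex hull {p,a,b}"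
    unfolding convex_hull_3 mem_Collect_eq using t t3 ab
    by (intro exI[of _ t] exI[of _ "t * \<alpha>"] exI[of _ "t * \<beta>"]) auto
  then have "(\<Sum>x\<in>{p,c}. f x *\<^sub>R x) \<in> convex hull {p,a,b}" using s by simp
  then have "{p,c} \<subseteq> mins A w (pt {p,a,b})"
    using t c'(2) mins_pt[OF c'(1)] mins_pt[OF X]
    by - (rule mins_hull[of "{p,c}" A w "pt {p,c,c'}" f "{p,a,b}"], auto simp: f_def)
  then have "c \<in> {p,a,b}" using mins_pt[OF X] by auto
  then show False using c'(2) pos by auto
qed

lemma no_overlap:
  assumes "{p,a,b} \<in> TV" "edg p c" "\<epsilon> = 1 \<or> \<epsilon> = -1"
    and "\<epsilon> * cr (a - p) (c - p) > 0" "\<epsilon> * cr (c - p) (b - p) > 0" "\<epsilon> * cr (a - p) (b - p) > 0"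
  shows False
  using assms(3)
proof
  assume "\<epsilon> = 1" then show False using assms no_overlap_pos[of p a b c] by auto
next
  have "{p,b,a} \<in> TV" using assms(1) by (simp add: insert_commute)
  moreover assume "\<epsilon> = -1"
  ultimately show False using assms no_overlap_pos[of p b a c] cr_skew[of "b - p" "c - p"] cr_skew[of "c - p" "a - p"]
    cr_skew[of "b - p" "a - p"] by auto
qed

text \<open>If \<open>s\<close> and \<open>s'\<close> were seen from \<open>p\<close> in different
  directions, one of the edges \<open>ps\<close>, \<open>ps'\<close> would start inside the triangle
  of the other. In the same direction, equal area over \<open>pq\<close> makes the points
  equal.\<close>

lemma third_unique_pos:
  assumes T: "{p,q,s} \<in> TV" "{p,q,s'} \<in> TV" and s: "cr (q - p) (s - p) > 0" "cr (q - p) (s' - p) > 0"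
  shows "s = s'"
proof -
  have 1: "cr (q - p) (s - p) = 1" "cr (q - p) (s' - p) = 1"
    using TV_unit[OF T(1)] TV_unit[OF T(2)] s by auto
  define k where "k = cr (s' - p) (s - p)"
  have "\<not> k > 0" using no_overlap_pos[of p q s s'] T s tri_edg[OF T(2)] by (auto simp: k_def)
  moreover have "\<not> k < 0" using no_overlap_pos[of p q s' s] T s tri_edg[OF T(1)] cr_skew[of "s - p"]
    by (auto simp: k_def)
  ultimately have "k = 0" by simp
  then have "cr (q - p) (s - s') = 0" "cr (s - p) (s - s') = 0"
    using 1 cr_diff(2)[of "q - p" "s - p" "s' - p"] cr_diff(2)[of "s - p" "s - p" "s' - p"] cr_skew[of "s - p" "s' - p"]
    by (auto simp: k_def)
  then show ?thesis
    using cr_cramer[of "q - p" "s - p" "s - s'"] 1 cr_skew[of "s - p" "s - s'"] by simp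
qed

lemma third_unique:
  assumes T: "{p,q,s} \<in> TV" "{p,q,s'} \<in> TV" and e: "\<epsilon> = 1 \<or> \<epsilon> = -1"
    and s: "\<epsilon> * cr (q - p) (s - p) > 0" "\<epsilon> * cr (q - p) (s' - p) > 0"
  shows "s = s'"
  using e
proof
  assume "\<epsilon> = 1" then show ?thesis using third_unique_pos[of p q s s'] T s by auto
next
  have "{q,p,s} \<in> TV" "{q,p,s'} \<in> TV" using T by (simp_all add: insert_commute)
  moreover assume "\<epsilon> = -1"
  ultimately show ?thesis using third_unique_pos[of q p s s'] s cr_swap[of p q s] cr_swap[of p q s'] by simp
qed

text \<open>A pivot: moving the dual point along the normal of \<open>pq\<close> keeps
  \<open>p\<close> and \<open>q\<close> tied until a point on the far side joins them. The point
  \<open>a\<close> guarantees that this happens.\<close>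

lemma adjacent_tri:
  assumes T: "{p,q,r} \<in> TV" and a: "a \<in> A" "cr (q - p) (a - p) < 0" and r: "cr (q - p) (r - p) > 0"
  obtains s t where "{p,q,s} \<in> TV" "cr (q - p) (s - p) < 0" "t \<ge> 0"
    "pt {p,q,s} = pt {p,q,r} + t *\<^sub>R rot (q - p)"
proof -
  have P: "{p,q} \<subseteq> mins A w (pt {p,q,r})" using mins_pt[OF T] by auto
  obtain t s where s: "t \<ge> 0" "s \<in> A" "rot (q - p) \<bullet> (s - p) < 0"
    "insert s {p,q} \<subseteq> mins A w (pt {p,q,r} + t *\<^sub>R rot (q - p))"
    by (rule mins_linesearch[OF finA P, of p "rot (q - p)" a]) (use a in \<open>auto simp: rot_inner\<close>)
  then have c: "cr (q - p) (s - p) < 0" by (simp add: rot_inner)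
  obtain X where X: "X \<in> TV" "insert s {p,q} \<subseteq> X" "mins A w (pt {p,q,r} + t *\<^sub>R rot (q - p)) \<subseteq> X"
    using mins_sub_TV s(4) by (meson order_trans)
  have "p \<noteq> q" "p \<noteq> s" "q \<noteq> s" using c tri_distinct[OF T] by auto
  then have Xe: "X = {p,q,s}" using tri_eqI[of p q s X] X by auto
  have m: "mins A w (pt {p,q,r} + t *\<^sub>R rot (q - p)) = {p,q,s}" using s(4) X Xe by auto
  have S: "{p,q,s} \<in> TV" using X Xe by auto
  have u: "x = y" if xy: "mins A w x = {p,q,s}" "mins A w y = {p,q,s}" for x y
  proof -
    have "w p + p \<bullet> x = w q + q \<bullet> x" "w p + p \<bullet> x = w s + s \<bullet> x"
      "w p + p \<bullet> y = w q + q \<bullet> y" "w p + p \<bullet> y = w s + s \<bullet> y"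
      using xy by (auto intro!: mins_eq[of _ A w])
    then have "(q - p) \<bullet> (x - y) = 0" "(s - p) \<bullet> (x - y) = 0"
      by (auto simp: algebra_simps)
    then have "x - y = 0" using c by (intro inner_zero_zero[of "q - p" "s - p"]) auto
    then show "x = y" by simp
  qed
  show ?thesis using that[OF S c s(1)] u[OF mins_pt[OF S] m] by auto
qed

lemma edge_side:
  assumes e: "edg p q" and a: "a \<in> A" "\<epsilon> * cr (q - p) (a - p) > 0" and eps: "\<epsilon> = 1 \<or> \<epsilon> = -1"
  obtains s where "{p,q,s} \<in> TV" "\<epsilon> * cr (q - p) (s - p) > 0"
proof -
  obtain r where r: "{p,q,r} \<in> TV" using edgE[OF e] by metis
  then have r1: "cr (q - p) (r - p) = 1 \<or> cr (q - p) (r - p) = -1" by (rule TV_unit)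
  show ?thesis
  proof (cases "\<epsilon> * cr (q - p) (r - p) > 0")
    case True then show ?thesis using r that by blast
  next
    case False
    show ?thesis
    proof (cases "\<epsilon> = 1")
      case True
      have "{q,p,r} \<in> TV" using r by (simp add: insert_commute)
      moreover have "cr (p - q) (r - q) > 0" "cr (p - q) (a - q) < 0"
        using True False r1 a cr_swap[of p q r] cr_swap[of p q a] by auto
      ultimately obtain s where "{q,p,s} \<in> TV" "cr (p - q) (s - q) < 0"
        using adjacent_tri[of q p r a] a by metis
      moreover have "{q,p,s} = {p,q,s}" by auto
      ultimately show ?thesis using that[of s] True cr_swap[of p q s] by simp
    next
      case F2: False
      then have "cr (q - p) (r - p) > 0" "cr (q - p) (a - p) < 0" using False r1 a eps by auto
      then obtain s where "{p,q,s} \<in> TV" "cr (q - p) (s - p) < 0"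
        using adjacent_tri[of p q r a] a r by metis
      then show ?thesis using that[of s] F2 eps by auto
    qed
  qed
qed

text \<open>One turn around \<open>v\<close> from \<open>a\<close> towards \<open>b\<close>. The
  form \<open>h\<close> certifies that the angle between them is less than a half turn; by
  \<open>no_overlap\<close> the next neighbour \<open>r\<close> does not pass \<open>b\<close>, so
  it stays in the half plane of \<open>h\<close>.\<close>

lemma next_edge:
  assumes e: "edg v a" "edg v b" and eps: "\<epsilon> = 1 \<or> \<epsilon> = -1" and ab: "\<epsilon> * cr (a - v) (b - v) > 0"
    and h: "h \<bullet> (a - v) > 0" "h \<bullet> (b - v) > 0"
  obtains r where "{v,a,r} \<in> TV" "\<epsilon> * cr (a - v) (r - v) > 0" "h \<bullet> (r - v) > 0" "\<epsilon> * cr (r - v) (b - v) \<ge> 0"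
proof -
  obtain r where r: "{v,a,r} \<in> TV" "\<epsilon> * cr (a - v) (r - v) > 0"
    using edge_side[OF e(1) _ ab eps] edg_A[OF e(2)] by metis
  have 1: "\<epsilon> * cr (r - v) (b - v) \<ge> 0"
    using no_overlap[OF r(1) e(2) eps ab _ r(2)] cr_skew[of "r - v" "b - v"] by (cases "\<epsilon> = 1") (use eps in \<open>auto simp flip: not_less\<close>)
  have c: "cr (a - v) (b - v) * (h \<bullet> (r - v)) = cr (r - v) (b - v) * (h \<bullet> (a - v)) + cr (a - v) (r - v) * (h \<bullet> (b - v))"
    using arg_cong[OF cr_cramer[of "a - v" "b - v" "r - v"], of "\<lambda>x. h \<bullet> x"] by (simp add: inner_add_right)
  have "(\<epsilon> * cr (a - v) (b - v)) * (h \<bullet> (r - v))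
     = (\<epsilon> * cr (r - v) (b - v)) * (h \<bullet> (a - v)) + (\<epsilon> * cr (a - v) (r - v)) * (h \<bullet> (b - v))"
    using arg_cong[OF c, of "\<lambda>y. \<epsilon> * y"] by (simp add: distrib_left mult.assoc)
  also have "\<dots> > 0"
    using h by (intro add_nonneg_pos[OF mult_nonneg_nonneg[OF 1] mult_pos_pos[OF r(2)]]) auto
  finally have "h \<bullet> (r - v) > 0" using ab by (simp add: zero_less_mult_iff)
  then show ?thesis using that r 1 by blast
qed

text \<open>Some triangle contains \<open>v\<close> by the covering property, and a unimodular
  triangle has no lattice points but its corners.\<close>

lemma A_in_tri: assumes "v \<in> A" obtains X where "X \<in> TV" "v \<in> X"
proof -
  have "v \<in> convex hull A" using assms by (rule hull_inc)
  then obtain X where X: "X \<in> TV" "v \<in> convex hull X" using cover by blast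
  obtain p q r where pqr: "X = {p,q,r}" "cr (q - p) (r - p) = 1" "p \<in> A" "q \<in> A" "r \<in> A"
    using TV_tri[OF X(1)] by blast
  have "p \<in> lattice_points" "q \<in> lattice_points" "r \<in> lattice_points" "v \<in> lattice_points"
    using latA assms pqr(3-5) by auto
  then have "v \<in> X" using unimodular_triangle_lattice[OF pqr(2)] X(2) unfolding pqr(1) by blast
  then show ?thesis using that X by blast
qed

lemma edge_in_halfplane:
  assumes v: "v \<in> A" and a: "a \<in> A" "h \<bullet> (a - v) > 0"
  obtains b where "edg v b" "h \<bullet> (b - v) > 0"
proof -
  obtain X where X: "X \<in> TV" "v \<in> X" using A_in_tri v by blast
  have P: "{v} \<subseteq> mins A w (pt X)" using mins_pt X by auto
  obtain t q where q: "q \<in> A" "(-h) \<bullet> (q - v) < 0" "insert q {v} \<subseteq> mins A w (pt X + t *\<^sub>R (-h))"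
    by (rule mins_linesearch[OF finA P, of v "-h" a]) (use a in auto)
  obtain Y where "Y \<in> TV" "q \<in> Y" "v \<in> Y" using mins_sub_TV q(3) by (meson insert_subset order_trans)
  moreover have "q \<noteq> v" using q(2) by auto
  ultimately have "edg v q" unfolding Eall_def by blast
  then show ?thesis using that q by auto
qed

end

section \<open>Adjacent triangles and interior points\<close>

lemma cr_zero_parallel:
  assumes "cr u v = 0" "u \<noteq> 0"
  obtains k where "v = k *\<^sub>R u"
proof (rule that)
  have n: "u \<bullet> u \<noteq> 0" using assms(2) by simp
  have "cr u v = u$1 * v$2 - u$2 * v$1" by (simp add: cr_def)
  then have e: "u$1 * v$2 = u$2 * v$1" using assms(1) by simp
  have "(u \<bullet> u) * v$1 = (u \<bullet> v) * u$1" "(u \<bullet> u) * v$2 = (u \<bullet> v) * u$2"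
    using e by (simp_all add: inner_plane algebra_simps)
  then show "v = ((u \<bullet> v) / (u \<bullet> u)) *\<^sub>R u"
    using n by (simp add: plane_eq_iff field_simps)
qed

context regtri
begin

lemma pt_unique:
  assumes X: "X \<in> TV" and m: "X \<subseteq> mins A w x"
  shows "pt X = x"
proof -
  obtain p q r where pqr: "X = {p,q,r}" "cr (q - p) (r - p) = 1" using TV_tri[OF X] by blast
  have "w p + p \<bullet> x = w q + q \<bullet> x" "w p + p \<bullet> x = w r + r \<bullet> x"
    using m pqr by (auto intro!: mins_eq[of _ A w])
  moreover have "w p + p \<bullet> pt X = w q + q \<bullet> pt X" "w p + p \<bullet> pt X = w r + r \<bullet> pt X"
    using mins_pt[OF X] pqr by (auto intro!: mins_eq[of _ A w])
  ultimately have "(q - p) \<bullet> (pt X - x) = 0" "(r - p) \<bullet> (pt X - x) = 0"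
    by (simp_all add: inner_diff_left inner_diff_right)
  then show "pt X = x" using inner_zero_zero[of "q - p" "r - p" "pt X - x"] pqr(2) by simp
qed

section \<open>Gaps above a triangle and walks between triangles\<close>

definition hgt :: "plane set \<Rightarrow> real" where
  "hgt X = w (SOME p. p \<in> X) + (SOME p. p \<in> X) \<bullet> pt X"

text \<open>The vertical distance of the lifted point \<open>v\<close> from the plane through the
  lifted triangle \<open>X\<close>, the reduced cost of the simplex method.\<close>

definition gap :: "plane set \<Rightarrow> plane \<Rightarrow> real" where
  "gap X v = w v + v \<bullet> pt X - hgt X"

lemma hgt_eq: assumes "X \<in> TV" "p \<in> X" shows "hgt X = w p + p \<bullet> pt X"
proof -
  have "(SOME p. p \<in> X) \<in> X" using assms(2) by (rule someI)
  then show ?thesis unfolding hgt_def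
    using mins_eq[of _ A w "pt X" p] mins_pt[OF assms(1)] assms(2) by metis
qed

lemma gap_eq: "X \<in> TV \<Longrightarrow> p \<in> X \<Longrightarrow> gap X v = w v + v \<bullet> pt X - (w p + p \<bullet> pt X)"
  by (simp add: gap_def hgt_eq)

lemma TV_obtain_mem: assumes "X \<in> TV" obtains p where "p \<in> X" "p \<in> A"
  using TV_tri[OF assms] by blast

lemma gap_nonneg: assumes "X \<in> TV" "v \<in> A" shows "gap X v \<ge> 0"
proof -
  obtain p where p: "p \<in> X" using TV_obtain_mem assms(1) by metis
  then show ?thesis using gap_eq[OF assms(1) p] mins_le[of p A w "pt X" v] mins_pt[OF assms(1)] assms(2) by auto
qed

lemma gap_zero_iff: assumes "X \<in> TV" "v \<in> A" shows "gap X v = 0 \<longleftrightarrow> v \<in> X"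
proof -
  obtain p where p: "p \<in> X" using TV_obtain_mem assms(1) by metis
  have pm: "p \<in> mins A w (pt X)" using p mins_pt[OF assms(1)] by auto
  show ?thesis
  proof
    assume "gap X v = 0"
    then have "v \<in> mins A w (pt X)" using gap_eq[OF assms(1) p, of v] assms(2) by (intro mins_memI[OF pm]) auto
    then show "v \<in> X" using mins_pt[OF assms(1)] by auto
  next
    assume "v \<in> X" then show "gap X v = 0" using gap_eq[OF assms(1), of v v] by simp
  qed
qed

text \<open>Crossing the edge \<open>pq\<close> away from \<open>r\<close> moves the dual point along this vector.\<close>

definition nrm :: "plane \<Rightarrow> plane \<Rightarrow> plane \<Rightarrow> plane" where
  "nrm p q r = cr (q - p) (r - p) *\<^sub>R rot (q - p)"

lemma nrm_inner: "nrm p q r \<bullet> v = cr (q - p) (r - p) * cr (q - p) v"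
  by (simp add: nrm_def rot_inner)

text \<open>Both dual points tie \<open>p\<close> and \<open>q\<close>, so they differ along the
  normal of \<open>pq\<close>. As both doubled areas are 1, \<open>s\<close> gains on
  \<open>p\<close> at unit rate along \<open>nrm p q r\<close>, and the distance to go is exactly
  the gap.\<close>

lemma cross:
  assumes X: "{p,q,r} \<in> TV" and Y: "{p,q,s} \<in> TV" and op: "cr (q - p) (r - p) * cr (q - p) (s - p) < 0"
  shows "pt {p,q,s} = pt {p,q,r} + gap {p,q,r} s *\<^sub>R nrm p q r" and "gap {p,q,r} s > 0"
proof -
  define d where "d = pt {p,q,s} - pt {p,q,r} - gap {p,q,r} s *\<^sub>R nrm p q r"
  have op1: "cr (q - p) (r - p) * cr (q - p) (s - p) = -1"
    using TV_unit[OF X] TV_unit[OF Y] op by auto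
  have n: "(q - p) \<bullet> nrm p q r = 0" "(s - p) \<bullet> nrm p q r = -1"
    using op1 by (simp_all add: nrm_inner inner_commute[of _ "nrm p q r"])
  have e: "w p + p \<bullet> pt {p,q,s} = w q + q \<bullet> pt {p,q,s}" "w p + p \<bullet> pt {p,q,s} = w s + s \<bullet> pt {p,q,s}"
    "w p + p \<bullet> pt {p,q,r} = w q + q \<bullet> pt {p,q,r}"
    using mins_pt[OF X] mins_pt[OF Y] by (auto intro!: mins_eq[of _ A w])
  have g: "gap {p,q,r} s = w s + s \<bullet> pt {p,q,r} - (w p + p \<bullet> pt {p,q,r})"
    using gap_eq[OF X, of p s] by simp
  have "(q - p) \<bullet> d = 0"
    unfolding d_def inner_diff_right inner_scaleR_right n using e by (simp add: inner_diff_left)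
  moreover have "(s - p) \<bullet> d = 0"
    unfolding d_def inner_diff_right inner_scaleR_right n g using e by (simp add: inner_diff_left)
  ultimately have "d = 0" using op by (intro inner_zero_zero[of "q - p" "s - p" d]) auto
  then show "pt {p,q,s} = pt {p,q,r} + gap {p,q,r} s *\<^sub>R nrm p q r"
    by (simp add: d_def algebra_simps)
  have "s \<notin> {p,q,r}"
    using op tri_distinct[OF Y] mult_neg_neg[of "cr (q - p) (s - p)" "cr (q - p) (s - p)"]
    by (auto simp: mult_less_0_iff)
  then have "gap {p,q,r} s \<noteq> 0" using gap_zero_iff[OF X, of s] TV_sub[OF Y] by simp
  then show "gap {p,q,r} s > 0" using gap_nonneg[OF X, of s] TV_sub[OF Y] by simp
qed

lemma gap_cross:
  assumes X: "{p,q,r} \<in> TV" and Y: "{p,q,s} \<in> TV" and op: "cr (q - p) (r - p) * cr (q - p) (s - p) < 0"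
  shows "gap {p,q,s} v = gap {p,q,r} v + gap {p,q,r} s * (nrm p q r \<bullet> (v - p))"
proof -
  have "gap {p,q,s} v = w v + v \<bullet> pt {p,q,s} - (w p + p \<bullet> pt {p,q,s})" using gap_eq[OF Y] by simp
  moreover have "gap {p,q,r} v = w v + v \<bullet> pt {p,q,r} - (w p + p \<bullet> pt {p,q,r})" using gap_eq[OF X] by simp
  ultimately show ?thesis unfolding cross(1)[OF assms]
    by (simp add: inner_diff_right inner_add_right inner_commute algebra_simps)
qed

lemma TV_mem3: assumes "X \<in> TV" "p \<in> X" obtains q r where "X = {p,q,r}"
proof -
  obtain a b c where "X = {a,b,c}" using TV_tri[OF assms(1)] by blast
  then have "X = {p,b,c} \<or> X = {p,a,c} \<or> X = {p,a,b}" using assms(2) by auto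
  then show ?thesis using that by blast
qed

text \<open>The displacement from \<open>pt X\<close> to \<open>pt X0\<close> is a nonnegative
  combination of the two pivot directions at a suitable corner \<open>p\<close>. It lowers the total
  height of \<open>X0\<close> relative to \<open>p\<close>, hence so does one of the pivot
  directions, and the pivot along it decreases the total gap.\<close>

lemma walk_step:
  assumes X: "X \<in> TV" and X0: "X0 \<in> TV" and ne: "X \<noteq> X0"
  obtains p q r s where "X = {p,q,r}" "{p,q,s} \<in> TV" "cr (q - p) (r - p) * cr (q - p) (s - p) < 0"
    "\<exists>v\<in>X0. cr (q - p) (r - p) * cr (q - p) (v - p) < 0"
    "(\<Sum>v\<in>X0. gap {p,q,s} v) < (\<Sum>v\<in>X0. gap X v)"
proof -
  define \<delta> where "\<delta> = pt X0 - pt X"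
  define S where "S p m = (\<Sum>v\<in>X0. m \<bullet> (v - p))" for p m
  \<comment> \<open>At a corner that is lowest for \<open>\<delta>\<close> both coefficients of the
    decomposition \<open>dec\<close> are nonnegative.\<close>
  obtain p where p: "p \<in> X" "\<And>q. q \<in> X \<Longrightarrow> p \<bullet> \<delta> \<le> q \<bullet> \<delta>"
    using arg_min_if_finite[of X "\<lambda>p. p \<bullet> \<delta>"] TV_fin[OF X] TV_obtain_mem[OF X]
    by (metis all_not_in_conv not_less)
  obtain q r where X3: "X = {p,q,r}" using TV_mem3[OF X p(1)] by blast
  have T: "{p,q,r} \<in> TV" using X X3 by simp
  define D where "D = cr (q - p) (r - p)"
  have D: "D = 1 \<or> D = -1" using TV_unit[OF T] by (simp add: D_def)
  have gX: "(\<Sum>v\<in>X0. gap X v) > 0"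
  proof -
    have "\<not> X0 \<subseteq> X" using ne TV_card[OF X] TV_card[OF X0] TV_fin[OF X] card_subset_eq by metis
    then obtain v where v: "v \<in> X0" "v \<notin> X" by blast
    then have "gap X v > 0" using gap_zero_iff[OF X, of v] gap_nonneg[OF X, of v] TV_sub[OF X0] by force
    then show ?thesis using v gap_nonneg[OF X] TV_sub[OF X0] TV_fin[OF X0] by (intro sum_pos2[of _ v]) auto
  qed
  \<comment> \<open>At \<open>pt X0\<close> the points of \<open>X0\<close> are minimizers, so that
    relative to \<open>p\<close> none of them is positive any more.\<close>
  have "(\<Sum>v\<in>X0. gap X v) + S p \<delta> \<le> 0"
  proof -
    have "gap X v + \<delta> \<bullet> (v - p) \<le> 0" if v: "v \<in> X0" for v
    proof -
      have "gap X v + \<delta> \<bullet> (v - p) = w v + v \<bullet> pt X0 - (w p + p \<bullet> pt X0)"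
        using gap_eq[OF X p(1), of v] by (simp add: \<delta>_def inner_diff_left inner_diff_right inner_commute)
      also have "\<dots> \<le> 0" using mins_le[of v A w "pt X0" p] mins_pt[OF X0] v TV_sub[OF X] p(1) by auto
      finally show ?thesis .
    qed
    then show ?thesis unfolding S_def sum.distrib[symmetric] by (intro sum_nonpos)
  qed
  then have neg: "S p \<delta> < 0" using gX by linarith
  have S_lin: "S p (a *\<^sub>R x + b *\<^sub>R y) = a * S p x + b * S p y" for a b x y
    by (simp add: S_def inner_add_left sum.distrib sum_distrib_left)
  have dec: "\<delta> = ((r - p) \<bullet> \<delta>) *\<^sub>R nrm p q r + ((q - p) \<bullet> \<delta>) *\<^sub>R nrm p r q"
  proof -
    define e where "e = \<delta> - ((r - p) \<bullet> \<delta>) *\<^sub>R nrm p q r - ((q - p) \<bullet> \<delta>) *\<^sub>R nrm p r q"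
    have n: "(q - p) \<bullet> nrm p q r = 0" "(r - p) \<bullet> nrm p q r = 1" "(r - p) \<bullet> nrm p r q = 0" "(q - p) \<bullet> nrm p r q = 1"
      using D cr_skew[of "r - p" "q - p"] by (auto simp: nrm_inner inner_commute[of _ "nrm _ _ _"] D_def)
    have "(q - p) \<bullet> e = 0" "(r - p) \<bullet> e = 0"
      by (simp_all add: e_def inner_diff_right n)
    then have "e = 0" using D by (intro inner_zero_zero[of "q - p" "r - p"]) (auto simp: D_def)
    then show ?thesis by (simp add: e_def diff_eq_eq add.commute)
  qed
  have c: "(r - p) \<bullet> \<delta> \<ge> 0" "(q - p) \<bullet> \<delta> \<ge> 0"
    using p X3 by (auto simp: inner_diff_left)
  have "((r - p) \<bullet> \<delta>) * S p (nrm p q r) + ((q - p) \<bullet> \<delta>) * S p (nrm p r q) < 0"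
    using neg S_lin dec by metis
  then have "S p (nrm p q r) < 0 \<or> S p (nrm p r q) < 0"
    using c by (meson add_nonneg_nonneg linorder_not_less mult_nonneg_nonneg)
  moreover have "X = {p,r,q}" using X3 by auto
  ultimately obtain a b where ab: "X = {p,a,b}" "S p (nrm p a b) < 0"
    using X3 by blast
  have T': "{p,a,b} \<in> TV" using X ab by simp
  define m where "m = nrm p a b"
  have D': "cr (a - p) (b - p) = 1 \<or> cr (a - p) (b - p) = -1" by (rule TV_unit[OF T'])
  have "\<exists>v\<in>X0. m \<bullet> (v - p) < 0"
  proof (rule ccontr)
    assume "\<not> ?thesis" then have "S p m \<ge> 0" unfolding S_def by (intro sum_nonneg) force
    then show False using ab m_def by simp
  qed
  then obtain v where v: "v \<in> X0" "m \<bullet> (v - p) < 0" by blast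
  have vA: "v \<in> A" using v TV_sub[OF X0] by blast
  have P: "{p,a} \<subseteq> mins A w (pt {p,a,b})" using mins_pt[OF T'] by auto
  obtain t s where s: "t \<ge> 0" "s \<in> A" "m \<bullet> (s - p) < 0" "insert s {p,a} \<subseteq> mins A w (pt {p,a,b} + t *\<^sub>R m)"
    by (rule mins_linesearch[OF finA P, of p m v]) (use v vA in \<open>auto simp: m_def nrm_inner\<close>)
  obtain Z where Z: "Z \<in> TV" "insert s {p,a} \<subseteq> Z" "mins A w (pt {p,a,b} + t *\<^sub>R m) \<subseteq> Z"
    using mins_sub_TV s(4) by (meson order_trans)
  have dd: "p \<noteq> a" "p \<noteq> s" "a \<noteq> s" using s(3) tri_distinct[OF T'] by (auto simp: m_def nrm_inner)
  then have "Z = {p,a,s}" using tri_eqI[of p a s Z] Z by auto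
  then have Y: "{p,a,s} \<in> TV" using Z by simp
  have op: "cr (a - p) (b - p) * cr (a - p) (s - p) < 0" using s(3) by (simp add: m_def nrm_inner)
  have "(\<Sum>v\<in>X0. gap {p,a,s} v) = (\<Sum>v\<in>X0. gap X v) + gap X s * S p m"
    unfolding gap_cross[OF T' Y op] by (simp add: ab(1) S_def m_def sum.distrib sum_distrib_left)
  also have "\<dots> < (\<Sum>v\<in>X0. gap X v)"
    using ab cross(2)[OF T' Y op] by (simp add: m_def mult_pos_neg)
  finally show ?thesis using that[OF ab(1) Y op _] v by (auto simp: m_def nrm_inner)
qed

text \<open>The total gap of the vertices of \<open>X0\<close> decreases with each step of a walk towards \<open>X0\<close>, so the walk
  reaches \<open>X0\<close>.\<close>

lemma connected_tri:
  assumes X0: "X0 \<in> TV" and X: "X \<in> S" "S \<subseteq> TV"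
    and step: "\<And>p q r s. {p,q,r} \<in> S \<Longrightarrow> {p,q,s} \<in> TV \<Longrightarrow> cr (q - p) (r - p) * cr (q - p) (s - p) < 0 \<Longrightarrow>
        \<exists>v\<in>X0. cr (q - p) (r - p) * cr (q - p) (v - p) < 0 \<Longrightarrow> {p,q,s} \<in> S"
  shows "X0 \<in> S"
proof -
  have "finite S" using X(2) finTV finite_subset by auto
  then obtain Y where Y: "Y \<in> S" "\<And>Z. Z \<in> S \<Longrightarrow> (\<Sum>v\<in>X0. gap Y v) \<le> (\<Sum>v\<in>X0. gap Z v)"
    using arg_min_if_finite[of S "\<lambda>Y. \<Sum>v\<in>X0. gap Y v"] X(1) by (metis empty_iff not_less)
  show ?thesis
  proof (cases "Y = X0")
    case False
    have "Y \<in> TV" using Y X by blast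
    from walk_step[OF this X0 False] obtain p q r s where st: "Y = {p,q,r}" "{p,q,s} \<in> TV" "cr (q - p) (r - p) * cr (q - p) (s - p) < 0"
      "\<exists>v\<in>X0. cr (q - p) (r - p) * cr (q - p) (v - p) < 0" "(\<Sum>v\<in>X0. gap {p,q,s} v) < (\<Sum>v\<in>X0. gap Y v)" by blast
    then have "{p,q,s} \<in> S" using step[of p q r s] Y(1) by blast
    then show ?thesis using Y(2) st(5) by force
  qed (use Y in auto)
qed

section \<open>Orientation, boundary points and chords of the hull\<close>

definition ccw :: "plane \<Rightarrow> plane \<Rightarrow> plane \<Rightarrow> bool" where
  "ccw p q r \<longleftrightarrow> {p,q,r} \<in> TV \<and> cr (q - p) (r - p) = 1"

lemma ccw_rot: "ccw p q r \<Longrightarrow> ccw q r p"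
  unfolding ccw_def using cr_rebase[of q p r] by (auto simp: insert_commute)

lemma ccw_edg: "ccw p q r \<Longrightarrow> edg p q \<and> edg q r \<and> edg r p \<and> edg q p \<and> edg r q \<and> edg p r"
  unfolding ccw_def using tri_edg by blast

lemma ccw_distinct: "ccw p q r \<Longrightarrow> p \<noteq> q \<and> q \<noteq> r \<and> p \<noteq> r"
  unfolding ccw_def using tri_distinct by blast

lemma ccw_A: "ccw p q r \<Longrightarrow> p \<in> A \<and> q \<in> A \<and> r \<in> A"
  unfolding ccw_def using TV_sub by blast

lemma ccw_unique: "ccw p q r \<Longrightarrow> ccw p q s \<Longrightarrow> r = s"
  unfolding ccw_def using third_unique_pos[of p q r s] by simp

lemma TV_ccw: assumes "{p,q,r} \<in> TV" shows "ccw p q r \<or> ccw q p r"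
  using TV_unit[OF assms] assms cr_swap[of p q r] by (auto simp: ccw_def insert_commute)

lemma ccwI: "{p,q,r} \<in> TV \<Longrightarrow> cr (q - p) (r - p) > 0 \<Longrightarrow> ccw p q r"
  using TV_unit[of p q r] by (auto simp: ccw_def)

lemma ccwI': assumes "{p,q,r} \<in> TV" "cr (q - p) (r - p) < 0" shows "ccw q p r"
  using assms cr_swap[of p q r] ccwI[of q p r] by (simp add: insert_commute)

lemma ccw_pos: "ccw p q r \<Longrightarrow> cr (q - p) (r - p) = 1"
  by (simp add: ccw_def)

lemma edge_left:
  assumes "edg p q" "a \<in> A" "cr (q - p) (a - p) > 0"
  obtains r where "ccw p q r"
  using edge_side[OF assms(1,2), of 1] assms(3) ccwI by (metis mult_1)

lemma edg_ccw: assumes "edg p q" shows "(\<exists>r. ccw p q r) \<or> (\<exists>r. ccw q p r)"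
proof -
  obtain r where "{p,q,r} \<in> TV" using edgE[OF assms] by metis
  then show ?thesis using TV_ccw by blast
qed

lemma TV_ccwE: assumes "X \<in> TV" obtains p q r where "X = {p,q,r}" "ccw p q r"
  using TV_tri[OF assms] assms unfolding ccw_def by metis

text \<open>The interior lattice points: no closed half plane with \<open>p\<close> on its border contains \<open>A\<close>.\<close>

definition I :: "plane set" where
  "I = {p \<in> A. \<forall>d. d \<noteq> 0 \<longrightarrow> (\<exists>a\<in>A. d \<bullet> (a - p) > 0)}"

lemma I_sub: "I \<subseteq> A"
  by (auto simp: I_def)

lemma I_dir: "p \<in> I \<Longrightarrow> d \<noteq> 0 \<Longrightarrow> \<exists>a\<in>A. d \<bullet> (a - p) > 0"
  by (auto simp: I_def)

lemma boundary_dir: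
  assumes "v \<in> A" "v \<notin> I"
  obtains d where "d \<noteq> 0" "\<And>a. a \<in> A \<Longrightarrow> d \<bullet> (a - v) \<ge> 0"
proof -
  obtain d where d: "d \<noteq> 0" "\<And>a. a \<in> A \<Longrightarrow> \<not> d \<bullet> (a - v) > 0"
    using assms by (auto simp: I_def)
  show ?thesis by (rule that[of "-d"]) (use d in \<open>auto simp: not_less\<close>)
qed

lemma I_ccw: assumes "p \<in> I" "edg p q" obtains r where "ccw p q r"
proof -
  have "p \<noteq> q" using assms(2) by (metis edgE)
  then have "rot (q - p) \<noteq> 0" by (simp add: plane_eq_iff) metis
  then obtain a where "a \<in> A" "cr (q - p) (a - p) > 0"
    using I_dir[OF assms(1)] by (metis rot_inner)
  then show ?thesis using edge_left[OF assms(2)] that by blast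
qed

lemma I_ccw': assumes "p \<in> I" "edg p q" obtains r where "ccw q p r"
proof -
  have "p \<noteq> q" using assms(2) by (metis edgE)
  then have "rot (p - q) \<noteq> 0" by (simp add: plane_eq_iff) metis
  then obtain a where a: "a \<in> A" "cr (p - q) (a - p) > 0"
    using I_dir[OF assms(1)] by (metis rot_inner)
  have "cr (p - q) (a - q) = cr (p - q) (a - p)" by (simp add: cr_def algebra_simps)
  moreover have "edg q p" using assms(2) by (simp add: insert_commute)
  ultimately show ?thesis using edge_left[of q p a] that a by auto
qed

text \<open>Since \<open>k > 1\<close>, the point \<open>b\<close> lies strictly between
  \<open>a\<close> and the interior point \<open>i\<close>, so a line that supports the hull at
  \<open>b\<close> would also support it at \<open>i\<close>.\<close>

lemma boundary_line_aux:
  assumes "edg a b" "b \<notin> I" "i \<in> I" "a \<in> A" "b \<in> A" and k: "i - a = k *\<^sub>R (b - a)" "k > 1"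
  shows False
proof -
  obtain d where d: "d \<noteq> 0" "\<And>x. x \<in> A \<Longrightarrow> d \<bullet> (x - b) \<ge> 0" by (rule boundary_dir[OF assms(5,2)]) blast
  have "i - b = (k - 1) *\<^sub>R (b - a)" using k(1) by (simp add: scaleR_diff_left algebra_simps)
  then have e: "d \<bullet> (i - b) = (k - 1) * (d \<bullet> (b - a))" by simp
  have "d \<bullet> (a - b) \<ge> 0" using d(2) assms(4) by blast
  then have "d \<bullet> (b - a) \<le> 0" by (simp add: inner_diff_right)
  then have "d \<bullet> (i - b) \<le> 0" using k(2) e by (simp add: mult_nonneg_nonpos)
  moreover obtain x where "x \<in> A" "(-d) \<bullet> (x - i) > 0" using I_dir[OF assms(3), of "-d"] d(1) by auto
  moreover have "d \<bullet> (x - i) = d \<bullet> (x - b) - d \<bullet> (i - b)" by (simp add: inner_diff_right)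
  ultimately show False using d(2)[of x] by simp
qed

text \<open>On the line \<open>ab\<close> a lattice point differs from \<open>a\<close> by an
  integral multiple of \<open>b - a\<close>, by unimodularity, so \<open>i\<close> would lie beyond
  one of the two ends.\<close>

lemma boundary_edge_off_line:
  assumes e: "edg a b" and ab: "a \<notin> I" "b \<notin> I" and i: "i \<in> I"
  shows "cr (b - a) (i - a) \<noteq> 0"
proof
  assume z: "cr (b - a) (i - a) = 0"
  obtain r where r: "{a,b,r} \<in> TV" "a \<noteq> b" using edgE[OF e] by metis
  define D where "D = cr (b - a) (r - a)"
  have D: "D = 1 \<or> D = -1" using TV_unit[OF r(1)] by (simp add: D_def)
  have AA: "a \<in> A" "b \<in> A" "r \<in> A" "i \<in> A" using TV_sub[OF r(1)] I_sub i by auto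
  define k where "k = D * cr (i - a) (r - a)"
  have "D *\<^sub>R (i - a) = cr (i - a) (r - a) *\<^sub>R (b - a)"
    using cr_cramer[of "b - a" "r - a" "i - a"] z by (simp add: D_def)
  then have k: "i - a = k *\<^sub>R (b - a)" using D by (auto simp: k_def) (metis minus_diff_eq minus_minus)
  have "cr (i - a) (r - a) \<in> \<int>" using latA AA by (auto intro!: cr_lattice lattice_diff)
  then have "k \<in> \<int>" using D by (auto simp: k_def)
  then obtain n where n: "k = of_int n" by (auto elim: Ints_cases)
  have "k \<noteq> 0" using k i ab by auto
  moreover have "k \<noteq> 1" using k i ab by auto
  ultimately have "n < 0 \<or> n > 1" using n by auto
  then show False
  proof
    assume "n > 1" then show False using boundary_line_aux[OF e ab(2) i AA(1,2) k] n by simp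
  next
    assume "n < 0"
    then have k1: "1 - k > 1" using n by simp
    have "i - b = (1 - k) *\<^sub>R (a - b)" using k by (simp add: scaleR_diff_left scaleR_diff_right algebra_simps)
    then show False using boundary_line_aux[OF _ ab(1) i AA(2,1) _ k1] e by (simp add: insert_commute)
  qed
qed

text \<open>The combination is the crossing point of the segment \<open>ij\<close> with the line
  \<open>ab\<close>, seen from \<open>a\<close> and scaled by \<open>ci + cj\<close>. If it were
  outside the segment \<open>ab\<close>, the end of \<open>ab\<close> next to it would be interior
  to the hull.\<close>

lemma chord_cross:
  assumes ab: "a \<in> A" "b \<in> A" "a \<notin> I" "b \<notin> I" and ij: "i \<in> A" "j \<in> A"
    and c: "cr (b - a) (i - a) = ci" "ci > 0" "cr (b - a) (j - a) = - cj" "cj > 0"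
  obtains t where "0 \<le> t" "t \<le> 1" "cj *\<^sub>R (i - a) + ci *\<^sub>R (j - a) = ((ci + cj) * t) *\<^sub>R (b - a)"
proof -
  define V where "V = cj *\<^sub>R (i - a) + ci *\<^sub>R (j - a)"
  have "cr (b - a) V = 0" using c by (simp add: V_def cr_add)
  moreover have "b - a \<noteq> 0" using c by auto
  ultimately obtain \<kappa> where \<kappa>: "V = \<kappa> *\<^sub>R (b - a)" using cr_zero_parallel by blast
  have "\<not> \<kappa> < 0"
  proof
    assume neg: "\<kappa> < 0"
    obtain d where d: "d \<noteq> 0" "\<And>x. x \<in> A \<Longrightarrow> d \<bullet> (x - a) \<ge> 0" by (rule boundary_dir[OF ab(1,3)]) blast
    have "d \<bullet> V = cj * (d \<bullet> (i - a)) + ci * (d \<bullet> (j - a))" by (simp add: V_def inner_add_right)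
    moreover have "d \<bullet> V \<le> 0" using \<kappa> neg d(2)[OF ab(2)] by (simp add: mult_nonpos_nonneg)
    moreover have "cj * (d \<bullet> (i - a)) \<ge> 0" "ci * (d \<bullet> (j - a)) \<ge> 0" using c ij d(2) by simp_all
    ultimately have "cj * (d \<bullet> (i - a)) = 0" "d \<bullet> V = 0" by linarith+
    then have "(i - a) \<bullet> d = 0" "(b - a) \<bullet> d = 0" using c \<kappa> neg by (simp_all add: inner_commute)
    then show False using inner_zero_zero[of "b - a" "i - a" d] c d(1) by simp
  qed
  moreover have "\<not> \<kappa> > ci + cj"
  proof
    assume big: "\<kappa> > ci + cj"
    obtain d where d: "d \<noteq> 0" "\<And>x. x \<in> A \<Longrightarrow> d \<bullet> (x - b) \<ge> 0" by (rule boundary_dir[OF ab(2,4)]) blast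
    have "cj * (d \<bullet> (i - b)) + ci * (d \<bullet> (j - b)) = d \<bullet> V - (ci + cj) * (d \<bullet> (b - a))"
      by (simp add: V_def inner_add_right inner_diff_right algebra_simps)
    also have "\<dots> = (\<kappa> - (ci + cj)) * (d \<bullet> (b - a))" by (simp add: \<kappa> left_diff_distrib)
    finally have e: "cj * (d \<bullet> (i - b)) + ci * (d \<bullet> (j - b)) = (\<kappa> - (ci + cj)) * (d \<bullet> (b - a))" .
    have "d \<bullet> (b - a) \<le> 0" using d(2)[OF ab(1)] by (simp add: inner_diff_right)
    then have "(\<kappa> - (ci + cj)) * (d \<bullet> (b - a)) \<le> 0" using big by (simp add: mult_nonneg_nonpos)
    moreover have "cj * (d \<bullet> (i - b)) \<ge> 0" "ci * (d \<bullet> (j - b)) \<ge> 0" using c ij d(2) by simp_all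
    ultimately have "cj * (d \<bullet> (i - b)) = 0" "(\<kappa> - (ci + cj)) * (d \<bullet> (b - a)) = 0" using e by linarith+
    then have "d \<bullet> (i - b) = 0" and q: "(b - a) \<bullet> d = 0" using c big by (simp_all add: inner_commute)
    then have "(i - a) \<bullet> d = 0" by (simp add: inner_diff_left inner_diff_right inner_commute)
    then show False using q inner_zero_zero[of "b - a" "i - a" d] c d(1) by simp
  qed
  ultimately have "0 \<le> \<kappa> / (ci + cj)" "\<kappa> / (ci + cj) \<le> 1" using c by (simp_all add: divide_le_eq_1)
  then show ?thesis using that[of "\<kappa> / (ci + cj)"] \<kappa> c by (simp add: V_def)
qed

text \<open>\<open>chord_cross\<close> yields a point of the segment \<open>ab\<close> with positive
  weights at \<open>u\<close> and \<open>v\<close>; by \<open>mins_hull\<close> both would be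
  corners of a triangle at \<open>ab\<close>, which has only one corner off the line.\<close>

lemma edges_no_cross:
  assumes e: "edg a b" "edg u v" and ab: "a \<notin> I" "b \<notin> I"
    and c: "cr (b - a) (u - a) > 0" "cr (b - a) (v - a) < 0"
  shows False
proof -
  obtain r where r: "{a,b,r} \<in> TV" "a \<noteq> b" using edgE[OF e(1)] by metis
  obtain r' where r': "{u,v,r'} \<in> TV" "u \<noteq> v" using edgE[OF e(2)] by metis
  define ci cj where "ci = cr (b - a) (u - a)" and "cj = - cr (b - a) (v - a)"
  have p: "ci > 0" "cj > 0" using c by (auto simp: ci_def cj_def)
  obtain t where t: "0 \<le> t" "t \<le> 1" "cj *\<^sub>R (u - a) + ci *\<^sub>R (v - a) = ((ci + cj) * t) *\<^sub>R (b - a)"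
    using chord_cross[of a b u v ci cj] edg_A e ab p by (metis ci_def cj_def minus_minus)
  define f where "f x = (if x = u then cj / (ci + cj) else ci / (ci + cj))" for x
  have f1: "f u + f v = 1" using p r'(2) by (auto simp: f_def add_divide_distrib[symmetric])
  have f: "(ci + cj) * f u = cj" "(ci + cj) * f v = ci" using p r'(2) by (auto simp: f_def)
  have E: "(ci + cj) *\<^sub>R (f u *\<^sub>R (u - a) + f v *\<^sub>R (v - a)) = (ci + cj) *\<^sub>R (t *\<^sub>R (b - a))"
    using t(3) f by (simp add: scaleR_add_right)
  have "f u *\<^sub>R (u - a) + f v *\<^sub>R (v - a) = t *\<^sub>R (b - a)"
    using scaleR_left_imp_eq[OF _ E] p by simp
  moreover have "f u *\<^sub>R u + f v *\<^sub>R v = (f u + f v) *\<^sub>R a + (f u *\<^sub>R (u - a) + f v *\<^sub>R (v - a))"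
    by (simp add: scaleR_add_left scaleR_diff_right)
  ultimately have "f u *\<^sub>R u + f v *\<^sub>R v = a + t *\<^sub>R (b - a)" using f1 by simp
  then have "f u *\<^sub>R u + f v *\<^sub>R v = (1 - t) *\<^sub>R a + t *\<^sub>R b" by (simp add: scaleR_diff_left scaleR_diff_right)
  then have z: "(\<Sum>x\<in>{u,v}. f x *\<^sub>R x) \<in> convex hull {a,b}"
    unfolding convex_hull_2 mem_Collect_eq using r'(2) t by (intro exI[of _ "1 - t"] exI[of _ t]) simp
  have "{u,v} \<subseteq> mins A w (pt {a,b,r})"
    using mins_pt[OF r(1)] mins_pt[OF r'(1)] p r'(2) f1 z
    by - (rule mins_hull[of "{u,v}" A w "pt {u,v,r'}" f "{a,b}"], auto simp: f_def)
  then have "u \<in> {a,b,r}" "v \<in> {a,b,r}" using mins_pt[OF r(1)] by auto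
  then show False using c r'(2) by auto
qed

end

section \<open>Counting triangles and edges\<close>

text \<open>A linear functional that separates all lattice points, by its irrational slope. Each triangle
  has a highest and a middle vertex for it, and counting triangles by the one and by the other
  yields the two relations between the numbers of vertices, edges and triangles.\<close>

definition irr :: plane where
  "irr = vector [1, sqrt 2]"

lemma irr_inner: "irr \<bullet> v = v$1 + sqrt 2 * v$2"
  by (simp add: irr_def inner_plane)

lemma sqrt_2_not_rat: "sqrt 2 \<notin> \<rat>"
proof
  assume "sqrt 2 \<in> \<rat>"
  then obtain m n :: nat where mn: "n \<noteq> 0" "\<bar>sqrt 2\<bar> = real m / real n" "coprime m n"
    by (rule Rats_abs_nat_div_natE)
  then have "real m = sqrt 2 * real n" by simp
  then have "(real m)\<^sup>2 = 2 * (real n)\<^sup>2" by (simp add: power_mult_distrib)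
  then have e: "m\<^sup>2 = 2 * n\<^sup>2" by (metis of_nat_eq_iff of_nat_mult of_nat_numeral of_nat_power)
  then have "even m" by (metis dvd_triv_left even_power pos2)
  then obtain k where "m = 2 * k" by (rule dvdE)
  then have "n\<^sup>2 = 2 * k\<^sup>2" using e by (simp add: power_mult_distrib)
  then have "even n" by (metis dvd_triv_left even_power pos2)
  then show False using \<open>even m\<close> mn(3) by (metis coprime_common_divisor odd_one)
qed

lemma irr_generic:
  assumes "u \<in> lattice_points" "v \<in> lattice_points" "irr \<bullet> (u - v) = 0"
  shows "u = v"
proof -
  have "u - v \<in> lattice_points" using assms lattice_diff by blast
  then obtain m n where mn: "(u - v)$1 = of_int m" "(u - v)$2 = of_int n"
    unfolding lattice_points_def by (metis (mono_tags, lifting) Ints_cases mem_Collect_eq)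
  have e: "of_int m + sqrt 2 * of_int n = 0" using assms(3) mn by (simp only: irr_inner)
  have "n = 0"
  proof (rule ccontr)
    assume "n \<noteq> 0"
    then have "sqrt 2 = of_int (- m) / of_int n" using e by (simp add: field_simps)
    then have "sqrt 2 \<in> \<rat>" by (metis Rats_divide Rats_of_int)
    then show False using sqrt_2_not_rat by simp
  qed
  then have "(u - v)$1 = 0" "(u - v)$2 = 0" using e mn by auto
  then show ?thesis by (simp add: plane_eq_iff)
qed

lemma irr_irr: "irr \<bullet> irr = 3"
  by (simp add: irr_def inner_plane)

context regtri
begin

text \<open>A triangle at \<open>va\<close> gives a lattice basis, in which the parallel vector
  \<open>b - v\<close> is an integral multiple of \<open>a - v\<close>, with factor at least 1. By
  symmetry both factors are 1.\<close>

lemma edge_parallel_unique: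
  assumes a: "edg v a" and b: "edg v b" and c: "cr (a - v) (b - v) = 0" and h: "h \<bullet> (a - v) > 0" "h \<bullet> (b - v) > 0"
  shows "a = b"
proof -
  have main: "\<exists>k. k \<ge> 1 \<and> b - v = k *\<^sub>R (a - v)" if a: "edg v a" and b: "edg v b" and c: "cr (a - v) (b - v) = 0"
    and h: "h \<bullet> (a - v) > 0" "h \<bullet> (b - v) > 0" for a b
  proof -
    obtain r where r: "{v,a,r} \<in> TV" using edgE[OF a] by metis
    define D where "D = cr (a - v) (r - v)"
    have D: "D = 1 \<or> D = -1" using TV_unit[OF r] by (simp add: D_def)
    define k where "k = D * cr (b - v) (r - v)"
    have "D *\<^sub>R (b - v) = cr (b - v) (r - v) *\<^sub>R (a - v)"
      using cr_cramer[of "a - v" "r - v" "b - v"] c by (simp add: D_def)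
    then have "(D * D) *\<^sub>R (b - v) = k *\<^sub>R (a - v)" unfolding k_def by (metis scaleR_scaleR)
    then have k: "b - v = k *\<^sub>R (a - v)" using D by auto
    have "v \<in> A" "b \<in> A" "r \<in> A" using edg_A[OF b] TV_sub[OF r] by auto
    then have "cr (b - v) (r - v) \<in> \<int>" using latA by (auto intro!: cr_lattice lattice_diff)
    then have "k \<in> \<int>" using D by (auto simp: k_def)
    moreover have "h \<bullet> (b - v) = k * (h \<bullet> (a - v))" using k by simp
    then have "k > 0" using h by (simp add: zero_less_mult_iff)
    ultimately have "k \<ge> 1" by (auto elim: Ints_cases)
    then show ?thesis using k by blast
  qed
  obtain k where k: "k \<ge> 1" "b - v = k *\<^sub>R (a - v)" using main[OF a b c h] by blast
  obtain l where l: "l \<ge> 1" "a - v = l *\<^sub>R (b - v)"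
    using main[OF b a _ h(2,1)] c cr_skew[of "a - v" "b - v"] by auto
  have e: "h \<bullet> (b - v) = k * (h \<bullet> (a - v))" "h \<bullet> (a - v) = l * (h \<bullet> (b - v))"
    using arg_cong[OF k(2), of "\<lambda>x. h \<bullet> x"] arg_cong[OF l(2), of "\<lambda>x. h \<bullet> x"] by (simp_all only: inner_scaleR_right)
  have "h \<bullet> (a - v) \<le> h \<bullet> (b - v)" using e(1) k(1) h by simp
  moreover have "h \<bullet> (b - v) \<le> h \<bullet> (a - v)" using e(2) l(1) h by simp
  ultimately have "k = 1" using e(1) h by simp
  then show ?thesis using k(2) by simp
qed

section \<open>Counting triangles by their highest and by their middle vertex\<close>

definition down :: "plane \<Rightarrow> plane set" where
  "down v = {u. edg v u \<and> irr \<bullet> (u - v) < 0}"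

lemma fin_down: "finite (down v)"
  by (rule finite_subset[OF _ finA]) (use edg_A in \<open>auto simp: down_def\<close>)

lemma down_irr: "u \<in> down v \<Longrightarrow> irr \<bullet> (u - v) < 0"
  by (simp add: down_def)

lemma irr_ne: "u \<in> A \<Longrightarrow> v \<in> A \<Longrightarrow> u \<noteq> v \<Longrightarrow> irr \<bullet> (u - v) \<noteq> 0"
  using irr_generic latA by blast

text \<open>Directions in an open half plane are ordered by angle: up to the sign
  \<open>\<epsilon>\<close>, \<open>sl\<close> is the tangent of the angle with \<open>h\<close>.
  Strictness holds as no two edges at \<open>v\<close> have the same direction.\<close>

lemma extreme_half:
  assumes fin: "finite N" "N \<noteq> {}" and N: "\<And>u. u \<in> N \<Longrightarrow> edg v u \<and> h \<bullet> (u - v) > 0"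
    and eps: "\<epsilon> = 1 \<or> \<epsilon> = -1"
  obtains e where "e \<in> N" "\<And>u. u \<in> N \<Longrightarrow> u \<noteq> e \<Longrightarrow> \<epsilon> * cr (u - v) (e - v) > 0"
proof -
  define sl where "sl u = \<epsilon> * ((rot h \<bullet> (u - v)) / (h \<bullet> (u - v)))" for u
  obtain e where e: "e \<in> N" "\<And>u. u \<in> N \<Longrightarrow> sl u \<le> sl e"
    using arg_min_if_finite[OF fin, of "\<lambda>u. - sl u"] by (metis neg_less_iff_less not_less)
  have hh: "h \<bullet> h > 0" using N[OF e(1)] by (auto simp: less_le)
  have hcr: "cr x y * (h \<bullet> h) = (h \<bullet> x) * (rot h \<bullet> y) - (rot h \<bullet> x) * (h \<bullet> y)" for x y
    by (simp add: inner_plane cr_def algebra_simps)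
  have 1: "\<epsilon> * cr (e - v) (u - v) \<le> 0" if u: "u \<in> N" for u
  proof -
    have n: "h \<bullet> (u - v) > 0" "h \<bullet> (e - v) > 0" using u e N by auto
    have aux: "\<epsilon> * (a * d - c * b) = a * b * (\<epsilon> * (d / b) - \<epsilon> * (c / a))" if "a \<noteq> 0" "b \<noteq> 0" for a b c d :: real
      using that by (simp add: field_simps)
    have "\<epsilon> * cr (e - v) (u - v) * (h \<bullet> h) = \<epsilon> * (cr (e - v) (u - v) * (h \<bullet> h))" by simp
    also have "\<dots> = (h \<bullet> (e - v)) * (h \<bullet> (u - v)) * (sl u - sl e)"
      unfolding hcr sl_def using n by (intro aux) auto
    also have "\<dots> \<le> 0" using n e(2)[OF u] by (intro mult_nonneg_nonpos mult_nonneg_nonneg) auto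
    finally show ?thesis using hh by (simp add: mult_le_0_iff)
  qed
  have 2: "\<epsilon> * cr (u - v) (e - v) > 0" if u: "u \<in> N" "u \<noteq> e" for u
  proof -
    have "cr (u - v) (e - v) \<noteq> 0"
      using edge_parallel_unique[of v u e h] u e N by blast
    then show ?thesis using 1[OF u(1)] cr_skew[of "u - v" "e - v"] eps by auto
  qed
  show ?thesis using that[OF e(1) 2] .
qed

lemma extreme_down:
  assumes "down v \<noteq> {}" and eps: "\<epsilon> = 1 \<or> \<epsilon> = -1"
  obtains e where "e \<in> down v" "\<And>u. u \<in> down v \<Longrightarrow> \<epsilon> * cr (e - v) (u - v) \<le> 0"
    "\<And>u. u \<in> down v \<Longrightarrow> u \<noteq> e \<Longrightarrow> \<epsilon> * cr (u - v) (e - v) > 0"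
proof -
  have N: "edg v u \<and> - irr \<bullet> (u - v) > 0" if "u \<in> down v" for u using that by (simp add: down_def)
  obtain e where e: "e \<in> down v" "\<And>u. u \<in> down v \<Longrightarrow> u \<noteq> e \<Longrightarrow> \<epsilon> * cr (u - v) (e - v) > 0"
    using extreme_half[OF fin_down assms(1) N eps] by blast
  have "\<epsilon> * cr (e - v) (u - v) \<le> 0" if "u \<in> down v" for u
    using e(2)[OF that] cr_skew[of "u - v" "e - v"] by (cases "u = e") auto
  then show ?thesis using that[OF e(1) _ e(2)] by blast
qed

definition Top :: "plane \<Rightarrow> plane set set" where
  "Top v = {X \<in> TV. v \<in> X \<and> (\<forall>u\<in>X. u \<noteq> v \<longrightarrow> irr \<bullet> (u - v) < 0)}"

text \<open>The triangles below \<open>v\<close> fill the sectors between consecutive descending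
  edges. The bijection sends each descending edge but the last one, \<open>e\<close>, to the
  triangle on its left.\<close>

lemma card_Top:
  assumes "down v \<noteq> {}"
  shows "card (Top v) + 1 = card (down v)"
proof -
  obtain e where e: "e \<in> down v" "\<And>u. u \<in> down v \<Longrightarrow> 1 * cr (e - v) (u - v) \<le> 0"
    "\<And>u. u \<in> down v \<Longrightarrow> u \<noteq> e \<Longrightarrow> 1 * cr (u - v) (e - v) > 0"
    by (rule extreme_down[OF assms, of 1]) auto
  define g where "g u = {v, u, THE r. ccw v u r}" for u
  have g: "\<exists>r. ccw v u r \<and> r \<in> down v \<and> g u = {v,u,r}" if u: "u \<in> down v - {e}" for u
  proof -
    obtain r where r: "{v,u,r} \<in> TV" "1 * cr (u - v) (r - v) > 0" "(-irr) \<bullet> (r - v) > 0"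
      by (rule next_edge[of v u e 1 "-irr"]) (use u e e(3)[of u] in \<open>auto simp: down_def\<close>)
    then have c: "ccw v u r" using ccwI by simp
    then have "r \<in> down v" using r ccw_edg by (auto simp: down_def)
    moreover have "(THE r. ccw v u r) = r" using c ccw_unique by blast
    ultimately show ?thesis using c by (auto simp: g_def)
  qed
  have "bij_betw g (down v - {e}) (Top v)"
    unfolding bij_betw_def
  proof
    show "inj_on g (down v - {e})"
    proof (rule inj_onI)
      fix a b assume ab: "a \<in> down v - {e}" "b \<in> down v - {e}" "g a = g b"
      obtain r s where r: "ccw v a r" "g a = {v,a,r}" and s: "ccw v b s" "g b = {v,b,s}"
        using g ab by metis
      show "a = b"
      proof (rule ccontr)
        assume "a \<noteq> b"
        then have "b = r" "a = s" using r s ab(3) ccw_distinct[OF r(1)] ccw_distinct[OF s(1)] by auto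
        then show False using r(1) s(1) cr_skew[of "a - v" "b - v"] by (simp add: ccw_def)
      qed
    qed
    show "g ` (down v - {e}) = Top v"
    proof
      show "g ` (down v - {e}) \<subseteq> Top v"
      proof
        fix X assume "X \<in> g ` (down v - {e})"
        then obtain u where u: "u \<in> down v - {e}" "X = g u" by blast
        obtain r where r: "ccw v u r" "r \<in> down v" "X = {v,u,r}" using g u by metis
        have "X \<in> TV" using r by (simp add: ccw_def)
        then show "X \<in> Top v" using r u down_irr by (auto simp: Top_def)
      qed
      show "Top v \<subseteq> g ` (down v - {e})"
      proof
        fix X assume X: "X \<in> Top v"
        then obtain a b where ab: "X = {v,a,b}" using TV_mem3[of X v] by (auto simp: Top_def)
        have T: "{v,a,b} \<in> TV" using X ab by (simp add: Top_def)
        have "\<exists>u r. X = {v,u,r} \<and> ccw v u r"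
        proof (cases "ccw v a b")
          case False
          then have "ccw v b a" using TV_ccw[OF T] ccw_rot by blast
          moreover have "X = {v,b,a}" using ab by auto
          ultimately show ?thesis by blast
        qed (use ab in blast)
        then obtain u r where ur: "X = {v,u,r}" "ccw v u r" by blast
        have d: "u \<in> down v" "r \<in> down v"
          using X ur ccw_edg[OF ur(2)] ccw_distinct[OF ur(2)] by (auto simp: Top_def down_def)
        have "u \<noteq> e" using e(2)[OF d(2)] ccw_pos[OF ur(2)] by auto
        then have "u \<in> down v - {e}" using d by simp
        moreover have "g u = X" using g[OF calculation] ccw_unique ur by blast
        ultimately show "X \<in> g ` (down v - {e})" by blast
      qed
    qed
  qed
  then have "card (Top v) = card (down v - {e})" by (simp add: bij_betw_same_card)
  moreover have "card (down v) > 0" using e(1) fin_down card_gt_0_iff by blast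
  ultimately show ?thesis using e(1) fin_down by simp
qed

text \<open>A triangle with middle vertex \<open>v\<close> meets the level line of
  \<open>irr\<close> through \<open>v\<close> on one side of \<open>v\<close>; the sign tells
  which.\<close>

definition MidS :: "real \<Rightarrow> plane \<Rightarrow> plane set set" where
  "MidS \<epsilon> v = {X. \<exists>u r. X = {v,u,r} \<and> X \<in> TV \<and> irr \<bullet> (u - v) < 0 \<and> irr \<bullet> (r - v) > 0 \<and> \<epsilon> * cr (u - v) (r - v) > 0}"

text \<open>The lower edge of such a triangle is the extreme descending edge on that side: before
  any other descending edge reaches the level of \<open>v\<close>, the triangle next to it has a
  second descending edge.\<close>

lemma card_MidS_le:
  assumes eps: "\<epsilon> = 1 \<or> \<epsilon> = -1"
  shows "card (MidS \<epsilon> v) \<le> 1"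
proof -
  have "X = Y" if XY: "X \<in> MidS \<epsilon> v" "Y \<in> MidS \<epsilon> v" for X Y
  proof -
    obtain u r where X: "X = {v,u,r}" "{v,u,r} \<in> TV" "irr \<bullet> (u - v) < 0" "irr \<bullet> (r - v) > 0" "\<epsilon> * cr (u - v) (r - v) > 0"
      using XY(1) unfolding MidS_def by blast
    obtain u' r' where Y: "Y = {v,u',r'}" "{v,u',r'} \<in> TV" "irr \<bullet> (u' - v) < 0" "irr \<bullet> (r' - v) > 0" "\<epsilon> * cr (u' - v) (r' - v) > 0"
      using XY(2) unfolding MidS_def by blast
    have u: "u \<in> down v" "u' \<in> down v" using X Y tri_edg by (auto simp: down_def)
    obtain e where e: "e \<in> down v" "\<And>u. u \<in> down v \<Longrightarrow> \<epsilon> * cr (e - v) (u - v) \<le> 0"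
      "\<And>u. u \<in> down v \<Longrightarrow> u \<noteq> e \<Longrightarrow> \<epsilon> * cr (u - v) (e - v) > 0"
      by (rule extreme_down[OF _ eps, of v]) (use u in auto)
    have ext: "u = e" if T: "{v,u,r} \<in> TV" "irr \<bullet> (u - v) < 0" "irr \<bullet> (r - v) > 0" "\<epsilon> * cr (u - v) (r - v) > 0"
      and u: "u \<in> down v" for u r
    proof (rule ccontr)
      assume "u \<noteq> e"
      then have "\<epsilon> * cr (u - v) (e - v) > 0" using e(3) u by blast
      then obtain r' where r': "{v,u,r'} \<in> TV" "\<epsilon> * cr (u - v) (r' - v) > 0" "(-irr) \<bullet> (r' - v) > 0"
        by (rule next_edge[of v u e \<epsilon> "-irr", rotated 3]) (use u e eps in \<open>auto simp: down_def\<close>)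
      then have "r' = r" using third_unique[OF r'(1) T(1) eps r'(2) T(4)] by blast
      then show False using r'(3) T(3) by simp
    qed
    have "u = u'" using ext[OF X(2-5) u(1)] ext[OF Y(2-5) u(2)] by simp
    then have "r = r'" using third_unique[of v u r r'] X Y eps by auto
    then show ?thesis using X Y \<open>u = u'\<close> by simp
  qed
  then show ?thesis using card_le_Suc0_iff_eq[of "MidS \<epsilon> v"] finTV
    by (metis One_nat_def card.infinite zero_le)
qed

text \<open>If the hull continues beyond the extreme descending edge, the triangle there has a third
  corner that no longer descends.\<close>

lemma MidS_exI:
  assumes eps: "\<epsilon> = 1 \<or> \<epsilon> = -1" and d: "down v \<noteq> {}"
    and a: "\<And>e. e \<in> down v \<Longrightarrow> (\<And>u. u \<in> down v \<Longrightarrow> \<epsilon> * cr (e - v) (u - v) \<le> 0) \<Longrightarrow> \<exists>a\<in>A. \<epsilon> * cr (e - v) (a - v) > 0"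
  shows "MidS \<epsilon> v \<noteq> {}"
proof -
  obtain e where e: "e \<in> down v" "\<And>u. u \<in> down v \<Longrightarrow> \<epsilon> * cr (e - v) (u - v) \<le> 0"
    using extreme_down[OF d eps] by metis
  obtain a where a: "a \<in> A" "\<epsilon> * cr (e - v) (a - v) > 0" using a[OF e] by blast
  have "edg v e" using e by (simp add: down_def)
  from edge_side[OF this a eps] obtain s where s: "{v,e,s} \<in> TV" "\<epsilon> * cr (e - v) (s - v) > 0" by blast
  have "s \<notin> down v" using e(2)[of s] s(2) by auto
  then have "\<not> irr \<bullet> (s - v) < 0" using tri_edg[OF s(1)] by (auto simp: down_def)
  moreover have "irr \<bullet> (s - v) \<noteq> 0" using irr_ne[of s v] tri_distinct[OF s(1)] TV_sub[OF s(1)] by auto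
  ultimately have "{v,e,s} \<in> MidS \<epsilon> v" unfolding MidS_def using s e(1) down_irr by fastforce
  then show ?thesis by blast
qed

lemma MidS_empty_D:
  assumes "\<epsilon> = 1 \<or> \<epsilon> = -1" "down v \<noteq> {}" "MidS \<epsilon> v = {}"
  shows "\<exists>e\<in>down v. \<forall>a\<in>A. \<epsilon> * cr (e - v) (a - v) \<le> 0"
proof (rule ccontr)
  assume n: "\<not> ?thesis"
  have "MidS \<epsilon> v \<noteq> {}" by (rule MidS_exI[OF assms(1,2)]) (use n in \<open>force simp: not_le\<close>)
  then show False using assms(3) by simp
qed

lemma MidS_sub: "MidS \<epsilon> v \<subseteq> TV"
  unfolding MidS_def by blast

lemma card_MidS_eq: "\<epsilon> = 1 \<or> \<epsilon> = -1 \<Longrightarrow> MidS \<epsilon> v \<noteq> {} \<Longrightarrow> card (MidS \<epsilon> v) = 1"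
  using card_MidS_le[of \<epsilon> v] finite_subset[OF MidS_sub finTV] card_gt_0_iff[of "MidS \<epsilon> v"] by (simp add: le_Suc_eq)

definition Mid :: "plane \<Rightarrow> plane set set" where
  "Mid v = MidS 1 v \<union> MidS (-1) v"

lemma MidS_disjoint: "MidS 1 v \<inter> MidS (-1) v = {}"
proof -
  have False if X: "X \<in> MidS 1 v" "X \<in> MidS (-1) v" for X
  proof -
    obtain u r where 1: "X = {v,u,r}" "X \<in> TV" "irr \<bullet> (u - v) < 0" "irr \<bullet> (r - v) > 0" "1 * cr (u - v) (r - v) > 0"
      using X(1) unfolding MidS_def by blast
    obtain u' r' where 2: "X = {v,u',r'}" "irr \<bullet> (u' - v) < 0" "irr \<bullet> (r' - v) > 0" "(-1) * cr (u' - v) (r' - v) > 0"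
      using X(2) unfolding MidS_def by blast
    have "u' \<in> {v,u,r}" "r' \<in> {v,u,r}" using 1(1) 2(1) by auto
    then have "u' = u" "r' = r" using 1 2 by auto
    then show False using 1 2 by simp
  qed
  then show ?thesis by blast
qed

lemma card_Mid: "card (Mid v) = card (MidS 1 v) + card (MidS (-1) v)"
  unfolding Mid_def using MidS_disjoint finite_subset[OF MidS_sub finTV] by (intro card_Un_disjoint) auto

lemma down_nonempty: assumes "v \<in> A" "a \<in> A" "irr \<bullet> (a - v) < 0" shows "down v \<noteq> {}"
  using edge_in_halfplane[OF assms(1,2), of "-irr"] assms(3) by (force simp: down_def)

lemma card_Mid_I:
  assumes v: "v \<in> I" shows "card (Mid v) = 2"
proof -
  have vA: "v \<in> A" using v I_sub by blast
  have "irr \<noteq> 0" using irr_irr by auto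
  then obtain a where "a \<in> A" "(-irr) \<bullet> (a - v) > 0" using I_dir[OF v, of "-irr"] by auto
  then have d: "down v \<noteq> {}" using down_nonempty[OF vA] by simp
  have "MidS \<epsilon> v \<noteq> {}" if eps: "\<epsilon> = 1 \<or> \<epsilon> = -1" for \<epsilon>
  proof (rule MidS_exI[OF eps d])
    fix e assume "e \<in> down v"
    then have "e - v \<noteq> 0" using down_irr by force
    then have "\<epsilon> *\<^sub>R rot (e - v) \<noteq> 0" using eps by (auto simp: plane_eq_iff)
    then obtain a where "a \<in> A" "(\<epsilon> *\<^sub>R rot (e - v)) \<bullet> (a - v) > 0" using I_dir[OF v] by blast
    then show "\<exists>a\<in>A. \<epsilon> * cr (e - v) (a - v) > 0" by (auto simp: rot_inner)
  qed
  then show ?thesis using card_Mid card_MidS_eq by auto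
qed

text \<open>If both sides were missing, the hull would lie in the cone of the two extreme descending
  edges, which has no room for \<open>b\<close> above \<open>v\<close>. If both were present, the
  level line would run inside triangles on both sides of \<open>v\<close>, which a line supporting
  the hull at \<open>v\<close> excludes.\<close>

lemma card_Mid_boundary:
  assumes v: "v \<in> A" "v \<notin> I" and a: "a \<in> A" "irr \<bullet> (a - v) < 0" and b: "b \<in> A" "irr \<bullet> (b - v) > 0"
  shows "card (Mid v) = 1"
proof -
  have d: "down v \<noteq> {}" using down_nonempty[OF v(1) a] .
  have ne: "MidS 1 v \<noteq> {} \<or> MidS (-1) v \<noteq> {}"
  proof (rule ccontr)
    assume H: "\<not> ?thesis"
    obtain e1 where e1: "e1 \<in> down v" "\<And>a. a \<in> A \<Longrightarrow> cr (e1 - v) (a - v) \<le> 0"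
      using MidS_empty_D[of 1 v] d H by auto
    obtain e2 where e2: "e2 \<in> down v" "\<And>a. a \<in> A \<Longrightarrow> cr (e2 - v) (a - v) \<ge> 0"
      using MidS_empty_D[of "-1" v] d H by auto
    have eA: "edg v e1" "edg v e2" using e1 e2 by (auto simp: down_def)
    have A2: "e1 \<in> A" "e2 \<in> A" using eA edg_A by blast+
    show False
    proof (cases "e1 = e2")
      case True
      obtain r where r: "{v,e1,r} \<in> TV" using edgE[OF eA(1)] by metis
      then have "r \<in> A" "cr (e1 - v) (r - v) = 1 \<or> cr (e1 - v) (r - v) = -1" using TV_unit[OF r] TV_sub[OF r] by auto
      then show False using e1(2)[of r] e2(2)[of r] True by auto
    next
      case False
      have "cr (e1 - v) (e2 - v) \<noteq> 0"
        using edge_parallel_unique[OF eA, of "-irr"] False down_irr e1(1) e2(1) by auto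
      then have n: "cr (e1 - v) (e2 - v) < 0" using e1(2)[OF A2(2)] by auto
      have "cr (e1 - v) (e2 - v) * (irr \<bullet> (b - v)) = cr (b - v) (e2 - v) * (irr \<bullet> (e1 - v)) + cr (e1 - v) (b - v) * (irr \<bullet> (e2 - v))"
        using arg_cong[OF cr_cramer[of "e1 - v" "e2 - v" "b - v"], of "\<lambda>x. irr \<bullet> x"] by (simp add: inner_add_right)
      moreover have "cr (b - v) (e2 - v) \<le> 0" "cr (e1 - v) (b - v) \<le> 0"
        using e1(2)[OF b(1)] e2(2)[OF b(1)] cr_skew[of "b - v" "e2 - v"] by auto
      moreover have "irr \<bullet> (e1 - v) < 0" "irr \<bullet> (e2 - v) < 0" using e1 e2 down_irr by auto
      ultimately have "cr (e1 - v) (e2 - v) * (irr \<bullet> (b - v)) \<ge> 0"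
        by (simp add: mult_nonpos_nonpos)
      then show False using n b(2) by (simp add: zero_le_mult_iff)
    qed
  qed
  have "MidS 1 v = {} \<or> MidS (-1) v = {}"
  proof (rule ccontr)
    assume H: "\<not> ?thesis"
    obtain d where dd: "d \<noteq> 0" "\<And>a. a \<in> A \<Longrightarrow> d \<bullet> (a - v) \<ge> 0" by (rule boundary_dir[OF v]) blast
    have key: "\<epsilon> * (d \<bullet> rot irr) < 0" if eps: "\<epsilon> = 1 \<or> \<epsilon> = -1" and M: "MidS \<epsilon> v \<noteq> {}" for \<epsilon>
    proof -
      obtain u r where ur: "{v,u,r} \<in> TV" "irr \<bullet> (u - v) < 0" "irr \<bullet> (r - v) > 0" "\<epsilon> * cr (u - v) (r - v) > 0"
        using M unfolding MidS_def by blast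
      \<comment> \<open>The positive combination of the two edge vectors that stays on the level of
        \<open>v\<close>; it is a multiple of \<open>rot irr\<close>, and the factor 3 below is
        \<open>irr \<bullet> irr\<close>.\<close>
      define x where "x = (irr \<bullet> (r - v)) *\<^sub>R (u - v) - (irr \<bullet> (u - v)) *\<^sub>R (r - v)"
      have E: "3 *\<^sub>R x = 3 *\<^sub>R (- cr (u - v) (r - v) *\<^sub>R rot irr)"
        by (simp add: x_def irr_def inner_plane cr_def plane_eq_iff algebra_simps)
      have x: "x = - cr (u - v) (r - v) *\<^sub>R rot irr" by (rule scaleR_left_imp_eq[OF _ E]) simp
      have uA: "u \<in> A" "r \<in> A" using TV_sub[OF ur(1)] by auto
      have dx: "d \<bullet> x = (irr \<bullet> (r - v)) * (d \<bullet> (u - v)) + (- (irr \<bullet> (u - v))) * (d \<bullet> (r - v))"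
        by (simp only: x_def inner_diff_right[of _ "_ *\<^sub>R _"] inner_scaleR_right)
      have nn: "(irr \<bullet> (r - v)) * (d \<bullet> (u - v)) \<ge> 0"
        by (rule mult_nonneg_nonneg) (use ur dd(2)[OF uA(1)] in simp_all)
      have nn': "(- (irr \<bullet> (u - v))) * (d \<bullet> (r - v)) \<ge> 0"
        by (rule mult_nonneg_nonneg) (use ur dd(2)[OF uA(2)] in simp_all)
      have "d \<bullet> x \<noteq> 0"
      proof
        assume "d \<bullet> x = 0"
        then have "(irr \<bullet> (r - v)) * (d \<bullet> (u - v)) = 0" "(- (irr \<bullet> (u - v))) * (d \<bullet> (r - v)) = 0"
          using dx nn nn' by linarith+
        then have "(u - v) \<bullet> d = 0" "(r - v) \<bullet> d = 0" using ur by (simp_all add: inner_commute)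
        moreover have "cr (u - v) (r - v) \<noteq> 0" using ur(4) by (metis less_irrefl mult_zero_right)
        ultimately show False using inner_zero_zero[of "u - v" "r - v" d] dd(1) by blast
      qed
      then have "d \<bullet> x > 0" using dx nn nn' by linarith
      then have "cr (u - v) (r - v) * (d \<bullet> rot irr) < 0" using x by simp
      then show ?thesis using ur(4) eps by (auto simp: mult_less_0_iff)
    qed
    show False using key[of 1] key[of "-1"] H by auto
  qed
  then show ?thesis using ne card_Mid[of v] card_MidS_eq[of 1 v] card_MidS_eq[of "-1" v] by (elim disjE) simp_all
qed

lemma TV_three:
  assumes "X \<in> TV"
  obtains a b c where "X = {a,b,c}" "irr \<bullet> (b - a) > 0" "irr \<bullet> (c - b) > 0"
proof -
  obtain p q r where X: "X = {p,q,r}" using TV_tri[OF assms] by blast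
  have d: "p \<noteq> q" "q \<noteq> r" "p \<noteq> r" using tri_distinct[of p q r] assms X by auto
  have A3: "p \<in> A" "q \<in> A" "r \<in> A" using TV_sub[OF assms] X by auto
  have "irr \<bullet> p \<noteq> irr \<bullet> q" "irr \<bullet> q \<noteq> irr \<bullet> r" "irr \<bullet> p \<noteq> irr \<bullet> r"
    using irr_ne d A3 by (auto simp: inner_diff_right)
  then consider "irr \<bullet> p < irr \<bullet> q" "irr \<bullet> q < irr \<bullet> r" | "irr \<bullet> p < irr \<bullet> r" "irr \<bullet> r < irr \<bullet> q"
    | "irr \<bullet> q < irr \<bullet> p" "irr \<bullet> p < irr \<bullet> r" | "irr \<bullet> q < irr \<bullet> r" "irr \<bullet> r < irr \<bullet> p"
    | "irr \<bullet> r < irr \<bullet> p" "irr \<bullet> p < irr \<bullet> q" | "irr \<bullet> r < irr \<bullet> q" "irr \<bullet> q < irr \<bullet> p"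
    by linarith
  moreover have Y: "X = {p,r,q}" "X = {q,p,r}" "X = {q,r,p}" "X = {r,p,q}" "X = {r,q,p}" using X by auto
  ultimately show ?thesis
  proof cases
    case 1 show ?thesis by (rule that[OF X]) (use 1 in \<open>simp_all add: inner_diff_right\<close>)
  next
    case 2 show ?thesis by (rule that[OF Y(1)]) (use 2 in \<open>simp_all add: inner_diff_right\<close>)
  next
    case 3 show ?thesis by (rule that[OF Y(2)]) (use 3 in \<open>simp_all add: inner_diff_right\<close>)
  next
    case 4 show ?thesis by (rule that[OF Y(3)]) (use 4 in \<open>simp_all add: inner_diff_right\<close>)
  next
    case 5 show ?thesis by (rule that[OF Y(4)]) (use 5 in \<open>simp_all add: inner_diff_right\<close>)
  next
    case 6 show ?thesis by (rule that[OF Y(5)]) (use 6 in \<open>simp_all add: inner_diff_right\<close>)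
  qed
qed

lemma Top_iff:
  assumes "{a,b,c} \<in> TV" "irr \<bullet> (b - a) > 0" "irr \<bullet> (c - b) > 0"
  shows "{a,b,c} \<in> Top v \<longleftrightarrow> v = c"
  using assms by (auto simp: Top_def inner_diff_right)

lemma Mid_iff:
  assumes T: "{a,b,c} \<in> TV" "irr \<bullet> (b - a) > 0" "irr \<bullet> (c - b) > 0"
  shows "{a,b,c} \<in> Mid v \<longleftrightarrow> v = b"
proof
  assume "{a,b,c} \<in> Mid v"
  then obtain u r where ur: "{a,b,c} = {v,u,r}" "irr \<bullet> (u - v) < 0" "irr \<bullet> (r - v) > 0"
    unfolding Mid_def MidS_def by blast
  then have "v \<in> {a,b,c}" "u \<in> {a,b,c}" "r \<in> {a,b,c}" by simp_all
  then show "v = b" using ur(2,3) T(2,3) by (auto simp: inner_diff_right)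
next
  assume v: "v = b"
  have T': "{b,a,c} \<in> TV" "{a,b,c} = {b,a,c}" using T(1) by (auto simp: insert_commute)
  have "irr \<bullet> (a - b) < 0" using T(2) by (simp add: inner_diff_right)
  moreover have "cr (a - b) (c - b) = 1 \<or> cr (a - b) (c - b) = -1" using TV_unit[OF T'(1)] .
  ultimately have "{b,a,c} \<in> MidS 1 b \<or> {b,a,c} \<in> MidS (-1) b"
    unfolding MidS_def using T' T(3) by fastforce
  then show "{a,b,c} \<in> Mid v" unfolding Mid_def v T'(2) by blast
qed

lemma card_TV_by:
  assumes fin: "\<And>v. v \<in> A \<Longrightarrow> f v \<subseteq> TV"
    and u: "\<And>X. X \<in> TV \<Longrightarrow> \<exists>c\<in>A. \<forall>v. X \<in> f v \<longleftrightarrow> v = c"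
  shows "card TV = (\<Sum>v\<in>A. card (f v))"
proof -
  have "TV = (\<Union>v\<in>A. f v)"
  proof
    show "TV \<subseteq> (\<Union>v\<in>A. f v)" using u by blast
  qed (use fin in blast)
  also have "card \<dots> = (\<Sum>v\<in>A. card (f v))"
  proof (rule card_UN_disjoint)
    show "\<forall>i\<in>A. finite (f i)" using fin finTV finite_subset by blast
    show "\<forall>i\<in>A. \<forall>j\<in>A. i \<noteq> j \<longrightarrow> f i \<inter> f j = {}"
    proof (intro ballI impI)
      fix i j assume "i \<in> A" "j \<in> A" "i \<noteq> j"
      show "f i \<inter> f j = {}"
      proof (rule ccontr)
        assume "f i \<inter> f j \<noteq> {}"
        then obtain X where "X \<in> f i" "X \<in> f j" by blast
        moreover have "X \<in> TV" using calculation fin \<open>i \<in> A\<close> by blast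
        ultimately show False using u \<open>i \<noteq> j\<close> by metis
      qed
    qed
  qed (rule finA)
  finally show ?thesis .
qed

lemma card_TV_Top: "card TV = (\<Sum>v\<in>A. card (Top v))"
proof (rule card_TV_by)
  fix X assume X: "X \<in> TV"
  obtain a b c where abc: "X = {a,b,c}" "irr \<bullet> (b - a) > 0" "irr \<bullet> (c - b) > 0" using TV_three[OF X] .
  then show "\<exists>c\<in>A. \<forall>v. X \<in> Top v \<longleftrightarrow> v = c"
    using Top_iff[of a b c] X TV_sub[OF X] by (intro bexI[of _ c]) auto
qed (auto simp: Top_def)

lemma card_TV_Mid: "card TV = (\<Sum>v\<in>A. card (Mid v))"
proof (rule card_TV_by)
  fix X assume X: "X \<in> TV"
  obtain a b c where abc: "X = {a,b,c}" "irr \<bullet> (b - a) > 0" "irr \<bullet> (c - b) > 0" using TV_three[OF X] .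
  then show "\<exists>c\<in>A. \<forall>v. X \<in> Mid v \<longleftrightarrow> v = c"
    using Mid_iff[of a b c] X TV_sub[OF X] by (intro bexI[of _ b]) auto
qed (auto simp: Mid_def dest: MidS_sub[THEN subsetD])

lemma card_Eall_down: "card Eall = (\<Sum>v\<in>A. card (down v))"
proof -
  have "Eall = (\<Union>v\<in>A. (\<lambda>u. {v,u}) ` down v)"
  proof
    show "Eall \<subseteq> (\<Union>v\<in>A. (\<lambda>u. {v,u}) ` down v)"
    proof
      fix e assume e: "e \<in> Eall"
      then obtain p q where pq: "e = {p,q}" "p \<noteq> q" unfolding Eall_def by blast
      have E: "edg p q" "edg q p" using e pq by (simp_all add: insert_commute)
      have A2: "p \<in> A" "q \<in> A" using edg_A[OF E(1)] by auto
      have "irr \<bullet> (q - p) < 0 \<or> irr \<bullet> (p - q) < 0" using irr_ne[OF A2 pq(2)] by (auto simp: inner_diff_right)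
      then have "q \<in> down p \<or> p \<in> down q" using E by (auto simp: down_def)
      moreover have "{p,q} = {q,p}" by auto
      ultimately show "e \<in> (\<Union>v\<in>A. (\<lambda>u. {v,u}) ` down v)" unfolding pq(1) using A2 by blast
    qed
  qed (auto simp: down_def)
  also have "card \<dots> = (\<Sum>v\<in>A. card ((\<lambda>u. {v,u}) ` down v))"
  proof (rule card_UN_disjoint)
    show "\<forall>i\<in>A. \<forall>j\<in>A. i \<noteq> j \<longrightarrow> (\<lambda>u. {i,u}) ` down i \<inter> (\<lambda>u. {j,u}) ` down j = {}"
      by (auto simp: down_def doubleton_eq_iff inner_diff_right)
  qed (use finA fin_down in auto)
  also have "\<dots> = (\<Sum>v\<in>A. card (down v))"
    by (intro sum.cong card_image refl) (auto intro!: inj_onI simp: doubleton_eq_iff)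
  finally show ?thesis .
qed

lemma exists_extremes:
  obtains lo hi where "lo \<in> A" "hi \<in> A" "lo \<noteq> hi"
    "\<And>a. a \<in> A \<Longrightarrow> a \<noteq> lo \<Longrightarrow> irr \<bullet> (a - lo) > 0" "\<And>a. a \<in> A \<Longrightarrow> a \<noteq> hi \<Longrightarrow> irr \<bullet> (a - hi) < 0"
proof -
  obtain lo where lo: "lo \<in> A" "\<And>a. a \<in> A \<Longrightarrow> irr \<bullet> lo \<le> irr \<bullet> a"
    using arg_min_if_finite[OF finA A_ne, of "\<lambda>u. irr \<bullet> u"] by (metis not_less)
  obtain hi where hi: "hi \<in> A" "\<And>a. a \<in> A \<Longrightarrow> irr \<bullet> a \<le> irr \<bullet> hi"
    using arg_min_if_finite[OF finA A_ne, of "\<lambda>u. - (irr \<bullet> u)"] by (metis neg_less_iff_less not_less)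
  obtain X where X: "X \<in> TV" using TV_ne by blast
  obtain a b c where abc: "X = {a,b,c}" "irr \<bullet> (b - a) > 0" "irr \<bullet> (c - b) > 0" using TV_three[OF X] .
  then have "a \<in> A" "c \<in> A" "irr \<bullet> a < irr \<bullet> c" using TV_sub[OF X] by (auto simp: inner_diff_right)
  then have "lo \<noteq> hi" using lo(2)[of a] hi(2)[of c] by auto
  moreover have "irr \<bullet> (a - lo) > 0" if "a \<in> A" "a \<noteq> lo" for a
    using lo(2)[OF that(1)] irr_ne[OF that(1) lo(1) that(2)] by (simp add: inner_diff_right)
  moreover have "irr \<bullet> (a - hi) < 0" if "a \<in> A" "a \<noteq> hi" for a
    using hi(2)[OF that(1)] irr_ne[OF that(1) hi(1) that(2)] by (simp add: inner_diff_right)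
  ultimately show ?thesis using that lo(1) hi(1) by blast
qed

text \<open>Sum \<open>card_Top\<close> over all points but the lowest one, which has neither
  descending edges nor triangles below it.\<close>

lemma euler_all: "card TV + card A = card Eall + 1"
proof -
  obtain lo hi where e: "lo \<in> A" "hi \<in> A" "lo \<noteq> hi"
    "\<And>a. a \<in> A \<Longrightarrow> a \<noteq> lo \<Longrightarrow> irr \<bullet> (a - lo) > 0" by (rule exists_extremes) blast
  have lo0: "down lo = {}"
  proof -
    have False if u: "u \<in> down lo" for u
    proof -
      have "u \<in> A" "u \<noteq> lo" using u edg_A by (auto simp: down_def)
      then show False using e(4)[of u] down_irr[OF u] by simp
    qed
    then show ?thesis by blast
  qed
  have "Top lo = {}"
  proof -
    have False if X: "X \<in> Top lo" for X
    proof -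
      have XT: "X \<in> TV" "lo \<in> X" using X by (auto simp: Top_def)
      obtain b c where bc: "X = {lo,b,c}" using TV_mem3[OF XT] .
      have b: "b \<noteq> lo" "b \<in> A" using tri_distinct[of lo b c] XT(1) TV_sub[OF XT(1)] bc by auto
      have "b \<in> X" using bc by simp
      then have "irr \<bullet> (b - lo) < 0" using X b(1) unfolding Top_def by blast
      then show False using e(4)[OF b(2,1)] by simp
    qed
    then show ?thesis by blast
  qed
  then have 1: "card TV = (\<Sum>v\<in>A-{lo}. card (Top v))"
    unfolding card_TV_Top by (subst sum.remove[OF finA e(1)]) simp
  have 2: "card Eall = (\<Sum>v\<in>A-{lo}. card (down v))"
    unfolding card_Eall_down by (subst sum.remove[OF finA e(1)]) (simp add: lo0)
  have "(\<Sum>v\<in>A-{lo}. card (down v)) = (\<Sum>v\<in>A-{lo}. card (Top v) + 1)"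
  proof (rule sum.cong)
    fix v assume v: "v \<in> A - {lo}"
    have "irr \<bullet> (lo - v) < 0" using e(4)[of v] v by (auto simp: inner_diff_right)
    then show "card (down v) = card (Top v) + 1" using card_Top[OF down_nonempty] v e(1) by auto
  qed simp
  then have "card Eall = card TV + card (A - {lo})" using 1 2 by (simp add: sum_Suc)
  moreover have "card A = card (A - {lo}) + 1" using finA e(1) by (metis Suc_eq_plus1 card.remove)
  ultimately show ?thesis by simp
qed

text \<open>Pick's formula, with \<open>card TV\<close> as the doubled area. Interior points are in
  the middle of two triangles, boundary points of one, except for the lowest and the highest point,
  which account for the constant 2.\<close>

lemma euler_pick: "card TV + 2 = card A + card I"
proof -
  obtain lo hi where e: "lo \<in> A" "hi \<in> A" "lo \<noteq> hi"
    "\<And>a. a \<in> A \<Longrightarrow> a \<noteq> lo \<Longrightarrow> irr \<bullet> (a - lo) > 0" "\<And>a. a \<in> A \<Longrightarrow> a \<noteq> hi \<Longrightarrow> irr \<bullet> (a - hi) < 0"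
    by (rule exists_extremes) blast
  have p0: "irr \<noteq> 0" "-irr \<noteq> 0" using irr_irr by auto
  have nI: "lo \<notin> I" "hi \<notin> I"
  proof -
    show "lo \<notin> I"
    proof
      assume "lo \<in> I" then obtain a where "a \<in> A" "(-irr) \<bullet> (a - lo) > 0" using I_dir p0 by blast
      then show False using e(4)[of a] by (cases "a = lo") auto
    qed
    show "hi \<notin> I"
    proof
      assume "hi \<in> I" then obtain a where "a \<in> A" "irr \<bullet> (a - hi) > 0" using I_dir p0 by blast
      then show False using e(5)[of a] by (cases "a = hi") auto
    qed
  qed
  have M0: "Mid lo = {}" "Mid hi = {}"
  proof -
    have "irr \<bullet> (u - lo) \<ge> 0" "irr \<bullet> (u - hi) \<le> 0" if "u \<in> A" for u
      using e(4,5)[OF that] by (cases "u = lo"; cases "u = hi"; force)+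
    then show "Mid lo = {}" "Mid hi = {}" unfolding Mid_def MidS_def using TV_sub by force+
  qed
  define B where "B = A - I - {lo,hi}"
  have A: "A = I \<union> B \<union> {lo,hi}" "finite I" "finite B" using I_sub e finA finite_subset by (auto simp: B_def)
  have "card TV = (\<Sum>v\<in>I \<union> B \<union> {lo,hi}. card (Mid v))" using card_TV_Mid A(1) by simp
  also have "\<dots> = (\<Sum>v\<in>I. card (Mid v)) + (\<Sum>v\<in>B. card (Mid v)) + (\<Sum>v\<in>{lo,hi}. card (Mid v))"
  proof -
    have "(\<Sum>v\<in>I \<union> B. card (Mid v)) = (\<Sum>v\<in>I. card (Mid v)) + (\<Sum>v\<in>B. card (Mid v))"
      using A(2,3) by (intro sum.union_disjoint) (auto simp: B_def)
    moreover have "(\<Sum>v\<in>I \<union> B \<union> {lo,hi}. card (Mid v)) = (\<Sum>v\<in>I \<union> B. card (Mid v)) + (\<Sum>v\<in>{lo,hi}. card (Mid v))"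
      using A(2,3) nI by (intro sum.union_disjoint) (auto simp: B_def)
    ultimately show ?thesis by simp
  qed
  also have "(\<Sum>v\<in>I. card (Mid v)) = 2 * card I" using card_Mid_I by simp
  also have "(\<Sum>v\<in>B. card (Mid v)) = card B"
  proof -
    have "card (Mid v) = 1" if v: "v \<in> B" for v
    proof (rule card_Mid_boundary)
      show "irr \<bullet> (lo - v) < 0" using e(4)[of v] v by (auto simp: inner_diff_right B_def)
      show "irr \<bullet> (hi - v) > 0" using e(5)[of v] v by (auto simp: inner_diff_right B_def)
    qed (use v e in \<open>auto simp: B_def\<close>)
    then show ?thesis by simp
  qed
  also have "(\<Sum>v\<in>{lo,hi}. card (Mid v)) = 0" using M0 by simp
  finally have "card TV = 2 * card I + card B" by simp
  moreover have "card A = card I + card B + 2"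
  proof -
    have "card (I \<union> B \<union> {lo,hi}) = card (I \<union> B) + card {lo,hi}" using A(2,3) nI by (intro card_Un_disjoint) (auto simp: B_def)
    also have "card (I \<union> B) = card I + card B" using A(2,3) by (intro card_Un_disjoint) (auto simp: B_def)
    finally show ?thesis using A(1) e(3) by simp
  qed
  ultimately show ?thesis by simp
qed

section \<open>Interior edges and the resulting Euler relation\<close>

definition Eint :: "plane set set" where
  "Eint = {{p,q} | p q. \<exists>r s. ccw p q r \<and> ccw q p s}"

lemma Eint_iff: "{p,q} \<in> Eint \<longleftrightarrow> (\<exists>r. ccw p q r) \<and> (\<exists>s. ccw q p s)"
  unfolding Eint_def by (auto simp: doubleton_eq_iff)

lemma Eint_sub: "Eint \<subseteq> Eall"
  unfolding Eint_def using ccw_edg by blast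

lemma ccw_ne_rev: "ccw p q r \<Longrightarrow> ccw q p s \<Longrightarrow> {p,q,r} \<noteq> {p,q,s}"
proof
  assume a: "ccw p q r" "ccw q p s" "{p,q,r} = {p,q,s}"
  then have "r = s" using ccw_distinct[OF a(1)] ccw_distinct[OF a(2)] by auto
  then show False using a ccw_pos[OF a(1)] ccw_pos[OF a(2)] cr_swap[of p q r] by simp
qed

lemma tris_at_edge:
  assumes "edg p q"
  shows "{X \<in> TV. {p,q} \<subseteq> X} = {{p,q,r} | r. ccw p q r} \<union> {{p,q,s} | s. ccw q p s}"
proof -
  have "X \<in> {{p,q,r} | r. ccw p q r} \<union> {{p,q,s} | s. ccw q p s}" if X: "X \<in> TV" "{p,q} \<subseteq> X" for X
  proof -
    obtain b c where bc: "X = {p,b,c}" using TV_mem3[of X p] X by auto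
    have "p \<noteq> q" using assms edgE by metis
    then have "q = b \<or> q = c" using X bc by auto
    then have "X = {p,q,c} \<or> X = {p,q,b}" using bc by auto
    then obtain r where r: "X = {p,q,r}" by blast
    then have "ccw p q r \<or> ccw q p r" using TV_ccw X by blast
    then show ?thesis using r by blast
  qed
  moreover have "{p,q,s} \<in> TV" if "ccw q p s" for s using that unfolding ccw_def by (simp add: insert_commute)
  moreover have "{p,q,s} \<in> TV" if "ccw p q s" for s using that unfolding ccw_def by simp
  ultimately show ?thesis by blast
qed

lemma card_tris_at_edge:
  assumes e: "e \<in> Eall"
  shows "card {X \<in> TV. e \<subseteq> X} = (if e \<in> Eint then 2 else 1)"
proof -
  obtain p q where pq: "e = {p,q}" using e unfolding Eall_def by blast
  have E: "edg p q" using e pq by simp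
  have S1: "{{p,q,r} | r. ccw p q r} = {{p,q,r}}" if "ccw p q r" for r using that ccw_unique by blast
  have S2: "{{p,q,r} | r. ccw q p r} = {{p,q,r}}" if "ccw q p r" for r using that ccw_unique by blast
  show ?thesis
  proof (cases "e \<in> Eint")
    case True
    then obtain r s where "ccw p q r" "ccw q p s" using pq Eint_iff by blast
    moreover have "{p,q,r} \<noteq> {p,q,s}" using ccw_ne_rev calculation by blast
    ultimately have "card ({{p,q,r}} \<union> {{p,q,s}}) = 2" by simp
    then show ?thesis unfolding pq tris_at_edge[OF E] S1[OF \<open>ccw p q r\<close>] S2[OF \<open>ccw q p s\<close>] using True pq by simp
  next
    case False
    then have "(\<exists>r. ccw p q r \<and> \<not> (\<exists>s. ccw q p s)) \<or> (\<exists>r. ccw q p r \<and> \<not> (\<exists>s. ccw p q s))"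
      using edg_ccw[OF E] pq Eint_iff by blast
    then show ?thesis unfolding pq tris_at_edge[OF E] using S1 S2 False pq by auto
  qed
qed

lemma edges_in_tri:
  assumes "{p,q,r} \<in> TV" shows "{e \<in> Eall. e \<subseteq> {p,q,r}} = {{p,q},{q,r},{p,r}}"
proof
  show "{e \<in> Eall. e \<subseteq> {p,q,r}} \<subseteq> {{p,q},{q,r},{p,r}}"
  proof
    fix e assume e: "e \<in> {e \<in> Eall. e \<subseteq> {p,q,r}}"
    then obtain a b where ab: "e = {a,b}" "a \<noteq> b" unfolding Eall_def by blast
    then have "a \<in> {p,q,r}" "b \<in> {p,q,r}" using e by auto
    then show "e \<in> {{p,q},{q,r},{p,r}}" using ab by auto
  qed
qed (use tri_edg[OF assms] in auto)

lemma card_edges_in_tri: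
  assumes "{p,q,r} \<in> TV" shows "card {{p,q},{q,r},{p,r}} = 3"
  using tri_distinct[OF assms] by (auto simp: doubleton_eq_iff card_insert_if)

lemma euler_edges: "3 * card TV = card Eall + card Eint"
proof -
  have "3 * card TV = (\<Sum>X\<in>TV. card {e \<in> Eall. e \<subseteq> X})"
  proof -
    have "card {e \<in> Eall. e \<subseteq> X} = 3" if "X \<in> TV" for X
    proof -
      obtain p q r where X: "X = {p,q,r}" using TV_tri[OF \<open>X \<in> TV\<close>] by blast
      have T: "{p,q,r} \<in> TV" using X that by simp
      show ?thesis unfolding X edges_in_tri[OF T] by (rule card_edges_in_tri[OF T])
    qed
    then show ?thesis by simp
  qed
  also have "\<dots> = (\<Sum>X\<in>TV. \<Sum>e\<in>Eall. if e \<subseteq> X then 1 else 0)"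
    using finEall by (simp add: sum.If_cases Int_def)
  also have "\<dots> = (\<Sum>e\<in>Eall. \<Sum>X\<in>TV. if e \<subseteq> X then 1 else 0)" by (rule sum.swap)
  also have "\<dots> = (\<Sum>e\<in>Eall. card {X \<in> TV. e \<subseteq> X})"
    using finTV by (simp add: sum.If_cases Int_def)
  also have "\<dots> = (\<Sum>e\<in>Eall. if e \<in> Eint then 2 else 1)"
    by (intro sum.cong card_tris_at_edge refl)
  also have "\<dots> = (\<Sum>e\<in>Eall. 1) + (\<Sum>e\<in>Eall. if e \<in> Eint then 1 else 0)"
    unfolding sum.distrib[symmetric] by (intro sum.cong) auto
  also have "\<dots> = card Eall + card Eint"
    using Eint_sub finEall by (simp add: sum.If_cases Int_absorb1)
  finally show ?thesis .
qed

lemma euler_interior: "card Eint + 3 = card A + 2 * card I"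
  using euler_all euler_pick euler_edges by linarith

end

section \<open>Linear algebra of finitely supported functions\<close>

lemma dim_zero_set: "dim {0::'a::real_vector} = 0"
  using dim_span[of "{}::'a set"] dim_eq_card_independent[of "{}::'a set"] by (simp add: independent_empty)

lemma span_Int_independent:
  assumes "independent (B \<union> C)" "B \<inter> C = {}" "x \<in> span B" "x \<in> span C"
  shows "x = (0::'a::real_vector)"
proof -
  have C: "independent C" using assms(1) by (rule independent_mono) auto
  have "representation B x = representation C x"
    using representation_extend[OF assms(1,3)] representation_extend[OF assms(1,4)] by simp
  then have "{b. representation C x b \<noteq> 0} = {}"
    using representation_ne_zero[of B x] representation_ne_zero[of C x] assms(2) by auto
  then show ?thesis using sum_nonzero_representation_eq[OF C assms(4)] by simp
qed

text \<open>The functions of finite support form a space that may have infinite dimension, so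
  finiteness is supplied by a finite set that spans a larger space. A basis of the kernel is
  extended to one of \<open>U\<close>, and \<open>f\<close> is injective on the span of the added
  part \<open>C\<close>.\<close>

lemma rank_nullity_subspace:
  fixes f :: "'a::real_vector \<Rightarrow> 'b::real_vector"
  assumes U: "subspace U" and fin: "finite B0" "U \<subseteq> span B0" and f: "linear f"
  shows "dim U = dim (f ` U) + dim {u \<in> U. f u = 0}"
proof -
  define K where "K = {u \<in> U. f u = 0}"
  have K: "subspace K"
    using U f by (auto simp: K_def subspace_def linear_add linear_scale linear_0)
  obtain BK where BK: "BK \<subseteq> K" "independent BK" "K \<subseteq> span BK" "card BK = dim K"
    using basis_exists[of K] by blast
  have "BK \<subseteq> U" using BK by (auto simp: K_def)
  then obtain B where B: "BK \<subseteq> B" "B \<subseteq> U" "independent B" "U \<subseteq> span B"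
    using maximal_independent_subset_extend[OF _ BK(2), of U] by blast
  have finB: "finite B"
    using independent_span_bound[OF fin(1) B(3)] B(2) fin(2) by (meson order_trans)
  define C where "C = B - BK"
  have BC: "B = BK \<union> C" "BK \<inter> C = {}" using B by (auto simp: C_def)
  have sC: "span C \<subseteq> U" using B U by (metis C_def Diff_subset order_trans span_minimal)
  have inj: "inj_on f (span C)"
  proof (rule inj_onI)
    fix x y assume xy: "x \<in> span C" "y \<in> span C" "f x = f y"
    have "x - y \<in> span C" using xy span_diff by blast
    moreover have "x - y \<in> K"
      using sC xy calculation by (auto simp: K_def linear_diff[OF f])
    ultimately have "x - y \<in> span BK" "x - y \<in> span C" using BK by blast+
    then have "x - y = 0" using span_Int_independent[of BK C "x - y"] B(3) BC by simp
    then show "x = y" by simp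
  qed
  have indC: "independent C" using B(3) BC by (metis Un_upper2 independent_mono)
  have ind: "independent (f ` C)"
    using linear_independent_injective_image[OF f indC inj] .
  have "f ` U = span (f ` C)"
  proof -
    have "U = span B" using B U span_minimal[of B U] by (intro antisym) auto
    then have "f ` U = f ` span B" by simp
    also have "\<dots> = span (f ` B)" using linear_span_image[OF f] by metis
    finally have fU: "f ` U = span (f ` B)" .
    have "f ` B \<subseteq> span (f ` C)"
    proof
      fix y assume "y \<in> f ` B"
      then obtain b where b: "b \<in> B" "y = f b" by blast
      show "y \<in> span (f ` C)"
      proof (cases "b \<in> C")
        case True then show ?thesis unfolding b(2) by (intro span_base imageI)
      next
        case False then have "y = 0" using b BC BK by (auto simp: K_def)
        then show ?thesis by (simp add: span_0)
      qed
    qed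
    then have s1: "span (f ` B) \<subseteq> span (f ` C)" by (rule span_minimal) (rule subspace_span)
    have s2: "span (f ` C) \<subseteq> span (f ` B)" using BC by (intro span_mono) auto
    have "span (f ` B) = span (f ` C)" using s1 s2 by (rule antisym)
    then show ?thesis using fU by simp
  qed
  then have "dim (f ` U) = card (f ` C)" using ind by (simp add: dim_eq_card_independent)
  also have "\<dots> = card C"
    using inj span_superset[of C] by (intro card_image) (rule inj_on_subset)
  finally have "dim (f ` U) = card C" .
  moreover have "dim U = card B"
    using B U by (metis basis_card_eq_dim)
  moreover have "card B = card BK + card C"
    using BC finB by (metis card_Un_disjoint finite_Un)
  ultimately show ?thesis using BK K_def by simp
qed

lemma dim_image_injective:
  fixes f :: "'a::real_vector \<Rightarrow> 'b::real_vector"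
  assumes U: "subspace U" and fin: "finite B0" "U \<subseteq> span B0" and f: "linear f"
    and inj: "\<And>u. u \<in> U \<Longrightarrow> f u = 0 \<Longrightarrow> u = 0"
  shows "dim (f ` U) = dim U"
proof -
  have "{u \<in> U. f u = 0} = {0}" using inj U f by (auto simp: subspace_0 linear_0)
  then show ?thesis using rank_nullity_subspace[OF U fin f] by (simp add: dim_zero_set)
qed

lemma subspace_eq_of_dim:
  assumes U: "subspace U" and UV: "U \<subseteq> V" and fin: "finite B0" "V \<subseteq> span B0" and d: "dim V \<le> dim U"
  shows "U = V"
proof (rule ccontr)
  assume "U \<noteq> V"
  then obtain x where x: "x \<in> V" "x \<notin> U" using UV by blast
  obtain B where B: "B \<subseteq> U" "independent B" "U \<subseteq> span B" "card B = dim U"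
    using basis_exists[of U] by blast
  have "x \<notin> span B" using x B U by (metis span_minimal subsetD)
  have i: "independent (insert x B)" using \<open>x \<notin> span B\<close> B independent_insertI by blast
  obtain B' where B': "insert x B \<subseteq> B'" "B' \<subseteq> V" "independent B'" "V \<subseteq> span B'"
    by (rule maximal_independent_subset_extend[OF _ i, of V]) (use B x UV in auto)
  have finB: "finite B'"
    using independent_span_bound[OF fin(1) B'(3)] B'(2) fin(2) by (meson order_trans)
  have "x \<notin> B" using \<open>x \<notin> span B\<close> span_base by blast
  have "card (insert x B) \<le> card B'" using B' finB card_mono by blast
  moreover have "card (insert x B) = Suc (card B)"
    using \<open>x \<notin> B\<close> B'(1) finite_subset[OF _ finB, of B] by simp
  moreover have "card B' = dim V" using B' by (metis basis_card_eq_dim)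
  ultimately show False using d B by simp
qed

section \<open>Coordinate spaces and orthogonal complements in them\<close>

definition coord_space :: "'i set \<Rightarrow> ('i \<Rightarrow>\<^sub>0 'b::real_vector) set" where
  "coord_space X = {f. Poly_Mapping.keys f \<subseteq> X}"

definition restr :: "'i set \<Rightarrow> ('i \<Rightarrow> 'b::real_vector) \<Rightarrow> ('i \<Rightarrow>\<^sub>0 'b)" where
  "restr X g = Abs_poly_mapping (\<lambda>i. if i \<in> X then g i else 0)"

lemma lookup_scaleR [simp]: "Poly_Mapping.lookup (c *\<^sub>R f) i = c *\<^sub>R Poly_Mapping.lookup f i"
proof -
  have "finite {i. c *\<^sub>R Poly_Mapping.lookup f i \<noteq> 0}"
    by (rule finite_subset[OF _ finite_keys[of f]]) (auto simp: in_keys_iff)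
  then show ?thesis by (simp add: scaleR_poly_mapping_def)
qed

lemma lookup_restr [simp]:
  assumes "finite X"
  shows "Poly_Mapping.lookup (restr X g) i = (if i \<in> X then g i else 0)"
proof -
  have "finite {i. (if i \<in> X then g i else 0) \<noteq> 0}"
    by (rule finite_subset[OF _ assms]) auto
  then show ?thesis by (simp add: restr_def)
qed

lemma restr_coord_space [simp]: "finite X \<Longrightarrow> restr X g \<in> coord_space X"
  by (auto simp: coord_space_def in_keys_iff split: if_splits)

lemma coord_space_iff: "f \<in> coord_space X \<longleftrightarrow> (\<forall>i. i \<notin> X \<longrightarrow> Poly_Mapping.lookup f i = 0)"
  by (auto simp: coord_space_def in_keys_iff)

lemma subspace_coord_space: "subspace (coord_space X)"
  by (auto simp: subspace_def coord_space_iff lookup_add)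

lemma linear_restr:
  assumes "finite X" "\<And>i. i \<in> X \<Longrightarrow> linear (\<lambda>v. g v i)"
  shows "linear (\<lambda>v. restr X (g v))"
  using assms(1) by (intro linearI poly_mapping_eqI)
    (auto simp: lookup_add linear_add[OF assms(2)] linear_scale[OF assms(2)])

lemma linear_lookup: "linear (\<lambda>f. Poly_Mapping.lookup f i)"
  by (intro linearI) (auto simp: lookup_add)

lemma coord_space_finite_span:
  assumes "finite X"
  obtains B :: "('i \<Rightarrow>\<^sub>0 'b::euclidean_space) set" where "finite B" "coord_space X \<subseteq> span B"
proof -
  define B where "B = (\<lambda>(x, b). Poly_Mapping.single x (b::'b)) ` (X \<times> Basis)"
  have "f \<in> span B" if f: "f \<in> coord_space X" for f :: "'i \<Rightarrow>\<^sub>0 'b"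
  proof -
    have "f = (\<Sum>(x,b)\<in>X \<times> Basis. (Poly_Mapping.lookup f x \<bullet> b) *\<^sub>R Poly_Mapping.single x b)"
    proof (rule poly_mapping_eqI)
      fix i
      have "Poly_Mapping.lookup (\<Sum>(x,b)\<in>X \<times> Basis. (Poly_Mapping.lookup f x \<bullet> b) *\<^sub>R Poly_Mapping.single x b) i
          = (\<Sum>(x,b)\<in>X \<times> Basis. (Poly_Mapping.lookup f x \<bullet> b) *\<^sub>R (if x = i then b else 0))"
        by (simp add: lookup_sum lookup_single when_def case_prod_beta)
      also have "\<dots> = (\<Sum>x\<in>X. \<Sum>b\<in>Basis. (Poly_Mapping.lookup f x \<bullet> b) *\<^sub>R (if x = i then b else 0))"
        by (simp add: sum.cartesian_product)
      also have "\<dots> = (\<Sum>x\<in>X. if x = i then Poly_Mapping.lookup f x else 0)"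
        by (intro sum.cong) (auto simp: euclidean_representation)
      also have "\<dots> = Poly_Mapping.lookup f i"
        using f assms by (auto simp: coord_space_iff)
      finally show "Poly_Mapping.lookup f i = Poly_Mapping.lookup (\<Sum>(x,b)\<in>X \<times> Basis. (Poly_Mapping.lookup f x \<bullet> b) *\<^sub>R Poly_Mapping.single x b) i" ..
    qed
    also have "\<dots> \<in> span B"
      by (intro span_sum) (force simp: B_def intro: span_scale span_base)
    finally show ?thesis .
  qed
  moreover have "finite B" using assms by (auto simp: B_def)
  ultimately show ?thesis using that by blast
qed

text \<open>Evaluation at the index \<open>x\<close> maps the space onto \<open>W x\<close>; its
  kernel is the space for the remaining indices.\<close>

lemma dim_coord_family:
  fixes W :: "'i \<Rightarrow> 'b::euclidean_space set"
  assumes "finite X" "\<And>i. i \<in> X \<Longrightarrow> subspace (W i)"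
  shows "dim {f \<in> coord_space X. \<forall>i\<in>X. Poly_Mapping.lookup f i \<in> W i} = (\<Sum>i\<in>X. dim (W i))"
  using assms
proof (induction X rule: finite_induct)
  case empty
  have "{f \<in> coord_space {}. \<forall>i\<in>{}. Poly_Mapping.lookup f i \<in> W i} = {0}"
    by (auto simp: coord_space_def)
  then show ?case by (simp add: dim_zero_set)
next
  case (insert x X)
  define U where "U = {f \<in> coord_space (insert x X). \<forall>i\<in>insert x X. Poly_Mapping.lookup f i \<in> W i}"
  have U: "subspace U"
    using insert.prems subspace_coord_space[of "insert x X"]
    by (auto simp: U_def subspace_def lookup_add)
  obtain B :: "('i \<Rightarrow>\<^sub>0 'b) set" where B: "finite B" "coord_space (insert x X) \<subseteq> span B"
    using coord_space_finite_span insert.hyps by (metis finite_insert)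
  have "U \<subseteq> span B" using B by (auto simp: U_def)
  then have "dim U = dim ((\<lambda>f. Poly_Mapping.lookup f x) ` U) + dim {f \<in> U. Poly_Mapping.lookup f x = 0}"
    by (intro rank_nullity_subspace[OF U B(1)] linear_lookup)
  moreover have "(\<lambda>f. Poly_Mapping.lookup f x) ` U = W x"
  proof
    show "W x \<subseteq> (\<lambda>f. Poly_Mapping.lookup f x) ` U"
    proof
      fix v assume "v \<in> W x"
      then have "Poly_Mapping.single x v \<in> U"
        using insert.prems by (auto simp: U_def coord_space_iff lookup_single when_def subspace_0)
      then show "v \<in> (\<lambda>f. Poly_Mapping.lookup f x) ` U" by (force simp: image_iff)
    qed
  qed (auto simp: U_def)
  moreover have "{f \<in> U. Poly_Mapping.lookup f x = 0} = {f \<in> coord_space X. \<forall>i\<in>X. Poly_Mapping.lookup f i \<in> W i}"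
    using insert.hyps insert.prems by (force simp: U_def coord_space_iff subspace_0)
  ultimately show ?case using insert by (simp add: U_def)
qed

lemma dim_coord_space_real: "finite X \<Longrightarrow> dim (coord_space X :: ('i \<Rightarrow>\<^sub>0 real) set) = card X"
  using dim_coord_family[of X "\<lambda>_. UNIV :: real set"] by simp

lemma dim_coord_space_plane: "finite X \<Longrightarrow> dim (coord_space X :: ('i \<Rightarrow>\<^sub>0 plane) set) = 2 * card X"
  using dim_coord_family[of X "\<lambda>_. UNIV :: plane set"] by simp

definition pairing :: "'i set \<Rightarrow> ('i \<Rightarrow>\<^sub>0 real) \<Rightarrow> ('i \<Rightarrow>\<^sub>0 real) \<Rightarrow> real" where
  "pairing X f g = (\<Sum>i\<in>X. Poly_Mapping.lookup f i * Poly_Mapping.lookup g i)"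

definition annihilator :: "'i set \<Rightarrow> ('i \<Rightarrow>\<^sub>0 real) set \<Rightarrow> ('i \<Rightarrow>\<^sub>0 real) set" where
  "annihilator X W = {g \<in> coord_space X. \<forall>f\<in>W. pairing X f g = 0}"

lemma linear_pairing: "linear (pairing X f)"
  by (intro linearI) (auto simp: pairing_def lookup_add algebra_simps sum.distrib sum_distrib_left)

lemma linear_pairing_left: "linear (\<lambda>f. pairing X f g)"
  by (intro linearI) (auto simp: pairing_def lookup_add algebra_simps sum.distrib sum_distrib_left)

lemma subspace_annihilator: "subspace (annihilator X W)"
  using subspace_coord_space[of X] linear_pairing[of X]
  by (auto simp: annihilator_def subspace_def linear_add linear_scale linear_0)

text \<open>\<open>T\<close> records the pairings with a basis of \<open>W\<close>, so its kernel is
  the annihilator. As the pairing is positive definite, \<open>T\<close> is injective already on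
  \<open>W\<close>; by dimension it maps \<open>W\<close> onto all functions on the basis and has
  rank \<open>dim W\<close>.\<close>

lemma dim_annihilator:
  fixes W :: "('i \<Rightarrow>\<^sub>0 real) set"
  assumes X: "finite X" and W: "subspace W" "W \<subseteq> coord_space X"
  shows "dim W + dim (annihilator X W) = card X"
proof -
  obtain B0 :: "('i \<Rightarrow>\<^sub>0 real) set" where B0: "finite B0" "coord_space X \<subseteq> span B0"
    using coord_space_finite_span[OF X] by blast
  obtain B where B: "B \<subseteq> W" "independent B" "W \<subseteq> span B" "card B = dim W"
    using basis_exists[of W] by blast
  have finB: "finite B"
    using independent_span_bound[OF B0(1) B(2)] B(1) W(2) B0(2) by (meson order_trans)
  define T where "T g = restr B (\<lambda>b. pairing X b g)" for g
  have T: "linear T" unfolding T_def by (intro linear_restr finB linear_pairing)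
  have T0: "T g = 0 \<longleftrightarrow> (\<forall>f\<in>W. pairing X f g = 0)" for g
  proof
    assume "T g = 0"
    then have "\<forall>b\<in>B. pairing X b g = 0" by (metis T_def finB lookup_restr lookup_zero)
    moreover have "subspace {f. pairing X f g = 0}"
      by (simp add: subspace_def linear_add[OF linear_pairing_left] linear_scale[OF linear_pairing_left]
          linear_0[OF linear_pairing_left])
    ultimately have "span B \<subseteq> {f. pairing X f g = 0}" by (intro span_minimal) auto
    then show "\<forall>f\<in>W. pairing X f g = 0" using B by blast
  next
    assume "\<forall>f\<in>W. pairing X f g = 0"
    then show "T g = 0" using B finB by (intro poly_mapping_eqI) (auto simp: T_def)
  qed
  have K: "{g \<in> coord_space X. T g = 0} = annihilator X W"
    by (simp add: T0 annihilator_def)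
  have 1: "card X = dim (T ` coord_space X) + dim (annihilator X W)"
    using rank_nullity_subspace[OF subspace_coord_space B0 T] K dim_coord_space_real[OF X] by simp
  have TB: "T ` S \<subseteq> coord_space B" for S using finB by (auto simp: T_def)
  obtain B1 :: "(('i \<Rightarrow>\<^sub>0 real) \<Rightarrow>\<^sub>0 real) set" where B1: "finite B1" "coord_space B \<subseteq> span B1"
    using coord_space_finite_span[OF finB] by blast
  have "dim (T ` W) = dim W"
  proof (rule dim_image_injective[OF W(1) B0(1) _ T])
    show "W \<subseteq> span B0" using W B0 by blast
    fix u assume u: "u \<in> W" "T u = 0"
    then have "pairing X u u = 0" using T0 by blast
    then have "\<forall>i\<in>X. Poly_Mapping.lookup u i = 0"
      using X by (simp add: pairing_def sum_nonneg_eq_0_iff)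
    moreover have "u \<in> coord_space X" using u W by blast
    ultimately show "u = 0" by (intro poly_mapping_eqI) (metis coord_space_iff lookup_zero)
  qed
  moreover have "T ` W = coord_space B"
  proof (rule subspace_eq_of_dim[OF _ TB B1])
    show "subspace (T ` W)" using linear_subspace_image[OF T W(1)] .
    show "dim (coord_space B :: (('i \<Rightarrow>\<^sub>0 real) \<Rightarrow>\<^sub>0 real) set) \<le> dim (T ` W)"
      using calculation B dim_coord_space_real[OF finB] by simp
  qed
  moreover have "T ` W \<subseteq> T ` coord_space X" using W by blast
  ultimately have "T ` coord_space X = T ` W" using TB by blast
  then show ?thesis using 1 \<open>dim (T ` W) = dim W\<close> by simp
qed

section \<open>Live edges\<close>

context regtri
begin

text \<open>The three determinants are the barycentric coordinates of \<open>j\<close>. If none were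
  negative, \<open>j\<close> would be in the triangle and thus a corner.\<close>

lemma outside_tri:
  assumes c: "ccw p q r" and j: "j \<in> A" "j \<notin> {p,q,r}"
  shows "cr (q - p) (j - p) < 0 \<or> cr (r - q) (j - q) < 0 \<or> cr (p - r) (j - r) < 0"
proof (rule ccontr)
  assume n: "\<not> ?thesis"
  define wr wp wq where "wr = cr (q - p) (j - p)" and "wp = cr (r - q) (j - q)" and "wq = cr (p - r) (j - r)"
  have nn: "wr \<ge> 0" "wp \<ge> 0" "wq \<ge> 0" using n by (auto simp: wr_def wp_def wq_def)
  have T: "{p,q,r} \<in> TV" using c by (simp add: ccw_def)
  have one: "cr (q - p) (r - p) = 1" using ccw_pos[OF c] .
  have s: "wp + wq + wr = 1" using one by (simp add: wr_def wp_def wq_def cr_def algebra_simps)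
  have "cr (q - p) (r - p) *\<^sub>R (j - p) = cr (j - p) (r - p) *\<^sub>R (q - p) + cr (q - p) (j - p) *\<^sub>R (r - p)"
    by (rule cr_cramer)
  moreover have "cr (j - p) (r - p) = wq" by (simp add: wq_def cr_def algebra_simps)
  ultimately have e: "j - p = wq *\<^sub>R (q - p) + wr *\<^sub>R (r - p)" using one by (simp add: wr_def)
  have "j = wp *\<^sub>R p + wq *\<^sub>R q + wr *\<^sub>R r"
  proof -
    have wp: "wp = 1 - wq - wr" using s by simp
    have "j = p + (wq *\<^sub>R (q - p) + wr *\<^sub>R (r - p))" using e by (simp add: diff_eq_eq add.commute)
    then show ?thesis unfolding wp by (simp add: scaleR_diff_left scaleR_diff_right)
  qed
  then have "j \<in> convex hull {p,q,r}" unfolding convex_hull_3 mem_Collect_eq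
    using nn s by (intro exI[of _ wp] exI[of _ wq] exI[of _ wr]) auto
  moreover obtain X where "X \<in> TV" "j \<in> X" using A_in_tri j(1) by blast
  ultimately have "{j} \<subseteq> mins A w (pt {p,q,r})"
    using mins_pt[OF T] mins_pt[of X] by - (rule mins_hull[of "{j}" A w "pt X" "\<lambda>_. 1" "{p,q,r}"], auto)
  then show False using mins_pt[OF T] j(2) by auto
qed

text \<open>A point beyond both edges at \<open>q\<close> lies in the cone opposite to the triangle,
  and then \<open>q\<close> is interior to the triangle with the corners \<open>p\<close>,
  \<open>r\<close>, \<open>i\<close>.\<close>

lemma beyond_unique:
  assumes c: "ccw p q r" and q: "q \<notin> I" and i: "i \<in> A"
    and n: "cr (q - p) (i - p) < 0" "cr (r - q) (i - q) < 0"
  shows False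
proof -
  have A3: "p \<in> A" "q \<in> A" "r \<in> A" using ccw_A[OF c] by auto
  obtain d where d: "d \<noteq> 0" "\<And>x. x \<in> A \<Longrightarrow> d \<bullet> (x - q) \<ge> 0" by (rule boundary_dir[OF A3(2) q]) blast
  have m: "cr (p - q) (r - q) = -1" using ccw_pos[OF c] cr_swap[of p q r] by simp
  have 1: "cr (i - q) (r - q) > 0" using n(2) cr_skew[of "r - q" "i - q"] by simp
  have 2: "cr (p - q) (i - q) > 0" using n(1) cr_swap[of p q i] by simp
  have "- (d \<bullet> (i - q)) = cr (i - q) (r - q) * (d \<bullet> (p - q)) + cr (p - q) (i - q) * (d \<bullet> (r - q))"
    using arg_cong[OF cr_cramer[of "p - q" "r - q" "i - q"], of "\<lambda>x. d \<bullet> x"] unfolding m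
    by (simp only: inner_add_right inner_scaleR_right inner_minus_right scaleR_minus1_left)
  moreover have "cr (i - q) (r - q) * (d \<bullet> (p - q)) \<ge> 0" "cr (p - q) (i - q) * (d \<bullet> (r - q)) \<ge> 0"
    using 1 2 d(2) A3 by simp_all
  ultimately have "cr (i - q) (r - q) * (d \<bullet> (p - q)) = 0" "cr (p - q) (i - q) * (d \<bullet> (r - q)) = 0"
    using d(2)[OF i] by linarith+
  then have "(p - q) \<bullet> d = 0" "(r - q) \<bullet> d = 0" using 1 2 by (simp_all add: inner_commute)
  then show False using inner_zero_zero[of "p - q" "r - q" d] m d(1) by simp
qed

text \<open>The live edges will turn out to be those that survive the pruning of the dual curve: they have an
  interior end point or separate interior points.\<close>

definition live_pair :: "plane \<Rightarrow> plane \<Rightarrow> bool" where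
  "live_pair p q \<longleftrightarrow> p \<in> I \<or> q \<in> I \<or> ((\<exists>i\<in>I. cr (q - p) (i - p) > 0) \<and> (\<exists>i\<in>I. cr (q - p) (i - p) < 0))"

definition Live :: "plane set set" where
  "Live = {{p,q} | p q. edg p q \<and> live_pair p q}"

lemma live_pair_sym: "live_pair p q \<longleftrightarrow> live_pair q p"
  unfolding live_pair_def using cr_swap[of p q] cr_swap[of q p] by auto

lemma Live_iff: "{p,q} \<in> Live \<longleftrightarrow> edg p q \<and> live_pair p q"
proof
  assume "{p,q} \<in> Live"
  then obtain a b where ab: "{p,q} = {a,b}" "edg a b" "live_pair a b" unfolding Live_def by blast
  have "edg p q" using ab by simp
  moreover have "live_pair p q" using ab live_pair_sym by (auto simp: doubleton_eq_iff)
  ultimately show "edg p q \<and> live_pair p q" by simp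
qed (auto simp: Live_def)

lemma Live_sub_Eint: "Live \<subseteq> Eint"
proof
  fix e assume "e \<in> Live"
  then obtain p q where e: "e = {p,q}" "edg p q" "live_pair p q" unfolding Live_def by blast
  have e2: "edg q p" using e(2) by (simp add: insert_commute)
  consider "p \<in> I" | "q \<in> I" | i j where "i \<in> I" "j \<in> I" "cr (q - p) (i - p) > 0" "cr (q - p) (j - p) < 0"
    using e(3) unfolding live_pair_def by blast
  then have "(\<exists>r. ccw p q r) \<and> (\<exists>s. ccw q p s)"
  proof cases
    case 1 then show ?thesis using I_ccw I_ccw' e(2) by metis
  next
    case 2 then show ?thesis using I_ccw I_ccw' e2 by metis
  next
    case 3
    have "cr (p - q) (j - q) > 0" using 3(4) cr_swap[of p q j] by simp
    then show ?thesis using edge_left[OF e(2)] edge_left[OF e2] 3 I_sub by (metis subsetD)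
  qed
  then show "e \<in> Eint" using e(1) Eint_iff by simp
qed

lemma finEint: "finite Eint"
  using Eint_sub finEall finite_subset by blast

lemma finLive: "finite Live"
  using Live_sub_Eint finEint finite_subset by blast

section \<open>Triangles by the number of their live edges\<close>

definition live_count :: "plane set \<Rightarrow> nat" where
  "live_count X = card {e \<in> Live. e \<subseteq> X}"

definition T0 :: "plane set set" where "T0 = {X \<in> TV. live_count X = 0}"
text \<open>Dual to the 2-valent vertices of the pruned curve, where edges are concatenated;
  \<open>T3\<close> is dual to the vertices of the skeleton.\<close>

definition T2 :: "plane set set" where "T2 = {X \<in> TV. live_count X = 2}"
definition T3 :: "plane set set" where "T3 = {X \<in> TV. live_count X = 3}"

lemma finT: "finite T0" "finite T2" "finite T3"
  using finTV by (auto simp: T0_def T2_def T3_def)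

lemma live_in_tri:
  assumes "{p,q,r} \<in> TV" shows "{e \<in> Live. e \<subseteq> {p,q,r}} = {{p,q},{q,r},{p,r}} \<inter> Live"
  using edges_in_tri[OF assms] Live_sub_Eint Eint_sub by blast

lemma live_count_zero_iff: "live_count X = 0 \<longleftrightarrow> (\<forall>e\<in>Live. \<not> e \<subseteq> X)"
  unfolding live_count_def using finLive by auto

lemma dead_cases:
  assumes e: "edg a b" and d: "{a,b} \<notin> Live"
  shows "a \<notin> I" "b \<notin> I" "(\<forall>i\<in>I. cr (b - a) (i - a) > 0) \<or> (\<forall>i\<in>I. cr (b - a) (i - a) < 0)"
proof -
  have n: "\<not> live_pair a b" using e d Live_iff by blast
  then show ab: "a \<notin> I" "b \<notin> I" by (auto simp: live_pair_def)
  show "(\<forall>i\<in>I. cr (b - a) (i - a) > 0) \<or> (\<forall>i\<in>I. cr (b - a) (i - a) < 0)"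
    using n boundary_edge_off_line[OF e ab] unfolding live_pair_def by (meson linorder_neqE_linordered_idom)
qed

text \<open>No edge crosses \<open>ab\<close>, so all of \<open>X\<close> lies beyond it. A live
  edge of \<open>X\<close> would be a chord separating two interior points, and would meet the
  segment between them, although this segment stays strictly on the near side of
  \<open>ab\<close>.\<close>

lemma dead_beyond:
  assumes e: "edg a b" and ab: "a \<notin> I" "b \<notin> I" and l: "\<forall>i\<in>I. cr (b - a) (i - a) > 0"
    and X: "X \<in> TV" "v \<in> X" "cr (b - a) (v - a) < 0"
  shows "live_count X = 0"
proof -
  have r: "cr (b - a) (u - a) \<le> 0" if u: "u \<in> X" for u
  proof (rule ccontr)
    assume "\<not> ?thesis"
    then have p: "cr (b - a) (u - a) > 0" by simp
    then have "u \<noteq> v" using X(3) by auto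
    then have "edg u v" using edgI X u by blast
    then show False using edges_no_cross[OF e _ ab p X(3)] by blast
  qed
  show ?thesis unfolding live_count_zero_iff
  proof (intro ballI notI)
    fix f assume f: "f \<in> Live" "f \<subseteq> X"
    then obtain u v where uv: "f = {u,v}" "edg u v" "live_pair u v" unfolding Live_def by blast
    have ux: "u \<in> X" "v \<in> X" using uv f by auto
    then have nI: "u \<notin> I" "v \<notin> I" using r l by force+
    then obtain i j where ij: "i \<in> I" "j \<in> I" "cr (v - u) (i - u) > 0" "cr (v - u) (j - u) < 0"
      using uv(3) unfolding live_pair_def by blast
    define ci cj where "ci = cr (v - u) (i - u)" and "cj = - cr (v - u) (j - u)"
    have c: "ci > 0" "cj > 0" using ij by (auto simp: ci_def cj_def)
    have uvA: "u \<in> A" "v \<in> A" "i \<in> A" "j \<in> A" using ux TV_sub[OF X(1)] ij I_sub by auto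
    obtain t where t: "0 \<le> t" "t \<le> 1" "cj *\<^sub>R (i - u) + ci *\<^sub>R (j - u) = ((ci + cj) * t) *\<^sub>R (v - u)"
      by (rule chord_cross[OF uvA(1,2) nI uvA(3,4), of ci cj]) (use c in \<open>auto simp: ci_def cj_def\<close>)
    define f where "f x = cr (b - a) (x - a)" for x
    have fd: "cr (b - a) (x - u) = f x - f u" for x by (simp add: f_def cr_diff)
    have "cj * (f i - f u) + ci * (f j - f u) = (ci + cj) * t * (f v - f u)"
      using arg_cong[OF t(3), of "cr (b - a)"] by (simp add: cr_add fd)
    then have "cj * f i + ci * f j = (ci + cj) * ((1 - t) * f u + t * f v)" by (simp add: algebra_simps)
    moreover have "cj * f i > 0" "ci * f j > 0" using c l ij by (auto simp: f_def)
    moreover have "(ci + cj) * ((1 - t) * f u + t * f v) \<le> 0"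
    proof -
      have "(1 - t) * f u \<le> 0" "t * f v \<le> 0" using t r ux by (auto simp: f_def intro: mult_nonneg_nonpos)
      then show ?thesis using c by (simp add: mult_nonneg_nonpos)
    qed
    ultimately show False by linarith
  qed
qed

text \<open>If no corner is interior, \<open>pq\<close> separates some \<open>i\<close> beyond it
  from some \<open>j\<close> on the side of the triangle. As \<open>j\<close> is not in the
  triangle, it lies beyond another edge; by \<open>beyond_unique\<close>, \<open>i\<close> does not,
  so this edge separates \<open>i\<close> and \<open>j\<close> as well.\<close>

lemma live_second:
  assumes c: "ccw p q r" and l: "{p,q} \<in> Live"
  shows "{q,r} \<in> Live \<or> {p,r} \<in> Live"
proof (cases "p \<in> I \<or> q \<in> I \<or> r \<in> I")
  case True
  have "edg q r" "edg p r" using ccw_edg[OF c] by auto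
  then show ?thesis using True unfolding Live_iff live_pair_def by blast
next
  case F: False
  have lp: "live_pair p q" using l Live_iff by blast
  then obtain i j where ij: "i \<in> I" "j \<in> I" "cr (q - p) (i - p) < 0" "cr (q - p) (j - p) > 0"
    using F unfolding live_pair_def by blast
  have A2: "i \<in> A" "j \<in> A" using ij I_sub by auto
  have "j \<notin> {p,q,r}" using F ij by auto
  then consider "cr (r - q) (j - q) < 0" | "cr (p - r) (j - r) < 0" using outside_tri[OF c A2(2)] ij(4) by force
  then show ?thesis
  proof cases
    case 1
    have E: "edg q r" using ccw_edg[OF c] by auto
    have "cr (r - q) (i - q) \<noteq> 0" using boundary_edge_off_line[OF E] F ij by blast
    moreover have "\<not> cr (r - q) (i - q) < 0" using beyond_unique[OF c _ A2(1) ij(3)] F by blast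
    ultimately have "live_pair q r" using 1 ij unfolding live_pair_def by (metis linorder_neqE_linordered_idom)
    then show ?thesis using E Live_iff by blast
  next
    case 2
    have E: "edg r p" "edg p r" using ccw_edg[OF c] by auto
    have c2: "ccw r p q" using c ccw_rot by blast
    have "cr (p - r) (i - r) \<noteq> 0" using boundary_edge_off_line[OF E(1)] F ij by blast
    moreover have "\<not> cr (p - r) (i - r) < 0" using beyond_unique[OF c2 _ A2(1) _ ij(3)] F by blast
    ultimately have "live_pair r p" using 2 ij unfolding live_pair_def by (metis linorder_neqE_linordered_idom)
    then show ?thesis using E Live_iff live_pair_sym by blast
  qed
qed

lemma live_count_ge2: assumes X: "X \<in> TV" and e: "e \<in> Live" "e \<subseteq> X" shows "live_count X \<ge> 2"
proof -
  obtain p q where pq: "e = {p,q}" "edg p q" using e(1) unfolding Live_def by blast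
  have Xe: "X \<in> {X \<in> TV. {p,q} \<subseteq> X}" using X e pq by simp
  have "\<exists>f\<in>Live. f \<subseteq> X \<and> f \<noteq> e"
  proof -
    from Xe consider r where "X = {p,q,r}" "ccw p q r" | r where "X = {p,q,r}" "ccw q p r"
      unfolding tris_at_edge[OF pq(2)] by blast
    then show ?thesis
    proof cases
      case 1
      have "{q,r} \<noteq> e" "{p,r} \<noteq> e" using ccw_distinct[OF 1(2)] pq(1) by (auto simp: doubleton_eq_iff)
      moreover have "{q,r} \<subseteq> X" "{p,r} \<subseteq> X" using 1 by auto
      ultimately show ?thesis using live_second[OF 1(2)] e pq by blast
    next
      case 2
      have "{q,r} \<noteq> e" "{p,r} \<noteq> e" using ccw_distinct[OF 2(2)] pq(1) by (auto simp: doubleton_eq_iff)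
      moreover have "{q,r} \<subseteq> X" "{p,r} \<subseteq> X" using 2 by auto
      moreover have "{q,p} \<in> Live" using e pq by (simp add: insert_commute)
      ultimately show ?thesis using live_second[OF 2(2)] by blast
    qed
  qed
  then obtain f where "f \<in> Live" "f \<subseteq> X" "f \<noteq> e" by blast
  then have "{e,f} \<subseteq> {e \<in> Live. e \<subseteq> X}" using e by auto
  then have "card {e,f} \<le> live_count X" unfolding live_count_def using finLive by (intro card_mono) auto
  then show ?thesis using \<open>f \<noteq> e\<close> by simp
qed

lemma live_count_le3: assumes "X \<in> TV" shows "live_count X \<le> 3"
proof -
  obtain p q r where X: "X = {p,q,r}" using TV_tri[OF assms] by blast
  have T: "{p,q,r} \<in> TV" using assms X by simp
  have "live_count X \<le> card {{p,q},{q,r},{p,r}}" unfolding live_count_def X live_in_tri[OF T] by (intro card_mono) auto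
  then show ?thesis using card_edges_in_tri[OF T] by simp
qed

lemma live_count_cases: assumes "X \<in> TV" shows "live_count X = 0 \<or> live_count X = 2 \<or> live_count X = 3"
proof (cases "live_count X = 0")
  case False
  then obtain e where "e \<in> Live" "e \<subseteq> X" unfolding live_count_zero_iff by blast
  then show ?thesis using live_count_ge2[OF assms] live_count_le3[OF assms] by force
qed simp

lemma card_TV_split: "card TV = card T0 + card T2 + card T3"
proof -
  have "TV = T0 \<union> T2 \<union> T3" using live_count_cases by (auto simp: T0_def T2_def T3_def)
  moreover have "card (T0 \<union> T2 \<union> T3) = card (T0 \<union> T2) + card T3"
    using finT by (intro card_Un_disjoint) (auto simp: T0_def T2_def T3_def)
  moreover have "card (T0 \<union> T2) = card T0 + card T2"
    using finT by (intro card_Un_disjoint) (auto simp: T0_def T2_def T3_def)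
  ultimately show ?thesis by simp
qed

lemma handshake: "2 * card Live = 2 * card T2 + 3 * card T3"
proof -
  have "2 * card Live = (\<Sum>e\<in>Live. card {X \<in> TV. e \<subseteq> X})"
  proof -
    have "card {X \<in> TV. e \<subseteq> X} = 2" if "e \<in> Live" for e
    proof -
      have "e \<in> Eint" "e \<in> Eall" using that Live_sub_Eint Eint_sub by auto
      then show ?thesis using card_tris_at_edge[of e] by simp
    qed
    then show ?thesis by simp
  qed
  also have "\<dots> = (\<Sum>e\<in>Live. \<Sum>X\<in>TV. if e \<subseteq> X then 1 else 0)"
    using finTV by (simp add: sum.If_cases Int_def)
  also have "\<dots> = (\<Sum>X\<in>TV. \<Sum>e\<in>Live. if e \<subseteq> X then 1 else 0)" by (rule sum.swap)
  also have "\<dots> = (\<Sum>X\<in>TV. live_count X)"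
    using finLive by (simp add: sum.If_cases Int_def live_count_def)
  also have "\<dots> = (\<Sum>X\<in>T0 \<union> T2 \<union> T3. live_count X)"
    using live_count_cases by (intro sum.cong) (auto simp: T0_def T2_def T3_def)
  also have "\<dots> = (\<Sum>X\<in>T0 \<union> T2. live_count X) + (\<Sum>X\<in>T3. live_count X)"
    using finT by (intro sum.union_disjoint) (auto simp: T0_def T2_def T3_def)
  also have "(\<Sum>X\<in>T0 \<union> T2. live_count X) = (\<Sum>X\<in>T0. live_count X) + (\<Sum>X\<in>T2. live_count X)"
    using finT by (intro sum.union_disjoint) (auto simp: T0_def T2_def T3_def)
  also have "(\<Sum>X\<in>T0. live_count X) = 0" by (simp add: T0_def)
  also have "(\<Sum>X\<in>T2. live_count X) = 2 * card T2" by (simp add: T2_def)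
  also have "(\<Sum>X\<in>T3. live_count X) = 3 * card T3" by (simp add: T3_def)
  finally show ?thesis by simp
qed

text \<open>The walk towards \<open>X0\<close> crosses an edge only if a point of \<open>X0\<close>
  lies beyond it. Were that edge dead, \<open>dead_beyond\<close> would deprive the current triangle
  or \<open>X0\<close> of its live edges, depending on the side of the interior points.\<close>

lemma live_connected:
  assumes X: "X \<in> S" "S \<subseteq> T2 \<union> T3" and X0: "X0 \<in> T2 \<union> T3"
    and step: "\<And>p q r s. {p,q,r} \<in> S \<Longrightarrow> {p,q,s} \<in> TV \<Longrightarrow> cr (q - p) (r - p) * cr (q - p) (s - p) < 0 \<Longrightarrow>
        {p,q} \<in> Live \<Longrightarrow> {p,q,s} \<in> S"
  shows "X0 \<in> S"
proof (rule connected_tri[OF _ X(1)])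
  show "X0 \<in> TV" "S \<subseteq> TV" using X0 X(2) by (auto simp: T2_def T3_def)
  fix p q r s
  assume a: "{p,q,r} \<in> S" "{p,q,s} \<in> TV" "cr (q - p) (r - p) * cr (q - p) (s - p) < 0"
    and v: "\<exists>v\<in>X0. cr (q - p) (r - p) * cr (q - p) (v - p) < 0"
  have Xr: "{p,q,r} \<in> TV" "live_count {p,q,r} \<noteq> 0" using a(1) X(2) by (auto simp: T2_def T3_def)
  have X0': "X0 \<in> TV" "live_count X0 \<noteq> 0" using X0 by (auto simp: T2_def T3_def)
  obtain v where v: "v \<in> X0" "cr (q - p) (r - p) * cr (q - p) (v - p) < 0" using v by blast
  have E: "edg p q" "edg q p" using tri_edg[OF Xr(1)] by auto
  have "{p,q} \<in> Live"
  proof (rule ccontr)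
    assume d: "{p,q} \<notin> Live"
    note dc = dead_cases[OF E(1) d]
    have sw: "cr (p - q) (x - q) = - cr (q - p) (x - p)" for x by (rule cr_swap)
    have b1: False if "\<forall>i\<in>I. cr (q - p) (i - p) > 0" "cr (q - p) (x - p) < 0" "Z \<in> TV" "live_count Z \<noteq> 0" "x \<in> Z" for x Z
      using dead_beyond[OF E(1) dc(1,2) that(1) that(3,5,2)] that(4) by simp
    have b2: False if "\<forall>i\<in>I. cr (q - p) (i - p) < 0" "cr (q - p) (x - p) > 0" "Z \<in> TV" "live_count Z \<noteq> 0" "x \<in> Z" for x Z
      using dead_beyond[OF E(2) dc(2,1) _ that(3,5)] that(1,2,4) sw by auto
    have rv: "cr (q - p) (r - p) < 0 \<and> cr (q - p) (v - p) > 0 \<or> cr (q - p) (r - p) > 0 \<and> cr (q - p) (v - p) < 0"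
      using v(2) by (auto simp: mult_less_0_iff)
    show False using dc(3)
    proof
      assume l: "\<forall>i\<in>I. cr (q - p) (i - p) > 0"
      show False using rv b1[OF l _ Xr, of r] b1[OF l _ X0' v(1)] by auto
    next
      assume l: "\<forall>i\<in>I. cr (q - p) (i - p) < 0"
      show False using rv b2[OF l _ Xr, of r] b2[OF l _ X0' v(1)] by auto
    qed
  qed
  then show "{p,q,s} \<in> S" using step[OF a] by blast
qed

text \<open>The edge of a dead triangle beyond which all interior points lie. It is unique, which pairs off the
  triangles without live edges and the interior edges that are not live.\<close>

definition root :: "plane set \<Rightarrow> plane set \<Rightarrow> bool" where
  "root X e \<longleftrightarrow> (\<exists>a b s. X = {a,b,s} \<and> e = {a,b} \<and> ccw b a s \<and> (\<forall>i\<in>I. cr (b - a) (i - a) > 0) \<and> a \<notin> I \<and> b \<notin> I)"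

lemma root_facts:
  assumes r: "root X e" and I: "I \<noteq> {}"
  shows "X \<in> T0" "e \<in> Eint - Live" "e \<subseteq> X"
proof -
  obtain a b s where x: "X = {a,b,s}" "e = {a,b}" "ccw b a s" "\<forall>i\<in>I. cr (b - a) (i - a) > 0" "a \<notin> I" "b \<notin> I"
    using r unfolding root_def by blast
  have X: "X \<in> TV" using x by (simp add: ccw_def insert_commute)
  have E: "edg a b" using ccw_edg[OF x(3)] by auto
  have s: "cr (b - a) (s - a) < 0" using ccw_pos[OF x(3)] cr_swap[of a b s] by simp
  have "live_count X = 0" by (rule dead_beyond[OF E x(5,6,4) X _ s]) (use x in auto)
  then show "X \<in> T0" using X by (simp add: T0_def)
  show "e \<subseteq> X" using x by auto
  then have "e \<notin> Live" using \<open>live_count X = 0\<close> live_count_zero_iff by blast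
  obtain i where "i \<in> I" using I by blast
  then obtain r where "ccw a b r" using edge_left[OF E, of i] x(4) I_sub by blast
  then have "e \<in> Eint" using x Eint_iff by blast
  then show "e \<in> Eint - Live" using \<open>e \<notin> Live\<close> by blast
qed

lemma root_unique_tri:
  assumes "root X e" "root Y e" and I: "I \<noteq> {}"
  shows "X = Y"
proof -
  obtain a b s where x: "X = {a,b,s}" "e = {a,b}" "ccw b a s" "\<forall>i\<in>I. cr (b - a) (i - a) > 0"
    using assms(1) unfolding root_def by blast
  obtain a' b' s' where y: "Y = {a',b',s'}" "e = {a',b'}" "ccw b' a' s'" "\<forall>i\<in>I. cr (b' - a') (i - a') > 0"
    using assms(2) unfolding root_def by blast
  obtain i where i: "i \<in> I" using I by blast
  have "a' = a \<and> b' = b"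
  proof (rule ccontr)
    assume "\<not> ?thesis"
    then have "a' = b" "b' = a" using x(2) y(2) by (auto simp: doubleton_eq_iff)
    then have "cr (b - a) (i - a) > 0" "cr (a - b) (i - b) > 0" using x(4) y(4) i by auto
    then show False using cr_swap[of a b i] by simp
  qed
  then show ?thesis using x y ccw_unique by metis
qed

text \<open>Two root edges would meet in a corner that is not interior, with every interior point
  beyond both of them, contrary to \<open>beyond_unique\<close>.\<close>

lemma root_unique_edge:
  assumes "root X e" "root X f" and I: "I \<noteq> {}"
  shows "e = f"
proof -
  obtain a b s where x: "X = {a,b,s}" "e = {a,b}" "ccw b a s" "\<forall>i\<in>I. cr (b - a) (i - a) > 0" "a \<notin> I" "b \<notin> I"
    using assms(1) unfolding root_def by blast
  obtain a' b' s' where y: "X = {a',b',s'}" "f = {a',b'}" "ccw b' a' s'" "\<forall>i\<in>I. cr (b' - a') (i - a') > 0" "a' \<notin> I" "b' \<notin> I"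
    using assms(2) unfolding root_def by blast
  obtain i where i: "i \<in> I" "i \<in> A" using I I_sub by blast
  have n: "cr (a - b) (i - b) < 0" "cr (a' - b') (i - b') < 0"
    using x(4) y(4) i cr_swap[of a b i] cr_swap[of a' b' i] by auto
  have mem: "a' \<in> {a,b,s}" "b' \<in> {a,b,s}" using x(1) y(1) by auto
  have c1: "ccw a s b" "ccw s b a" using x(3) ccw_rot by blast+
  have rev: False if "ccw p q u" "ccw q p v" "{p,q,u} = {q,p,v}" for p q u v
    using ccw_ne_rev[OF that(1,2)] that(3) by (simp add: insert_commute)
  have "s' \<in> {a,b,s}" using x(1) y(1) by auto
  then have "(b' = b \<and> a' = a) \<or> (b' = a \<and> a' = s) \<or> (b' = s \<and> a' = b) \<or> (ccw a b s' \<or> ccw s a s' \<or> ccw b s s')"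
    using mem ccw_distinct[OF y(3)] y(3) by auto
  \<comment> \<open>The first three cases are the rotations of the first naming of the triangle, the
    last three are namings of the opposite orientation.\<close>
  then consider "b' = b" "a' = a" | "b' = a" "a' = s" | "b' = s" "a' = b" | "ccw a b s'" "b' = a" "a' = b"
    | "ccw s a s'" "b' = s" "a' = a" | "ccw b s s'" "b' = b" "a' = s"
    using mem ccw_distinct[OF y(3)] y(3) by auto
  then show ?thesis
  proof cases
    case 1 then show ?thesis using x y by simp
  next
    case 2
    then show ?thesis using beyond_unique[OF x(3,5) i(2) n(1)] n(2) by blast
  next
    case 3
    then show ?thesis using beyond_unique[OF c1(2) x(6) i(2)] n by blast
  next
    case 4 then show ?thesis using x y by auto
  next
    case 5
    then have "s' = b" using x(1) y(1) ccw_distinct[OF y(3)] ccw_distinct[OF x(3)] by auto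
    then show ?thesis using 5 rev[OF 5(1), of b] c1 by (auto simp: insert_commute)
  next
    case 6
    then have "s' = a" using x(1) y(1) ccw_distinct[OF y(3)] ccw_distinct[OF x(3)] by auto
    then show ?thesis using 6 rev[OF 6(1), of a] c1 by (auto simp: insert_commute)
  qed
qed

lemma root_exists_tri:
  assumes e: "e \<in> Eint - Live" obtains X where "root X e"
proof -
  obtain p q r s where pq: "e = {p,q}" "ccw p q r" "ccw q p s" using e unfolding Eint_def by blast
  have E: "edg p q" using ccw_edg[OF pq(2)] by auto
  have d: "{p,q} \<notin> Live" using e pq by simp
  note dc = dead_cases[OF E d]
  from dc(3) show ?thesis
  proof
    assume "\<forall>i\<in>I. cr (q - p) (i - p) > 0"
    then have "root {p,q,s} e" unfolding root_def using pq dc by blast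
    then show ?thesis using that by blast
  next
    assume "\<forall>i\<in>I. cr (q - p) (i - p) < 0"
    then have "\<forall>i\<in>I. cr (p - q) (i - q) > 0" using cr_swap[of p q] by simp
    moreover have "e = {q,p}" using pq by auto
    ultimately have "root {q,p,r} e" unfolding root_def using pq dc by blast
    then show ?thesis using that by blast
  qed
qed

text \<open>An interior point is not in the dead triangle and so lies beyond one of its edges; as
  that edge is dead, the other interior points lie beyond it too.\<close>

lemma root_exists_edge:
  assumes X: "X \<in> T0" and I: "I \<noteq> {}" obtains e where "root X e"
proof -
  have XT: "X \<in> TV" "live_count X = 0" using X by (auto simp: T0_def)
  obtain p q r where pqr: "X = {p,q,r}" "ccw p q r" using TV_ccwE[OF XT(1)] .
  have E: "edg p q" "edg q r" "edg r p" using ccw_edg[OF pqr(2)] by auto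
  have "e \<notin> Live" if "e \<subseteq> X" for e using XT(2) that unfolding live_count_zero_iff by blast
  then have d: "{p,q} \<notin> Live" "{q,r} \<notin> Live" "{r,p} \<notin> Live" using pqr(1) by simp_all
  have nI: "p \<notin> I" "q \<notin> I" "r \<notin> I" using dead_cases[OF E(1) d(1)] dead_cases[OF E(2) d(2)] by auto
  obtain i where i: "i \<in> I" "i \<in> A" using I I_sub by blast
  have key: "root {b,a,s} {b,a}" if "ccw a b s" "{a,b} \<notin> Live" "cr (b - a) (i - a) < 0" for a b s
  proof -
    have "edg a b" using ccw_edg[OF that(1)] by auto
    note dc = dead_cases[OF this that(2)]
    have "\<forall>j\<in>I. cr (b - a) (j - a) < 0" using dc(3) that(3) i by force
    then have "\<forall>j\<in>I. cr (a - b) (j - b) > 0" using cr_swap[of a b] by simp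
    then show ?thesis unfolding root_def using that(1) dc by blast
  qed
  have c: "ccw q r p" "ccw r p q" using pqr(2) ccw_rot by blast+
  have "i \<notin> {p,q,r}" using nI i by auto
  then consider "cr (q - p) (i - p) < 0" | "cr (r - q) (i - q) < 0" | "cr (p - r) (i - r) < 0"
    using outside_tri[OF pqr(2) i(2)] by blast
  moreover have "X = {q,p,r}" "X = {r,q,p}" "X = {p,r,q}" using pqr by auto
  ultimately show ?thesis using that key[OF pqr(2) d(1)] key[OF c(1) d(2)] key[OF c(2) d(3)] by cases auto
qed

lemma card_dead: assumes I: "I \<noteq> {}" shows "card T0 = card (Eint - Live)"
proof -
  define g where "g e = (THE X. root X e)" for e
  have g: "root (g e) e" if e: "e \<in> Eint - Live" for e
  proof -
    obtain X where "root X e" using root_exists_tri[OF e] .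
    then have "\<exists>!X. root X e" using root_unique_tri[OF _ _ I] by blast
    then show ?thesis unfolding g_def by (rule theI')
  qed
  have "bij_betw g (Eint - Live) T0" unfolding bij_betw_def
  proof
    show "inj_on g (Eint - Live)"
    proof (rule inj_onI)
      fix x y assume xy: "x \<in> Eint - Live" "y \<in> Eint - Live" "g x = g y"
      show "x = y" by (rule root_unique_edge[OF g[OF xy(1)] _ I]) (use g[OF xy(2)] xy(3) in simp)
    qed
    show "g ` (Eint - Live) = T0"
    proof
      show "g ` (Eint - Live) \<subseteq> T0" using g root_facts[OF _ I] by blast
      show "T0 \<subseteq> g ` (Eint - Live)"
      proof
        fix X assume "X \<in> T0"
        then obtain e where e: "root X e" using root_exists_edge I by blast
        then have "e \<in> Eint - Live" using root_facts[OF _ I] by blast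
        moreover have "g e = X" using root_unique_tri[OF g[OF calculation] e I] .
        ultimately show "X \<in> g ` (Eint - Live)" by blast
      qed
    qed
  qed
  then show ?thesis by (simp add: bij_betw_same_card)
qed

text \<open>Dead triangles and dead interior edges are equally many, so dropping them keeps Euler's
  relation. For \<open>g = card I\<close> there remain \<open>2 * g - 2\<close> trivalent vertices,
  and \<open>card Live - card T2 = 3 * g - 3\<close> is the number of edges after each 2-valent
  vertex has merged two.\<close>

lemma core_counts:
  assumes I: "I \<noteq> {}"
  shows "card T3 + 2 = 2 * card I" and "card Live + 3 = card T2 + 3 * card I"
proof -
  have "card (Eint - Live) + card Live = card Eint"
    using Live_sub_Eint finEint by (metis card_Diff_subset card_mono finLive le_add_diff_inverse2)
  then show "card T3 + 2 = 2 * card I" "card Live + 3 = card T2 + 3 * card I"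
    using card_dead[OF I] handshake card_TV_split euler_interior euler_pick by linarith+
qed

end

section \<open>Relations between edge lengths\<close>

text \<open>The lattice length of the edge dual to \<open>pq\<close>, where \<open>r\<close> and \<open>s\<close> are the opposite vertices of the two
  triangles at \<open>pq\<close>, for the heights \<open>u\<close>. The coefficients are those of the affine relation between the
  four points.\<close>

definition len4 :: "(plane \<Rightarrow> real) \<Rightarrow> plane \<Rightarrow> plane \<Rightarrow> plane \<Rightarrow> plane \<Rightarrow> real" where
  "len4 u p q r s = u r + u s - cr (r - q) (s - q) * u p - cr (s - p) (r - p) * u q"

lemma len4_sym: "len4 u q p s r = len4 u p q r s"
  by (simp add: len4_def)

text \<open>\<open>r\<close> and \<open>s\<close> have opposite unit distances from the line
  \<open>pq\<close>, so \<open>r + s - 2 *\<^sub>R p\<close> is parallel to it.\<close>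

lemma flip_relation:
  assumes "cr (q - p) (r - p) = 1" "cr (q - p) (s - p) = -1"
  shows "r + s - 2 *\<^sub>R p = cr (s - p) (r - p) *\<^sub>R (q - p)"
    and "cr (r - q) (s - q) = 2 - cr (s - p) (r - p)"
proof -
  have "1 *\<^sub>R (s - p) = cr (s - p) (r - p) *\<^sub>R (q - p) + (-1) *\<^sub>R (r - p)"
    using cr_cramer[of "q - p" "r - p" "s - p"] unfolding assms .
  then have "s - p + (r - p) = cr (s - p) (r - p) *\<^sub>R (q - p)" by (simp add: plane_eq_iff)
  moreover have "s - p + (r - p) = r + s - 2 *\<^sub>R p" by (simp add: plane_eq_iff)
  ultimately show "r + s - 2 *\<^sub>R p = cr (s - p) (r - p) *\<^sub>R (q - p)" by simp
  have "cr (r - q) (s - q) = cr (q - p) (r - p) - cr (q - p) (s - p) - cr (s - p) (r - p)"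
    by (simp add: cr_def algebra_simps)
  then show "cr (r - q) (s - q) = 2 - cr (s - p) (r - p)" using assms by simp
qed

text \<open>The dual vertex before a quarter turn: if \<open>cr (q - p) (r - p) = 1\<close>, then at
  \<open>x = rot (wvec u p q r)\<close> the values \<open>u p + p \<bullet> x\<close>,
  \<open>u q + q \<bullet> x\<close> and \<open>u r + r \<bullet> x\<close> agree. The formula
  applies to all heights, including those that do not induce the triangulation.\<close>

definition wvec :: "(plane \<Rightarrow> real) \<Rightarrow> plane \<Rightarrow> plane \<Rightarrow> plane \<Rightarrow> plane" where
  "wvec u p q r = u p *\<^sub>R (q - r) + u q *\<^sub>R (r - p) + u r *\<^sub>R (p - q)"

lemma wvec_rot: "wvec u p q r = wvec u q r p"
  by (simp add: wvec_def add_ac)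

text \<open>The coefficient of the length of \<open>e\<close> when the closing relations of the cycles around the interior
  points are added up with coefficient vectors \<open>l\<close>.\<close>

definition strain :: "(plane \<Rightarrow> plane) \<Rightarrow> plane set \<Rightarrow> real" where
  "strain l e = (\<Sum>p\<in>e. l p \<bullet> (\<Sum>q\<in>e. q - p))"

lemma strain_pair: "p \<noteq> q \<Longrightarrow> strain l {p,q} = l p \<bullet> (q - p) + l q \<bullet> (p - q)"
  by (simp add: strain_def)

context regtri
begin

text \<open>A signed length, linear in the heights and defined for all of them. The choice can only
  exchange the two ends of the edge, and \<open>len4\<close> is symmetric under this. For the
  inducing heights \<open>w\<close> it is the lattice length, by
  \<open>interior_edge_cell\<close>.\<close>

definition elen :: "(plane \<Rightarrow> real) \<Rightarrow> plane set \<Rightarrow> real" where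
  "elen u e = (case (SOME t. case t of (p,q,r,s) \<Rightarrow> e = {p,q} \<and> ccw p q r \<and> ccw q p s) of
     (p,q,r,s) \<Rightarrow> len4 u p q r s)"

lemma elen_eq:
  assumes "ccw p q r" "ccw q p s" shows "elen u {p,q} = len4 u p q r s"
proof -
  define P where "P t = (case t of (p',q',r',s') \<Rightarrow> {p,q} = {p',q'} \<and> ccw p' q' r' \<and> ccw q' p' s')" for t
  define t where "t = (SOME t. P t)"
  have "P (p,q,r,s)" using assms by (simp add: P_def)
  then have "P t" unfolding t_def by (rule someI)
  obtain p' q' r' s' where t: "t = (p',q',r',s')" by (cases t)
  have h: "{p,q} = {p',q'}" "ccw p' q' r'" "ccw q' p' s'" using \<open>P t\<close> by (auto simp: t P_def)
  have e: "elen u {p,q} = len4 u p' q' r' s'"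
    using t unfolding elen_def t_def P_def by simp
  from h(1) consider "p' = p" "q' = q" | "p' = q" "q' = p" by (auto simp: doubleton_eq_iff)
  then show ?thesis
  proof cases
    case 1
    then have "r' = r" "s' = s" using h ccw_unique assms by blast+
    then show ?thesis using e 1 by simp
  next
    case 2
    then have "r' = s" "s' = r" using h ccw_unique assms by blast+
    then show ?thesis using e 2 len4_sym by simp
  qed
qed

lemma flip: assumes "ccw p q r" "ccw q p s"
  shows "cr (q - p) (r - p) = 1" "cr (q - p) (s - p) = -1"
  using ccw_pos[OF assms(1)] ccw_pos[OF assms(2)] cr_swap[of p q s] by simp_all

text \<open>The step between adjacent dual vertices; eliminating \<open>s\<close> with
  \<open>flip_relation\<close> leaves a multiple of \<open>q - p\<close> whose factor is
  \<open>len4\<close>.\<close>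

lemma wvec_diff:
  assumes "ccw p q r" "ccw q p s"
  shows "wvec u q p s - wvec u p q r = elen u {p,q} *\<^sub>R (q - p)"
proof -
  define m where "m = cr (s - p) (r - p)"
  note fl = flip_relation[OF flip[OF assms], folded m_def]
  have s: "s$1 = m * (q$1 - p$1) - r$1 + 2 * p$1" "s$2 = m * (q$2 - p$2) - r$2 + 2 * p$2"
    using fl(1) by (simp_all add: plane_eq_iff algebra_simps)
  have "wvec u q p s - wvec u p q r = (u r + u s - (2 - m) * u p - m * u q) *\<^sub>R (q - p)"
    by (simp add: wvec_def plane_eq_iff s algebra_simps)
  then show ?thesis unfolding elen_eq[OF assms] len4_def fl(2) m_def[symmetric] .
qed

definition nbr :: "plane \<Rightarrow> plane set" where "nbr p = {q. edg p q}"

lemma fin_nbr: "finite (nbr p)"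
  by (rule finite_subset[OF _ finA]) (use edg_A in \<open>auto simp: nbr_def\<close>)

text \<open>The edges of the curve dual to the edges at \<open>p\<close> form a closed polygon.\<close>

lemma star_balance:
  assumes p: "p \<in> I"
  shows "(\<Sum>q\<in>nbr p. elen u {p,q} *\<^sub>R (q - p)) = 0"
proof -
  define nx where "nx q = (THE r. ccw p q r)" for q
  define pv where "pv q = (THE s. ccw q p s)" for q
  have nx: "ccw p q (nx q)" if "q \<in> nbr p" for q
  proof -
    have "\<exists>!r. ccw p q r" using I_ccw[OF p, of q] that ccw_unique by (metis nbr_def mem_Collect_eq)
    then show ?thesis unfolding nx_def by (rule theI')
  qed
  have pv: "ccw q p (pv q)" if "q \<in> nbr p" for q
  proof -
    have "\<exists>!r. ccw q p r" using I_ccw'[OF p, of q] that ccw_unique by (metis nbr_def mem_Collect_eq)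
    then show ?thesis unfolding pv_def by (rule theI')
  qed
  have nxn: "nx q \<in> nbr p" "pv q \<in> nbr p" if "q \<in> nbr p" for q
    using ccw_edg[OF nx[OF that]] ccw_edg[OF pv[OF that]] by (simp_all add: nbr_def)
  have inv: "nx (pv q) = q" "pv (nx q) = q" if q: "q \<in> nbr p" for q
  proof -
    have "ccw p (pv q) q" using pv[OF q] ccw_rot by blast
    then show "nx (pv q) = q" using nx[OF nxn(2)[OF q]] ccw_unique by blast
    have "ccw (nx q) p q" using nx[OF q] ccw_rot by blast
    then show "pv (nx q) = q" using pv[OF nxn(1)[OF q]] ccw_unique by blast
  qed
  have "(\<Sum>q\<in>nbr p. elen u {p,q} *\<^sub>R (q - p)) = (\<Sum>q\<in>nbr p. wvec u q p (pv q) - wvec u p q (nx q))"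
    by (intro sum.cong refl) (use wvec_diff[OF nx pv] in simp)
  also have "\<dots> = (\<Sum>q\<in>nbr p. wvec u q p (pv q)) - (\<Sum>q\<in>nbr p. wvec u p q (nx q))"
    by (rule sum_subtractf)
  also have "(\<Sum>q\<in>nbr p. wvec u q p (pv q)) = (\<Sum>q\<in>nbr p. wvec u p q (nx q))"
    by (rule sum.reindex_bij_witness[of _ nx pv]) (use inv nxn in \<open>auto simp: wvec_rot[of _ _ p]\<close>)
  finally show ?thesis by simp
qed

lemma Eint_at: assumes p: "p \<in> I" shows "{e \<in> Eint. p \<in> e} = (\<lambda>q. {p,q}) ` nbr p"
proof
  show "{e \<in> Eint. p \<in> e} \<subseteq> (\<lambda>q. {p,q}) ` nbr p"
  proof
    fix e assume e: "e \<in> {e \<in> Eint. p \<in> e}"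
    then obtain a b where ab: "e = {a,b}" "edg a b" unfolding Eint_def using ccw_edg by blast
    then have "edg b a" by (simp add: insert_commute)
    have "p = a \<or> p = b" using e ab by auto
    then show "e \<in> (\<lambda>q. {p,q}) ` nbr p"
    proof
      assume "p = a" then show ?thesis using ab by (auto simp: nbr_def)
    next
      assume "p = b" then show ?thesis using ab \<open>edg b a\<close> by (auto simp: nbr_def insert_commute)
    qed
  qed
  show "(\<lambda>q. {p,q}) ` nbr p \<subseteq> {e \<in> Eint. p \<in> e}"
  proof
    fix e assume "e \<in> (\<lambda>q. {p,q}) ` nbr p"
    then obtain q where q: "e = {p,q}" "edg p q" by (auto simp: nbr_def)
    obtain r where "ccw p q r" using I_ccw[OF p q(2)] .
    moreover obtain s where "ccw q p s" using I_ccw'[OF p q(2)] .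
    ultimately have "{p,q} \<in> Eint" unfolding Eint_iff by blast
    then show "e \<in> {e \<in> Eint. p \<in> e}" using q(1) by simp
  qed
qed

lemma Eint_memE: assumes "e \<in> Eint" obtains p q where "e = {p,q}" "p \<noteq> q" "edg p q"
  using assms unfolding Eint_def using ccw_distinct ccw_edg by blast

lemma Eint_subA: "e \<in> Eint \<Longrightarrow> e \<subseteq> A"
  by (metis Eint_memE edg_A empty_subsetI insert_subset)

text \<open>Summing over points instead of edges collects at each \<open>p\<close> the product of
  \<open>l p\<close> with the closing relation \<open>star_balance\<close>.\<close>

lemma strain_elen_orthogonal:
  assumes l: "\<And>p. p \<notin> I \<Longrightarrow> l p = 0"
  shows "(\<Sum>e\<in>Eint. strain l e * elen u e) = 0"
proof -
  have "(\<Sum>e\<in>Eint. strain l e * elen u e) = (\<Sum>e\<in>Eint. \<Sum>p\<in>A. if p \<in> e then l p \<bullet> (elen u e *\<^sub>R (\<Sum>q\<in>e. q - p)) else 0)"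
  proof (intro sum.cong refl)
    fix e assume "e \<in> Eint"
    then have "A \<inter> {p. p \<in> e} = e" using Eint_subA by blast
    then show "strain l e * elen u e = (\<Sum>p\<in>A. if p \<in> e then l p \<bullet> (elen u e *\<^sub>R (\<Sum>q\<in>e. q - p)) else 0)"
      using finA by (simp add: sum.If_cases strain_def sum_distrib_left mult.commute)
  qed
  also have "\<dots> = (\<Sum>p\<in>A. \<Sum>e\<in>Eint. if p \<in> e then l p \<bullet> (elen u e *\<^sub>R (\<Sum>q\<in>e. q - p)) else 0)"
    by (rule sum.swap)
  also have "\<dots> = 0"
  proof (rule sum.neutral, rule ballI)
    fix p assume "p \<in> A"
    show "(\<Sum>e\<in>Eint. if p \<in> e then l p \<bullet> (elen u e *\<^sub>R (\<Sum>q\<in>e. q - p)) else 0) = 0"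
    proof (cases "p \<in> I")
      case True
      have "(\<Sum>e\<in>Eint. if p \<in> e then l p \<bullet> (elen u e *\<^sub>R (\<Sum>q\<in>e. q - p)) else 0)
        = (\<Sum>e\<in>{e \<in> Eint. p \<in> e}. l p \<bullet> (elen u e *\<^sub>R (\<Sum>q\<in>e. q - p)))"
        using finEint by (simp add: sum.If_cases Int_def)
      also have "\<dots> = (\<Sum>q\<in>nbr p. l p \<bullet> (elen u {p,q} *\<^sub>R (\<Sum>q'\<in>{p,q}. q' - p)))"
      proof -
        have "inj_on (\<lambda>q. {p,q}) (nbr p)" by (auto intro!: inj_onI simp: doubleton_eq_iff)
        then show ?thesis unfolding Eint_at[OF True] by (simp only: sum.reindex comp_def)
      qed
      also have "\<dots> = (\<Sum>q\<in>nbr p. l p \<bullet> (elen u {p,q} *\<^sub>R (q - p)))"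
      proof (intro sum.cong refl)
        fix q assume "q \<in> nbr p"
        then have "p \<noteq> q" using edgE by (metis nbr_def mem_Collect_eq)
        then show "l p \<bullet> (elen u {p,q} *\<^sub>R (\<Sum>q'\<in>{p,q}. q' - p)) = l p \<bullet> (elen u {p,q} *\<^sub>R (q - p))" by simp
      qed
      also have "\<dots> = l p \<bullet> (\<Sum>q\<in>nbr p. elen u {p,q} *\<^sub>R (q - p))" by (simp add: inner_sum_right)
      finally show ?thesis using star_balance[OF True] by simp
    next
      case False
      then show ?thesis using l[OF False] by (simp cong: if_cong)
    qed
  qed
  finally show ?thesis .
qed

text \<open>With zero coefficients at \<open>p\<close> and \<open>q\<close>, the edges
  \<open>sp\<close> and \<open>sq\<close> make \<open>l s\<close> orthogonal to two independent
  vectors.\<close>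

lemma zero_third:
  assumes l: "\<And>p. p \<notin> I \<Longrightarrow> l p = 0" and st: "\<And>e. e \<in> Eint \<Longrightarrow> strain l e = 0"
    and T: "{p,q,s} \<in> TV" and z: "l p = 0" "l q = 0"
  shows "l s = 0"
proof (cases "s \<in> I")
  case True
  have E: "edg s p" "edg s q" using tri_edg[OF T] by auto
  have d: "s \<noteq> p" "s \<noteq> q" using tri_distinct[OF T] by auto
  have "{s,p} \<in> Eint" "{s,q} \<in> Eint" using Eint_at[OF True] E by (auto simp: nbr_def)
  then have "l s \<bullet> (p - s) = 0" "l s \<bullet> (q - s) = 0"
    using st strain_pair[OF d(1), of l] strain_pair[OF d(2), of l] z by auto
  moreover have "cr (p - s) (q - s) \<noteq> 0"
    using TV_unit[of s p q] T by (auto simp: insert_commute)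
  ultimately show ?thesis using inner_zero_zero[of "p - s" "q - s" "l s"] by (simp add: inner_commute)
qed (use l in simp)

text \<open>The counting relations give \<open>card Eall - card Eint = card A - card I\<close>,
  which is positive because the lowest point is not interior.\<close>

lemma exists_boundary_edge: obtains a b where "edg a b" "a \<notin> I" "b \<notin> I"
proof -
  obtain lo hi where e: "lo \<in> A" "\<And>a. a \<in> A \<Longrightarrow> a \<noteq> lo \<Longrightarrow> irr \<bullet> (a - lo) > 0" by (rule exists_extremes) blast
  have "lo \<notin> I"
  proof
    have "- irr \<noteq> 0" using irr_irr by auto
    moreover assume "lo \<in> I"
    ultimately obtain a where "a \<in> A" "(-irr) \<bullet> (a - lo) > 0" using I_dir by blast
    then show False using e(2)[of a] by (cases "a = lo") auto
  qed
  then have "A - I \<noteq> {}" using e by blast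
  then have "card A > card I" using I_sub finA psubset_card_mono by blast
  then have "card Eint < card Eall" using euler_all euler_pick euler_edges by linarith
  then have "\<not> Eall \<subseteq> Eint" using finEint card_mono by (metis leD)
  then obtain x where x: "x \<in> Eall" "x \<notin> Eint" by blast
  then obtain a b where ab: "x = {a,b}" unfolding Eall_def by blast
  have E: "edg a b" "edg b a" using x ab by (simp_all add: insert_commute)
  have "a \<notin> I"
  proof
    assume "a \<in> I"
    then have "{a,b} \<in> Eint" using Eint_at E by (auto simp: nbr_def)
    then show False using x ab by simp
  qed
  moreover have "b \<notin> I"
  proof
    assume "b \<in> I"
    then have "{b,a} \<in> Eint" using Eint_at E by (auto simp: nbr_def)
    then show False using x ab by (simp add: insert_commute)
  qed
  ultimately show ?thesis using that E by blast
qed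

text \<open>Independence of the closing relations: both ends of a boundary edge have coefficient 0,
  and by \<open>zero_third\<close> the zeros spread from triangle to triangle.\<close>

lemma strain_zero:
  assumes l: "\<And>p. p \<notin> I \<Longrightarrow> l p = 0" and st: "\<And>e. e \<in> Eint \<Longrightarrow> strain l e = 0"
  shows "l v = 0"
proof (cases "v \<in> A")
  case True
  obtain X0 where X0: "X0 \<in> TV" "v \<in> X0" using A_in_tri[OF True] .
  obtain a b where ab: "edg a b" "a \<notin> I" "b \<notin> I" by (rule exists_boundary_edge)
  obtain c where c: "{a,b,c} \<in> TV" using edgE[OF ab(1)] by metis
  define S where "S = {X \<in> TV. \<forall>p\<in>X. l p = 0}"
  have "l c = 0" by (rule zero_third[OF l st c]) (use ab l in auto)
  then have "{a,b,c} \<in> S" using c ab l by (simp add: S_def)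
  then have "X0 \<in> S"
  proof (rule connected_tri[OF X0(1)])
    fix p q r s assume a: "{p,q,r} \<in> S" "{p,q,s} \<in> TV"
    then have "l p = 0" "l q = 0" by (auto simp: S_def)
    then have "l s = 0" using zero_third[OF l st a(2)] by blast
    then show "{p,q,s} \<in> S" using a(2) \<open>l p = 0\<close> \<open>l q = 0\<close> by (simp add: S_def)
  qed (auto simp: S_def)
  then show ?thesis using X0 by (simp add: S_def)
qed (use l I_sub in blast)

section \<open>The linear maps that send heights to lengths and coefficient vectors to
  relations\<close>

definition length_map :: "(plane \<Rightarrow>\<^sub>0 real) \<Rightarrow> (plane set \<Rightarrow>\<^sub>0 real)" where
  "length_map f = restr Eint (elen (Poly_Mapping.lookup f))"

definition strain_map :: "(plane \<Rightarrow>\<^sub>0 plane) \<Rightarrow> (plane set \<Rightarrow>\<^sub>0 real)" where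
  "strain_map l = restr Eint (strain (Poly_Mapping.lookup l))"

lemma linear_elen: "linear (\<lambda>f. elen (Poly_Mapping.lookup f) e)"
  unfolding elen_def len4_def case_prod_beta
  by (intro linearI) (simp_all add: lookup_add algebra_simps)

lemma linear_length_map: "linear length_map"
  unfolding length_map_def by (intro linear_restr finEint linear_elen)

lemma linear_strain: "linear (\<lambda>l. strain (Poly_Mapping.lookup l) e)"
  unfolding strain_def
  by (intro linearI) (simp_all add: lookup_add inner_add_left sum.distrib sum_distrib_left)

lemma linear_strain_map: "linear strain_map"
  unfolding strain_map_def by (intro linear_restr finEint linear_strain)

lemma finI: "finite I"
  using I_sub finA finite_subset by blast

lemma strain_map_injective:
  assumes l: "l \<in> coord_space I" "strain_map l = 0" shows "l = 0"
proof (rule poly_mapping_eqI)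
  fix v
  have "strain (Poly_Mapping.lookup l) e = 0" if "e \<in> Eint" for e
    using l(2) that finEint unfolding strain_map_def by (metis lookup_restr lookup_zero)
  then show "Poly_Mapping.lookup l v = Poly_Mapping.lookup 0 v"
    using strain_zero[of "Poly_Mapping.lookup l" v] l(1) by (simp add: coord_space_iff)
qed

text \<open>An edge of length 0 means that the lifted surface does not bend there, so a function
  that vanishes on one triangle and has only zero lengths vanishes on the neighbours, and in the end
  everywhere.\<close>

lemma length_map_kernel:
  assumes f: "f \<in> coord_space A" "length_map f = 0" and X: "X \<in> TV" "\<And>p. p \<in> X \<Longrightarrow> Poly_Mapping.lookup f p = 0"
  shows "f = 0"
proof (rule poly_mapping_eqI)
  fix v
  have el: "elen (Poly_Mapping.lookup f) e = 0" if "e \<in> Eint" for e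
    using f(2) that finEint unfolding length_map_def by (metis lookup_restr lookup_zero)
  show "Poly_Mapping.lookup f v = Poly_Mapping.lookup 0 v"
  proof (cases "v \<in> A")
    case True
    obtain X0 where X0: "X0 \<in> TV" "v \<in> X0" using A_in_tri[OF True] .
    define S where "S = {X \<in> TV. \<forall>p\<in>X. Poly_Mapping.lookup f p = 0}"
    have "X \<in> S" using X by (auto simp: S_def)
    then have "X0 \<in> S"
    proof (rule connected_tri[OF X0(1)])
      fix p q r s assume a: "{p,q,r} \<in> S" "{p,q,s} \<in> TV" and op: "cr (q - p) (r - p) * cr (q - p) (s - p) < 0"
      have T: "{p,q,r} \<in> TV" and z: "Poly_Mapping.lookup f p = 0" "Poly_Mapping.lookup f q = 0" "Poly_Mapping.lookup f r = 0"
        using a by (auto simp: S_def)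
      consider "cr (q - p) (r - p) > 0" "cr (q - p) (s - p) < 0" | "cr (q - p) (r - p) < 0" "cr (q - p) (s - p) > 0"
        using op by (auto simp: mult_less_0_iff)
      then have "Poly_Mapping.lookup f s = 0"
      proof cases
        case 1
        have c: "ccw p q r" "ccw q p s" using ccwI[OF T 1(1)] ccwI'[OF a(2) 1(2)] .
        have "elen (Poly_Mapping.lookup f) {p,q} = 0" using el Eint_iff c by blast
        then show ?thesis unfolding elen_eq[OF c] len4_def using z by simp
      next
        case 2
        have c: "ccw p q s" "ccw q p r" using ccwI[OF a(2) 2(2)] ccwI'[OF T 2(1)] .
        have "elen (Poly_Mapping.lookup f) {p,q} = 0" using el Eint_iff c by blast
        then show ?thesis unfolding elen_eq[OF c] len4_def using z by simp
      qed
      then show "{p,q,s} \<in> S" using a(2) z by (simp add: S_def)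
    qed (auto simp: S_def)
    then show ?thesis using X0 by (simp add: S_def)
  qed (use f in \<open>simp add: coord_space_iff\<close>)
qed

lemma dim_le_coord:
  fixes W :: "('i \<Rightarrow>\<^sub>0 real) set"
  assumes "finite X" "subspace W" "W \<subseteq> coord_space X" shows "dim W \<le> card X"
  using dim_annihilator[OF assms] by simp

text \<open>The closing relations are the only linear relations between edge lengths; since they are
  independent, this is a count of dimensions.\<close>

lemma annihilator_length_map: "annihilator Eint (length_map ` coord_space A) = strain_map ` coord_space I"
proof -
  obtain BA :: "(plane \<Rightarrow>\<^sub>0 real) set" where BA: "finite BA" "coord_space A \<subseteq> span BA"
    using coord_space_finite_span[OF finA] by blast
  obtain BI :: "(plane \<Rightarrow>\<^sub>0 plane) set" where BI: "finite BI" "coord_space I \<subseteq> span BI"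
    using coord_space_finite_span[OF finI] by blast
  obtain BE :: "(plane set \<Rightarrow>\<^sub>0 real) set" where BE: "finite BE" "coord_space Eint \<subseteq> span BE"
    using coord_space_finite_span[OF finEint] by blast
  define K where "K = {f \<in> coord_space A. length_map f = 0}"
  have K: "subspace K"
    using subspace_coord_space[of A] unfolding K_def
    by (auto simp: subspace_def linear_add[OF linear_length_map] linear_scale[OF linear_length_map] linear_0[OF linear_length_map])
  obtain X where X: "X \<in> TV" using TV_ne by blast
  have lr: "linear (\<lambda>f::plane \<Rightarrow>\<^sub>0 real. restr X (Poly_Mapping.lookup f))"
    by (intro linear_restr TV_fin[OF X] linear_lookup)
  \<comment> \<open>Restriction to the three corners of a single triangle is injective on the
    kernel, so the kernel has dimension at most 3.\<close>
  have "dim ((\<lambda>f. restr X (Poly_Mapping.lookup f)) ` K) = dim K"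
  proof (rule dim_image_injective[OF K BA(1) _ lr])
    show "K \<subseteq> span BA" using BA by (auto simp: K_def)
    fix f assume f: "f \<in> K" "restr X (Poly_Mapping.lookup f) = 0"
    have "Poly_Mapping.lookup f p = 0" if "p \<in> X" for p
      using f(2) that TV_fin[OF X] by (metis lookup_restr lookup_zero)
    then show "f = 0" using length_map_kernel[OF _ _ X] f(1) by (auto simp: K_def)
  qed
  moreover have "dim ((\<lambda>f. restr X (Poly_Mapping.lookup f)) ` K) \<le> card X"
    by (rule dim_le_coord[OF TV_fin[OF X] linear_subspace_image[OF lr K]]) (use TV_fin[OF X] in auto)
  ultimately have K3: "dim K \<le> 3" using TV_card[OF X] by simp
  have 1: "card A = dim (length_map ` coord_space A) + dim K"
    using rank_nullity_subspace[OF subspace_coord_space BA linear_length_map] dim_coord_space_real[OF finA] by (simp add: K_def)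
  have 2: "dim (length_map ` coord_space A) + dim (annihilator Eint (length_map ` coord_space A)) = card Eint"
    by (rule dim_annihilator[OF finEint linear_subspace_image[OF linear_length_map subspace_coord_space]])
       (use finEint in \<open>auto simp: length_map_def\<close>)
  have 3: "dim (strain_map ` coord_space I) = 2 * card I"
    using dim_image_injective[OF subspace_coord_space BI linear_strain_map strain_map_injective] dim_coord_space_plane[OF finI] by simp
  show ?thesis
  proof (rule subspace_eq_of_dim[symmetric, OF _ _ BE(1)])
    show "subspace (strain_map ` coord_space I)" by (rule linear_subspace_image[OF linear_strain_map subspace_coord_space])
    show "annihilator Eint (length_map ` coord_space A) \<subseteq> span BE" using BE by (auto simp: annihilator_def)
    \<comment> \<open>\<open>euler_interior\<close> says that
      \<open>card Eint - (card A - 3) = 2 * card I\<close>: there are at most as many independent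
      relations as there are coefficients of closing relations.\<close>
    show "dim (annihilator Eint (length_map ` coord_space A)) \<le> dim (strain_map ` coord_space I)"
      using 1 2 3 K3 euler_interior by linarith
    show "strain_map ` coord_space I \<subseteq> annihilator Eint (length_map ` coord_space A)"
    proof
      fix d assume "d \<in> strain_map ` coord_space I"
      then obtain l where l: "l \<in> coord_space I" "d = strain_map l" by blast
      have "pairing Eint (length_map f) d = 0" for f
      proof -
        have "pairing Eint (length_map f) d = (\<Sum>e\<in>Eint. strain (Poly_Mapping.lookup l) e * elen (Poly_Mapping.lookup f) e)"
          using finEint by (simp add: pairing_def length_map_def l strain_map_def mult.commute)
        also have "\<dots> = 0" by (rule strain_elen_orthogonal) (use l in \<open>auto simp: coord_space_iff\<close>)
        finally show ?thesis .
      qed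
      then show "d \<in> annihilator Eint (length_map ` coord_space A)"
        using finEint by (auto simp: annihilator_def l strain_map_def)
    qed
  qed
qed

text \<open>Relations in which all edges of a chain that is concatenated in the skeleton have the same
  coefficient, so that they are relations between the lengths of skeleton edges.\<close>

definition chain_const :: "(plane set \<Rightarrow>\<^sub>0 real) set" where
  "chain_const = {d \<in> coord_space Live. \<forall>X\<in>T2. \<forall>e\<in>Live. \<forall>f\<in>Live. e \<subseteq> X \<longrightarrow> f \<subseteq> X \<longrightarrow>
     Poly_Mapping.lookup d e = Poly_Mapping.lookup d f}"

text \<open>There is one equation for each triangle of \<open>T2\<close>, so by
  \<open>core_counts\<close> their independence is what matters. In a linear relation between the
  equations the contributions of the two triangles at a live edge cancel, so a nonzero coefficient
  spreads across live edges until it reaches a triangle of \<open>T3\<close>, which has no equation.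
  \<open>T3\<close> is nonempty since \<open>card I \<ge> 2\<close>.\<close>

lemma dim_chain_const:
  assumes I2: "card I \<ge> 2"
  shows "dim chain_const + 3 = 3 * card I"
proof -
  have "\<exists>e f. {g \<in> Live. g \<subseteq> X} = {e,f} \<and> e \<noteq> f" if "X \<in> T2" for X
    using that unfolding T2_def live_count_def by (auto simp: card_2_iff)
  then have "\<forall>X. \<exists>h. X \<in> T2 \<longrightarrow> {g \<in> Live. g \<subseteq> X} = {fst h, snd h} \<and> fst h \<noteq> snd h" by fastforce
  then obtain h where h: "\<forall>X. X \<in> T2 \<longrightarrow> {g \<in> Live. g \<subseteq> X} = {fst (h X), snd (h X)} \<and> fst (h X) \<noteq> snd (h X)"
    by (rule choice[THEN exE])
  define e1 e2 where "e1 X = fst (h X)" and "e2 X = snd (h X)" for X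
  have e12: "{g \<in> Live. g \<subseteq> X} = {e1 X, e2 X} \<and> e1 X \<noteq> e2 X" if "X \<in> T2" for X
    using h that by (simp add: e1_def e2_def)
  have e1: "e1 X \<in> Live" "e2 X \<in> Live" "e1 X \<subseteq> X" "e2 X \<subseteq> X" if "X \<in> T2" for X
    using e12[OF that] by auto
  define Q where "Q d = restr T2 (\<lambda>X. Poly_Mapping.lookup d (e1 X) - Poly_Mapping.lookup d (e2 X))"
    for d :: "plane set \<Rightarrow>\<^sub>0 real"
  have Q: "linear Q" unfolding Q_def
    by (intro linear_restr finT) (intro linearI, simp_all add: lookup_add algebra_simps)
  have ker: "{d \<in> coord_space Live. Q d = 0} = chain_const"
  proof -
    have "Q d = 0 \<longleftrightarrow> (\<forall>X\<in>T2. \<forall>e\<in>Live. \<forall>f\<in>Live. e \<subseteq> X \<longrightarrow> f \<subseteq> X \<longrightarrow>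
      Poly_Mapping.lookup d e = Poly_Mapping.lookup d f)" (is "_ \<longleftrightarrow> ?R") for d
    proof
      assume z: "Q d = 0"
      have eq: "Poly_Mapping.lookup d (e1 X) = Poly_Mapping.lookup d (e2 X)" if "X \<in> T2" for X
      proof -
        have "Poly_Mapping.lookup (Q d) X = 0" using z by simp
        then show ?thesis using that finT unfolding Q_def by simp
      qed
      show ?R
      proof (intro ballI impI)
        fix X e f assume x: "X \<in> T2" "e \<in> Live" "f \<in> Live" "e \<subseteq> X" "f \<subseteq> X"
        then have "e \<in> {e1 X, e2 X}" "f \<in> {e1 X, e2 X}" using e12[OF x(1)] by blast+
        then show "Poly_Mapping.lookup d e = Poly_Mapping.lookup d f" using eq[OF x(1)] by auto
      qed
    next
      assume r: ?R
      show "Q d = 0"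
      proof (rule poly_mapping_eqI)
        fix X show "Poly_Mapping.lookup (Q d) X = Poly_Mapping.lookup 0 X"
          using r e1[of X] finT unfolding Q_def by auto
      qed
    qed
    then show ?thesis unfolding chain_const_def by blast
  qed
  obtain BL :: "(plane set \<Rightarrow>\<^sub>0 real) set" where BL: "finite BL" "coord_space Live \<subseteq> span BL"
    using coord_space_finite_span[OF finLive] by blast
  have 1: "card Live = dim (Q ` coord_space Live) + dim chain_const"
    using rank_nullity_subspace[OF subspace_coord_space BL Q] ker dim_coord_space_real[OF finLive] by simp
  have 2: "dim (Q ` coord_space Live) + dim (annihilator T2 (Q ` coord_space Live)) = card T2"
    by (rule dim_annihilator[OF finT(2) linear_subspace_image[OF Q subspace_coord_space]])
       (use finT in \<open>auto simp: Q_def\<close>)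
  have Ine: "I \<noteq> {}" using I2 by auto
  have "annihilator T2 (Q ` coord_space Live) = {0}"
  proof -
    have "\<mu> = 0" if m: "\<mu> \<in> annihilator T2 (Q ` coord_space Live)" for \<mu>
    proof (rule ccontr)
      assume "\<mu> \<noteq> 0"
      define m where "m = Poly_Mapping.lookup \<mu>"
      obtain X1 where "m X1 \<noteq> 0" using \<open>\<mu> \<noteq> 0\<close> unfolding m_def by (metis lookup_zero poly_mapping_eqI)
      moreover have "\<mu> \<in> coord_space T2" using m by (auto simp: annihilator_def)
      ultimately have X1: "X1 \<in> T2" by (auto simp: coord_space_iff m_def)
      define S where "S = {X \<in> T2. m X \<noteq> 0}"
      \<comment> \<open>The relation \<open>\<mu>\<close> tested on the unit vector of
        \<open>e\<close>.\<close>
      have bal: "(\<Sum>X\<in>T2. ((if e = e1 X then 1 else 0) - (if e = e2 X then 1 else 0)) * m X) = 0" if e: "e \<in> Live" for e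
      proof -
        have "Poly_Mapping.single e 1 \<in> coord_space Live" using e by (auto simp: coord_space_iff lookup_single when_def)
        then have "pairing T2 (Q (Poly_Mapping.single e 1)) \<mu> = 0" using m by (auto simp: annihilator_def)
        then show ?thesis using finT by (simp add: pairing_def Q_def m_def lookup_single when_def)
      qed
      have "card T3 > 0" using core_counts(1)[OF Ine] I2 by linarith
      then have "T3 \<noteq> {}" by auto
      then obtain X0 where X0: "X0 \<in> T3" by blast
      have "X1 \<in> S" using X1 \<open>m X1 \<noteq> 0\<close> by (simp add: S_def)
      then have "X0 \<in> S"
      proof (rule live_connected)
        show "S \<subseteq> T2 \<union> T3" "X0 \<in> T2 \<union> T3" using X0 by (auto simp: S_def)
        fix p q r s assume a: "{p,q,r} \<in> S" "{p,q,s} \<in> TV" "cr (q - p) (r - p) * cr (q - p) (s - p) < 0" "{p,q} \<in> Live"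
        have X: "{p,q,r} \<in> T2" "m {p,q,r} \<noteq> 0" using a(1) by (auto simp: S_def)
        have XT: "{p,q,r} \<in> TV" using X by (auto simp: T2_def)
        show "{p,q,s} \<in> S"
        proof (rule ccontr)
          assume nS: "{p,q,s} \<notin> S"
          \<comment> \<open>The coefficient of the unknown at \<open>pq\<close> in the equation of a
            triangle: 1, -1 or 0. Only the two triangles at \<open>pq\<close> can have a nonzero
            one.\<close>
          define c where "c X = ((if {p,q} = e1 X then 1 else 0) - (if {p,q} = e2 X then 1 else (0::real)))" for X
          have E: "edg p q" using tri_edg[OF XT] by auto
          have two: "X' = {p,q,r} \<or> X' = {p,q,s}" if X': "X' \<in> TV" "{p,q} \<subseteq> X'" for X'
          proof -
            have "card {X \<in> TV. {p,q} \<subseteq> X} \<le> 2" using card_tris_at_edge[OF E] by simp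
            moreover have "{p,q,r} \<noteq> {p,q,s}"
            proof
              assume "{p,q,r} = {p,q,s}"
              then have "r = s" using tri_distinct[OF XT] tri_distinct[OF a(2)] by auto
              then show False using a(3) by (auto simp: mult_less_0_iff)
            qed
            moreover have "{{p,q,r},{p,q,s}} \<subseteq> {X \<in> TV. {p,q} \<subseteq> X}" using XT a(2) by auto
            moreover have "finite {X \<in> TV. {p,q} \<subseteq> X}" using finTV by simp
            ultimately have "{{p,q,r},{p,q,s}} = {X \<in> TV. {p,q} \<subseteq> X}"
              by (intro card_seteq) auto
            then show ?thesis using X' by blast
          qed
          have zero: "c X' * m X' = 0" if "X' \<in> T2" "X' \<noteq> {p,q,r}" for X'
          proof (rule ccontr)
            assume n: "c X' * m X' \<noteq> 0"
            then have "{p,q} \<subseteq> X'" using e1[OF that(1)] by (auto simp: c_def split: if_splits)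
            then have "X' = {p,q,s}" using two[of X'] that by (auto simp: T2_def)
            then show False using nS n that(1) by (simp add: S_def)
          qed
          have "(\<Sum>X\<in>T2. c X * m X) = c {p,q,r} * m {p,q,r} + (\<Sum>X\<in>T2 - {{p,q,r}}. c X * m X)"
            by (rule sum.remove[OF finT(2) X(1)])
          also have "(\<Sum>X\<in>T2 - {{p,q,r}}. c X * m X) = 0" using zero by (intro sum.neutral) auto
          finally have "c {p,q,r} * m {p,q,r} = 0" using bal[OF a(4)] unfolding c_def by simp
          moreover have "{p,q} \<in> {g \<in> Live. g \<subseteq> {p,q,r}}" using a(4) by auto
          then have "c {p,q,r} \<noteq> 0" using e12[OF X(1)] by (auto simp: c_def)
          ultimately show False using X(2) by simp
        qed
      qed
      then show False using X0 by (simp add: S_def T2_def T3_def)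
    qed
    moreover have "0 \<in> annihilator T2 (Q ` coord_space Live)" using subspace_annihilator subspace_0 by blast
    ultimately show ?thesis by blast
  qed
  then have "dim (Q ` coord_space Live) = card T2" using 2 by (simp add: dim_zero_set)
  then show ?thesis using 1 core_counts(2)[OF Ine] by linarith
qed

end

section \<open>Relations between lengths of skeleton edges\<close>

context regtri
begin

definition J :: "(plane set \<times> plane set) set" where
  "J = {(e, f). e \<in> Live \<and> f \<in> Live \<and> (\<exists>X\<in>T2. e \<subseteq> X \<and> f \<subseteq> X)}"

definition live_class :: "plane set \<Rightarrow> plane set set" where
  "live_class e = J\<^sup>* `` {e}"

definition live_classes :: "plane set set set" where
  "live_classes = Live // J\<^sup>*"

lemma live_classes_eq: "live_classes = live_class ` Live"
  by (auto simp: live_classes_def live_class_def quotient_def)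

lemma live_class_self: "e \<in> live_class e"
  by (simp add: live_class_def)

lemma live_class_eq: "f \<in> live_class e \<Longrightarrow> live_class f = live_class e"
proof -
  assume f: "f \<in> live_class e"
  have "sym (J\<^sup>*)" by (rule sym_rtrancl) (auto simp: J_def sym_def)
  then have "(f, e) \<in> J\<^sup>*" "(e, f) \<in> J\<^sup>*" using f by (auto simp: live_class_def sym_def)
  then show ?thesis unfolding live_class_def by (auto intro: rtrancl_trans)
qed

lemma live_class_sub: assumes "e \<in> Live" shows "live_class e \<subseteq> Live"
proof
  fix f assume "f \<in> live_class e"
  then have "(e, f) \<in> J\<^sup>*" by (simp add: live_class_def)
  then show "f \<in> Live" using assms by (induction rule: rtrancl_induct) (auto simp: J_def)
qed

lemma live_class_fiber: "L \<in> live_classes \<Longrightarrow> {e \<in> Live. live_class e = L} = L"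
proof -
  assume "L \<in> live_classes"
  then obtain f where f: "f \<in> Live" "L = live_class f" unfolding live_classes_eq by blast
  show ?thesis
  proof
    show "{e \<in> Live. live_class e = L} \<subseteq> L" using live_class_self by auto
    show "L \<subseteq> {e \<in> Live. live_class e = L}" using live_class_sub[OF f(1)] live_class_eq f(2) by blast
  qed
qed

lemma finLcls: "finite live_classes"
  unfolding live_classes_eq using finLive by simp

lemma YconstD:
  "d \<in> chain_const \<Longrightarrow> X \<in> T2 \<Longrightarrow> e \<in> Live \<Longrightarrow> f \<in> Live \<Longrightarrow> e \<subseteq> X \<Longrightarrow> f \<subseteq> X \<Longrightarrow>
    Poly_Mapping.lookup d e = Poly_Mapping.lookup d f"
  unfolding chain_const_def by blast

lemma live_class_chain_const:
  assumes d: "d \<in> chain_const" and f: "f \<in> live_class e"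
  shows "Poly_Mapping.lookup d f = Poly_Mapping.lookup d e"
proof -
  have "(e, f) \<in> J\<^sup>*" using f by (simp add: live_class_def)
  then show ?thesis
  proof (induction rule: rtrancl_induct)
    case (step y z)
    then obtain X where "X \<in> T2" "y \<in> Live" "z \<in> Live" "y \<subseteq> X" "z \<subseteq> X" by (auto simp: J_def)
    then show ?case using YconstD[OF d] step by metis
  qed simp
qed

section \<open>Sums over classes of concatenated edges\<close>

definition skel_lengths :: "(plane \<Rightarrow>\<^sub>0 real) \<Rightarrow> (plane set set \<Rightarrow>\<^sub>0 real)" where
  "skel_lengths f = restr live_classes (\<lambda>L. \<Sum>e\<in>L. elen (Poly_Mapping.lookup f) e)"

text \<open>The transpose of adding up edge lengths over the classes, which is what
  \<open>pairing_skel_lengths\<close> says.\<close>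

definition spread :: "(plane set set \<Rightarrow>\<^sub>0 real) \<Rightarrow> (plane set \<Rightarrow>\<^sub>0 real)" where
  "spread c = restr Eint (\<lambda>e. if e \<in> Live then Poly_Mapping.lookup c (live_class e) else 0)"

lemma linear_skel_lengths: "linear skel_lengths"
  unfolding skel_lengths_def by (intro linear_restr finLcls linear_compose_sum ballI linear_elen)

lemma linear_spread: "linear spread"
  unfolding spread_def by (intro linear_restr finEint linearI) (simp_all add: lookup_add)

lemma spread_image: "spread ` coord_space live_classes = chain_const"
proof
  show "spread ` coord_space live_classes \<subseteq> chain_const"
  proof
    fix d assume "d \<in> spread ` coord_space live_classes"
    then obtain c where c: "d = spread c" by blast
    have "d \<in> coord_space Live" using finEint by (simp add: c spread_def coord_space_iff)
    moreover have "Poly_Mapping.lookup d e = Poly_Mapping.lookup d f"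
      if "X \<in> T2" "e \<in> Live" "f \<in> Live" "e \<subseteq> X" "f \<subseteq> X" for X e f
    proof -
      have "(e, f) \<in> J" using that by (auto simp: J_def)
      then have "f \<in> live_class e" by (auto simp: live_class_def)
      then have "live_class f = live_class e" by (rule live_class_eq)
      moreover have "e \<in> Eint" "f \<in> Eint" using that Live_sub_Eint by auto
      ultimately show ?thesis using finEint that by (simp add: c spread_def)
    qed
    ultimately show "d \<in> chain_const" unfolding chain_const_def by blast
  qed
  show "chain_const \<subseteq> spread ` coord_space live_classes"
  proof
    fix d assume d: "d \<in> chain_const"
    define c where "c = restr live_classes (\<lambda>L. Poly_Mapping.lookup d (SOME e. e \<in> L))"
    have "d = spread c"
    proof (rule poly_mapping_eqI)
      fix e
      show "Poly_Mapping.lookup d e = Poly_Mapping.lookup (spread c) e"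
      proof (cases "e \<in> Live")
        case True
        have "(SOME f. f \<in> live_class e) \<in> live_class e" using live_class_self by (rule someI)
        then have "Poly_Mapping.lookup d (SOME f. f \<in> live_class e) = Poly_Mapping.lookup d e"
          by (rule live_class_chain_const[OF d])
        moreover have "live_class e \<in> live_classes" "e \<in> Eint" using True Live_sub_Eint by (auto simp: live_classes_eq)
        ultimately show ?thesis using True finLcls finEint by (simp add: spread_def c_def)
      next
        case False
        then show ?thesis using d finEint by (simp add: spread_def chain_const_def coord_space_iff)
      qed
    qed
    then show "d \<in> spread ` coord_space live_classes" using finLcls c_def by auto
  qed
qed

lemma spread_injective:
  assumes c: "c \<in> coord_space live_classes" "spread c = 0" shows "c = 0"
proof (rule poly_mapping_eqI)
  fix L
  show "Poly_Mapping.lookup c L = Poly_Mapping.lookup 0 L"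
  proof (cases "L \<in> live_classes")
    case True
    then obtain e where e: "e \<in> Live" "L = live_class e" unfolding live_classes_eq by blast
    have "e \<in> Eint" using e Live_sub_Eint by blast
    moreover have "Poly_Mapping.lookup (spread c) e = 0" using c(2) by simp
    ultimately show ?thesis using e finEint by (simp add: spread_def)
  qed (use c in \<open>simp add: coord_space_iff\<close>)
qed

lemma pairing_skel_lengths: "pairing live_classes (skel_lengths f) c = pairing Eint (length_map f) (spread c)"
proof -
  define x where "x e = elen (Poly_Mapping.lookup f) e" for e
  have "pairing live_classes (skel_lengths f) c = (\<Sum>L\<in>live_classes. (\<Sum>e\<in>L. x e) * Poly_Mapping.lookup c L)"
    using finLcls by (simp add: pairing_def skel_lengths_def x_def)
  also have "\<dots> = (\<Sum>L\<in>live_classes. \<Sum>e\<in>{e \<in> Live. live_class e = L}. x e * Poly_Mapping.lookup c (live_class e))"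
  proof (rule sum.cong[OF refl])
    fix L assume L: "L \<in> live_classes"
    have "(\<Sum>e\<in>{e \<in> Live. live_class e = L}. x e * Poly_Mapping.lookup c (live_class e)) = (\<Sum>e\<in>{e \<in> Live. live_class e = L}. x e * Poly_Mapping.lookup c L)"
      by (rule sum.cong) auto
    then show "(\<Sum>e\<in>L. x e) * Poly_Mapping.lookup c L = (\<Sum>e\<in>{e \<in> Live. live_class e = L}. x e * Poly_Mapping.lookup c (live_class e))"
      unfolding live_class_fiber[OF L] by (simp add: sum_distrib_right)
  qed
  also have "\<dots> = (\<Sum>e\<in>Live. x e * Poly_Mapping.lookup c (live_class e))"
    by (rule sum.group[OF finLive finLcls]) (simp add: live_classes_eq)
  also have "\<dots> = (\<Sum>e\<in>Eint. x e * (if e \<in> Live then Poly_Mapping.lookup c (live_class e) else 0))"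
    using Live_sub_Eint finEint by (intro sum.mono_neutral_cong_left) auto
  also have "\<dots> = pairing Eint (length_map f) (spread c)"
    using finEint by (simp add: pairing_def length_map_def spread_def x_def)
  finally show ?thesis .
qed

text \<open>The coefficient vectors at \<open>p\<close> for which the pruned edges opposite to \<open>p\<close> impose no obstruction:
  across a triangle \<open>pab\<close> with \<open>ab\<close> pruned, the edges \<open>pa\<close> and \<open>pb\<close> are concatenated and hence must get
  the same coefficient.\<close>

definition chain_dirs :: "plane \<Rightarrow> plane set" where
  "chain_dirs p = {v. \<forall>a b. {p,a,b} \<in> TV \<longrightarrow> a \<notin> I \<longrightarrow> b \<notin> I \<longrightarrow> {a,b} \<notin> Live \<longrightarrow> v \<bullet> (a - b) = 0}"

lemma subspace_chain_dirs: "subspace (chain_dirs p)"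
  unfolding chain_dirs_def subspace_def by (auto simp: inner_add_left)

text \<open>In a triangle \<open>pab\<close> whose dead edge is \<open>ab\<close>, neither
  \<open>a\<close> nor \<open>b\<close> is interior, so only \<open>l p\<close> enters the
  coefficients of \<open>pa\<close> and \<open>pb\<close>, and they agree iff \<open>l p\<close> is
  orthogonal to \<open>a - b\<close>. For the same reason dead edges get coefficient 0.\<close>

lemma strain_map_chain_const_iff:
  assumes l: "l \<in> coord_space I"
  shows "strain_map l \<in> chain_const \<longleftrightarrow> (\<forall>p\<in>I. Poly_Mapping.lookup l p \<in> chain_dirs p)"
proof -
  define L where "L = Poly_Mapping.lookup l"
  have L0: "L p = 0" if "p \<notin> I" for p using l that by (simp add: coord_space_iff L_def)
  have val: "Poly_Mapping.lookup (strain_map l) e = strain L e" if "e \<in> Live" for e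
    using that Live_sub_Eint finEint by (auto simp: strain_map_def L_def)
  have at: "strain L {p,a} = L p \<bullet> (a - p)" if "a \<notin> I" "p \<noteq> a" for p a
    using strain_pair[OF that(2)] L0[OF that(1)] by simp
  have off: "Poly_Mapping.lookup (strain_map l) e = 0" if e: "e \<notin> Live" for e
  proof (cases "e \<in> Eint")
    case True
    obtain p q where pq: "e = {p,q}" "p \<noteq> q" "edg p q" using Eint_memE[OF True] .
    have "p \<notin> I" "q \<notin> I" using dead_cases[OF pq(3)] e pq by auto
    then show ?thesis using True finEint pq strain_pair[OF pq(2), of L] L0 by (simp add: strain_map_def L_def)
  qed (use finEint in \<open>simp add: strain_map_def\<close>)
  show ?thesis
  proof
    assume Y: "strain_map l \<in> chain_const"
    show "\<forall>p\<in>I. Poly_Mapping.lookup l p \<in> chain_dirs p"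
      unfolding chain_dirs_def
    proof (intro ballI CollectI allI impI)
      fix p a b assume p: "p \<in> I" and T: "{p,a,b} \<in> TV" and ab: "a \<notin> I" "b \<notin> I" "{a,b} \<notin> Live"
      have E: "edg p a" "edg p b" using tri_edg[OF T] by auto
      have lv: "{p,a} \<in> Live" "{p,b} \<in> Live" unfolding Live_iff live_pair_def using p E by auto
      have d: "p \<noteq> a" "p \<noteq> b" "a \<noteq> b" using tri_distinct[OF T] by auto
      have "{e \<in> Live. e \<subseteq> {p,a,b}} = {{p,a},{p,b}}" unfolding live_in_tri[OF T] using lv ab by auto
      then have "live_count {p,a,b} = 2" unfolding live_count_def using d by (simp add: doubleton_eq_iff)
      then have "{p,a,b} \<in> T2" using T by (simp add: T2_def)
      then have "Poly_Mapping.lookup (strain_map l) {p,a} = Poly_Mapping.lookup (strain_map l) {p,b}"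
        by (rule YconstD[OF Y _ lv]) auto
      then have "L p \<bullet> (a - p) = L p \<bullet> (b - p)" using val lv at ab d by simp
      then show "Poly_Mapping.lookup l p \<bullet> (a - b) = 0" by (simp add: L_def inner_diff_right)
    qed
  next
    assume W: "\<forall>p\<in>I. Poly_Mapping.lookup l p \<in> chain_dirs p"
    have "Poly_Mapping.lookup (strain_map l) e = Poly_Mapping.lookup (strain_map l) f"
      if X: "X \<in> T2" "e \<in> Live" "f \<in> Live" "e \<subseteq> X" "f \<subseteq> X" for X e f
    proof (cases "e = f")
      case False
      have XT: "X \<in> TV" "live_count X = 2" using X by (auto simp: T2_def)
      obtain x y where xy: "e = {x,y}" "x \<noteq> y" "edg x y" using Eint_memE X(2) Live_sub_Eint by blast
      obtain x' y' where xy': "f = {x',y'}" "x' \<noteq> y'" "edg x' y'" using Eint_memE X(3) Live_sub_Eint by blast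
      obtain p q r where pqr: "X = {p,q,r}" using TV_tri[OF XT(1)] by blast
      have "\<exists>p a b. X = {p,a,b} \<and> e = {p,a} \<and> f = {p,b}"
      proof -
        have "e \<in> {{p,q},{q,r},{p,r}}" "f \<in> {{p,q},{q,r},{p,r}}"
          using live_in_tri[of p q r] X XT(1) unfolding pqr by blast+
        moreover have "{p,q,r} = {q,p,r}" "{p,q,r} = {r,p,q}" "{p,q} = {q,p}" "{q,r} = {r,q}" "{p,r} = {r,p}"
          "{p,q,r} = {q,r,p}" "{p,q,r} = {p,r,q}" "{p,q,r} = {r,q,p}" by auto
        ultimately show ?thesis using False unfolding pqr by (elim insertE emptyE; simp; metis)
      qed
      then obtain p a b where pab: "X = {p,a,b}" "e = {p,a}" "f = {p,b}" by blast
      have T: "{p,a,b} \<in> TV" using XT pab by simp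
      have d: "p \<noteq> a" "p \<noteq> b" "a \<noteq> b" using tri_distinct[OF T] by auto
      have E: "edg a b" using tri_edg[OF T] by auto
      have dead: "{a,b} \<notin> Live"
      proof
        assume "{a,b} \<in> Live"
        then have "{e \<in> Live. e \<subseteq> X} = {{p,a},{a,b},{p,b}}"
          unfolding pab(1) live_in_tri[OF T] using X(2,3) pab by auto
        then show False using XT(2) card_edges_in_tri[OF T] unfolding live_count_def by simp
      qed
      have ab: "a \<notin> I" "b \<notin> I" using dead_cases[OF E dead] by auto
      have v: "Poly_Mapping.lookup (strain_map l) e = L p \<bullet> (a - p)" "Poly_Mapping.lookup (strain_map l) f = L p \<bullet> (b - p)"
        using val X pab at ab d by simp_all
      show ?thesis
      proof (cases "p \<in> I")
        case True
        then have "L p \<bullet> (a - b) = 0" using W T ab dead unfolding chain_dirs_def L_def by blast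
        then show ?thesis using v by (simp add: inner_diff_right)
      qed (use v L0 in simp)
    qed simp
    moreover have "strain_map l \<in> coord_space Live" using off by (simp add: coord_space_iff)
    ultimately show "strain_map l \<in> chain_const" unfolding chain_const_def by blast
  qed
qed

text \<open>A relation between skeleton lengths, spread over the constituent edges, is a relation
  between edge lengths and hence comes from unique coefficient vectors. Those that arise form the
  product of the spaces \<open>chain_dirs p\<close>.\<close>

lemma dim_skel_lengths_image:
  assumes I2: "card I \<ge> 2"
  shows "dim (skel_lengths ` coord_space A) + (\<Sum>p\<in>I. dim (chain_dirs p)) + 3 = 3 * card I"
proof -
  obtain BI :: "(plane \<Rightarrow>\<^sub>0 plane) set" where BI: "finite BI" "coord_space I \<subseteq> span BI"
    using coord_space_finite_span[OF finI] by blast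
  obtain BL :: "(plane set set \<Rightarrow>\<^sub>0 real) set" where BL: "finite BL" "coord_space live_classes \<subseteq> span BL"
    using coord_space_finite_span[OF finLcls] by blast
  define Ann where "Ann = annihilator live_classes (skel_lengths ` coord_space A)"
  define K where "K = {l \<in> coord_space I. \<forall>p\<in>I. Poly_Mapping.lookup l p \<in> chain_dirs p}"
  have "card live_classes = dim (spread ` coord_space live_classes)"
    using dim_image_injective[OF subspace_coord_space BL linear_spread spread_injective] dim_coord_space_real[OF finLcls] by simp
  then have 1: "card live_classes + 3 = 3 * card I" using dim_chain_const[OF I2] spread_image by simp
  have 2: "dim (skel_lengths ` coord_space A) + dim Ann = card live_classes" unfolding Ann_def
    by (rule dim_annihilator[OF finLcls linear_subspace_image[OF linear_skel_lengths subspace_coord_space]])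
       (use finLcls in \<open>auto simp: skel_lengths_def\<close>)
  have mem: "c \<in> Ann \<longleftrightarrow> c \<in> coord_space live_classes \<and> spread c \<in> strain_map ` coord_space I" for c
  proof -
    have "c \<in> Ann \<longleftrightarrow> c \<in> coord_space live_classes \<and> (\<forall>f\<in>coord_space A. pairing Eint (length_map f) (spread c) = 0)"
      by (auto simp: Ann_def annihilator_def pairing_skel_lengths)
    also have "\<dots> \<longleftrightarrow> c \<in> coord_space live_classes \<and> spread c \<in> annihilator Eint (length_map ` coord_space A)"
      using finEint by (auto simp: annihilator_def spread_def)
    finally show ?thesis unfolding annihilator_length_map .
  qed
  have "spread ` Ann = strain_map ` K"
  proof
    show "spread ` Ann \<subseteq> strain_map ` K"
    proof
      fix d assume "d \<in> spread ` Ann"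
      then obtain c where c: "c \<in> coord_space live_classes" "d = spread c" "d \<in> strain_map ` coord_space I" using mem by blast
      then obtain l where l: "l \<in> coord_space I" "d = strain_map l" by blast
      have "strain_map l \<in> chain_const" using c(1) unfolding l(2)[symmetric] c(2) spread_image[symmetric] by (rule imageI)
      then show "d \<in> strain_map ` K" using l strain_map_chain_const_iff[OF l(1)] unfolding K_def by blast
    qed
    show "strain_map ` K \<subseteq> spread ` Ann"
    proof
      fix d assume "d \<in> strain_map ` K"
      then obtain l where l: "l \<in> coord_space I" "d = strain_map l" "\<forall>p\<in>I. Poly_Mapping.lookup l p \<in> chain_dirs p"
        unfolding K_def by blast
      then have "d \<in> chain_const" using strain_map_chain_const_iff by blast
      then have "d \<in> spread ` coord_space live_classes" using spread_image by simp
      then obtain c where "c \<in> coord_space live_classes" "d = spread c" by blast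
      then show "d \<in> spread ` Ann" using mem l by blast
    qed
  qed
  moreover have "dim (spread ` Ann) = dim Ann"
  proof (rule dim_image_injective[OF _ BL(1) _ linear_spread])
    show "subspace Ann" unfolding Ann_def by (rule subspace_annihilator)
    have "Ann \<subseteq> coord_space live_classes" using mem by blast
    then show "Ann \<subseteq> span BL" using BL(2) by blast
    show "c = 0" if "c \<in> Ann" "spread c = 0" for c using that mem spread_injective by blast
  qed
  moreover have "subspace K"
    using subspace_coord_space[of I] subspace_chain_dirs unfolding K_def by (auto simp: subspace_def lookup_add)
  then have "dim (strain_map ` K) = dim K"
    by (rule dim_image_injective[OF _ BI(1) _ linear_strain_map]) (use BI strain_map_injective in \<open>auto simp: K_def\<close>)
  moreover have "dim K = (\<Sum>p\<in>I. dim (chain_dirs p))"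
    unfolding K_def by (rule dim_coord_family[OF finI subspace_chain_dirs])
  ultimately show ?thesis using 1 2 by simp
qed

end

section \<open>Radial edges\<close>

lemma cr_plucker: "cr a b * (h \<bullet> r) = cr a r * (h \<bullet> b) + cr r b * (h \<bullet> a)"
  by (simp add: cr_def inner_plane algebra_simps)

lemma cr_plucker4: "cr c x * cr y z - cr c y * cr x z + cr c z * cr x y = 0"
  by (simp add: cr_def algebra_simps)

context regtri
begin

abbreviation K :: "plane set" where "K \<equiv> convex hull I"

definition radial_nbrs :: "plane \<Rightarrow> plane set" where
  "radial_nbrs p = {a. edg p a \<and> a \<notin> I \<and> closed_segment p a \<inter> K = {p}}"



text \<open>The ray from \<open>p\<close> through \<open>x\<close> meets \<open>K\<close> again. In
  contrast to the intersection with a segment, this depends on the direction of \<open>x\<close>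
  alone, which permits arguments by angle.\<close>

definition enters :: "plane \<Rightarrow> plane \<Rightarrow> bool" where
  "enters p x \<longleftrightarrow> (\<exists>s>0. p + s *\<^sub>R (x - p) \<in> K)"

lemma I_K: "p \<in> I \<Longrightarrow> p \<in> K"
  by (rule hull_inc)

lemma K_segment:
  assumes "p \<in> K" "p + s *\<^sub>R y \<in> K" "0 \<le> t" "t \<le> s"
  shows "p + t *\<^sub>R y \<in> K"
proof (cases "s = 0")
  case False
  have "p + t *\<^sub>R y = (1 - t / s) *\<^sub>R p + (t / s) *\<^sub>R (p + s *\<^sub>R y)"
    using False by (simp add: scaleR_diff_left scaleR_add_right)
  also have "\<dots> \<in> K" using assms False
    by (intro convexD[OF convex_convex_hull]) (auto simp: divide_le_eq_1)
  finally show ?thesis .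
qed (use assms in auto)

lemma radial_nbrs_iff:
  assumes p: "p \<in> I" shows "a \<in> radial_nbrs p \<longleftrightarrow> edg p a \<and> \<not> enters p a"
proof
  assume a: "a \<in> radial_nbrs p"
  have "\<not> enters p a"
  proof
    assume "enters p a"
    then obtain s where s: "s > 0" "p + s *\<^sub>R (a - p) \<in> K" unfolding enters_def by blast
    define t where "t = min s 1"
    have t: "0 < t" "t \<le> 1" "t \<le> s" using s by (auto simp: t_def)
    have "p + t *\<^sub>R (a - p) \<in> K" using K_segment[OF I_K[OF p] s(2), of t] t by simp
    moreover have "p + t *\<^sub>R (a - p) = (1 - t) *\<^sub>R p + t *\<^sub>R a" by (simp add: scaleR_diff_left scaleR_diff_right)
    then have "p + t *\<^sub>R (a - p) \<in> closed_segment p a" unfolding closed_segment_def mem_Collect_eq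
      using t by (intro exI[of _ t]) auto
    ultimately have "p + t *\<^sub>R (a - p) = p" using a unfolding radial_nbrs_def by blast
    then have "a = p" using t by simp
    then show False using a p by (simp add: radial_nbrs_def)
  qed
  then show "edg p a \<and> \<not> enters p a" using a by (simp add: radial_nbrs_def)
next
  assume a: "edg p a \<and> \<not> enters p a"
  have "a \<notin> I"
  proof
    assume "a \<in> I"
    then have "p + 1 *\<^sub>R (a - p) \<in> K" using I_K by simp
    then show False using a unfolding enters_def by (metis zero_less_one)
  qed
  moreover have "closed_segment p a \<inter> K = {p}"
  proof
    show "closed_segment p a \<inter> K \<subseteq> {p}"
    proof
      fix z assume z: "z \<in> closed_segment p a \<inter> K"
      then obtain u where u: "0 \<le> u" "z = (1 - u) *\<^sub>R p + u *\<^sub>R a" unfolding closed_segment_def by blast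
      then have z2: "z = p + u *\<^sub>R (a - p)" by (simp add: scaleR_diff_left scaleR_diff_right)
      have "u = 0" using a z z2 u(1) unfolding enters_def by (metis IntE less_le)
      then show "z \<in> {p}" using z2 by simp
    qed
  qed (use I_K[OF p] in auto)
  ultimately show "a \<in> radial_nbrs p" using a by (simp add: radial_nbrs_def)
qed

lemma enters_cone:
  assumes p: "p \<in> I" and b: "enters p b" and c0: "c0 \<in> K"
    and a: "a - p = \<alpha> *\<^sub>R (c0 - p) + \<beta> *\<^sub>R (b - p)" "\<alpha> \<ge> 0" "\<beta> \<ge> 0"
  shows "enters p a"
proof -
  obtain s where s: "s > 0" "p + s *\<^sub>R (b - p) \<in> K" using b unfolding enters_def by blast
  \<comment> \<open>Normalises the weights \<open>t\<close>, \<open>t * \<alpha>\<close>,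
    \<open>t * (\<beta> / s)\<close> of \<open>p\<close>, \<open>c0\<close> and the point of
    \<open>K\<close> on the ray to \<open>b\<close> to the sum 1.\<close>
  define t where "t = 1 / (1 + \<alpha> + \<beta> / s)"
  have D: "1 + \<alpha> + \<beta> / s > 0" using a s by (simp add: add_pos_nonneg)
  have t: "t > 0" using D by (simp add: t_def)
  have "t * (1 + \<alpha> + \<beta> / s) = 1" using D by (simp add: t_def)
  then have sum: "t + t * \<alpha> + t * (\<beta> / s) = 1" by (simp add: distrib_left)
  have "p + t *\<^sub>R (a - p) = t *\<^sub>R p + (t * \<alpha>) *\<^sub>R c0 + (t * (\<beta> / s)) *\<^sub>R (p + s *\<^sub>R (b - p))"
  proof -
    have t1: "t = 1 - t * \<alpha> - t * (\<beta> / s)" using sum by simp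
    have "t *\<^sub>R p + (t * \<alpha>) *\<^sub>R c0 + (t * (\<beta> / s)) *\<^sub>R (p + s *\<^sub>R (b - p))
      = (1 - t * \<alpha> - t * (\<beta> / s)) *\<^sub>R p + (t * \<alpha>) *\<^sub>R c0 + (t * (\<beta> / s)) *\<^sub>R (p + s *\<^sub>R (b - p))"
      by (simp only: t1[symmetric])
    also have "\<dots> = p + t *\<^sub>R (\<alpha> *\<^sub>R (c0 - p) + \<beta> *\<^sub>R (b - p))"
      using s(1) by (simp add: scaleR_diff_left scaleR_diff_right scaleR_add_right)
    finally show ?thesis using a(1) by simp
  qed
  also have "\<dots> \<in> K"
  proof -
    have "{p, c0, p + s *\<^sub>R (b - p)} \<subseteq> K" using I_K[OF p] c0 s by auto
    then have "convex hull {p, c0, p + s *\<^sub>R (b - p)} \<subseteq> K" by (intro hull_minimal convex_convex_hull)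
    moreover have "t *\<^sub>R p + (t * \<alpha>) *\<^sub>R c0 + (t * (\<beta> / s)) *\<^sub>R (p + s *\<^sub>R (b - p)) \<in> convex hull {p, c0, p + s *\<^sub>R (b - p)}"
      unfolding convex_hull_3 mem_Collect_eq using t a s sum
      by (intro exI[of _ t] exI[of _ "t * \<alpha>"] exI[of _ "t * (\<beta> / s)"]) auto
    ultimately show ?thesis by blast
  qed
  finally show ?thesis using t unfolding enters_def by blast
qed

lemma enters_between:
  assumes p: "p \<in> I" and b: "enters p b" and c0: "c0 \<in> K"
    and e: "\<epsilon> * cr (c0 - p) (b - p) > 0" "\<epsilon> * cr (a - p) (b - p) \<ge> 0" "\<epsilon> * cr (c0 - p) (a - p) \<ge> 0"
  shows "enters p a"
proof (rule enters_cone[OF p b c0])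
  define D where "D = cr (c0 - p) (b - p)"
  have D: "D \<noteq> 0" using e(1) by (auto simp: D_def)
  have "D *\<^sub>R (a - p) = cr (a - p) (b - p) *\<^sub>R (c0 - p) + cr (c0 - p) (a - p) *\<^sub>R (b - p)"
    unfolding D_def by (rule cr_cramer)
  then have "(1 / D) *\<^sub>R (D *\<^sub>R (a - p)) = (1 / D) *\<^sub>R (cr (a - p) (b - p) *\<^sub>R (c0 - p) + cr (c0 - p) (a - p) *\<^sub>R (b - p))"
    by simp
  then show "a - p = (cr (a - p) (b - p) / D) *\<^sub>R (c0 - p) + (cr (c0 - p) (a - p) / D) *\<^sub>R (b - p)"
    using D by (simp add: scaleR_add_right)
  have "x / D \<ge> 0" if "\<epsilon> * x \<ge> 0" for x
  proof -
    have "(\<epsilon> * x) / (\<epsilon> * D) \<ge> 0" by (rule divide_nonneg_pos) (use that e(1) D_def in simp_all)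
    moreover have "\<epsilon> \<noteq> 0" using e(1) by auto
    ultimately show ?thesis by simp
  qed
  then show "cr (a - p) (b - p) / D \<ge> 0" "cr (c0 - p) (a - p) / D \<ge> 0" using e by auto
qed

text \<open>By unimodularity \<open>p\<close> has lattice distance exactly 1 from the dead edge
  \<open>ab\<close>. All interior lattice points are on the same side at distance at least 1, so the
  parallel to \<open>ab\<close> through \<open>p\<close> supports \<open>K\<close>; \<open>h\<close>
  is its normal.\<close>

lemma dead_tri_form:
  assumes T: "{p,a,b} \<in> TV" and p: "p \<in> I" and d: "{a,b} \<notin> Live"
  obtains h where "h \<bullet> (a - p) = -1" "h \<bullet> (b - p) = -1" "\<And>x. x \<in> K \<Longrightarrow> h \<bullet> (x - p) \<ge> 0" "h \<noteq> 0"
proof -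
  have E: "edg a b" using tri_edg[OF T] by auto
  note dc = dead_cases[OF E d]
  have T2: "{a,b,p} \<in> TV" using T by (simp add: insert_commute)
  define \<epsilon> where "\<epsilon> = cr (b - a) (p - a)"
  have eps: "\<epsilon> = 1 \<or> \<epsilon> = -1" using TV_unit[OF T2] by (simp add: \<epsilon>_def)
  define h where "h = \<epsilon> *\<^sub>R rot (b - a)"
  have hx: "h \<bullet> (x - p) = \<epsilon> * cr (b - a) (x - a) - 1" for x
  proof -
    have "h \<bullet> (x - p) = \<epsilon> * cr (b - a) (x - p)" by (simp only: h_def inner_scaleR_left rot_inner)
    moreover have "cr (b - a) (x - p) = cr (b - a) (x - a) - \<epsilon>" by (simp add: \<epsilon>_def cr_def algebra_simps)
    ultimately show ?thesis using eps by auto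
  qed
  have pos: "\<epsilon> * cr (b - a) (i - a) \<ge> 1" if i: "i \<in> I" for i
  proof -
    have A3: "a \<in> lattice_points" "b \<in> lattice_points" "i \<in> lattice_points"
      using edg_A[OF E] i I_sub latA by auto
    have "cr (b - a) (i - a) \<in> \<int>" using A3 by (intro cr_lattice lattice_diff)
    moreover have "\<epsilon> * cr (b - a) (i - a) > 0" using dc(3) i p eps by (auto simp: \<epsilon>_def)
    ultimately show ?thesis using eps by (auto elim!: Ints_cases)
  qed
  have "K \<subseteq> {x. h \<bullet> x \<ge> h \<bullet> p}"
  proof (rule hull_minimal)
    show "I \<subseteq> {x. h \<bullet> x \<ge> h \<bullet> p}"
    proof
      fix i assume "i \<in> I"
      then have "h \<bullet> (i - p) \<ge> 0" using pos[of i] hx[of i] by linarith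
      then show "i \<in> {x. h \<bullet> x \<ge> h \<bullet> p}" by (simp add: inner_diff_right)
    qed
    show "convex {x. h \<bullet> x \<ge> h \<bullet> p}" by (rule convex_halfspace_ge)
  qed
  then have K0: "h \<bullet> (x - p) \<ge> 0" if "x \<in> K" for x using that by (auto simp: inner_diff_right)
  have ha: "h \<bullet> (a - p) = -1" "h \<bullet> (b - p) = -1" using hx by simp_all
  then have "h \<noteq> 0" by auto
  then show ?thesis using that ha K0 by blast
qed

lemma dead_tri_radial:
  assumes T: "{p,a,b} \<in> TV" and p: "p \<in> I" and d: "{a,b} \<notin> Live"
  shows "a \<in> radial_nbrs p" "b \<in> radial_nbrs p"
proof -
  obtain h where h: "h \<bullet> (a - p) = -1" "h \<bullet> (b - p) = -1" "\<And>x. x \<in> K \<Longrightarrow> h \<bullet> (x - p) \<ge> 0"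
    using dead_tri_form[OF assms] by metis
  have "\<not> enters p x" if "h \<bullet> (x - p) = -1" for x
  proof
    assume "enters p x"
    then obtain s where "s > 0" "p + s *\<^sub>R (x - p) \<in> K" unfolding enters_def by blast
    then show False using h(3)[of "p + s *\<^sub>R (x - p)"] that by simp
  qed
  then show "a \<in> radial_nbrs p" "b \<in> radial_nbrs p" using radial_nbrs_iff[OF p] h tri_edg[OF T] by auto
qed

text \<open>A dead edge opposite to \<open>p\<close> would give a line through \<open>p\<close> that
  supports \<open>K\<close>, so no condition arises.\<close>

lemma chain_dirs_interior:
  assumes p: "p \<in> I" "p \<in> interior K" shows "chain_dirs p = UNIV"
proof -
  have False if T: "{p,a,b} \<in> TV" "{a,b} \<notin> Live" for a b
  proof -
    obtain h where h: "\<And>x. x \<in> K \<Longrightarrow> h \<bullet> (x - p) \<ge> 0" "h \<noteq> 0"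
      using dead_tri_form[OF T(1) p(1) T(2)] by blast
    obtain e where e: "e > 0" "cball p e \<subseteq> K" using p(2) mem_interior_cball by blast
    define x where "x = p - (e / norm h) *\<^sub>R h"
    have "x \<in> cball p e" using e h by (simp add: x_def dist_norm)
    then have "h \<bullet> (x - p) \<ge> 0" using e h by blast
    moreover have "h \<bullet> (x - p) = - (e / norm h) * (h \<bullet> h)" by (simp add: x_def)
    moreover have "(e / norm h) * (h \<bullet> h) > 0" using e h by simp
    ultimately show False by simp
  qed
  then show ?thesis unfolding chain_dirs_def by blast
qed

text \<open>If \<open>ab\<close> were live, an interior lattice point would lie across
  \<open>ab\<close> from \<open>p\<close>. By \<open>chord_cross\<close> the segment from
  \<open>p\<close> to it passes through the segment \<open>ab\<close>, so a ray through a point of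
  \<open>ab\<close> would enter \<open>K\<close>.\<close>

lemma tri_dead_if_avoids:
  assumes T: "{p,a,b} \<in> TV" and p: "p \<in> I" and ab: "a \<in> radial_nbrs p" "b \<in> radial_nbrs p"
    and av: "\<And>t. 0 \<le> t \<Longrightarrow> t \<le> 1 \<Longrightarrow> \<not> enters p ((1 - t) *\<^sub>R a + t *\<^sub>R b)"
  shows "{a,b} \<notin> Live"
proof
  assume l: "{a,b} \<in> Live"
  have nI: "a \<notin> I" "b \<notin> I" using ab by (auto simp: radial_nbrs_def)
  obtain i0 j0 where ij: "i0 \<in> I" "j0 \<in> I" "cr (b - a) (i0 - a) > 0" "cr (b - a) (j0 - a) < 0"
    using l nI unfolding Live_iff live_pair_def by blast
  have T2: "{a,b,p} \<in> TV" using T by (simp add: insert_commute)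
  have pu: "cr (b - a) (p - a) = 1 \<or> cr (b - a) (p - a) = -1" by (rule TV_unit[OF T2])
  have A2: "a \<in> A" "b \<in> A" "p \<in> A" using TV_sub[OF T] by auto
  have fin: False if i: "i \<in> I" and t: "0 \<le> t" "t \<le> 1" and x: "x > 0" "y > 0"
    and eq: "y *\<^sub>R (p - a) + x *\<^sub>R (i - a) = ((x + y) * t) *\<^sub>R (b - a)" for i t x y
  proof -
    have iA: "i \<in> K" using I_K[OF i] .
    \<comment> \<open>The fraction of the way from \<open>p\<close> to \<open>i\<close> at which
      \<open>ab\<close> is crossed.\<close>
    define s where "s = x / (x + y)"
    have s: "s > 0" "(x + y) * s = x" using x by (auto simp: s_def)
    have "(x + y) *\<^sub>R (p + s *\<^sub>R (i - p) - a) = y *\<^sub>R (p - a) + x *\<^sub>R (i - a)"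
    proof -
      have "(x + y) *\<^sub>R (p + s *\<^sub>R (i - p) - a) = (x + y) *\<^sub>R (p - a) + ((x + y) * s) *\<^sub>R (i - p)"
        by (simp add: scaleR_add_right scaleR_diff_right)
      then show ?thesis unfolding s(2) by (simp add: scaleR_add_left scaleR_diff_right)
    qed
    also have "\<dots> = (x + y) *\<^sub>R (t *\<^sub>R (b - a))" using eq by simp
    finally have E: "(x + y) *\<^sub>R (p + s *\<^sub>R (i - p) - a) = (x + y) *\<^sub>R (t *\<^sub>R (b - a))" .
    have "p + s *\<^sub>R (i - p) - a = t *\<^sub>R (b - a)" by (rule scaleR_left_imp_eq[OF _ E]) (use x in simp)
    then have z: "p + s *\<^sub>R (i - p) = (1 - t) *\<^sub>R a + t *\<^sub>R b"
      by (simp add: diff_eq_eq scaleR_diff_left scaleR_diff_right)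
    have "s \<le> 1" using x by (simp add: s_def)
    then have "p + s *\<^sub>R (i - p) \<in> K" using K_segment[of p 1 "i - p" s] I_K[OF p] iA s by simp
    then have "p + 1 *\<^sub>R (((1 - t) *\<^sub>R a + t *\<^sub>R b) - p) \<in> K" unfolding z by simp
    then have "enters p ((1 - t) *\<^sub>R a + t *\<^sub>R b)" unfolding enters_def by (metis zero_less_one)
    then show False using av t by blast
  qed
  show False using pu
  proof
    assume pp: "cr (b - a) (p - a) = 1"
    define cj where "cj = - cr (b - a) (j0 - a)"
    have cj: "cj > 0" using ij by (simp add: cj_def)
    obtain t where "0 \<le> t" "t \<le> 1" "cj *\<^sub>R (p - a) + 1 *\<^sub>R (j0 - a) = ((1 + cj) * t) *\<^sub>R (b - a)"
      by (rule chord_cross[OF A2(1,2) nI A2(3), of j0 1 cj]) (use ij pp cj I_sub in \<open>auto simp: cj_def\<close>)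
    then show False using fin[OF ij(2), of t 1 cj] cj by simp
  next
    assume pp: "cr (b - a) (p - a) = -1"
    define ci where "ci = cr (b - a) (i0 - a)"
    have ci: "ci > 0" using ij by (simp add: ci_def)
    obtain t where "0 \<le> t" "t \<le> 1" "1 *\<^sub>R (i0 - a) + ci *\<^sub>R (p - a) = ((ci + 1) * t) *\<^sub>R (b - a)"
      by (rule chord_cross[OF A2(1,2) nI _ A2(3), of i0 ci 1]) (use ij pp ci I_sub in \<open>auto simp: ci_def\<close>)
    then show False using fin[OF ij(1), of t 1 ci] ci by (simp add: add.commute)
  qed
qed

text \<open>The line through \<open>p\<close> and \<open>c0\<close> cuts the neighbours of
  \<open>p\<close> into two halves. Turning away from \<open>c0\<close>, a ray that follows one
  outside \<open>K\<close> does not enter \<open>K\<close> either, or else the earlier ray would lie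
  between it and \<open>c0\<close>. So all neighbours from \<open>a\<close> to the last one,
  \<open>e\<close>, are radial, consecutive ones span dead edges, and \<open>v\<close> has the same
  product with all of them. The induction is on the number of neighbours after
  \<open>a\<close>.\<close>

lemma fan_half:
  assumes p: "p \<in> I" and c0: "c0 \<in> K" and eps: "\<epsilon> = 1 \<or> \<epsilon> = -1" and v: "v \<in> chain_dirs p"
  defines "N \<equiv> {q. edg p q \<and> \<epsilon> * cr (c0 - p) (q - p) > 0}"
  assumes e: "e \<in> N" "\<And>u. u \<in> N \<Longrightarrow> u \<noteq> e \<Longrightarrow> \<epsilon> * cr (u - p) (e - p) > 0"
  assumes a: "a \<in> N" "a \<in> radial_nbrs p"
  shows "e \<in> radial_nbrs p \<and> v \<bullet> a = v \<bullet> e"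
  using a
proof (induction "card {b \<in> N. \<epsilon> * cr (a - p) (b - p) > 0}" arbitrary: a rule: less_induct)
  case (less a)
  have finN: "finite N" unfolding N_def by (rule finite_subset[OF _ fin_nbr[of p]]) (auto simp: nbr_def)
  define h where "h = \<epsilon> *\<^sub>R rot (c0 - p)"
  have h: "h \<bullet> x = \<epsilon> * cr (c0 - p) x" for x by (simp add: h_def rot_inner)
  have Nh: "q \<in> N \<longleftrightarrow> edg p q \<and> h \<bullet> (q - p) > 0" for q by (simp add: N_def h)
  show ?case
  proof (cases "a = e")
    case False
    then have ae: "\<epsilon> * cr (a - p) (e - p) > 0" using e(2) less by blast
    obtain r where r: "{p,a,r} \<in> TV" "\<epsilon> * cr (a - p) (r - p) > 0" "h \<bullet> (r - p) > 0"
      by (rule next_edge[of p a e \<epsilon> h]) (use less e ae eps in \<open>auto simp: Nh\<close>)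
    have rN: "r \<in> N" using r tri_edg[OF r(1)] by (simp add: Nh)
    have na: "\<not> enters p a" using less radial_nbrs_iff[OF p] by blast
    have hpos: "\<epsilon> * cr (c0 - p) (a - p) > 0" "\<epsilon> * cr (c0 - p) (r - p) > 0" using less(2) rN by (auto simp: N_def)
    have "\<not> enters p r"
    proof
      assume "enters p r"
      then have "enters p a" by (rule enters_between[OF p _ c0, of r \<epsilon>]) (use hpos r in auto)
      then show False using na by simp
    qed
    then have rR: "r \<in> radial_nbrs p" using rN radial_nbrs_iff[OF p] by (auto simp: N_def)
    have "{a,r} \<notin> Live"
    proof (rule tri_dead_if_avoids[OF r(1) p less(3) rR])
      fix t :: real assume t: "0 \<le> t" "t \<le> 1"
      define z where "z = (1 - t) *\<^sub>R a + t *\<^sub>R r"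
      have zp: "z - p = (1 - t) *\<^sub>R (a - p) + t *\<^sub>R (r - p)"
        by (simp add: z_def scaleR_diff_left scaleR_diff_right)
      have "\<epsilon> * cr (c0 - p) (z - p) = (1 - t) * (\<epsilon> * cr (c0 - p) (a - p)) + t * (\<epsilon> * cr (c0 - p) (r - p))"
        unfolding zp by (simp only: cr_add cr_scale) (simp add: algebra_simps)
      also have "\<dots> > 0"
        using t hpos by (cases "t = 0") (auto intro!: add_nonneg_pos)
      finally have z1: "\<epsilon> * cr (c0 - p) (z - p) > 0" .
      have "\<epsilon> * cr (a - p) (z - p) = t * (\<epsilon> * cr (a - p) (r - p))" unfolding zp by (simp add: cr_add)
      moreover have "t * (\<epsilon> * cr (a - p) (r - p)) \<ge> 0" using t(1) less_imp_le[OF r(2)] by (rule mult_nonneg_nonneg)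
      ultimately have z2: "\<epsilon> * cr (a - p) (z - p) \<ge> 0" by linarith
      show "\<not> enters p ((1 - t) *\<^sub>R a + t *\<^sub>R r)"
        unfolding z_def[symmetric] using enters_between[OF p _ c0 z1 z2] hpos na by auto
    qed
    moreover have "a \<notin> I" "r \<notin> I" using less rR by (auto simp: radial_nbrs_def)
    ultimately have "v \<bullet> (a - r) = 0" using v r(1) unfolding chain_dirs_def by blast
    then have var: "v \<bullet> a = v \<bullet> r" by (simp add: inner_diff_right)
    have "{b \<in> N. \<epsilon> * cr (r - p) (b - p) > 0} \<subset> {b \<in> N. \<epsilon> * cr (a - p) (b - p) > 0}"
    proof
      show "{b \<in> N. \<epsilon> * cr (r - p) (b - p) > 0} \<subseteq> {b \<in> N. \<epsilon> * cr (a - p) (b - p) > 0}"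
      proof
        fix b assume b: "b \<in> {b \<in> N. \<epsilon> * cr (r - p) (b - p) > 0}"
        have "(\<epsilon> * cr (a - p) (b - p)) * (h \<bullet> (r - p)) = (\<epsilon> * cr (a - p) (r - p)) * (h \<bullet> (b - p)) + (\<epsilon> * cr (r - p) (b - p)) * (h \<bullet> (a - p))"
          using arg_cong[OF cr_plucker[of "a - p" "b - p" h "r - p"], of "\<lambda>x. \<epsilon> * x"] by (simp add: distrib_left mult.assoc)
        also have "\<dots> > 0"
          by (rule add_pos_pos[OF mult_pos_pos mult_pos_pos]) (use b r less(2) in \<open>simp_all add: Nh\<close>)
        finally have "\<epsilon> * cr (a - p) (b - p) > 0" using r(3) zero_less_mult_pos2 by blast
        then show "b \<in> {b \<in> N. \<epsilon> * cr (a - p) (b - p) > 0}" using b by simp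
      qed
      have "r \<in> {b \<in> N. \<epsilon> * cr (a - p) (b - p) > 0}" using rN r by simp
      moreover have "r \<notin> {b \<in> N. \<epsilon> * cr (r - p) (b - p) > 0}" by simp
      ultimately show "{b \<in> N. \<epsilon> * cr (r - p) (b - p) > 0} \<noteq> {b \<in> N. \<epsilon> * cr (a - p) (b - p) > 0}" by blast
    qed
    then have "card {b \<in> N. \<epsilon> * cr (r - p) (b - p) > 0} < card {b \<in> N. \<epsilon> * cr (a - p) (b - p) > 0}"
      using finN by (intro psubset_card_mono) auto
    then have "e \<in> radial_nbrs p \<and> v \<bullet> r = v \<bullet> e" using less(1) rN rR by blast
    then show ?thesis using var by simp
  qed (use less in simp)
qed

text \<open>A point moving along \<open>rot irr\<close> meets each line through \<open>p\<close> and
  a neighbour only once, as \<open>irr\<close> vanishes on no edge. So finitely many parameters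
  \<open>f q\<close> have to be avoided.\<close>

lemma interior_generic:
  assumes ne: "interior K \<noteq> {}" and p: "p \<in> A"
  obtains c0 where "c0 \<in> interior K" "\<And>q. edg p q \<Longrightarrow> cr (c0 - p) (q - p) \<noteq> 0"
proof -
  obtain c where c: "c \<in> interior K" using ne by blast
  obtain e where e: "e > 0" "cball c e \<subseteq> interior K" using c open_contains_cball[of "interior K"] by auto
  define n where "n = norm (rot irr)"
  have n: "n > 0"
  proof -
    have "rot irr \<noteq> 0" by (simp add: plane_eq_iff irr_def)
    then show ?thesis by (simp add: n_def)
  qed
  define f where "f q = cr (c - p) (q - p) / (irr \<bullet> (q - p))" for q
  have "infinite ({0<..<e / n} - f ` nbr p)"
    using e n fin_nbr by (intro Diff_infinite_finite) (auto simp: infinite_Ioo)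
  then have "{0<..<e / n} - f ` nbr p \<noteq> {}" by (rule infinite_imp_nonempty)
  then obtain t where t: "t \<in> {0<..<e / n}" "t \<notin> f ` nbr p" by blast
  define c0 where "c0 = c + t *\<^sub>R rot irr"
  have "dist c c0 = t * n" using t by (simp add: c0_def dist_norm n_def)
  also have "\<dots> \<le> e" using t n by (simp add: field_simps)
  finally have "c0 \<in> interior K" using e by (auto simp: mem_cball)
  moreover have "cr (c0 - p) (q - p) \<noteq> 0" if q: "edg p q" for q
  proof
    assume z: "cr (c0 - p) (q - p) = 0"
    have "irr \<bullet> (q - p) \<noteq> 0" using irr_ne[of q p] edg_A[OF q] edgE[OF q] by metis
    moreover have "cr (c0 - p) (q - p) = cr (c - p) (q - p) - t * (irr \<bullet> (q - p))"
    proof -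
      have "cr (rot irr) (q - p) = - (irr \<bullet> (q - p))" by (simp add: cr_def inner_plane)
      moreover have "c0 - p = (c - p) + t *\<^sub>R rot irr" by (simp add: c0_def)
      ultimately show ?thesis by (simp only: cr_add cr_scale)
    qed
    ultimately have "t = f q" using z by (simp add: f_def field_simps)
    then show False using t q by (auto simp: nbr_def)
  qed
  ultimately show ?thesis using that by blast
qed

lemma supporting_K:
  assumes p: "p \<in> K" "p \<notin> interior K" and ne: "interior K \<noteq> {}"
  obtains d where "d \<noteq> 0" "\<And>x. x \<in> K \<Longrightarrow> d \<bullet> (x - p) \<le> 0" "\<And>x. x \<in> interior K \<Longrightarrow> d \<bullet> (x - p) < 0"
proof -
  have ri: "rel_interior K = interior K" using ne by (rule rel_interior_nonempty_interior)
  obtain a where a: "a \<noteq> 0" "\<And>y. y \<in> K \<Longrightarrow> a \<bullet> p \<le> a \<bullet> y" "\<And>y. y \<in> rel_interior K \<Longrightarrow> a \<bullet> p < a \<bullet> y"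
    by (rule supporting_hyperplane_rel_boundary[of K p]) (use p ri convex_convex_hull in auto)
  show ?thesis
    by (rule that[of "-a"]) (use a ri in \<open>auto simp: inner_diff_right\<close>)
qed

text \<open>The neighbours of \<open>p\<close> that lie beyond \<open>K\<close> are the ends of the radial edges at \<open>p\<close>, and form a fan
  whose consecutive members span pruned edges.\<close>

lemma chain_dirs_frontier:
  assumes p: "p \<in> I" "p \<notin> interior K" and ne: "interior K \<noteq> {}"
  shows "chain_dirs p = {v. \<forall>a\<in>radial_nbrs p. \<forall>b\<in>radial_nbrs p. v \<bullet> (a - b) = 0}" and "radial_nbrs p \<noteq> {}"
proof -
  have pA: "p \<in> A" using p I_sub by blast
  obtain c0 where c0: "c0 \<in> interior K" "\<And>q. edg p q \<Longrightarrow> cr (c0 - p) (q - p) \<noteq> 0"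
    using interior_generic[OF ne pA] by blast
  have c0K: "c0 \<in> K" using c0 interior_subset by blast
  obtain d where d: "d \<noteq> 0" "\<And>x. x \<in> K \<Longrightarrow> d \<bullet> (x - p) \<le> 0" "\<And>x. x \<in> interior K \<Longrightarrow> d \<bullet> (x - p) < 0"
    using supporting_K[OF I_K[OF p(1)] p(2) ne] by blast
  have c0p: "c0 - p \<noteq> 0" using c0(1) p(2) by auto
  define N where "N \<epsilon> = {q. edg p q \<and> \<epsilon> * cr (c0 - p) (q - p) > 0}" for \<epsilon>
  have finN: "finite (N \<epsilon>)" for \<epsilon>
    unfolding N_def by (rule finite_subset[OF _ fin_nbr[of p]]) (auto simp: nbr_def)
  have ext: "\<exists>e. e \<in> N \<epsilon> \<and> (\<forall>u\<in>N \<epsilon>. u \<noteq> e \<longrightarrow> \<epsilon> * cr (u - p) (e - p) > 0)" if eps: "\<epsilon> = 1 \<or> \<epsilon> = -1" for \<epsilon>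
  proof -
    define h where "h = \<epsilon> *\<^sub>R rot (c0 - p)"
    have h: "h \<bullet> x = \<epsilon> * cr (c0 - p) x" for x by (simp add: h_def rot_inner)
    have "h \<noteq> 0" using c0p eps by (auto simp: h_def plane_eq_iff)
    then obtain a where "a \<in> A" "h \<bullet> (a - p) > 0" using I_dir[OF p(1)] by blast
    then obtain b where b: "edg p b" "h \<bullet> (b - p) > 0" using edge_in_halfplane[OF pA] by blast
    then have "b \<in> N \<epsilon>" by (simp add: N_def h)
    then have Nne: "N \<epsilon> \<noteq> {}" by blast
    have Nh: "edg p u \<and> h \<bullet> (u - p) > 0" if "u \<in> N \<epsilon>" for u using that by (simp add: N_def h)
    obtain e where "e \<in> N \<epsilon>" "\<And>u. u \<in> N \<epsilon> \<Longrightarrow> u \<noteq> e \<Longrightarrow> \<epsilon> * cr (u - p) (e - p) > 0"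
      using extreme_half[OF finN Nne Nh eps] by metis
    then show ?thesis by blast
  qed
  \<comment> \<open>\<open>ap\<close> and \<open>am\<close> are the last neighbours in the two
    halves, turning away from \<open>c0\<close>.\<close>
  obtain ap where ap: "ap \<in> N 1" "\<forall>u\<in>N 1. u \<noteq> ap \<longrightarrow> 1 * cr (u - p) (ap - p) > 0" using ext[of 1] by blast
  obtain am where am: "am \<in> N (-1)" "\<forall>u\<in>N (-1). u \<noteq> am \<longrightarrow> (-1) * cr (u - p) (am - p) > 0" using ext[of "-1"] by blast
  \<comment> \<open>The halves meet opposite to \<open>c0\<close>: the neighbour following
    \<open>ap\<close> is no longer in the first half, and if it were not \<open>am\<close>, the edge
    to \<open>am\<close> would start inside a triangle.\<close>
  have T: "{p,ap,am} \<in> TV" "cr (ap - p) (am - p) > 0"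
  proof -
    have E: "edg p ap" "edg p am" using ap am by (auto simp: N_def)
    obtain r where r: "ccw p ap r" using I_ccw[OF p(1) E(1)] .
    have cr1: "cr (ap - p) (r - p) = 1" using ccw_pos[OF r] .
    have Er: "edg p r" using ccw_edg[OF r] by auto
    have "r \<notin> N 1"
    proof
      assume "r \<in> N 1"
      moreover have "r \<noteq> ap" using ccw_distinct[OF r] by auto
      ultimately show False using ap(2) cr1 cr_skew[of "r - p" "ap - p"] by auto
    qed
    then have rN: "r \<in> N (-1)" using c0(2)[OF Er] Er by (auto simp: N_def)
    have "r = am"
    proof (rule ccontr)
      assume "r \<noteq> am"
      then have am_r: "cr (am - p) (r - p) > 0" using am(2) rN cr_skew[of "r - p" "am - p"] by auto
      have s: "cr (c0 - p) (ap - p) > 0" "cr (c0 - p) (am - p) < 0" "cr (c0 - p) (r - p) < 0"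
        using ap am rN by (auto simp: N_def)
      have "cr (c0 - p) (r - p) * cr (ap - p) (am - p) = cr (c0 - p) (am - p) * cr (ap - p) (r - p) - cr (c0 - p) (ap - p) * cr (am - p) (r - p)"
        using cr_plucker4[of "c0 - p" "ap - p" "am - p" "r - p"] by simp
      also have "\<dots> < 0"
      proof -
        have "cr (c0 - p) (ap - p) * cr (am - p) (r - p) > 0" using s am_r by simp
        then show ?thesis using s cr1 by simp
      qed
      finally have "cr (ap - p) (am - p) > 0" using s by (simp add: mult_less_0_iff)
      then show False using no_overlap_pos[of p ap r am] r E(2) am_r cr1 by (simp add: ccw_def)
    qed
    then show "{p,ap,am} \<in> TV" "cr (ap - p) (am - p) > 0" using r by (auto simp: ccw_def)
  qed
  show "chain_dirs p = {v. \<forall>a\<in>radial_nbrs p. \<forall>b\<in>radial_nbrs p. v \<bullet> (a - b) = 0}"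
  proof
    show "{v. \<forall>a\<in>radial_nbrs p. \<forall>b\<in>radial_nbrs p. v \<bullet> (a - b) = 0} \<subseteq> chain_dirs p"
      unfolding chain_dirs_def using dead_tri_radial[OF _ p(1)] by blast
    show "chain_dirs p \<subseteq> {v. \<forall>a\<in>radial_nbrs p. \<forall>b\<in>radial_nbrs p. v \<bullet> (a - b) = 0}"
    proof
      fix v assume v: "v \<in> chain_dirs p"
      have half1: "ap \<in> radial_nbrs p \<and> v \<bullet> a = v \<bullet> ap" if "a \<in> N 1" "a \<in> radial_nbrs p" for a
        by (rule fan_half[OF p(1) c0K _ v, of 1]) (use ap that in \<open>auto simp: N_def\<close>)
      have half2: "am \<in> radial_nbrs p \<and> v \<bullet> a = v \<bullet> am" if "a \<in> N (-1)" "a \<in> radial_nbrs p" for a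
        by (rule fan_half[OF p(1) c0K _ v, of "-1"]) (use am that in \<open>auto simp: N_def\<close>)
      have join: "v \<bullet> ap = v \<bullet> am" if R: "ap \<in> radial_nbrs p" "am \<in> radial_nbrs p"
      proof -
        have ne': "\<not> enters p ap" "\<not> enters p am" using R radial_nbrs_iff[OF p(1)] by auto
        have s: "cr (c0 - p) (ap - p) > 0" "cr (c0 - p) (am - p) < 0" using ap am by (auto simp: N_def)
        have "{ap,am} \<notin> Live"
        proof (rule tri_dead_if_avoids[OF T(1) p(1) R])
          fix t :: real assume t: "0 \<le> t" "t \<le> 1"
          define z where "z = (1 - t) *\<^sub>R ap + t *\<^sub>R am"
          have zp: "z - p = (1 - t) *\<^sub>R (ap - p) + t *\<^sub>R (am - p)"
            by (simp add: z_def scaleR_diff_left scaleR_diff_right)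
          have z2: "cr (ap - p) (z - p) = t * cr (ap - p) (am - p)" unfolding zp by (simp add: cr_add)
          have z3: "cr (am - p) (z - p) = - ((1 - t) * cr (ap - p) (am - p))"
            unfolding zp by (simp add: cr_add cr_skew[of "am - p" "ap - p"])
          show "\<not> enters p ((1 - t) *\<^sub>R ap + t *\<^sub>R am)"
            unfolding z_def[symmetric]
          proof
            assume en: "enters p z"
            consider "cr (c0 - p) (z - p) > 0" | "cr (c0 - p) (z - p) < 0" | "cr (c0 - p) (z - p) = 0" by linarith
            then show False
            proof cases
              case 1
              have "enters p ap" by (rule enters_between[OF p(1) en c0K, of 1]) (use 1 z2 t T s in auto)
              then show False using ne' by simp
            next
              case 2
              have "enters p am" by (rule enters_between[OF p(1) en c0K, of "-1"]) (use 2 z3 t T s in auto)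
              then show False using ne' by simp
            next
              \<comment> \<open>Here \<open>z\<close> is on the line through \<open>c0\<close>, and
                on the opposite ray from \<open>p\<close>, so strictly beyond the line that supports
                \<open>K\<close> at \<open>p\<close>.\<close>
              case 3
              obtain \<kappa> where k: "z - p = \<kappa> *\<^sub>R (c0 - p)" using cr_zero_parallel[OF 3 c0p] .
              have "t \<noteq> 0" using 3 s zp by auto
              then have "cr (ap - p) (z - p) > 0" using z2 t T by simp
              then have "\<kappa> * cr (ap - p) (c0 - p) > 0" using k by simp
              then have "\<kappa> < 0" using s cr_skew[of "ap - p" "c0 - p"] by (auto simp: mult_less_0_iff zero_less_mult_iff)
              obtain \<sigma> where "\<sigma> > 0" "p + \<sigma> *\<^sub>R (z - p) \<in> K" using en unfolding enters_def by blast
              then have "d \<bullet> (z - p) \<le> 0" using d(2)[of "p + \<sigma> *\<^sub>R (z - p)"] by (simp add: mult_le_0_iff)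
              then have "\<kappa> * (d \<bullet> (c0 - p)) \<le> 0" using k by simp
              then show False using d(3)[OF c0(1)] \<open>\<kappa> < 0\<close> by (simp add: mult_le_0_iff)
            qed
          qed
        qed
        moreover have "ap \<notin> I" "am \<notin> I" using R by (auto simp: radial_nbrs_def)
        ultimately have "v \<bullet> (ap - am) = 0" using v T(1) unfolding chain_dirs_def by blast
        then show ?thesis by (simp add: inner_diff_right)
      qed
      have side: "a \<in> N 1 \<or> a \<in> N (-1)" if "a \<in> radial_nbrs p" for a
        using that c0(2)[of a] by (auto simp: N_def radial_nbrs_def)
      have via: "(ap \<in> radial_nbrs p \<and> v \<bullet> a = v \<bullet> ap) \<or> (am \<in> radial_nbrs p \<and> v \<bullet> a = v \<bullet> am)" if a: "a \<in> radial_nbrs p" for a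
        using side[OF a]
      proof
        assume "a \<in> N 1" then show ?thesis using half1[OF _ a] by blast
      next
        assume "a \<in> N (-1)" then show ?thesis using half2[OF _ a] by blast
      qed
      have eq: "v \<bullet> a = v \<bullet> b" if "a \<in> radial_nbrs p" "b \<in> radial_nbrs p" for a b
        using via[OF that(1)] via[OF that(2)] join by metis
      have "v \<bullet> (a - b) = 0" if "a \<in> radial_nbrs p" "b \<in> radial_nbrs p" for a b using eq[OF that] by (simp add: inner_diff_right)
      then show "v \<in> {v. \<forall>a\<in>radial_nbrs p. \<forall>b\<in>radial_nbrs p. v \<bullet> (a - b) = 0}" by blast
    qed
  qed
  \<comment> \<open>Some neighbour lies strictly beyond the supporting line at \<open>p\<close>; the
    ray to it cannot enter \<open>K\<close>, so it is radial.\<close>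
  obtain a where "a \<in> A" "d \<bullet> (a - p) > 0" using I_dir[OF p(1) d(1)] by blast
  then obtain b where b: "edg p b" "d \<bullet> (b - p) > 0" using edge_in_halfplane[OF pA] by blast
  have "\<not> enters p b"
  proof
    assume "enters p b"
    then obtain s where "s > 0" "p + s *\<^sub>R (b - p) \<in> K" unfolding enters_def by blast
    then show False using d(2)[of "p + s *\<^sub>R (b - p)"] b(2) by (simp add: mult_le_0_iff)
  qed
  then show "radial_nbrs p \<noteq> {}" using b radial_nbrs_iff[OF p(1)] by blast
qed

lemma fin_radial_nbrs: "finite (radial_nbrs p)"
  by (rule finite_subset[OF _ fin_nbr[of p]]) (auto simp: nbr_def radial_nbrs_def)

text \<open>\<open>chain_dirs p\<close> is the orthogonal complement of the differences of the
  radial ends, which span a space of dimension 0, 1 or 2.\<close>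

lemma dim_chain_dirs_frontier:
  assumes p: "p \<in> I" "p \<notin> interior K" and ne: "interior K \<noteq> {}"
  shows "dim (chain_dirs p) = (if card (radial_nbrs p) = 1 then 2 else if collinear (radial_nbrs p) then 1 else 0)"
proof -
  note W = chain_dirs_frontier[OF assms]
  show ?thesis
  proof (cases "card (radial_nbrs p) = 1")
    case True
    then obtain a where "radial_nbrs p = {a}" by (meson card_1_singletonE)
    then have "chain_dirs p = UNIV" unfolding W(1) by simp
    then show ?thesis using True by simp
  next
    case F: False
    have "card (radial_nbrs p) > 0" using W(2) fin_radial_nbrs card_gt_0_iff by blast
    then have "card (radial_nbrs p) \<ge> 2" using F by linarith
    then obtain a b where ab: "a \<in> radial_nbrs p" "b \<in> radial_nbrs p" "a \<noteq> b"
      by (metis card_2_iff' card_le_Suc0_iff_eq fin_radial_nbrs not_less_eq_eq numeral_2_eq_2)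
    show ?thesis
    proof (cases "collinear (radial_nbrs p)")
      case True
      then obtain u where u: "\<And>x y. x \<in> radial_nbrs p \<Longrightarrow> y \<in> radial_nbrs p \<Longrightarrow> \<exists>c. x - y = c *\<^sub>R u"
        unfolding collinear_def by blast
      obtain c where c: "a - b = c *\<^sub>R u" using u ab by blast
      have c0: "c \<noteq> 0" "u \<noteq> 0" using c ab by auto
      have "chain_dirs p = {v. u \<bullet> v = 0}"
      proof
        show "chain_dirs p \<subseteq> {v. u \<bullet> v = 0}"
        proof
          fix v assume "v \<in> chain_dirs p"
          then have "v \<bullet> (a - b) = 0" unfolding W(1) using ab by blast
          then show "v \<in> {v. u \<bullet> v = 0}" using c c0 by (simp add: inner_commute)
        qed
        show "{v. u \<bullet> v = 0} \<subseteq> chain_dirs p" unfolding W(1)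
        proof (intro subsetI CollectI ballI)
          fix v x y assume "v \<in> {v. u \<bullet> v = 0}" "x \<in> radial_nbrs p" "y \<in> radial_nbrs p"
          then show "v \<bullet> (x - y) = 0" using u[of x y] by (auto simp: inner_commute)
        qed
      qed
      then have "dim (chain_dirs p) = 1" using dim_hyperplane[OF c0(2)] by simp
      then show ?thesis using F True by simp
    next
      case False
      have "\<exists>x\<in>radial_nbrs p. cr (b - a) (x - a) \<noteq> 0"
      proof (rule ccontr)
        assume n: "\<not> ?thesis"
        have "collinear (radial_nbrs p)" unfolding collinear_def
        proof (rule exI[of _ "b - a"], intro ballI)
          fix x y assume xy: "x \<in> radial_nbrs p" "y \<in> radial_nbrs p"
          have ba: "b - a \<noteq> 0" using ab by simp
          obtain k where k: "x - a = k *\<^sub>R (b - a)" using cr_zero_parallel[OF _ ba] n xy by metis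
          obtain l where l: "y - a = l *\<^sub>R (b - a)" using cr_zero_parallel[OF _ ba] n xy by metis
          have "x - y = (x - a) - (y - a)" by simp
          then show "\<exists>c. x - y = c *\<^sub>R (b - a)" unfolding k l by (metis scaleR_diff_left)
        qed
        then show False using False by simp
      qed
      then obtain x where x: "x \<in> radial_nbrs p" "cr (b - a) (x - a) \<noteq> 0" by blast
      have "chain_dirs p = {0}"
      proof -
        have "v = 0" if "v \<in> chain_dirs p" for v
        proof -
          have "v \<bullet> (b - a) = 0" "v \<bullet> (x - a) = 0" using that x ab unfolding W(1) by blast+
          then show ?thesis using inner_zero_zero[OF x(2), of v] by (simp add: inner_commute)
        qed
        then show ?thesis using subspace_0[OF subspace_chain_dirs] by blast
      qed
      then show ?thesis using F False by simp
    qed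
  qed
qed

lemma sum_dim_chain_dirs:
  assumes ne: "interior K \<noteq> {}"
  shows "(\<Sum>p\<in>I. dim (chain_dirs p)) = 2 * card (I \<inter> interior K) + 2 * card {p \<in> I - interior K. card (radial_nbrs p) = 1}
    + card {p \<in> I - interior K. card (radial_nbrs p) \<ge> 2 \<and> collinear (radial_nbrs p)}"
proof -
  have "(\<Sum>p\<in>I. dim (chain_dirs p)) = (\<Sum>p\<in>I \<inter> interior K. dim (chain_dirs p)) + (\<Sum>p\<in>I - interior K. dim (chain_dirs p))"
    using sum.Int_Diff[OF finI] .
  also have "(\<Sum>p\<in>I \<inter> interior K. dim (chain_dirs p)) = 2 * card (I \<inter> interior K)"
    using chain_dirs_interior by simp
  also have "(\<Sum>p\<in>I - interior K. dim (chain_dirs p))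
    = (\<Sum>p\<in>I - interior K. 2 * (if card (radial_nbrs p) = 1 then 1 else 0) + (if card (radial_nbrs p) \<ge> 2 \<and> collinear (radial_nbrs p) then 1 else 0))"
  proof (rule sum.cong[OF refl])
    fix p assume p: "p \<in> I - interior K"
    have "card (radial_nbrs p) > 0" using chain_dirs_frontier(2)[OF _ _ ne] fin_radial_nbrs card_gt_0_iff p by blast
    then show "dim (chain_dirs p) = 2 * (if card (radial_nbrs p) = 1 then 1 else 0) + (if card (radial_nbrs p) \<ge> 2 \<and> collinear (radial_nbrs p) then 1 else 0)"
      using dim_chain_dirs_frontier[OF _ _ ne, of p] p by auto
  qed
  also have "\<dots> = 2 * card {p \<in> I - interior K. card (radial_nbrs p) = 1} + card {p \<in> I - interior K. card (radial_nbrs p) \<ge> 2 \<and> collinear (radial_nbrs p)}"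
    using finI by (simp add: sum.distrib sum.If_cases Int_def flip: sum_distrib_left)
  finally show ?thesis by simp
qed

end

section \<open>The dual curve and its skeleton\<close>

text \<open>\<open>m * n' = n * m'\<close> together with coprimality gives divisibility in both
  directions, so the coordinates agree up to sign.\<close>

lemma primitive_parallel:
  assumes "primitive u" "primitive v" "u = k *\<^sub>R v"
  shows "norm u = norm v"
proof -
  obtain m n where u: "coprime m n" "u = vector [of_int m, of_int n]" using assms(1) unfolding primitive_def by blast
  obtain m' n' where v: "coprime m' n'" "v = vector [of_int m', of_int n']" using assms(2) unfolding primitive_def by blast
  have "real_of_int m = k * of_int m'" "real_of_int n = k * of_int n'"
    using assms(3) u v by (simp_all add: plane_eq_iff)
  then have "real_of_int m * of_int n' = real_of_int n * of_int m'" by simp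
  then have e: "m * n' = n * m'" by (metis of_int_eq_iff of_int_mult)
  have "m dvd m'" using u(1) e by (metis coprime_dvd_mult_right_iff dvd_triv_left)
  moreover have "m' dvd m" using v(1) e by (metis coprime_dvd_mult_left_iff dvd_triv_right)
  moreover have "n dvd n'" using u(1) e by (metis coprime_commute coprime_dvd_mult_right_iff dvd_triv_left)
  moreover have "n' dvd n" using v(1) e by (metis coprime_commute coprime_dvd_mult_left_iff dvd_triv_right)
  ultimately have "\<bar>m\<bar> = \<bar>m'\<bar>" "\<bar>n\<bar> = \<bar>n'\<bar>" using zdvd_antisym_abs by blast+
  then have "m\<^sup>2 = m'\<^sup>2" "n\<^sup>2 = n'\<^sup>2" by (metis power2_abs)+
  then have "(real_of_int m)\<^sup>2 = (real_of_int m')\<^sup>2" "(real_of_int n)\<^sup>2 = (real_of_int n')\<^sup>2"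
    by (metis of_int_power)+
  then have "u \<bullet> u = v \<bullet> v" using u v by (simp add: inner_plane power2_eq_square)
  then show ?thesis by (simp add: norm_eq_sqrt_inner)
qed

text \<open>A segment determines its end points up to order and a primitive vector along it up to
  sign, so the definite description is unambiguous.\<close>

lemma lattice_length_segment:
  assumes v: "primitive v" and ab: "b - a = g *\<^sub>R v" and g: "g > 0"
  shows "lattice_length (closed_segment a b) = g"
proof -
  have v0: "v \<noteq> 0"
  proof
    assume "v = 0"
    obtain m n where mn: "coprime m n" "v = vector [of_int m, of_int n]" using v unfolding primitive_def by blast
    then have "m = 0" "n = 0" using \<open>v = 0\<close> by (auto simp: plane_eq_iff)
    then show False using mn(1) by simp
  qed
  have ne: "a \<noteq> b" using ab g v0 by auto
  have val: "norm (b - a) / norm v = g" using ab g v0 by simp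
  show ?thesis unfolding lattice_length_def
  proof (rule the_equality)
    show "\<exists>a' b' v c. closed_segment a b = closed_segment a' b' \<and> a' \<noteq> b' \<and> primitive v \<and> b' - a' = c *\<^sub>R v \<and> g = norm (b' - a') / norm v"
      using ne v ab val by metis
    fix l
    assume "\<exists>a' b' v c. closed_segment a b = closed_segment a' b' \<and> a' \<noteq> b' \<and> primitive v \<and> b' - a' = c *\<^sub>R v \<and> l = norm (b' - a') / norm v"
    then obtain a' b' v' c where h: "closed_segment a b = closed_segment a' b'" "a' \<noteq> b'" "primitive v'" "b' - a' = c *\<^sub>R v'"
      "l = norm (b' - a') / norm v'" by blast
    have "{a,b} = {a',b'}" using h(1) closed_segment_eq by blast
    then have "(a' = a \<and> b' = b) \<or> (a' = b \<and> b' = a)" by (auto simp: doubleton_eq_iff)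
    then have n: "norm (b' - a') = norm (b - a)" and eq: "b' - a' = b - a \<or> b' - a' = - (b - a)"
      by (auto simp: norm_minus_commute)
    have "g *\<^sub>R v = c *\<^sub>R v' \<or> g *\<^sub>R v = (-c) *\<^sub>R v'" using eq h(4) ab by (auto simp: minus_equation_iff)
    then obtain c' where c': "g *\<^sub>R v = c' *\<^sub>R v'" by blast
    then have "v = (c' / g) *\<^sub>R v'" using g by (metis (no_types, lifting) divide_inverse_commute less_irrefl scaleR_one scaleR_scaleR left_inverse)
    then have "norm v = norm v'" using primitive_parallel v h(3) by blast
    then show "l = g" using h(5) n val by simp
  qed
qed

context regtri
begin

definition cell :: "plane set \<Rightarrow> plane set" where
  "cell e = {y. e \<subseteq> mins A w y}"

lemma card_mins_le: "card (mins A w x) \<le> 3"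
proof -
  obtain X where "X \<in> TV" "mins A w x \<subseteq> X" using mins_sub_TV by blast
  then show ?thesis using TV_card card_mono TV_fin by metis
qed

lemma card3_mins: assumes "card (mins A w x) = 3" shows "mins A w x \<in> TV" "x = pt (mins A w x)"
proof -
  obtain X where X: "X \<in> TV" "mins A w x \<subseteq> X" using mins_sub_TV by blast
  then have "mins A w x = X" using assms TV_card TV_fin card_subset_eq by metis
  then show M: "mins A w x \<in> TV" using X by simp
  show "x = pt (mins A w x)" using pt_unique[OF M, of x] by simp
qed

lemma card2_mins: assumes "card (mins A w x) = 2" shows "mins A w x \<in> Eall"
proof -
  obtain X where X: "X \<in> TV" "mins A w x \<subseteq> X" using mins_sub_TV by blast
  obtain p q where "mins A w x = {p,q}" "p \<noteq> q" using assms by (meson card_2_iff)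
  then show ?thesis using X edgI by auto
qed

lemma cell_tri: "X \<in> TV \<Longrightarrow> cell X = {pt X}"
  unfolding cell_def using mins_pt pt_unique by auto

text \<open>A line search along the normal of \<open>pq\<close> stays in the cell. Since it ends
  with a new minimizer, it ends at a new point.\<close>

lemma cell_edge_not_point:
  assumes m: "mins A w x = {p,q}" "p \<noteq> q"
  shows "\<exists>y\<in>cell {p,q}. y \<noteq> x"
proof -
  have "{p,q} \<in> Eall" using card2_mins[of x] m by simp
  then obtain r where r: "{p,q,r} \<in> TV" using edgE by metis
  define u where "u = - nrm p q r"
  have rr: "u \<bullet> (r - p) < 0" using TV_unit[OF r] by (auto simp: u_def nrm_inner)
  have rA: "r \<in> A" using TV_sub[OF r] by auto
  obtain t s where t: "t \<ge> 0" "s \<in> A" "u \<bullet> (s - p) < 0" "insert s {p,q} \<subseteq> mins A w (x + t *\<^sub>R u)"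
    by (rule mins_linesearch[OF finA, of "{p,q}" w x p u r]) (use m rr rA in \<open>auto simp: u_def nrm_inner\<close>)
  have "s \<notin> {p,q}" using t(3) by (auto simp: u_def nrm_inner)
  moreover have "s \<in> mins A w (x + t *\<^sub>R u)" using t(4) by simp
  ultimately have "t \<noteq> 0" using m by (cases "t = 0") simp_all
  moreover have "u \<noteq> 0" using rr by auto
  ultimately have "x + t *\<^sub>R u \<noteq> x" by simp
  moreover have "x + t *\<^sub>R u \<in> cell {p,q}" using t(4) by (simp add: cell_def)
  ultimately show ?thesis by blast
qed

lemma vertices_eq: "{x. card (mins A w x) \<ge> 2 \<and> cell (mins A w x) = {x}} = pt ` TV"
proof
  show "{x. card (mins A w x) \<ge> 2 \<and> cell (mins A w x) = {x}} \<subseteq> pt ` TV"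
  proof
    fix x assume x: "x \<in> {x. card (mins A w x) \<ge> 2 \<and> cell (mins A w x) = {x}}"
    have "card (mins A w x) \<noteq> 2"
    proof
      assume "card (mins A w x) = 2"
      then obtain p q where pq: "mins A w x = {p,q}" "p \<noteq> q" by (meson card_2_iff)
      then show False using cell_edge_not_point[OF pq] x by auto
    qed
    then have "card (mins A w x) = 3" using x card_mins_le[of x] by simp
    then show "x \<in> pt ` TV" using card3_mins by blast
  qed
  show "pt ` TV \<subseteq> {x. card (mins A w x) \<ge> 2 \<and> cell (mins A w x) = {x}}"
    using mins_pt TV_card cell_tri by auto
qed

lemma inj_pt: "inj_on pt TV"
  by (rule inj_onI) (metis mins_pt)

lemma pt_cell_iff: "X \<in> TV \<Longrightarrow> pt X \<in> cell e \<longleftrightarrow> e \<subseteq> X"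
  by (simp add: cell_def mins_pt)

text \<open>The determinant with \<open>r - p\<close>, which is 1 or -1, is an integral combination
  of the coordinates of \<open>q - p\<close>, so these are coprime.\<close>

lemma primitive_nrm: assumes T: "{p,q,r} \<in> TV" shows "primitive (nrm p q r)"
proof -
  define \<epsilon> where "\<epsilon> = cr (q - p) (r - p)"
  have eps: "\<epsilon> = 1 \<or> \<epsilon> = -1" using TV_unit[OF T] by (simp add: \<epsilon>_def)
  have "q - p \<in> lattice_points" "r - p \<in> lattice_points" using TV_sub[OF T] latA by (auto intro: lattice_diff)
  then obtain a b c d where abcd: "(q - p)$1 = of_int a" "(q - p)$2 = of_int b" "(r - p)$1 = of_int c" "(r - p)$2 = of_int d"
    unfolding lattice_points_def by (metis (mono_tags, lifting) Ints_cases mem_Collect_eq)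
  have "real_of_int (a * d - b * c) = \<epsilon>" unfolding \<epsilon>_def cr_def abcd by simp
  then have "a * d - b * c = 1 \<or> a * d - b * c = -1" using eps by (metis of_int_1 of_int_eq_iff of_int_minus)
  then have cop: "coprime a b"
  proof
    assume "a * d - b * c = 1"
    then show ?thesis by (intro coprimeI) (metis dvd_diff dvd_mult2)
  next
    assume "a * d - b * c = -1"
    then have e: "b * c - a * d = 1" by simp
    show ?thesis by (intro coprimeI) (metis e dvd_diff dvd_mult2)
  qed
  define k where "k = (if \<epsilon> = 1 then 1 else (-1::int))"
  have k: "real_of_int k = \<epsilon>" using eps by (auto simp: k_def)
  have "coprime (- k * b) (k * a)" using cop by (auto simp: k_def coprime_commute)
  moreover have "nrm p q r = vector [of_int (- k * b), of_int (k * a)]"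
    unfolding nrm_def \<epsilon>_def[symmetric] using abcd k by (simp add: plane_eq_iff)
  ultimately show ?thesis unfolding primitive_def by blast
qed

lemma cell_interior_edge:
  assumes X: "{p,q,r} \<in> TV" and Y: "{p,q,s} \<in> TV" and op: "cr (q - p) (r - p) * cr (q - p) (s - p) < 0"
  shows "cell {p,q} = closed_segment (pt {p,q,r}) (pt {p,q,s})"
proof -
  define x g n where "x = pt {p,q,r}" and "g = gap {p,q,r} s" and "n = nrm p q r"
  note c = cross[OF X Y op, folded x_def g_def n_def]
  have op1: "cr (q - p) (r - p) * cr (q - p) (s - p) = -1"
    using TV_unit[OF X] TV_unit[OF Y] op by auto
  have n1: "n \<bullet> (q - p) = 0" "n \<bullet> (s - p) = -1" using op1 by (simp_all add: n_def nrm_inner)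
  have nr: "n \<bullet> (r - p) = 1" using TV_unit[OF X] by (auto simp: n_def nrm_inner)
  have mx: "mins A w x = {p,q,r}" using mins_pt[OF X] by (simp add: x_def)
  have my: "mins A w (x + g *\<^sub>R n) = {p,q,s}" using mins_pt[OF Y] c by simp
  have seg: "closed_segment x (x + g *\<^sub>R n) = {x + t *\<^sub>R n | t. 0 \<le> t \<and> t \<le> g}"
  proof
    show "closed_segment x (x + g *\<^sub>R n) \<subseteq> {x + t *\<^sub>R n | t. 0 \<le> t \<and> t \<le> g}"
    proof
      fix z assume "z \<in> closed_segment x (x + g *\<^sub>R n)"
      then obtain u where u: "0 \<le> u" "u \<le> 1" "z = (1 - u) *\<^sub>R x + u *\<^sub>R (x + g *\<^sub>R n)"
        unfolding closed_segment_def by blast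
      then have "z = x + (u * g) *\<^sub>R n" by (simp add: scaleR_diff_left scaleR_add_right)
      moreover have "0 \<le> u * g" "u * g \<le> g" using u c(2) by (auto simp: mult_le_cancel_right1)
      ultimately show "z \<in> {x + t *\<^sub>R n | t. 0 \<le> t \<and> t \<le> g}" by blast
    qed
    show "{x + t *\<^sub>R n | t. 0 \<le> t \<and> t \<le> g} \<subseteq> closed_segment x (x + g *\<^sub>R n)"
    proof
      fix z assume "z \<in> {x + t *\<^sub>R n | t. 0 \<le> t \<and> t \<le> g}"
      then obtain t where t: "0 \<le> t" "t \<le> g" "z = x + t *\<^sub>R n" by blast
      have "z = (1 - t / g) *\<^sub>R x + (t / g) *\<^sub>R (x + g *\<^sub>R n)"
        using t(3) c(2) by (simp add: scaleR_diff_left scaleR_add_right)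
      then show "z \<in> closed_segment x (x + g *\<^sub>R n)" unfolding closed_segment_def mem_Collect_eq
        using t c(2) by (intro exI[of _ "t / g"]) (auto simp: divide_le_eq_1)
    qed
  qed
  have "y \<in> cell {p,q} \<longleftrightarrow> y \<in> {x + t *\<^sub>R n | t. 0 \<le> t \<and> t \<le> g}" for y
  proof
    assume y: "y \<in> cell {p,q}"
    have pm: "p \<in> mins A w y" "q \<in> mins A w y" using y by (auto simp: cell_def)
    have e1: "w p + p \<bullet> y = w q + q \<bullet> y" using mins_eq[OF pm] .
    have e2: "w p + p \<bullet> x = w q + q \<bullet> x" using mins_eq[of p A w x q] mx by auto
    have z: "(q - p) \<bullet> (y - x) = 0" using e1 e2 by (simp add: inner_diff_left inner_diff_right)
    define t where "t = (r - p) \<bullet> (y - x)"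
    have "(q - p) \<bullet> (y - x - t *\<^sub>R n) = 0" "(r - p) \<bullet> (y - x - t *\<^sub>R n) = 0"
      using z n1 nr by (simp_all add: inner_diff_right[of _ "_ - _"] t_def inner_commute[of _ n])
    then have "y - x - t *\<^sub>R n = 0" using TV_unit[OF X] by (intro inner_zero_zero[of "q - p" "r - p"]) auto
    then have yt: "y = x + t *\<^sub>R n" by (simp add: algebra_simps)
    have A2: "r \<in> A" "s \<in> A" using TV_sub[OF X] TV_sub[OF Y] by auto
    have "w p + p \<bullet> y \<le> w r + r \<bullet> y" using mins_le[OF pm(1) A2(1)] .
    moreover have "w p + p \<bullet> x = w r + r \<bullet> x" using mins_eq[of p A w x r] mx by auto
    ultimately have "t \<ge> 0" unfolding t_def by (simp add: inner_diff_left inner_diff_right)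
    have "w p + p \<bullet> y \<le> w s + s \<bullet> y" using mins_le[OF pm(1) A2(2)] .
    moreover have "g = w s + s \<bullet> x - (w p + p \<bullet> x)" unfolding g_def x_def using gap_eq[OF X, of p s] by simp
    moreover have "n \<bullet> s = n \<bullet> p - 1" using n1(2) by (simp add: inner_diff_right)
    ultimately have "t \<le> g" unfolding yt by (simp add: inner_add_right inner_commute[of _ n] algebra_simps)
    then show "y \<in> {x + t *\<^sub>R n | t. 0 \<le> t \<and> t \<le> g}" using yt \<open>t \<ge> 0\<close> by blast
  next
    assume "y \<in> {x + t *\<^sub>R n | t. 0 \<le> t \<and> t \<le> g}"
    then obtain t where t: "0 \<le> t" "t \<le> g" "y = x + t *\<^sub>R n" by blast
    have A2: "p \<in> A" "q \<in> A" using TV_sub[OF X] by auto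
    have le: "w p + p \<bullet> y \<le> w a + a \<bullet> y" if a: "a \<in> A" for a
    proof -
      \<comment> \<open>\<open>F\<close> is affine along the segment and nonnegative at both ends,
        hence at \<open>y\<close>.\<close>
      define F where "F z = w a + a \<bullet> z - (w p + p \<bullet> z)" for z
      have F0: "F x \<ge> 0" using mins_le[of p A w x a] mx a by (simp add: F_def)
      have F1: "F (x + g *\<^sub>R n) \<ge> 0" using mins_le[of p A w "x + g *\<^sub>R n" a] my a by (simp add: F_def)
      have "g * F y = (g - t) * F x + t * F (x + g *\<^sub>R n)" unfolding F_def t(3)
        by (simp add: inner_add_right algebra_simps)
      also have "\<dots> \<ge> 0" using F0 F1 t by simp
      finally show ?thesis using c(2) by (simp add: F_def zero_le_mult_iff)
    qed
    have pm: "p \<in> mins A w y" using le A2 by (auto simp: mins_def)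
    have "w p + p \<bullet> x = w q + q \<bullet> x" using mins_eq[of p A w x q] mx by auto
    moreover have "n \<bullet> q = n \<bullet> p" using n1(1) by (simp add: inner_diff_right)
    ultimately have "w q + q \<bullet> y \<le> w p + p \<bullet> y" unfolding t(3) by (simp add: inner_add_right inner_commute[of _ n])
    then have "q \<in> mins A w y" using mins_memI[OF pm A2(2)] by simp
    then show "y \<in> cell {p,q}" using pm by (simp add: cell_def)
  qed
  then show ?thesis using seg c(1) x_def by auto
qed

text \<open>By \<open>cross\<close>, the edge of the curve is the gap times a primitive vector. The
  affine relation between the four points eliminates the dual point from the gap and leaves
  \<open>len4\<close>.\<close>

lemma interior_edge_cell:
  assumes e: "e \<in> Eint"
  shows "lattice_length (cell e) = elen w e" "bounded (cell e)" "aff_dim (cell e) = 1" "\<exists>x. mins A w x = e"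
proof -
  obtain p q r s where pq: "e = {p,q}" "ccw p q r" "ccw q p s" using e unfolding Eint_def by blast
  have X: "{p,q,r} \<in> TV" and Y: "{p,q,s} \<in> TV" using pq by (auto simp: ccw_def insert_commute)
  note fl = flip[OF pq(2,3)]
  have op: "cr (q - p) (r - p) * cr (q - p) (s - p) < 0" using fl by simp
  note c = cross[OF X Y op]
  note seg = cell_interior_edge[OF X Y op]
  have g: "gap {p,q,r} s = elen w {p,q}"
  proof -
    have eq: "w p + p \<bullet> pt {p,q,r} = w q + q \<bullet> pt {p,q,r}" "w p + p \<bullet> pt {p,q,r} = w r + r \<bullet> pt {p,q,r}"
      using mins_pt[OF X] by (auto intro!: mins_eq[of _ A w])
    define m where "m = cr (s - p) (r - p)"
    note fr = flip_relation[OF fl, folded m_def]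
    define x where "x = pt {p,q,r}"
    have "(r + s - 2 *\<^sub>R p) \<bullet> x = m * ((q - p) \<bullet> x)" unfolding fr(1) by simp
    then have 1: "r \<bullet> x + s \<bullet> x - 2 * (p \<bullet> x) = m * (q \<bullet> x - p \<bullet> x)"
      by (simp add: inner_add_left inner_diff_left)
    have q: "q \<bullet> x - p \<bullet> x = w p - w q" and r: "r \<bullet> x = w p + p \<bullet> x - w r" using eq by (simp_all add: x_def)
    have "s \<bullet> x - p \<bullet> x = m * (w p - w q) + w r - w p" using 1 unfolding q r by simp
    then have "gap {p,q,r} s = w s - w p + m * (w p - w q) + w r - w p"
      using gap_eq[OF X, of p s] by (simp add: x_def)
    then show ?thesis unfolding elen_eq[OF pq(2,3)] len4_def fr(2) m_def[symmetric] by (simp add: algebra_simps)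
  qed
  show "lattice_length (cell e) = elen w e" unfolding pq(1) seg
    using lattice_length_segment[OF primitive_nrm[OF X], of "pt {p,q,s}" "pt {p,q,r}" "gap {p,q,r} s"] c g by simp
  show "bounded (cell e)" unfolding pq(1) seg by (rule bounded_closed_segment)
  have ne: "pt {p,q,r} \<noteq> pt {p,q,s}"
    using inj_onD[OF inj_pt _ X Y] ccw_ne_rev[OF pq(2,3)] by blast
  then show "aff_dim (cell e) = 1" unfolding pq(1) seg segment_convex_hull aff_dim_convex_hull by (simp add: aff_dim_2)
  \<comment> \<open>A third minimizer at the midpoint would make it the dual point of one of the two
    triangles, that is, an end point.\<close>
  define z where "z = midpoint (pt {p,q,r}) (pt {p,q,s})"
  have "z \<in> cell {p,q}" unfolding seg z_def by (rule midpoint_in_closed_segment)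
  then have sub: "{p,q} \<subseteq> mins A w z" by (simp add: cell_def)
  have "mins A w z = {p,q}"
  proof (rule ccontr)
    assume "mins A w z \<noteq> {p,q}"
    then have "{p,q} \<subset> mins A w z" using sub by blast
    then have "card {p,q} < card (mins A w z)" using finA mins_sub finite_subset psubset_card_mono by metis
    moreover have "card {p,q} = 2" using ccw_distinct[OF pq(2)] by simp
    ultimately have "card (mins A w z) = 3" using card_mins_le[of z] by simp
    note Z = card3_mins[OF this]
    have "mins A w z \<in> {X \<in> TV. {p,q} \<subseteq> X}" using Z(1) sub by simp
    moreover have E: "edg p q" using ccw_edg[OF pq(2)] by blast
    ultimately have "(\<exists>u. mins A w z = {p,q,u} \<and> ccw p q u) \<or> (\<exists>u. mins A w z = {p,q,u} \<and> ccw q p u)"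
      unfolding tris_at_edge[OF E] by blast
    then have "mins A w z = {p,q,r} \<or> mins A w z = {p,q,s}" using ccw_unique[OF pq(2)] ccw_unique[OF pq(3)] by metis
    then have "z = pt {p,q,r} \<or> z = pt {p,q,s}" using Z(2) by metis
    then show False using ne unfolding z_def by (auto simp: midpoint_eq_endpoint)
  qed
  then show "\<exists>x. mins A w x = e" using pq(1) by blast
qed

text \<open>All points of \<open>A\<close> are on one side of the line \<open>pq\<close>, so the
  dual point can move along the normal without end.\<close>

lemma boundary_edge_cell:
  assumes e: "e \<in> Eall" "e \<notin> Eint" shows "\<not> bounded (cell e)"
proof -
  obtain p q where pq0: "e = {p,q}" using e unfolding Eall_def by blast
  have E: "edg p q" using e pq0 by simp
  then obtain r where X: "{p,q,r} \<in> TV" using edgE by metis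
  define n where "n = nrm p q r"
  have u: "cr (q - p) (r - p) = 1 \<or> cr (q - p) (r - p) = -1" using TV_unit[OF X] .
  have pos: "n \<bullet> (a - p) \<ge> 0" if a: "a \<in> A" for a
  proof (rule ccontr)
    assume "\<not> ?thesis"
    then have d1: "- cr (q - p) (r - p) * cr (q - p) (a - p) > 0" by (simp add: n_def nrm_inner)
    have d2: "- cr (q - p) (r - p) = 1 \<or> - cr (q - p) (r - p) = -1" using u by auto
    obtain s where "{p,q,s} \<in> TV" "- cr (q - p) (r - p) * cr (q - p) (s - p) > 0"
      by (rule edge_side[OF E a d1 d2])
    then have s: "{p,q,s} \<in> TV" "cr (q - p) (r - p) * cr (q - p) (s - p) < 0" by simp_all
    have "{p,q} \<in> Eint"
    proof -
      consider "cr (q - p) (r - p) > 0" "cr (q - p) (s - p) < 0" | "cr (q - p) (r - p) < 0" "cr (q - p) (s - p) > 0"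
        using s by (auto simp: mult_less_0_iff)
      then show ?thesis
        by cases (use ccwI[OF X] ccwI'[OF X] ccwI[OF s(1)] ccwI'[OF s(1)] in \<open>auto simp: Eint_iff\<close>)
    qed
    then show False using e pq0 by simp
  qed
  have n1: "n \<bullet> (q - p) = 0" "n \<noteq> 0"
  proof -
    show "n \<bullet> (q - p) = 0" by (simp add: n_def nrm_inner)
    have "n \<bullet> (r - p) \<noteq> 0" using u by (auto simp: n_def nrm_inner)
    then show "n \<noteq> 0" by auto
  qed
  have ray: "pt {p,q,r} + t *\<^sub>R n \<in> cell e" if t: "t \<ge> 0" for t
  proof -
    have mx: "mins A w (pt {p,q,r}) = {p,q,r}" by (rule mins_pt[OF X])
    have A2: "p \<in> A" "q \<in> A" using TV_sub[OF X] by auto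
    have "w p + p \<bullet> (pt {p,q,r} + t *\<^sub>R n) \<le> w a + a \<bullet> (pt {p,q,r} + t *\<^sub>R n)" if a: "a \<in> A" for a
    proof -
      have "w p + p \<bullet> pt {p,q,r} \<le> w a + a \<bullet> pt {p,q,r}" using mins_le[of p A w "pt {p,q,r}" a] mx a by simp
      moreover have "t * (n \<bullet> (a - p)) \<ge> 0" using t pos[OF a] by simp
      ultimately show ?thesis by (simp add: inner_add_right inner_diff_right inner_commute[of _ n] algebra_simps)
    qed
    then have pm: "p \<in> mins A w (pt {p,q,r} + t *\<^sub>R n)" using A2 by (auto simp: mins_def)
    have "w p + p \<bullet> pt {p,q,r} = w q + q \<bullet> pt {p,q,r}" using mins_eq[of p A w "pt {p,q,r}" q] mx by auto
    moreover have "n \<bullet> q = n \<bullet> p" using n1(1) by (simp add: inner_diff_right)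
    ultimately have "w q + q \<bullet> (pt {p,q,r} + t *\<^sub>R n) \<le> w p + p \<bullet> (pt {p,q,r} + t *\<^sub>R n)"
      by (simp add: inner_add_right inner_commute[of _ n])
    then have "q \<in> mins A w (pt {p,q,r} + t *\<^sub>R n)" using mins_memI[OF pm A2(2)] by simp
    then show ?thesis using pm pq0 by (simp add: cell_def)
  qed
  show ?thesis
  proof
    assume "bounded (cell e)"
    then obtain B where B: "\<And>x. x \<in> cell e \<Longrightarrow> norm x \<le> B" unfolding bounded_iff by blast
    define t where "t = (\<bar>B\<bar> + norm (pt {p,q,r}) + 1) / norm n"
    have "t * norm n = \<bar>B\<bar> + norm (pt {p,q,r}) + 1" "t \<ge> 0" using n1 by (auto simp: t_def)
    then have tn: "norm (t *\<^sub>R n) = \<bar>B\<bar> + norm (pt {p,q,r}) + 1" by simp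
    have "norm (pt {p,q,r} + t *\<^sub>R n) \<le> B" using B ray \<open>t \<ge> 0\<close> by blast
    moreover have "norm (t *\<^sub>R n) \<le> norm (pt {p,q,r} + t *\<^sub>R n) + norm (pt {p,q,r})"
      using norm_triangle_ineq4[of "pt {p,q,r} + t *\<^sub>R n" "pt {p,q,r}"] by simp
    ultimately show False using tn by linarith
  qed
qed

lemma bounded_cells_eq:
  "{cell (mins A w x) | x. card (mins A w x) \<ge> 2 \<and> aff_dim (cell (mins A w x)) = 1 \<and> bounded (cell (mins A w x))} = cell ` Eint"
proof
  show "cell ` Eint \<subseteq> {cell (mins A w x) | x. card (mins A w x) \<ge> 2 \<and> aff_dim (cell (mins A w x)) = 1 \<and> bounded (cell (mins A w x))}"
  proof
    fix S assume "S \<in> cell ` Eint"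
    then obtain e where e: "e \<in> Eint" "S = cell e" by blast
    obtain x where x: "mins A w x = e" using interior_edge_cell(4)[OF e(1)] by blast
    obtain p q where "e = {p,q}" "p \<noteq> q" using Eint_memE[OF e(1)] by metis
    then have "card e = 2" by simp
    then show "S \<in> {cell (mins A w x) | x. card (mins A w x) \<ge> 2 \<and> aff_dim (cell (mins A w x)) = 1 \<and> bounded (cell (mins A w x))}"
      using x e interior_edge_cell[OF e(1)] by (intro CollectI exI[of _ x]) simp
  qed
  show "{cell (mins A w x) | x. card (mins A w x) \<ge> 2 \<and> aff_dim (cell (mins A w x)) = 1 \<and> bounded (cell (mins A w x))} \<subseteq> cell ` Eint"
  proof
    fix S assume "S \<in> {cell (mins A w x) | x. card (mins A w x) \<ge> 2 \<and> aff_dim (cell (mins A w x)) = 1 \<and> bounded (cell (mins A w x))}"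
    then obtain x where x: "S = cell (mins A w x)" "card (mins A w x) \<ge> 2" "aff_dim (cell (mins A w x)) = 1" "bounded (cell (mins A w x))"
      by blast
    have "card (mins A w x) \<noteq> 3"
    proof
      assume "card (mins A w x) = 3"
      then have "cell (mins A w x) = {pt (mins A w x)}" using cell_tri card3_mins by blast
      then show False using x(3) by simp
    qed
    then have "mins A w x \<in> Eall" using card2_mins x(2) card_mins_le[of x] by simp
    then have "mins A w x \<in> Eint" using boundary_edge_cell x(4) by blast
    then show "S \<in> cell ` Eint" using x(1) by blast
  qed
qed

lemma inj_cell: "inj_on cell Eint"
proof (rule inj_onI)
  fix e f assume ef: "e \<in> Eint" "f \<in> Eint" "cell e = cell f"
  obtain x where x: "mins A w x = e" using interior_edge_cell(4)[OF ef(1)] by blast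
  obtain y where y: "mins A w y = f" using interior_edge_cell(4)[OF ef(2)] by blast
  have "x \<in> cell f" "y \<in> cell e" using x y ef(3) by (auto simp: cell_def)
  then show "e = f" using x y by (auto simp: cell_def)
qed

lemma valence_cell:
  assumes "S \<subseteq> Eint" "X \<in> TV"
  shows "valence (cell ` S) (pt X) = card {e \<in> S. e \<subseteq> X}"
proof -
  have "{s \<in> cell ` S. pt X \<in> s} = cell ` {e \<in> S. e \<subseteq> X}" using pt_cell_iff[OF assms(2)] by auto
  moreover have "inj_on cell {e \<in> S. e \<subseteq> X}" using inj_cell assms(1) by (auto intro: inj_on_subset)
  ultimately show ?thesis unfolding valence_def by (simp add: card_image)
qed

section \<open>Pruning in terms of the triangulation\<close>

definition pr :: "plane set set \<Rightarrow> plane set set" where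
  "pr S = {e \<in> S. \<forall>X\<in>TV. e \<subseteq> X \<longrightarrow> card {f \<in> S. f \<subseteq> X} \<noteq> 1}"

lemma prI: "e \<in> S \<Longrightarrow> (\<And>X. X \<in> TV \<Longrightarrow> e \<subseteq> X \<Longrightarrow> card {f \<in> S. f \<subseteq> X} \<noteq> 1) \<Longrightarrow> e \<in> pr S"
  unfolding pr_def by blast

lemma prD: "e \<in> pr S \<Longrightarrow> X \<in> TV \<Longrightarrow> e \<subseteq> X \<Longrightarrow> card {f \<in> S. f \<subseteq> X} \<noteq> 1"
  unfolding pr_def by blast

lemma prune_cell:
  assumes S: "S \<subseteq> Eint" shows "prune (pt ` TV) (cell ` S) = cell ` pr S"
proof -
  have "(\<forall>v\<in>pt ` TV. v \<in> cell e \<longrightarrow> valence (cell ` S) v \<noteq> 1) \<longleftrightarrow> (\<forall>X\<in>TV. e \<subseteq> X \<longrightarrow> card {f \<in> S. f \<subseteq> X} \<noteq> 1)" for e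
    using pt_cell_iff valence_cell[OF S] by auto
  then show ?thesis unfolding prune_def pr_def by auto
qed

lemma pr_sub: "pr S \<subseteq> S"
  by (auto simp: pr_def)

lemma pr_pow_sub: "(pr ^^ n) Eint \<subseteq> Eint"
  by (induction n) (use pr_sub in auto)

lemma prune_pow: "(prune (pt ` TV) ^^ n) (cell ` Eint) = cell ` (pr ^^ n) Eint"
  by (induction n) (use prune_cell pr_pow_sub in auto)

lemma Live_pr_pow: "Live \<subseteq> (pr ^^ n) Eint"
proof (induction n)
  case (Suc n)
  have "e \<in> pr ((pr ^^ n) Eint)" if e: "e \<in> Live" for e
  proof (rule prI)
    show "e \<in> (pr ^^ n) Eint" using Suc e by blast
    fix X assume X: "X \<in> TV" "e \<subseteq> X"
    have "live_count X \<ge> 2" using live_count_ge2[OF X(1) e X(2)] .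
    moreover have "live_count X \<le> card {f \<in> (pr ^^ n) Eint. f \<subseteq> X}" unfolding live_count_def
      using Suc finEint pr_pow_sub[of n] by (intro card_mono) (auto intro: finite_subset)
    ultimately show "card {f \<in> (pr ^^ n) Eint. f \<subseteq> X} \<noteq> 1" by simp
  qed
  then show ?case by auto
qed (use Live_sub_Eint in simp)

lemma pr_fixpoint: "\<exists>n. (\<Inter>n. (pr ^^ n) Eint) = (pr ^^ n) Eint \<and> pr ((pr ^^ n) Eint) = (pr ^^ n) Eint"
proof -
  define f where "f n = card ((pr ^^ n) Eint)" for n
  have fin: "finite ((pr ^^ n) Eint)" for n using pr_pow_sub finEint finite_subset by blast
  obtain n where n: "\<And>m. f n \<le> f m" using ex_has_least_nat[of "\<lambda>_. True" _ f] by blast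
  have "pr ((pr ^^ n) Eint) = (pr ^^ n) Eint"
    using card_seteq[OF fin[of n] pr_sub] n[of "Suc n"] by (simp add: f_def)
  moreover have "(pr ^^ (n + k)) Eint = (pr ^^ n) Eint" for k
    by (induction k) (use calculation in auto)
  moreover have dec: "(pr ^^ (m + k)) Eint \<subseteq> (pr ^^ m) Eint" for m k
    by (induction k) (use pr_sub in auto)
  have "(pr ^^ n) Eint \<subseteq> (pr ^^ m) Eint" for m
  proof (cases "m \<le> n")
    case True then show ?thesis using dec[of m "n - m"] by simp
  next
    case False then show ?thesis using calculation(2)[of "m - n"] by simp
  qed
  then have "(\<Inter>n. (pr ^^ n) Eint) = (pr ^^ n) Eint" by blast
  ultimately show ?thesis by blast
qed

text \<open>Live edges survive since no triangle contains just one of them. If dead edges survived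
  as well, take a root triangle \<open>X\<close> of one of them with the largest gap at an interior
  point \<open>i\<close>. The final stage retains a second edge of \<open>X\<close>, which is dead
  too; its own root triangle lies behind it and has a larger gap at \<open>i\<close>.\<close>

lemma core_eq_Live:
  assumes I: "I \<noteq> {}" shows "(\<Inter>n. (pr ^^ n) Eint) = Live"
proof -
  obtain n where n: "(\<Inter>n. (pr ^^ n) Eint) = (pr ^^ n) Eint" "pr ((pr ^^ n) Eint) = (pr ^^ n) Eint"
    using pr_fixpoint by blast
  define S where "S = (pr ^^ n) Eint"
  have S: "pr S = S" "S \<subseteq> Eint" using n pr_pow_sub by (auto simp: S_def)
  obtain i where i: "i \<in> I" "i \<in> A" using I I_sub by blast
  have "S - Live = {}"
  proof (rule ccontr)
    assume ne: "S - Live \<noteq> {}"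
    define P where "P = {X. \<exists>e\<in>S - Live. root X e}"
    have "P \<subseteq> TV" using root_facts(1)[OF _ I] by (auto simp: P_def T0_def)
    then have "finite P" using finTV finite_subset by blast
    moreover have "P \<noteq> {}"
    proof -
      obtain e where e: "e \<in> S - Live" using ne by blast
      then have "e \<in> Eint - Live" using S by blast
      then obtain X where "root X e" using root_exists_tri by blast
      then show ?thesis using e by (auto simp: P_def)
    qed
    ultimately obtain X where X: "X \<in> P" "\<And>Y. Y \<in> P \<Longrightarrow> gap Y i \<le> gap X i"
      using arg_min_if_finite[of P "\<lambda>X. - gap X i"] by (metis neg_less_iff_less not_less)
    obtain e where e: "e \<in> S - Live" "root X e" using X(1) by (auto simp: P_def)
    note rf = root_facts[OF e(2) I]
    have XT: "X \<in> TV" "live_count X = 0" using rf(1) by (auto simp: T0_def)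
    have "card {f \<in> S. f \<subseteq> X} \<noteq> 1" using prD[of e S X] S(1) e(1) rf(3) XT(1) by simp
    then have "{f \<in> S. f \<subseteq> X} \<noteq> {e}" by auto
    then obtain f where f: "f \<in> S" "f \<subseteq> X" "f \<noteq> e" using e(1) rf(3) by blast
    have fL: "f \<notin> Live" using f(2) XT(2) unfolding live_count_zero_iff by blast
    then have "f \<in> Eint - Live" using f S by blast
    then obtain Y where Y: "root Y f" using root_exists_tri by blast
    have "Y \<noteq> X" using root_unique_edge[OF e(2) _ I, of f] Y f(3) by blast
    obtain a b s where y: "Y = {a,b,s}" "f = {a,b}" "ccw b a s" "\<forall>i\<in>I. cr (b - a) (i - a) > 0"
      using Y unfolding root_def by blast
    have E: "edg a b" using ccw_edg[OF y(3)] by blast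
    have "X \<in> {X \<in> TV. {a,b} \<subseteq> X}" using XT f y by auto
    then have "(\<exists>u. X = {a,b,u} \<and> ccw a b u) \<or> (\<exists>u. X = {a,b,u} \<and> ccw b a u)" unfolding tris_at_edge[OF E] by blast
    then obtain u where u: "X = {a,b,u}" "ccw a b u"
      using \<open>Y \<noteq> X\<close> y(1,3) ccw_unique by blast
    have TX: "{a,b,u} \<in> TV" and TY: "{a,b,s} \<in> TV" using u y by (auto simp: ccw_def insert_commute)
    note fl = flip[OF u(2) y(3)]
    have op: "cr (b - a) (u - a) * cr (b - a) (s - a) < 0" using fl by simp
    have "gap Y i = gap X i + gap {a,b,u} s * cr (b - a) (i - a)"
      using gap_cross[OF TX TY op, of i] unfolding u(1) y(1) by (simp add: nrm_inner fl)
    moreover have "gap {a,b,u} s * cr (b - a) (i - a) > 0" using cross(2)[OF TX TY op] y(4) i by simp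
    moreover have "Y \<in> P" using Y f fL by (auto simp: P_def)
    ultimately show False using X(2)[of Y] by simp
  qed
  moreover have "Live \<subseteq> S" using Live_pr_pow by (simp add: S_def)
  ultimately show ?thesis using n S_def by blast
qed

lemma core_edges_eq:
  assumes I: "I \<noteq> {}" shows "core_edges (pt ` TV) (cell ` Eint) = cell ` Live"
proof -
  have "core_edges (pt ` TV) (cell ` Eint) = (\<Inter>n. cell ` (pr ^^ n) Eint)"
    unfolding core_edges_def prune_pow ..
  also have "\<dots> = cell ` (\<Inter>n. (pr ^^ n) Eint)"
    by (rule image_INT[OF inj_cell, symmetric, of UNIV "\<lambda>n. (pr ^^ n) Eint" 0]) (use pr_pow_sub in auto)
  finally show ?thesis unfolding core_eq_Live[OF I] .
qed

lemma joined_eq: "joined (pt ` TV) (cell ` Live) = map_prod cell cell ` J"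
proof -
  have val: "valence (cell ` Live) (pt X) = live_count X" if "X \<in> TV" for X
    using valence_cell[OF Live_sub_Eint that] by (simp add: live_count_def)
  show ?thesis
  proof
    show "joined (pt ` TV) (cell ` Live) \<subseteq> map_prod cell cell ` J"
    proof
      fix z assume "z \<in> joined (pt ` TV) (cell ` Live)"
      then obtain e f X where h: "z = (cell e, cell f)" "e \<in> Live" "f \<in> Live" "X \<in> TV"
        "valence (cell ` Live) (pt X) = 2" "pt X \<in> cell e" "pt X \<in> cell f" unfolding joined_def by auto
      then have "X \<in> T2" "e \<subseteq> X" "f \<subseteq> X" using val pt_cell_iff by (auto simp: T2_def)
      then have "(e, f) \<in> J" using h by (auto simp: J_def)
      then show "z \<in> map_prod cell cell ` J" using h(1) by force
    qed
    show "map_prod cell cell ` J \<subseteq> joined (pt ` TV) (cell ` Live)"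
    proof
      fix z assume "z \<in> map_prod cell cell ` J"
      then obtain e f X where h: "z = (cell e, cell f)" "e \<in> Live" "f \<in> Live" "X \<in> T2" "e \<subseteq> X" "f \<subseteq> X"
        by (auto simp: J_def)
      have XT: "X \<in> TV" "live_count X = 2" using h by (auto simp: T2_def)
      have "valence (cell ` Live) (pt X) = 2" "pt X \<in> cell e" "pt X \<in> cell f" using val XT h pt_cell_iff by auto
      then show "z \<in> joined (pt ` TV) (cell ` Live)" unfolding joined_def using h XT by blast
    qed
  qed
qed

lemma skeleton_classes:
  "cell ` Live // (joined (pt ` TV) (cell ` Live))\<^sup>* = (\<lambda>L. cell ` L) ` live_classes"
proof -
  have "(joined (pt ` TV) (cell ` Live))\<^sup>* `` {cell e} = cell ` live_class e" if e: "e \<in> Live" for e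
  proof
    show "(joined (pt ` TV) (cell ` Live))\<^sup>* `` {cell e} \<subseteq> cell ` live_class e"
    proof
      fix s assume "s \<in> (joined (pt ` TV) (cell ` Live))\<^sup>* `` {cell e}"
      then have "(cell e, s) \<in> (joined (pt ` TV) (cell ` Live))\<^sup>*" by simp
      then show "s \<in> cell ` live_class e"
      proof (induction rule: rtrancl_induct)
        case base then show ?case using live_class_self by blast
      next
        case (step y z)
        then obtain f where f: "f \<in> live_class e" "y = cell f" by blast
        obtain f' g where fg: "(f', g) \<in> J" "y = cell f'" "z = cell g" using step(2) unfolding joined_eq by auto
        have "f \<in> Live" "f' \<in> Live" using f live_class_sub[OF e] fg by (auto simp: J_def)
        then have "f = f'" using inj_onD[OF inj_cell, of f f'] f fg Live_sub_Eint by auto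
        then have "g \<in> live_class e" using f(1) fg(1) unfolding live_class_def by (auto intro: rtrancl_into_rtrancl)
        then show ?case using fg(3) by blast
      qed
    qed
    show "cell ` live_class e \<subseteq> (joined (pt ` TV) (cell ` Live))\<^sup>* `` {cell e}"
    proof
      fix s assume "s \<in> cell ` live_class e"
      then obtain f where f: "(e, f) \<in> J\<^sup>*" "s = cell f" by (auto simp: live_class_def)
      have "(cell e, cell f) \<in> (joined (pt ` TV) (cell ` Live))\<^sup>*" using f(1)
      proof (induction rule: rtrancl_induct)
        case (step y z)
        have "(cell y, cell z) \<in> joined (pt ` TV) (cell ` Live)" unfolding joined_eq using step(2) by force
        then show ?case using step(3) by (rule rtrancl_into_rtrancl[rotated])
      qed simp
      then show "s \<in> (joined (pt ` TV) (cell ` Live))\<^sup>* `` {cell e}" using f(2) by simp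
    qed
  qed
  then show ?thesis unfolding quotient_def live_classes_eq by auto
qed

end

section \<open>Lattice polygons\<close>

lemma unimodular_triangle:
  assumes s: "2 simplex \<sigma>" and lat: "{v. v extreme_point_of \<sigma>} \<subseteq> lattice_points" and m: "measure lebesgue \<sigma> = 1 / 2"
  obtains p q r where "\<sigma> = convex hull {p,q,r}" "\<sigma> \<inter> lattice_points = {p,q,r}" "cr (q - p) (r - p) = 1"
    "\<not> affine_dependent {p,q,r}" "{v. v extreme_point_of \<sigma>} = {p,q,r}" "card {p,q,r} = 3"
proof -
  obtain C where C: "finite C" "\<not> affine_dependent C" "int (card C) = 2 + 1" "\<sigma> = convex hull C"
    using s unfolding simplex by blast
  have ext: "{v. v extreme_point_of \<sigma>} = C"
    using extreme_point_of_convex_hull_affine_independent[OF C(2)] C(4) by auto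
  have "card C = 3" using C(3) by simp
  then obtain p0 q0 r0 where C3: "C = {p0,q0,r0}" "p0 \<noteq> q0" "p0 \<noteq> r0" "q0 \<noteq> r0" unfolding card_3_iff by blast
  have "measure lebesgue \<sigma> = measure lborel \<sigma>"
    using C finite_imp_compact_convex_hull[OF C(1)] by (auto dest: compact_imp_closed)
  also have "\<dots> = \<bar>(r0 $ 1 - p0 $ 1) * (q0 $ 2 - p0 $ 2) - (q0 $ 1 - p0 $ 1) * (r0 $ 2 - p0 $ 2)\<bar> / 2"
    unfolding C(4) C3(1) by (rule content_triangle)
  also have "\<dots> = \<bar>cr (q0 - p0) (r0 - p0)\<bar> / 2"
    by (simp add: cr_def abs_if algebra_simps)
  finally have a: "\<bar>cr (q0 - p0) (r0 - p0)\<bar> = 1" using m by simp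
  have "\<exists>p q r. {p,q,r} = C \<and> cr (q - p) (r - p) = 1"
  proof (cases "cr (q0 - p0) (r0 - p0) = 1")
    case False
    then have "cr (r0 - p0) (q0 - p0) = 1" using a cr_skew[of "r0 - p0" "q0 - p0"] by auto
    moreover have "{p0,r0,q0} = C" using C3 by auto
    ultimately show ?thesis by blast
  qed (use C3 in blast)
  then obtain p q r where pqr: "{p,q,r} = C" "cr (q - p) (r - p) = 1" by blast
  have L: "p \<in> lattice_points" "q \<in> lattice_points" "r \<in> lattice_points" using lat ext pqr(1) by auto
  have "\<sigma> \<inter> lattice_points = {p,q,r}"
    using unimodular_triangle_lattice[OF pqr(2) L] L hull_subset[of C convex] pqr(1) C(4) by auto
  then show ?thesis using that[of p q r] C pqr ext \<open>card C = 3\<close> by simp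
qed

text \<open>The minimizers of a linear form are a face cut out by a supporting hyperplane, and a
  face of a convex hull is spanned by the generators that lie in it.\<close>

lemma mins_convex_hull:
  fixes A :: "plane set" and w :: "plane \<Rightarrow> real" and u :: plane
  assumes fin: "finite A" and A: "A \<noteq> {}"
  defines "P \<equiv> convex hull ((\<lambda>p. (p, w p)) ` A)"
  shows "{z \<in> P. \<forall>z'\<in>P. (u, 1) \<bullet> z \<le> (u, 1::real) \<bullet> z'} = convex hull ((\<lambda>p. (p, w p)) ` mins A w u)"
proof -
  define l where "l p = (p, w p)" for p :: plane
  have P: "P = convex hull (l ` A)" by (simp add: P_def l_def)
  obtain p0 where p0: "p0 \<in> mins A w u" using mins_nonempty[OF fin A, of w u] by blast
  define c where "c = w p0 + p0 \<bullet> u"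
  have val: "(u, 1) \<bullet> l p = w p + p \<bullet> u" for p by (simp add: l_def inner_commute)
  have "P \<subseteq> {z. (u, 1) \<bullet> z \<ge> c}" unfolding P
  proof (rule hull_minimal)
    show "l ` A \<subseteq> {z. (u, 1) \<bullet> z \<ge> c}" using mins_le[OF p0] val by (auto simp: c_def)
  qed (rule convex_halfspace_ge)
  then have ge: "(u, 1) \<bullet> z \<ge> c" if "z \<in> P" for z using that by blast
  have p0P: "l p0 \<in> P" "(u, 1) \<bullet> l p0 = c" unfolding P using subsetD[OF mins_sub p0] by (auto intro!: hull_inc simp: val c_def)
  define F where "F = P \<inter> {z. (u, 1) \<bullet> z = c}"
  have "{z \<in> P. \<forall>z'\<in>P. (u, 1) \<bullet> z \<le> (u, 1) \<bullet> z'} = F"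
  proof
    show "{z \<in> P. \<forall>z'\<in>P. (u, 1) \<bullet> z \<le> (u, 1) \<bullet> z'} \<subseteq> F"
      using ge p0P by (force simp: F_def)
    show "F \<subseteq> {z \<in> P. \<forall>z'\<in>P. (u, 1) \<bullet> z \<le> (u, 1) \<bullet> z'}" using ge by (auto simp: F_def)
  qed
  also have "F = convex hull (l ` mins A w u)"
  proof
    have "F face_of P" unfolding F_def
      by (rule face_of_Int_supporting_hyperplane_ge) (use ge in \<open>auto simp: P\<close>)
    then obtain S where S: "S \<subseteq> l ` A" "F = convex hull S"
      using face_of_convex_hull_subset[of "l ` A" F] fin unfolding P by (metis finite_imageI finite_imp_compact)
    have "S \<subseteq> l ` mins A w u"
    proof
      fix s assume s: "s \<in> S"
      then obtain p where p: "p \<in> A" "s = l p" using S by blast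
      have "s \<in> F" using S(2) s by (simp add: hull_inc)
      then have "w p + p \<bullet> u = c" using val p by (simp add: F_def)
      then have "p \<in> mins A w u" using mins_memI[OF p0 p(1)] by (simp add: c_def)
      then show "s \<in> l ` mins A w u" using p by blast
    qed
    then show "F \<subseteq> convex hull (l ` mins A w u)" unfolding S(2) by (rule hull_mono)
    have "convex F" unfolding F_def P using convex_hyperplane[of "(u,1)" c] by (intro convex_Int convex_convex_hull) auto
    moreover have "l ` mins A w u \<subseteq> F"
    proof
      fix s assume "s \<in> l ` mins A w u"
      then obtain p where p: "p \<in> mins A w u" "s = l p" by blast
      then have "p \<in> A" using mins_sub by blast
      then have "s \<in> P" unfolding P p(2) by (intro hull_inc imageI)
      moreover have "(u, 1) \<bullet> s = c" using val mins_eq[OF p(1) p0] p(2) by (simp add: c_def)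
      ultimately show "s \<in> F" by (simp add: F_def)
    qed
    ultimately show "convex hull (l ` mins A w u) \<subseteq> F" by (rule hull_minimal[rotated])
  qed
  finally show ?thesis by (simp add: l_def)
qed

section \<open>From polygons and triangles to finite sets of lattice points\<close>

locale polygon_triangulation =
  fixes D :: "plane set" and \<T> :: "plane set set"
  assumes poly: "lattice_polygon D" and nonhyp: "nonhyperelliptic D"
    and tri: "lattice_triangulation D \<T>" and unim: "unimodular \<T>"
begin

definition A :: "plane set" where "A = D \<inter> lattice_points"

text \<open>A unimodular triangle has no lattice points but its corners, so it can be recovered from
  the set of its lattice points, see \<open>tile_hull\<close>.\<close>

definition TV :: "plane set set" where "TV = (\<lambda>\<sigma>. \<sigma> \<inter> lattice_points) ` \<T>"

lemma compact_D: "compact D"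
  using poly unfolding lattice_polygon_def by (auto intro: finite_imp_compact_convex_hull)

lemma convex_D: "convex D"
  using poly unfolding lattice_polygon_def by auto

lemma finite_lattice_bounded: assumes "bounded S" shows "finite (S \<inter> lattice_points)"
proof -
  obtain B where B: "\<And>x. x \<in> S \<Longrightarrow> norm x \<le> B" using assms unfolding bounded_iff by blast
  define N where "N = \<lceil>B\<rceil>"
  have "S \<inter> lattice_points \<subseteq> (\<lambda>(m,n). vector [of_int m, of_int n]) ` ({-N..N} \<times> {-N..N})"
  proof
    fix x assume x: "x \<in> S \<inter> lattice_points"
    then obtain m n where mn: "x$1 = of_int m" "x$2 = of_int n"
      unfolding lattice_points_def by (metis (mono_tags, lifting) IntD2 Ints_cases mem_Collect_eq)
    have "\<bar>x$1\<bar> \<le> B" "\<bar>x$2\<bar> \<le> B" using B[of x] x component_le_norm_cart[of x] by (auto intro: order_trans)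
    then have "\<bar>real_of_int m\<bar> \<le> of_int N" "\<bar>real_of_int n\<bar> \<le> of_int N" using mn by (auto simp: N_def intro: order_trans[OF _ le_of_int_ceiling])
    then have "m \<in> {-N..N}" "n \<in> {-N..N}" by (auto simp: abs_le_iff simp flip: of_int_minus)
    moreover have "x = vector [of_int m, of_int n]" using mn by (simp add: plane_eq_iff)
    ultimately show "x \<in> (\<lambda>(m,n). vector [of_int m, of_int n]) ` ({-N..N} \<times> {-N..N})" by force
  qed
  then show ?thesis by (rule finite_subset) auto
qed

lemma fin_A: "finite A"
  unfolding A_def by (rule finite_lattice_bounded) (rule compact_imp_bounded[OF compact_D])

lemma D_hull: "D = convex hull A"
proof
  obtain S where S: "S \<subseteq> lattice_points" "D = convex hull S" using poly unfolding lattice_polygon_def by blast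
  then have "S \<subseteq> D" using hull_subset[of S convex] by simp
  then have "S \<subseteq> A" using S(1) by (auto simp: A_def)
  then show "D \<subseteq> convex hull A" unfolding S(2) by (rule hull_mono)
  show "convex hull A \<subseteq> D" by (rule hull_minimal) (use convex_D in \<open>auto simp: A_def\<close>)
qed

lemma tile_triangle:
  assumes "\<sigma> \<in> \<T>"
  obtains p q r where "\<sigma> = convex hull {p,q,r}" "\<sigma> \<inter> lattice_points = {p,q,r}" "cr (q - p) (r - p) = 1"
    "\<not> affine_dependent {p,q,r}" "{v. v extreme_point_of \<sigma>} = {p,q,r}" "card {p,q,r} = 3"
proof -
  have "2 simplex \<sigma>" "{v. v extreme_point_of \<sigma>} \<subseteq> lattice_points" "measure lebesgue \<sigma> = 1 / 2"
    using tri unim assms unfolding lattice_triangulation_def unimodular_def by auto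
  from unimodular_triangle[OF this] that show ?thesis by metis
qed

lemma tile_hull: "\<sigma> \<in> \<T> \<Longrightarrow> convex hull (\<sigma> \<inter> lattice_points) = \<sigma>"
  by (metis tile_triangle)

lemma tiles_union: "\<Union>\<T> = D"
  using tri unfolding lattice_triangulation_def by blast

lemma TV_tri: assumes "X \<in> TV"
  shows "\<exists>p q r. X = {p,q,r} \<and> p \<in> A \<and> q \<in> A \<and> r \<in> A \<and> cr (q - p) (r - p) = 1"
proof -
  obtain \<sigma> where s: "\<sigma> \<in> \<T>" "X = \<sigma> \<inter> lattice_points" using assms by (auto simp: TV_def)
  obtain p q r where pqr: "\<sigma> \<inter> lattice_points = {p,q,r}" "cr (q - p) (r - p) = 1" using tile_triangle[OF s(1)] by metis
  have "X \<subseteq> A" using s tiles_union by (auto simp: A_def)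
  then show ?thesis using pqr s(2) by auto
qed

lemma TV_cover: assumes "z \<in> convex hull A" shows "\<exists>X\<in>TV. z \<in> convex hull X"
proof -
  have "z \<in> \<Union>\<T>" using assms D_hull tiles_union by simp
  then obtain \<sigma> where "\<sigma> \<in> \<T>" "z \<in> \<sigma>" by blast
  then show ?thesis using tile_hull by (auto simp: TV_def)
qed

lemma A_nonempty: "A \<noteq> {}"
proof
  assume "A = {}"
  then have "D = {}" using D_hull by simp
  then show False using poly by (simp add: lattice_polygon_def)
qed

definition ind :: "(plane \<Rightarrow> real) \<Rightarrow> bool" where
  "ind w \<longleftrightarrow> (\<forall>X\<in>TV. \<exists>x. mins A w x = X)"

lemma regtri_ind: "ind w \<Longrightarrow> regtri A TV w"
  using fin_A TV_tri TV_cover A_nonempty by unfold_locales (auto simp: ind_def A_def)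

lemma lower_face:
  "lower_face_of F (lifted_polytope D w) \<longleftrightarrow> (\<exists>u. F = convex hull ((\<lambda>p. (p, w p)) ` mins A w u))"
  unfolding lower_face_of_def lifted_polytope_def A_def[symmetric] mins_convex_hull[OF fin_A A_nonempty] ..

lemma fst_lift: "fst ` (convex hull ((\<lambda>p. (p, w p)) ` S)) = convex hull S"
proof -
  have "fst ` (convex hull ((\<lambda>p. (p, w p)) ` S)) = convex hull (fst ` (\<lambda>p. (p, w p)) ` S)"
    by (rule convex_hull_linear_image[OF linear_fst])
  then show ?thesis by (simp add: image_image)
qed

text \<open>The less obvious point is that minimality of the given triangles excludes other faces: a
  lower face of dimension 2 has at least three minimizers, and as the triangles cover the polygon,
  \<open>mins_sub_TV\<close> makes them the corners of one triangle.\<close>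

lemma induces_iff_ind: "induces D w \<T> \<longleftrightarrow> ind w"
proof
  assume ih: "induces D w \<T>"
  show "ind w" unfolding ind_def
  proof
    fix X assume "X \<in> TV"
    then obtain \<sigma> where s: "\<sigma> \<in> \<T>" "X = \<sigma> \<inter> lattice_points" by (auto simp: TV_def)
    obtain F where F: "\<sigma> = fst ` F" "lower_face_of F (lifted_polytope D w)"
      using ih s(1) unfolding induces_def by blast
    obtain u where u: "F = convex hull ((\<lambda>p. (p, w p)) ` mins A w u)" using F(2) lower_face by blast
    have sh: "\<sigma> = convex hull (mins A w u)" using F(1) u fst_lift by simp
    obtain p q r where pqr: "\<sigma> \<inter> lattice_points = {p,q,r}" "{v. v extreme_point_of \<sigma>} = {p,q,r}"
      using tile_triangle[OF s(1)] by metis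
    have "{v. v extreme_point_of \<sigma>} \<subseteq> mins A w u"
      unfolding sh using extreme_point_of_convex_hull by blast
    moreover have "mins A w u \<subseteq> \<sigma> \<inter> lattice_points"
      using hull_subset[of "mins A w u" convex] sh mins_sub[of A w u] by (auto simp: A_def)
    ultimately have "mins A w u = X" using s(2) pqr by auto
    then show "\<exists>x. mins A w x = X" by blast
  qed
next
  assume i: "ind w"
  interpret regtri A TV w by (rule regtri_ind[OF i])
  show "induces D w \<T>" unfolding induces_def
  proof
    show "\<T> \<subseteq> {fst ` F |F. lower_face_of F (lifted_polytope D w) \<and> aff_dim F = 2}"
    proof
      fix \<sigma> assume s: "\<sigma> \<in> \<T>"
      obtain p q r where pqr: "\<sigma> = convex hull {p,q,r}" "\<sigma> \<inter> lattice_points = {p,q,r}" "\<not> affine_dependent {p,q,r}" "card {p,q,r} = 3"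
        using tile_triangle[OF s] by metis
      have "{p,q,r} \<in> TV" unfolding TV_def by (rule image_eqI[where x = \<sigma>]) (simp_all only: pqr(2) s)
      then obtain x where x: "mins A w x = {p,q,r}" using i unfolding ind_def by blast
      define F where "F = convex hull ((\<lambda>p. (p, w p)) ` {p,q,r})"
      have fF: "fst ` F = \<sigma>" unfolding F_def fst_lift pqr(1) ..
      have "aff_dim \<sigma> = 2" using aff_dim_affine_independent[OF pqr(3)] pqr(1,4) by (simp add: aff_dim_convex_hull)
      moreover have "aff_dim (fst ` F) \<le> aff_dim F" by (rule aff_dim_linear_image_le[OF linear_fst])
      moreover have "aff_dim F \<le> 2"
      proof -
        have "aff_dim F \<le> int (card ((\<lambda>p. (p, w p)) ` {p,q,r})) - 1" unfolding F_def aff_dim_convex_hull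
          by (rule aff_dim_le_card) simp
        also have "card ((\<lambda>p. (p, w p)) ` {p,q,r}) \<le> card {p,q,r}" by (rule card_image_le) simp
        finally show ?thesis using pqr(4) by simp
      qed
      ultimately have "aff_dim F = 2" using fF by simp
      moreover have "lower_face_of F (lifted_polytope D w)" unfolding lower_face F_def x[symmetric] by blast
      ultimately show "\<sigma> \<in> {fst ` F |F. lower_face_of F (lifted_polytope D w) \<and> aff_dim F = 2}" using fF by blast
    qed
    show "{fst ` F |F. lower_face_of F (lifted_polytope D w) \<and> aff_dim F = 2} \<subseteq> \<T>"
    proof
      fix \<sigma> assume "\<sigma> \<in> {fst ` F |F. lower_face_of F (lifted_polytope D w) \<and> aff_dim F = 2}"
      then obtain u where u: "\<sigma> = fst ` (convex hull ((\<lambda>p. (p, w p)) ` mins A w u))"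
        "aff_dim (convex hull ((\<lambda>p. (p, w p)) ` mins A w u)) = 2" unfolding lower_face by blast
      have fm: "finite (mins A w u)" using mins_sub fin_A finite_subset by metis
      have "aff_dim ((\<lambda>p. (p, w p)) ` mins A w u) \<le> int (card ((\<lambda>p. (p, w p)) ` mins A w u)) - 1"
        by (rule aff_dim_le_card) (use fm in simp)
      moreover have "card ((\<lambda>p. (p, w p)) ` mins A w u) \<le> card (mins A w u)" by (rule card_image_le[OF fm])
      ultimately have "card (mins A w u) \<ge> 3" using u(2) by (simp add: aff_dim_convex_hull)
      then have "card (mins A w u) = 3" using card_mins_le[of u] by simp
      then have "mins A w u \<in> TV" by (rule card3_mins)
      then obtain \<tau> where t: "\<tau> \<in> \<T>" "mins A w u = \<tau> \<inter> lattice_points" by (auto simp: TV_def)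
      have "\<sigma> = \<tau>" unfolding u(1) fst_lift t(2) by (rule tile_hull[OF t(1)])
      then show "\<sigma> \<in> \<T>" using t by simp
    qed
  qed
qed

lemma interior_D: "interior D \<noteq> {}" "rel_interior D = interior D"
proof -
  have a: "affine hull D = UNIV" using poly aff_dim_eq_full[of D] by (simp add: lattice_polygon_def)
  then show r: "rel_interior D = interior D" by (rule rel_interior_interior)
  have "D \<noteq> {}" using A_nonempty by (auto simp: A_def)
  then show "interior D \<noteq> {}" using rel_interior_eq_empty[OF convex_D] r by simp
qed

text \<open>Interior points of a convex set are those without a supporting line; as the polygon is
  the hull of \<open>A\<close>, it suffices to test points of \<open>A\<close>.\<close>

lemma I_eq: assumes "regtri A TV w" shows "regtri.I A = interior D \<inter> lattice_points"
proof -
  interpret regtri A TV w by (rule assms)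
  show ?thesis
  proof
    show "I \<subseteq> interior D \<inter> lattice_points"
    proof
      fix p assume p: "p \<in> I"
      have pA: "p \<in> A" using p I_sub by blast
      have "p \<in> interior D"
      proof (rule ccontr)
        assume n: "p \<notin> interior D"
        obtain a where a: "a \<noteq> 0" "\<And>y. y \<in> D \<Longrightarrow> a \<bullet> p \<le> a \<bullet> y"
          by (rule supporting_hyperplane_rel_boundary[of D p]) (use convex_D n interior_D pA in \<open>auto simp: A_def\<close>)
        obtain x where "x \<in> A" "(-a) \<bullet> (x - p) > 0" using I_dir[OF p, of "-a"] a(1) by auto
        then show False using a(2)[of x] by (auto simp: A_def inner_diff_right)
      qed
      then show "p \<in> interior D \<inter> lattice_points" using pA by (auto simp: A_def)
    qed
    show "interior D \<inter> lattice_points \<subseteq> I"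
    proof
      fix p assume p: "p \<in> interior D \<inter> lattice_points"
      then have pA: "p \<in> A" using interior_subset by (auto simp: A_def)
      have "\<exists>a\<in>A. d \<bullet> (a - p) > 0" if d: "d \<noteq> 0" for d
      proof (rule ccontr)
        assume n: "\<not> ?thesis"
        have "convex hull A \<subseteq> {x. d \<bullet> x \<le> d \<bullet> p}"
          by (rule hull_minimal) (use n in \<open>auto simp: inner_diff_right not_less convex_halfspace_le\<close>)
        then have Dp: "D \<subseteq> {x. d \<bullet> x \<le> d \<bullet> p}" using D_hull by simp
        obtain e where e: "e > 0" "cball p e \<subseteq> D" using p mem_interior_cball by blast
        define x where "x = p + (e / norm d) *\<^sub>R d"
        have "x \<in> cball p e" using e d by (simp add: x_def dist_norm)
        then have "d \<bullet> x \<le> d \<bullet> p" using e Dp by blast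
        moreover have "d \<bullet> x = d \<bullet> p + (e / norm d) * (d \<bullet> d)" by (simp add: x_def inner_add_right)
        moreover have "(e / norm d) * (d \<bullet> d) > 0" using e d by simp
        ultimately show False by simp
      qed
      then show "p \<in> I" using pA by (simp add: I_def)
    qed
  qed
qed

lemma interior_polygon_eq: "regtri A TV w \<Longrightarrow> interior_polygon D = convex hull (regtri.I A)"
  unfolding interior_polygon_def using I_eq by simp

lemma genus_eq: "regtri A TV w \<Longrightarrow> genus D = card (regtri.I A)"
  unfolding genus_def using I_eq by simp

text \<open>The interior of the polygon is convex and so contains \<open>K\<close>; hence
  \<open>K\<close> has no lattice points besides those of \<open>I\<close>.\<close>

lemma K_facts:
  assumes "regtri A TV w"
  shows "interior (convex hull (regtri.I A)) \<noteq> {}" "card (regtri.I A) \<ge> 2"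
    "frontier (convex hull (regtri.I A)) \<inter> lattice_points = regtri.I A - interior (convex hull (regtri.I A))"
    "interior (convex hull (regtri.I A)) \<inter> lattice_points = regtri.I A \<inter> interior (convex hull (regtri.I A))"
proof -
  interpret regtri A TV w by (rule assms)
  have d: "aff_dim K = 2" using nonhyp interior_polygon_eq[OF assms] by (simp add: nonhyperelliptic_def)
  then have a: "affine hull K = UNIV" using aff_dim_eq_full[of K] by simp
  have r: "rel_interior K = interior K" by (rule rel_interior_interior[OF a])
  have ne: "K \<noteq> {}" using d by auto
  then show "interior K \<noteq> {}" using rel_interior_eq_empty[of K] convex_convex_hull[of I] r by simp
  have "aff_dim I \<le> int (card I) - 1" by (rule aff_dim_le_card[OF finI])
  then show "card I \<ge> 2" using d by (simp add: aff_dim_convex_hull)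
  have KD: "K \<subseteq> interior D"
    by (rule hull_minimal) (use I_eq[OF assms] convex_interior[OF convex_D] in auto)
  have lat: "K \<inter> lattice_points = I"
  proof
    show "K \<inter> lattice_points \<subseteq> I" using KD I_eq[OF assms] by blast
    show "I \<subseteq> K \<inter> lattice_points" using I_eq[OF assms] I_K by blast
  qed
  have cl: "closed K" by (rule compact_imp_closed[OF finite_imp_compact_convex_hull[OF finI]])
  then have "frontier K = K - interior K" by (simp add: frontier_def closure_closed)
  then show "frontier K \<inter> lattice_points = I - interior K" using lat by blast
  show "interior K \<inter> lattice_points = I \<inter> interior K" using lat interior_subset[of K] by blast
qed

lemma edges_eq:
  assumes "regtri A TV w" shows "edges \<T> = (\<lambda>e. convex hull e) ` regtri.Eall TV"
proof -
  interpret regtri A TV w by (rule assms)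
  show ?thesis
  proof
    show "edges \<T> \<subseteq> (\<lambda>e. convex hull e) ` Eall"
    proof
      fix e assume "e \<in> edges \<T>"
      then obtain \<sigma> where s: "\<sigma> \<in> \<T>" "e edge_of \<sigma>" unfolding edges_def by blast
      obtain p q r where pqr: "\<sigma> = convex hull {p,q,r}" "\<sigma> \<inter> lattice_points = {p,q,r}" "\<not> affine_dependent {p,q,r}"
        using tile_triangle[OF s(1)] by metis
      have X: "{p,q,r} \<in> TV" unfolding TV_def by (rule image_eqI[where x = \<sigma>]) (simp_all only: pqr(2) s(1))
      have "e face_of convex hull {p,q,r}" "aff_dim e = 1" using s(2) pqr(1) by (auto simp: edge_of_def)
      then obtain c where c: "c \<subseteq> {p,q,r}" "e = convex hull c"
        using face_of_convex_hull_affine_independent[OF pqr(3)] by blast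
      have "aff_dim e = int (card c) - 1"
        using c(2) aff_dim_affine_independent[OF affine_independent_subset[OF pqr(3) c(1)]]
        by (simp add: aff_dim_convex_hull)
      then have "card c = 2" using \<open>aff_dim e = 1\<close> by simp
      then obtain a b where ab: "c = {a,b}" "a \<noteq> b" by (meson card_2_iff)
      then have "c \<in> Eall" using edgI[OF ab(2) X] c(1) by simp
      then show "e \<in> (\<lambda>e. convex hull e) ` Eall" using c(2) by blast
    qed
    show "(\<lambda>e. convex hull e) ` Eall \<subseteq> edges \<T>"
    proof
      fix e assume "e \<in> (\<lambda>e. convex hull e) ` Eall"
      then obtain a b X where ab: "e = convex hull {a,b}" "a \<noteq> b" "X \<in> TV" "a \<in> X" "b \<in> X"
        unfolding Eall_def by blast
      obtain \<sigma> where s: "\<sigma> \<in> \<T>" "X = \<sigma> \<inter> lattice_points" using ab(3) by (auto simp: TV_def)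
      obtain p q r where pqr: "\<sigma> = convex hull {p,q,r}" "\<sigma> \<inter> lattice_points = {p,q,r}" "\<not> affine_dependent {p,q,r}"
        using tile_triangle[OF s(1)] by metis
      have sub: "{a,b} \<subseteq> {p,q,r}" using ab s pqr(2) by auto
      then have "e face_of \<sigma>" unfolding pqr(1) face_of_convex_hull_affine_independent[OF pqr(3)] using ab(1) by blast
      moreover have "aff_dim e = 1" unfolding ab(1) aff_dim_convex_hull using ab(2) by (simp add: aff_dim_2)
      ultimately show "e \<in> edges \<T>" unfolding edges_def edge_of_def using s(1) by blast
    qed
  qed
qed

lemma hull_edge_lattice:
  assumes "regtri A TV w" and e: "e \<in> regtri.Eall TV"
  shows "convex hull e \<inter> lattice_points = e"
proof -
  interpret regtri A TV w by (rule assms)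
  obtain p q where pq: "e = {p,q}" using e unfolding Eall_def by blast
  obtain r where X: "{p,q,r} \<in> TV" using edgE[of p q] e pq by metis
  obtain \<sigma> where s: "\<sigma> \<in> \<T>" "{p,q,r} = \<sigma> \<inter> lattice_points" using X by (auto simp: TV_def)
  have "convex hull {p,q,r} = \<sigma>" using tile_hull[OF s(1)] s(2) by simp
  moreover have "convex hull {p,q} \<subseteq> convex hull {p,q,r}" by (rule hull_mono) auto
  ultimately have sub: "convex hull {p,q} \<inter> lattice_points \<subseteq> {p,q,r}" using s(2) by auto
  have "r \<notin> convex hull {p,q}"
  proof
    assume "r \<in> convex hull {p,q}"
    then obtain u v where "u + v = 1" "r = u *\<^sub>R p + v *\<^sub>R q" unfolding convex_hull_2 by blast
    then have "u = 1 - v" by simp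
    then have "r - p = v *\<^sub>R (q - p)" using \<open>r = u *\<^sub>R p + v *\<^sub>R q\<close> by (simp add: scaleR_diff_left scaleR_diff_right)
    then have "cr (q - p) (r - p) = 0" by simp
    then show False using TV_unit[OF X] by simp
  qed
  moreover have "{p,q} \<subseteq> lattice_points" using TV_sub[OF X] latA by auto
  ultimately show ?thesis unfolding pq using sub hull_subset[of "{p,q}" convex] by blast
qed

text \<open>The end of a radial edge at \<open>p\<close> that is interior to the polygon must be
  \<open>p\<close>, as the other end is on the frontier. The point shared with \<open>K\<close> is
  then \<open>p\<close> too.\<close>

lemma radial_edges_at_eq:
  assumes R: "regtri A TV w" and p: "p \<in> regtri.I A"
  shows "radial_edges_at D \<T> p = closed_segment p ` regtri.radial_nbrs A TV p"
proof -
  interpret regtri A TV w by (rule R)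
  have pD: "p \<in> interior D \<inter> lattice_points" using p I_eq[OF R] by simp
  have frD: "frontier D = D - interior D" using compact_imp_closed[OF compact_D] by (simp add: frontier_def closure_closed)
  show ?thesis
  proof
    show "radial_edges_at D \<T> p \<subseteq> closed_segment p ` radial_nbrs p"
    proof
      fix e assume "e \<in> radial_edges_at D \<T> p"
      then have e: "e \<in> edges \<T>" "p extreme_point_of e" and ex: "\<exists>x. e \<inter> interior_polygon D = {x}"
        and pq: "\<exists>p q. e = closed_segment p q \<and> p \<in> interior D \<inter> lattice_points \<and> q \<in> frontier D \<inter> lattice_points"
        unfolding radial_edges_at_def radial_edges_def by auto
      obtain p' q where q: "e = closed_segment p' q" "p' \<in> interior D" "q \<in> frontier D \<inter> lattice_points" using pq by blast
      have "p = p' \<or> p = q" using e(2) unfolding q(1) extreme_point_of_segment by simp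
      then have pp: "p = p'" using q(3) pD frD by blast
      have K: "interior_polygon D = K" by (rule interior_polygon_eq[OF R])
      have "p \<in> e \<inter> K" using I_K[OF p] q(1) pp by auto
      moreover obtain x where "e \<inter> K = {x}" using ex K by auto
      ultimately have "e \<inter> K = {p}" by (metis singletonD)
      have "edg p q"
      proof -
        obtain f where f: "f \<in> Eall" "e = convex hull f" using e(1) edges_eq[OF R] by blast
        obtain a b where ab: "f = {a,b}" using f(1) unfolding Eall_def by blast
        have "closed_segment a b = closed_segment p q" using f ab q(1) pp by (simp add: segment_convex_hull)
        then have "{a,b} = {p,q}" by (rule closed_segment_eq[THEN iffD1])
        then show ?thesis using f(1) ab by simp
      qed
      moreover have "q \<notin> I" using q(3) frD I_eq[OF R] by blast
      ultimately have "q \<in> radial_nbrs p" using q(1) pp \<open>e \<inter> K = {p}\<close> by (simp add: radial_nbrs_def)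
      then show "e \<in> closed_segment p ` radial_nbrs p" using q(1) pp by blast
    qed
    show "closed_segment p ` radial_nbrs p \<subseteq> radial_edges_at D \<T> p"
    proof
      fix e assume "e \<in> closed_segment p ` radial_nbrs p"
      then obtain a where a: "a \<in> radial_nbrs p" "e = closed_segment p a" by blast
      have E: "edg p a" "a \<notin> I" "closed_segment p a \<inter> K = {p}" using a(1) by (auto simp: radial_nbrs_def)
      have aA: "a \<in> A" using edg_A[OF E(1)] by blast
      then have "a \<in> frontier D \<inter> lattice_points" using E(2) I_eq[OF R] frD by (auto simp: A_def)
      moreover have "e \<in> edges \<T>" unfolding edges_eq[OF R] a(2) segment_convex_hull using E(1) by blast
      moreover have "p extreme_point_of e" unfolding a(2) extreme_point_of_segment by simp
      moreover have "e \<inter> interior_polygon D = {p}" using E(3) a(2) interior_polygon_eq[OF R] by simp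
      ultimately show "e \<in> radial_edges_at D \<T> p"
        unfolding radial_edges_at_def radial_edges_def using a(2) pD by blast
    qed
  qed
qed

lemma card_radial_edges_at:
  assumes R: "regtri A TV w" and p: "p \<in> regtri.I A"
  shows "card (radial_edges_at D \<T> p) = card (regtri.radial_nbrs A TV p)"
proof -
  have "inj_on (closed_segment p) (regtri.radial_nbrs A TV p)"
  proof (rule inj_onI)
    fix a b assume "closed_segment p a = closed_segment p b"
    then have "{p,a} = {p,b}" by (rule closed_segment_eq[THEN iffD1])
    then show "a = b" by (auto simp: doubleton_eq_iff)
  qed
  then show ?thesis unfolding radial_edges_at_eq[OF assms] by (rule card_image)
qed

lemma radial_ends_eq:
  assumes R: "regtri A TV w" and p: "p \<in> regtri.I A"
  shows "radial_ends D \<T> p = regtri.radial_nbrs A TV p"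
proof -
  interpret regtri A TV w by (rule R)
  have pD: "p \<in> interior D" using p I_eq[OF R] by simp
  have frD: "frontier D = D - interior D" using compact_imp_closed[OF compact_D] by (simp add: frontier_def closure_closed)
  have "a \<in> frontier D" if "a \<in> radial_nbrs p" for a
  proof -
    have "a \<in> A" "a \<notin> I" using that edg_A by (auto simp: radial_nbrs_def)
    then show ?thesis using I_eq[OF R] frD by (auto simp: A_def)
  qed
  moreover have "p \<notin> frontier D" using pD frD by blast
  ultimately show ?thesis unfolding radial_ends_def radial_edges_at_eq[OF assms]
    by (auto simp: extreme_point_of_segment)
qed

lemma b12_eq:
  assumes R: "regtri A TV w"
  shows "b1 D \<T> = card {p \<in> regtri.I A - interior (convex hull (regtri.I A)). card (regtri.radial_nbrs A TV p) = 1}"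
    and "b2 D \<T> = card {p \<in> regtri.I A - interior (convex hull (regtri.I A)). card (regtri.radial_nbrs A TV p) \<ge> 2 \<and> collinear (regtri.radial_nbrs A TV p)}"
proof -
  interpret regtri A TV w by (rule R)
  have fr: "frontier (interior_polygon D) \<inter> lattice_points = I - interior K"
    unfolding interior_polygon_eq[OF R] by (rule K_facts(3)[OF R])
  have "{p \<in> frontier (interior_polygon D) \<inter> lattice_points. card (radial_edges_at D \<T> p) = 1} = {p \<in> I - interior K. card (radial_nbrs p) = 1}"
    unfolding fr using card_radial_edges_at[OF R] by auto
  then show "b1 D \<T> = card {p \<in> I - interior K. card (radial_nbrs p) = 1}" unfolding b1_def by simp
  have "{p \<in> frontier (interior_polygon D) \<inter> lattice_points. card (radial_edges_at D \<T> p) \<ge> 2 \<and> collinear (radial_ends D \<T> p)}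
    = {p \<in> I - interior K. card (radial_nbrs p) \<ge> 2 \<and> collinear (radial_nbrs p)}"
    unfolding fr using card_radial_edges_at[OF R] radial_ends_eq[OF R] by auto
  then show "b2 D \<T> = card {p \<in> I - interior K. card (radial_nbrs p) \<ge> 2 \<and> collinear (radial_nbrs p)}" unfolding b2_def by simp
qed

lemma rank_formula:
  assumes R: "regtri A TV w"
  shows "int (dim (regtri.skel_lengths A TV ` coord_space A)) =
    3 * int (genus D) - 3 - 2 * int (genus (interior_polygon D)) - 2 * int (b1 D \<T>) - int (b2 D \<T>)"
proof -
  interpret regtri A TV w by (rule R)
  have "genus (interior_polygon D) = card (I \<inter> interior K)"
    unfolding genus_def interior_polygon_eq[OF R] K_facts(4)[OF R] ..
  then show ?thesis
    using dim_skel_lengths_image[OF K_facts(2)[OF R]] sum_dim_chain_dirs[OF K_facts(1)[OF R]] b12_eq[OF R] genus_eq[OF R] by linarith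
qed

section \<open>The skeleton and the edge lengths of the given curve\<close>

lemma minimizers_eq: "minimizers D w x = mins A w x"
  unfolding minimizers_def mins_def A_def ..

lemma dual_edge_eq:
  assumes R: "regtri A TV w" and e: "e \<in> regtri.Eall TV"
  shows "dual_edge D w (convex hull e) = regtri.cell A w e"
proof -
  interpret regtri A TV w by (rule R)
  have "card (mins A w x) \<ge> 2" if "e \<subseteq> mins A w x" for x
  proof -
    obtain p q where pq: "e = {p,q}" "p \<noteq> q" using e unfolding Eall_def by blast
    have "card e \<le> card (mins A w x)" using that fin_A mins_sub finite_subset by (metis card_mono)
    then show ?thesis using pq by simp
  qed
  then show ?thesis
    unfolding dual_edge_def tropical_curve_def minimizers_eq hull_edge_lattice[OF R e] cell_def by auto
qed

lemma skeleton_edges_eq: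
  assumes R: "regtri A TV w"
  shows "skeleton_edges D w = (\<lambda>L. regtri.cell A w ` L) ` regtri.live_classes A TV"
proof -
  interpret regtri A TV w by (rule R)
  have cc: "curve_cell D w x = cell (mins A w x)" for x
    unfolding curve_cell_def minimizers_eq cell_def ..
  have V: "curve_vertices D w = pt ` TV"
    unfolding curve_vertices_def tropical_curve_def minimizers_eq cc vertices_eq[symmetric] by blast
  have E: "bounded_edges D w = cell ` Eint"
    unfolding bounded_edges_def tropical_curve_def minimizers_eq cc bounded_cells_eq[symmetric] by blast
  have I: "I \<noteq> {}" using K_facts(2)[OF R] by auto
  show ?thesis
    unfolding skeleton_edges_def V E Let_def core_edges_eq[OF I] by (rule skeleton_classes)
qed

lemma len4_cong: "u p = v p \<Longrightarrow> u q = v q \<Longrightarrow> u r = v r \<Longrightarrow> u s = v s \<Longrightarrow> len4 u p q r s = len4 v p q r s"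
  by (simp add: len4_def)

lemma elen_restr:
  assumes R: "regtri A TV w" and e: "e \<in> regtri.Eint TV"
  shows "regtri.elen TV (Poly_Mapping.lookup (restr A u)) e = regtri.elen TV u e"
proof -
  interpret regtri A TV w by (rule R)
  obtain p q r s where pq: "e = {p,q}" "ccw p q r" "ccw q p s" using e unfolding Eint_def by blast
  have "p \<in> A" "q \<in> A" "r \<in> A" "s \<in> A" using ccw_A[OF pq(2)] ccw_A[OF pq(3)] by auto
  then show ?thesis unfolding pq(1) elen_eq[OF pq(2,3)] using fin_A by (intro len4_cong) auto
qed

text \<open>Renaming of the skeleton edges: their constituents are named by segments instead of
  pairs of lattice points.\<close>

definition rename_classes :: "(plane set set \<Rightarrow>\<^sub>0 real) \<Rightarrow> (plane set set \<Rightarrow>\<^sub>0 real)" where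
  "rename_classes c = restr ((\<lambda>L. (\<lambda>e. convex hull e) ` L) ` regtri.live_classes A TV)
     (\<lambda>L. Poly_Mapping.lookup c ((\<lambda>s. s \<inter> lattice_points) ` L))"

lemma hull_back:
  assumes R: "regtri A TV w" and L: "L \<subseteq> regtri.Eall TV"
  shows "(\<lambda>s. s \<inter> lattice_points) ` (\<lambda>e. convex hull e) ` L = L"
proof -
  have "(\<lambda>s. s \<inter> lattice_points) ` (\<lambda>e. convex hull e) ` L = (\<lambda>e. e) ` L"
    unfolding image_image by (rule image_cong[OF refl]) (use hull_edge_lattice[OF R] L in blast)
  then show ?thesis by simp
qed

lemma live_classes_sub:
  assumes R: "regtri A TV w" and L: "L \<in> regtri.live_classes A TV"
  shows "L \<subseteq> regtri.Eint TV" "L \<subseteq> regtri.Eall TV"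
proof -
  interpret regtri A TV w by (rule R)
  obtain e where "e \<in> Live" "L = live_class e" using L unfolding live_classes_eq by blast
  then have "L \<subseteq> Live" using live_class_sub by blast
  then show "L \<subseteq> Eint" "L \<subseteq> Eall" using Live_sub_Eint Eint_sub by auto
qed

text \<open>It has to be excluded that other sets of segments name a skeleton edge. This holds
  because edges with a bounded dual cell are interior edges, and the passage to the dual cell is
  injective on these.\<close>

lemma edge_lengths_eq:
  assumes R: "regtri A TV w"
  shows "edge_lengths D \<T> w = rename_classes (regtri.skel_lengths A TV (restr A w))"
proof -
  interpret regtri A TV w by (rule R)
  define H where "H L = (\<lambda>e. convex hull e) ` L" for L :: "plane set set"
  have fin: "finite (H ` live_classes)" using finLcls by simp
  have dual: "dual_edge D w ` H L = cell ` L" if "L \<subseteq> Eall" for L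
    unfolding H_def image_image by (rule image_cong[OF refl]) (use dual_edge_eq[OF R] that in blast)
  have name: "L \<subseteq> edges \<T> \<and> dual_edge D w ` L \<in> skeleton_edges D w \<longleftrightarrow> L \<in> H ` live_classes" for L
  proof
    assume a: "L \<subseteq> edges \<T> \<and> dual_edge D w ` L \<in> skeleton_edges D w"
    then obtain L' where L': "L' \<subseteq> Eall" "L = H L'"
      unfolding edges_eq[OF R] subset_image_iff H_def by blast
    obtain M where M: "M \<in> live_classes" "cell ` L' = cell ` M"
      using a unfolding L'(2) dual[OF L'(1)] skeleton_edges_eq[OF R] by blast
    note Ms = live_classes_sub[OF R M(1)]
    have "L' \<subseteq> Eint"
    proof
      fix e assume e: "e \<in> L'"
      then obtain f where f: "f \<in> M" "cell e = cell f" using M(2) by (metis imageE imageI)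
      then have "bounded (cell e)" using interior_edge_cell(2)[of f] Ms by auto
      then show "e \<in> Eint" using boundary_edge_cell[of e] e L'(1) by blast
    qed
    then have "L' = M" using inj_on_image_eq_iff[OF inj_cell, of L' M] M(2) Ms(1) by blast
    then show "L \<in> H ` live_classes" using L'(2) M(1) by blast
  next
    assume "L \<in> H ` live_classes"
    then obtain M where M: "M \<in> live_classes" "L = H M" by blast
    note Ms = live_classes_sub[OF R M(1)]
    have "L \<subseteq> edges \<T>" unfolding M(2) H_def edges_eq[OF R] using Ms(2) by (rule image_mono)
    moreover have "dual_edge D w ` L \<in> skeleton_edges D w"
      unfolding M(2) dual[OF Ms(2)] skeleton_edges_eq[OF R] using M(1) by (rule imageI)
    ultimately show "L \<subseteq> edges \<T> \<and> dual_edge D w ` L \<in> skeleton_edges D w" ..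
  qed
  have val: "skeleton_length (dual_edge D w ` L) = Poly_Mapping.lookup (skel_lengths (restr A w)) ((\<lambda>s. s \<inter> lattice_points) ` L)"
    if L: "L \<in> H ` live_classes" for L
  proof -
    obtain M where M: "M \<in> live_classes" "L = H M" using L by blast
    note Ms = live_classes_sub[OF R M(1)]
    have back_eq: "(\<lambda>s. s \<inter> lattice_points) ` L = M" unfolding M(2) H_def by (rule hull_back[OF R Ms(2)])
    have "skeleton_length (dual_edge D w ` L) = (\<Sum>s\<in>cell ` M. lattice_length s)"
      unfolding skeleton_length_def M(2) dual[OF Ms(2)] ..
    also have "\<dots> = (\<Sum>e\<in>M. lattice_length (cell e))"
      using inj_on_subset[OF inj_cell Ms(1)] by (simp add: sum.reindex)
    also have "\<dots> = (\<Sum>e\<in>M. elen w e)" using interior_edge_cell(1) Ms(1) by (intro sum.cong) auto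
    also have "\<dots> = (\<Sum>e\<in>M. elen (Poly_Mapping.lookup (restr A w)) e)"
      using elen_restr[OF R] Ms(1) by (intro sum.cong) auto
    also have "\<dots> = Poly_Mapping.lookup (skel_lengths (restr A w)) M" using finLcls M(1) by (simp add: skel_lengths_def)
    finally show ?thesis unfolding back_eq .
  qed
  show ?thesis
    unfolding edge_lengths_def name rename_classes_def H_def[symmetric] restr_def[of "H ` live_classes"]
    by (intro arg_cong[of _ _ Abs_poly_mapping] ext) (use val in auto)
qed

lemma linear_rename_classes: assumes "regtri A TV w" shows "linear rename_classes"
proof -
  interpret regtri A TV w by (rule assms)
  show ?thesis unfolding rename_classes_def using finLcls by (intro linear_restr linear_lookup) simp
qed

lemma rename_classes_injective:
  assumes R: "regtri A TV w" and c: "c \<in> coord_space (regtri.live_classes A TV)" "rename_classes c = 0"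
  shows "c = 0"
proof (rule poly_mapping_eqI)
  interpret regtri A TV w by (rule R)
  fix L
  show "Poly_Mapping.lookup c L = Poly_Mapping.lookup 0 L"
  proof (cases "L \<in> live_classes")
    case True
    have "Poly_Mapping.lookup (rename_classes c) ((\<lambda>e. convex hull e) ` L) = Poly_Mapping.lookup c L"
      unfolding rename_classes_def using True finLcls hull_back[OF R live_classes_sub(2)[OF R True]] by simp
    then show ?thesis using c(2) by simp
  qed (use c in \<open>simp add: coord_space_iff\<close>)
qed

section \<open>Openness of the set of inducing heights, and the dimension\<close>

lemma perturbation_small:
  assumes "finite S" "\<And>i. i \<in> S \<Longrightarrow> g i > (0::real)"
  shows "\<exists>\<epsilon>>0. \<forall>i\<in>S. g i + \<epsilon> * c i > 0"
  using assms
proof (induction S rule: finite_induct)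
  case (insert x S)
  then obtain \<epsilon> where e: "\<epsilon> > 0" "\<forall>i\<in>S. g i + \<epsilon> * c i > 0" by auto
  have gx: "g x > 0" using insert by simp
  define \<delta> where "\<delta> = min \<epsilon> (g x / (\<bar>c x\<bar> + 1))"
  have d: "\<delta> > 0" "\<delta> \<le> \<epsilon>" using e gx by (auto simp: \<delta>_def)
  have "g i + \<delta> * c i > 0" if i: "i \<in> S" for i
  proof (cases "c i \<ge> 0")
    case True
    then have "\<delta> * c i \<ge> 0" using d by simp
    then show ?thesis using insert.prems[of i] i by simp
  next
    case False
    then have "\<epsilon> * c i \<le> \<delta> * c i" using d by (simp add: mult_right_mono_neg)
    then show ?thesis using e(2) i by force
  qed
  moreover have "g x + \<delta> * c x > 0"
  proof -
    have "\<delta> * (\<bar>c x\<bar> + 1) \<le> g x"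
      using d by (simp add: \<delta>_def pos_le_divide_eq[symmetric] add_nonneg_pos)
    moreover have "- (\<delta> * c x) < \<delta> * (\<bar>c x\<bar> + 1)" using mult_left_mono[OF abs_ge_minus_self[of "c x"], of \<delta>] d by (simp add: distrib_left)
    ultimately show ?thesis by linarith
  qed
  ultimately show ?case using d by blast
qed (auto intro: exI[of _ 1])

text \<open>When the heights move along \<open>f\<close>, the dual point of a triangle
  \<open>X\<close> moves with constant velocity \<open>z X\<close>, which keeps its corners tied.
  The finitely many strict inequalities \<open>gap X a > 0\<close> survive a small step.\<close>

lemma ind_open:
  assumes i: "ind w" obtains \<epsilon> where "\<epsilon> > 0" "ind (\<lambda>p. w p + \<epsilon> * f p)"
proof -
  interpret regtri A TV w by (rule regtri_ind[OF i])
  have "\<exists>z. \<forall>p\<in>X. \<forall>q\<in>X. f p + p \<bullet> z = f q + q \<bullet> z" if X: "X \<in> TV" for X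
  proof -
    obtain p q r where pqr: "X = {p,q,r}" "cr (q - p) (r - p) = 1" using TV_tri[OF X] by blast
    \<comment> \<open>The solution, by Cramer's rule, of
      \<open>(q - p) \<bullet> z = f p - f q\<close> and
      \<open>(r - p) \<bullet> z = f p - f r\<close>.\<close>
    define z where "z = (f p - f r) *\<^sub>R rot (q - p) - (f p - f q) *\<^sub>R rot (r - p)"
    have "cr (r - p) (q - p) = -1" using pqr(2) cr_skew[of "r - p"] by simp
    then have "(q - p) \<bullet> z = f p - f q" "(r - p) \<bullet> z = f p - f r"
      using pqr(2) by (simp_all add: z_def inner_diff_right[of _ "_ *\<^sub>R _"] inner_commute[of _ "rot _"] rot_inner)
    then have "f q + q \<bullet> z = f p + p \<bullet> z" "f r + r \<bullet> z = f p + p \<bullet> z" by (simp_all add: inner_diff_left)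
    then show ?thesis using pqr(1) by (intro exI[of _ z]) auto
  qed
  then obtain z where z: "\<And>X p q. X \<in> TV \<Longrightarrow> p \<in> X \<Longrightarrow> q \<in> X \<Longrightarrow> f p + p \<bullet> z X = f q + q \<bullet> z X" by metis
  define b where "b X = (SOME p. p \<in> X)" for X :: "plane set"
  have b: "b X \<in> X" if "X \<in> TV" for X unfolding b_def using TV_obtain_mem[OF that] by (metis someI)
  define S where "S = {(X, a). X \<in> TV \<and> a \<in> A \<and> a \<notin> X}"
  define c where "c = (\<lambda>(X, a). f a + a \<bullet> z X - (f (b X) + b X \<bullet> z X))"
  have "S \<subseteq> TV \<times> A" by (auto simp: S_def)
  then have "finite S" using finTV fin_A finite_subset by blast
  moreover have "(\<lambda>(X, a). gap X a) s > 0" if "s \<in> S" for s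
    using that gap_nonneg gap_zero_iff by (force simp: S_def)
  ultimately obtain \<epsilon> where e: "\<epsilon> > 0" "\<forall>s\<in>S. (\<lambda>(X, a). gap X a) s + \<epsilon> * c s > 0"
    using perturbation_small[of S "\<lambda>(X, a). gap X a" c] by blast
  define w' where "w' p = w p + \<epsilon> * f p" for p
  have "ind w'" unfolding ind_def
  proof
    fix X assume X: "X \<in> TV"
    define x where "x = pt X + \<epsilon> *\<^sub>R z X"
    have val: "w' a + a \<bullet> x = (w a + a \<bullet> pt X) + \<epsilon> * (f a + a \<bullet> z X)" for a
      by (simp add: w'_def x_def inner_add_right algebra_simps)
    have eq: "w' p + p \<bullet> x = w' (b X) + b X \<bullet> x" if p: "p \<in> X" for p
    proof -
      have "w p + p \<bullet> pt X = w (b X) + b X \<bullet> pt X"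
        using mins_eq[of p A w "pt X" "b X"] mins_pt[OF X] p b[OF X] by simp
      then show ?thesis unfolding val using z[OF X p b[OF X]] by simp
    qed
    have lt: "w' (b X) + b X \<bullet> x < w' a + a \<bullet> x" if a: "a \<in> A" "a \<notin> X" for a
    proof -
      have "gap X a + \<epsilon> * c (X, a) > 0" using e(2) X a by (auto simp: S_def)
      then have "w a + a \<bullet> pt X - (w (b X) + b X \<bullet> pt X) + \<epsilon> * (f a + a \<bullet> z X - (f (b X) + b X \<bullet> z X)) > 0"
        using gap_eq[OF X b[OF X], of a] by (simp add: c_def)
      then show ?thesis unfolding val by (simp add: right_diff_distrib)
    qed
    have "mins A w' x = X"
    proof
      show "mins A w' x \<subseteq> X"
      proof
        fix a assume a: "a \<in> mins A w' x"
        have "b X \<in> A" using b[OF X] TV_sub[OF X] by blast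
        then have "w' a + a \<bullet> x \<le> w' (b X) + b X \<bullet> x" using mins_le[OF a] by blast
        moreover have "a \<in> A" using a mins_sub by blast
        ultimately show "a \<in> X" using lt[of a] by force
      qed
      show "X \<subseteq> mins A w' x"
      proof
        fix p assume p: "p \<in> X"
        have "w' p + p \<bullet> x \<le> w' a + a \<bullet> x" if "a \<in> A" for a
          using eq[OF p] eq[of a] lt[of a] that by (cases "a \<in> X") auto
        then show "p \<in> mins A w' x" using p TV_sub[OF X] by (auto simp: mins_def)
      qed
    qed
    then show "\<exists>x. mins A w' x = X" by blast
  qed
  then show ?thesis using that e(1) by (simp add: w'_def[abs_def])
qed

text \<open>By \<open>ind_open\<close> the cone contains, for each \<open>f\<close>, the image of
  \<open>w0\<close> displaced by a positive multiple of \<open>f\<close>. The scaled differences are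
  the whole image of the linear map, so this image is the span of the cone. The renaming of the
  classes is injective on it.\<close>

lemma moduli_dim_eq:
  assumes i: "ind w0" shows "moduli_dim D \<T> = dim (regtri.skel_lengths A TV ` coord_space A)"
proof -
  interpret regtri A TV w0 by (rule regtri_ind[OF i])
  have R: "regtri A TV w0" by (rule regtri_ind[OF i])
  define N where "N f = rename_classes (skel_lengths f)" for f
  have N: "linear N" unfolding N_def using linear_compose[OF linear_skel_lengths linear_rename_classes[OF R]] by (simp add: comp_def)
  define V where "V = N ` coord_space A"
  have sV: "subspace V" unfolding V_def by (rule linear_subspace_image[OF N subspace_coord_space])
  have cone: "moduli_cone D \<T> = (\<lambda>w. N (restr A w)) ` {w. ind w}"
    unfolding moduli_cone_def induces_iff_ind N_def
    by (rule image_cong[OF refl]) (use edge_lengths_eq regtri_ind in blast)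
  have sub: "moduli_cone D \<T> \<subseteq> V" unfolding cone V_def using fin_A by auto
  have "V \<subseteq> span (moduli_cone D \<T>)"
  proof
    fix y assume "y \<in> V"
    then obtain f where f: "f \<in> coord_space A" "y = N f" unfolding V_def by blast
    obtain \<epsilon> where e: "\<epsilon> > 0" "ind (\<lambda>p. w0 p + \<epsilon> * Poly_Mapping.lookup f p)" by (rule ind_open[OF i])
    have "restr A (\<lambda>p. w0 p + \<epsilon> * Poly_Mapping.lookup f p) = restr A w0 + \<epsilon> *\<^sub>R f"
      using fin_A f(1) by (intro poly_mapping_eqI) (auto simp: lookup_add coord_space_iff)
    then have "N (restr A (\<lambda>p. w0 p + \<epsilon> * Poly_Mapping.lookup f p)) = N (restr A w0) + \<epsilon> *\<^sub>R y"
      using f(2) by (simp add: linear_add[OF N] linear_scale[OF N])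
    then have "y = (1 / \<epsilon>) *\<^sub>R (N (restr A (\<lambda>p. w0 p + \<epsilon> * Poly_Mapping.lookup f p)) - N (restr A w0))"
      using e(1) by simp
    moreover have "N (restr A (\<lambda>p. w0 p + \<epsilon> * Poly_Mapping.lookup f p)) \<in> span (moduli_cone D \<T>)"
      unfolding cone using e(2) by (intro span_base) blast
    moreover have "N (restr A w0) \<in> span (moduli_cone D \<T>)" unfolding cone using i by (intro span_base) blast
    ultimately show "y \<in> span (moduli_cone D \<T>)" by (simp add: span_diff span_scale)
  qed
  moreover have "span (moduli_cone D \<T>) \<subseteq> V" by (rule span_minimal[OF sub sV])
  ultimately have "span (moduli_cone D \<T>) = V" by blast
  then have "moduli_dim D \<T> = dim V" unfolding moduli_dim_def by (metis dim_span)
  also have "\<dots> = dim (rename_classes ` (skel_lengths ` coord_space A))" unfolding V_def N_def image_image ..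
  also have "\<dots> = dim (skel_lengths ` coord_space A)"
  proof -
    obtain BL :: "(plane set set \<Rightarrow>\<^sub>0 real) set" where BL: "finite BL" "coord_space live_classes \<subseteq> span BL"
      using coord_space_finite_span[OF finLcls] by blast
    have sk: "skel_lengths ` coord_space A \<subseteq> coord_space live_classes" using finLcls by (auto simp: skel_lengths_def)
    show ?thesis
    proof (rule dim_image_injective[OF _ BL(1) _ linear_rename_classes[OF R]])
      show "subspace (skel_lengths ` coord_space A)" by (rule linear_subspace_image[OF linear_skel_lengths subspace_coord_space])
      show "skel_lengths ` coord_space A \<subseteq> span BL" using sk BL(2) by blast
      show "u = 0" if "u \<in> skel_lengths ` coord_space A" "rename_classes u = 0" for u
        using rename_classes_injective[OF R _ that(2)] sk that(1) by blast
    qed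
  qed
  finally show ?thesis .
qed

end

theorem theorem1p2:
  fixes D :: "(real ^ 2) set" and \<T> :: "(real ^ 2) set set"
  assumes "lattice_polygon D" and "nonhyperelliptic D"
    and "lattice_triangulation D \<T>" and "unimodular \<T>" and "regular D \<T>"
  shows "int (moduli_dim D \<T>) =
    3 * int (genus D) - 3 - 2 * int (genus (interior_polygon D)) - 2 * int (b1 D \<T>) - int (b2 D \<T>)"
proof -
  interpret polygon_triangulation D \<T> using assms by unfold_locales
  obtain w where "induces D w \<T>" using assms(5) unfolding regular_def by blast
  then have i: "ind w" using induces_iff_ind by blast
  show ?thesis unfolding moduli_dim_eq[OF i] by (rule rank_formula[OF regtri_ind[OF i]])
qed

end
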